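(* Suppose $m\ge3$ is odd. Then the Gerstenhaber bracket $[X,Y]$ equals zero for all generators $$X,Y\in\{\varepsilon_i,\ f_i,\ F_{2,i,1},\ \chi_{4,0},\ \varphi_{m-1,-1},\ \psi_{m-1,1},\ \chi_{2m,2},\ \chi_{2m,-2}\mid i\in\mathbb Z/m\mathbb Z\}$$ of $\mathrm{HH}^\bullet(A)$ (where $f_i$ and $F_{2,i,1}$ are among the generators only if $N>1$).
   Context: **Algebra.** Fix integers $N\ge1$, $m\ge3$ and a field $k$ whose characteristic does not divide $2$, $N$ or $m$. $Q$ is the quiver with vertex set $\mathbb Z/m\mathbb Z$ and arrows $a_i:i\to i+1$, $\bar a_i:i+1\to i$ ($i\in\mathbb Z/m\mathbb Z$); paths are composed from left to right, indices are modulo $m$. $A=kQ/\langle a_ia_{i+1},\ \bar a_{i+1}\bar a_i,\ (a_i\bar a_i)^N-(\bar a_{i-1}a_{i-1})^N\mid i\rangle$; $e_i$ is the trivial path at $i$, $E$ the span of the $e_i$, $A^e=A\otimes_kA^{op}$. **Resolution.** For $n\ge0$, $0\le r\le n$, $i\in\mathbb Z/m\mathbb Z$ define $g^n_{r,i}\in kQ$ by $g^0_{0,i}=e_i$ and, for $n\ge1$ (with $g^n_{-1,i}=g^{n-1}_{n,i}=0$, indices of the arrows $a,\bar a$ being the unique ones making paths compose): $g^n_{r,i}=g^{n-1}_{r,i}a+(-1)^ng^{n-1}_{r-1,i}\bar a(a\bar a)^{N-1}$ if $n-2r>0$; $g^n_{r,i}=g^{n-1}_{r,i}a(\bar aa)^{N-1}+(-1)^ng^{n-1}_{r-1,i}\bar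 a$ if $n-2r<0$; $g^n_{r,i}=g^{n-1}_{r,i}a(\bar aa)^{N-1}+g^{n-1}_{r-1,i}\bar a(a\bar a)^{N-1}$ if $n=2r$. Let $\mathcal B_n=\{g^n_{r,i}\}$ and $P_n=A\otimes_Ek\mathcal B_n\otimes_EA$. With augmentation $P_0=A\otimes_EA\to A$ given by multiplication, $P_\bullet$ is a minimal projective $A^e$-resolution of $A$ (Snashall–Taillefer) with $A^e$-linear differential $\partial_n:P_n\to P_{n-1}$ sending $1\otimes g^n_{r,i}\otimes1$ to: if $n-2r>0$: $1\otimes g^{n-1}_{r,i}\otimes a+(-1)^{n+r}a\otimes g^{n-1}_{r,i+1}\otimes1+(-1)^{n+r}\bar a(a\bar a)^{N-1}\otimes g^{n-1}_{r-1,i-1}\otimes1+(-1)^n1\otimes g^{n-1}_{r-1,i}\otimes\bar a(a\bar a)^{N-1}$; if $n-2r<0$: $1\otimes g^{n-1}_{r,i}\otimes a(\bar aa)^{N-1}+(-1)^{n+r}a(\bar aa)^{N-1}\otimes g^{n-1}_{r,i+1}\otimes1+(-1)^{n+r}\bar a\otimes g^{n-1}_{r-1,i-1}\otimes1+(-1)^n1\otimes g^{n-1}_{r-1,i}\otimes\bar a$; if $n=2r$: $\sum_{l=0}^{N-1}\big((\bar aa)^l\otimes g^{n-1}_{r,i}\otimes a(\bar aa)^{N-1-l}+(-1)^{n/2}(a\bar a)^la\otimes g^{n-1}_{r,i+1}\otimes(a\bar a)^{N-1-l}+(-1)^{n/2}(\bar aa)^l\bar a\otimes g^{n-1}_{r-1,i-1}\otimes(\bar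 aa)^{N-1-l}+(a\bar a)^l\otimes g^{n-1}_{r-1,i}\otimes\bar a(a\bar a)^{N-1-l}\big)$. **Cohomology and bracket.** $\mathrm{HH}^n(A)$ is the $n$-th cohomology of $\mathrm{Hom}_{A^e}(P_\bullet,A)$, with $\mathrm{Hom}_{A^e}(P_n,A)=\mathrm{Hom}_{E^e}(k\mathcal B_n,A)$. For $g\in\mathcal B_n$ and $u\in A$ parallel to $g$ (same source and target), $(g\parallel u)$ is the map sending $g$ to $u$ and all other elements of $\mathcal B_n$ to $0$; cohomology classes are named by cocycles. $\mathrm{HH}^0(A)$ is the center of $A$. $[-,-]$ is the Gerstenhaber bracket on $\mathrm{HH}^\bullet(A)$, defined on bar cochains of degrees $n,q$ by $[f,g]=f\circ g-(-1)^{(n-1)(q-1)}g\circ f$ with $(f\circ g)(x_1,\dots,x_{n+q-1})=\sum_{i=1}^n(-1)^{(q-1)(i-1)}f(x_1,\dots,x_{i-1},g(x_i,\dots,x_{i+q-1}),x_{i+q},\dots,x_{n+q-1})$. **Elements.** $\varepsilon_i=(a_i\bar a_i)^N$ and $f_i=a_i\bar a_i+\bar a_ia_i$ in degree $0$; $F_{2,j,1}=(g^2_{1,j}\parallel a_j\bar a_j)+(g^2_{1,j+1}\parallel-\bar a_ja_j)$ in degree $2$; $\chi_{4,0}=\sum_{i=0}^{m-1}(g^4_{2,i}\parallel e_i)$ in degree $4$; $\varphi_{m-1,-1}=\sum_i(g^{m-1}_{m-1,i}\parallel(a_i\bar a_i)^{N-1}a_i)$, $\psi_{m-1,1}=\sum_i(g^{m-1}_{0,i}\parallel(\bar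 a_{i-1}a_{i-1})^{N-1}\bar a_{i-1})$ in degree $m-1$; $\chi_{2m,2}=\sum_i(g^{2m}_{0,i}\parallel e_i)$, $\chi_{2m,-2}=\sum_i(g^{2m}_{2m,i}\parallel e_i)$ in degree $2m$. (Together with $1$ and the degree-one classes $\varphi_{1,0}=\sum_i(g^1_{0,i}\parallel a_i)$, $\psi_{1,0}=\sum_i(g^1_{1,i}\parallel\bar a_{i-1})$, these generate $\mathrm{HH}^\bullet(A)$ as a $k$-algebra for $m$ odd.) *)

theory Defs
  imports
    "HOL-Library.Poly_Mapping"
    "Berlekamp_Zassenhaus.Finite_Field"
begin

section \<open>The path algebra\<close>

text \<open>
  The integers \<open>m\<close> and \<open>N\<close> enter through types, as \<open>m = CARD('m)\<close> and \<open>N = CARD('n)\<close>; the vertex set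
  is \<open>'m mod_ring\<close>, i.e. \<open>\<int>/m\<int>\<close> (the class \<open>nontriv\<close> says \<open>m > 1\<close>). Every vertex \<open>v\<close> is the source of
  exactly one arrow \<open>a\<^sub>v : v \<rightarrow> v + 1\<close> and of exactly one arrow \<open>a'\<^bsub>v-1\<^esub> : v \<rightarrow> v - 1\<close>, so a path
  (composed from left to right) is the same as its source together with an arbitrary word of steps.
\<close>

datatype step = Fwd | Bwd

type_synonym 'm path = "'m mod_ring \<times> step list"

primrec shift :: "step \<Rightarrow> 'a::ring_1" where
  "shift Fwd = 1"
| "shift Bwd = - 1"

fun path_target :: "'m::nontriv path \<Rightarrow> 'm mod_ring" where
  "path_target (v, w) = v + sum_list (map shift w)"

typedef (overloaded) ('k::zero, 'm::finite) path_alg = "UNIV :: ('m path \<Rightarrow>\<^sub>0 'k) set"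
  by simp

setup_lifting type_definition_path_alg
lifting_forget mod_ring.lifting

lift_definition coeff :: "('k::zero, 'm::finite) path_alg \<Rightarrow> 'm path \<Rightarrow> 'k" is Poly_Mapping.lookup .

lemma path_alg_eqI: "(\<And>p. coeff x p = coeff y p) \<Longrightarrow> x = y"
  by transfer (rule poly_mapping_eqI)

lemma path_target_append: "path_target (v, u @ w) = path_target (path_target (v, u), w)"
  by (simp add: add.assoc)

text \<open>The coefficient of a path in a product is the sum over all factorizations of that path.\<close>

lift_definition path_mult :: "('m::nontriv path \<Rightarrow>\<^sub>0 'k::field) \<Rightarrow> ('m path \<Rightarrow>\<^sub>0 'k) \<Rightarrow> ('m path \<Rightarrow>\<^sub>0 'k)"
  is "\<lambda>x y (v, w). \<Sum>j\<le>length w. x (v, take j w) * y (path_target (v, take j w), drop j w)"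
proof -
  fix x y :: "'m path \<Rightarrow> 'k"
  let ?X = "{p. x p \<noteq> 0}" and ?Y = "{p. y p \<noteq> 0}"
  assume fin: "finite ?X" "finite ?Y"
  let ?f = "\<lambda>(v, w). \<Sum>j\<le>length w. x (v, take j w) * y (path_target (v, take j w), drop j w)"
  have "{p. ?f p \<noteq> 0} \<subseteq> (\<lambda>(p, q). (fst p, snd p @ snd q)) ` (?X \<times> ?Y)"
  proof
    fix p assume "p \<in> {p. ?f p \<noteq> 0}"
    moreover obtain v w where p: "p = (v, w)" by (cases p)
    ultimately have "(\<Sum>j\<le>length w. x (v, take j w) * y (path_target (v, take j w), drop j w)) \<noteq> 0"
      by simp
    then obtain j where "x (v, take j w) * y (path_target (v, take j w), drop j w) \<noteq> 0"
      by (meson sum.not_neutral_contains_not_neutral)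
    then have "((v, take j w), (path_target (v, take j w), drop j w)) \<in> ?X \<times> ?Y"
      by simp
    then show "p \<in> (\<lambda>(p, q). (fst p, snd p @ snd q)) ` (?X \<times> ?Y)"
      unfolding p by (rule rev_image_eqI) simp
  qed
  then show "finite {p. ?f p \<noteq> 0}"
    using fin by (meson finite_SigmaI finite_imageI finite_subset)
qed

instantiation path_alg :: (field, nontriv) ring_1
begin

lift_definition zero_path_alg :: "('a, 'b) path_alg" is 0 .
lift_definition one_path_alg :: "('a, 'b) path_alg" is "\<Sum>v\<in>UNIV. Poly_Mapping.single (v, []) 1" .
lift_definition plus_path_alg :: "('a, 'b) path_alg \<Rightarrow> ('a, 'b) path_alg \<Rightarrow> ('a, 'b) path_alg" is "(+)" .
lift_definition minus_path_alg :: "('a, 'b) path_alg \<Rightarrow> ('a, 'b) path_alg \<Rightarrow> ('a, 'b) path_alg" is "(-)" .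
lift_definition uminus_path_alg :: "('a, 'b) path_alg \<Rightarrow> ('a, 'b) path_alg" is uminus .
lift_definition times_path_alg :: "('a, 'b) path_alg \<Rightarrow> ('a, 'b) path_alg \<Rightarrow> ('a, 'b) path_alg" is path_mult .

lemma coeff_zero [simp]: "coeff 0 p = 0"
  by transfer simp

lemma coeff_plus [simp]: "coeff (x + y) p = coeff x p + coeff y p"
  by transfer (simp add: lookup_add)

lemma coeff_minus [simp]: "coeff (x - y) p = coeff x p - coeff y p"
  by transfer (simp add: lookup_minus)

lemma coeff_uminus [simp]: "coeff (- x) p = - coeff x p"
  by transfer simp

lemma coeff_one: "coeff 1 (v, w) = (if w = [] then 1 else 0)"
  by transfer (auto simp: lookup_sum lookup_single when_def intro!: sum.neutral)

lemma coeff_times: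
  "coeff (x * y) (v, w) =
     (\<Sum>j\<le>length w. coeff x (v, take j w) * coeff y (path_target (v, take j w), drop j w))"
  by transfer (simp add: path_mult.rep_eq)

instance
proof
  fix x y z :: "('a, 'b) path_alg"
  show "x * y * z = x * (y * z)"
  proof (rule path_alg_eqI, clarify)
    fix v :: "'b mod_ring" and w
    let ?t = "\<lambda>j. path_target (v, take j w)"
    let ?S = "\<lambda>i j. coeff x (v, take i w) * (coeff y (?t i, take (j - i) (drop i w)) * coeff z (?t j, drop j w))"
    have "coeff (x * y * z) (v, w) = (\<Sum>j\<le>length w. \<Sum>i\<le>j. ?S i j)"
      unfolding coeff_times
      by (intro sum.cong refl)
         (simp add: coeff_times sum_distrib_right mult.assoc min_def drop_take del: path_target.simps)
    also have "\<dots> = (\<Sum>(j, i)\<in>Sigma {..length w} (\<lambda>j. {..j}). ?S i j)"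
      by (subst sum.Sigma) auto
    also have "\<dots> = (\<Sum>(i, k)\<in>Sigma {..length w} (\<lambda>i. {..length w - i}). ?S i (i + k))"
      by (rule sum.reindex_bij_witness[where i = "\<lambda>(i, k). (i + k, i)" and j = "\<lambda>(j, i). (i, j - i)"])
         auto
    also have "\<dots> = (\<Sum>i\<le>length w. \<Sum>k\<le>length w - i. ?S i (i + k))"
      by (subst sum.Sigma) auto
    also have "\<dots> = coeff (x * (y * z)) (v, w)"
      unfolding coeff_times
      by (intro sum.cong refl)
         (simp add: coeff_times sum_distrib_left take_add path_target_append add.commute
               del: path_target.simps)
    finally show "coeff (x * y * z) (v, w) = coeff (x * (y * z)) (v, w)" .
  qed
  show "1 * x = x"
  proof (rule path_alg_eqI, clarify)
    fix v :: "'b mod_ring" and w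
    have "coeff (1 * x) (v, w) = (\<Sum>j\<le>length w. if j = 0 then coeff x (v, w) else 0)"
      unfolding coeff_times by (intro sum.cong refl) (auto simp: coeff_one)
    then show "coeff (1 * x) (v, w) = coeff x (v, w)" by simp
  qed
  show "x * 1 = x"
  proof (rule path_alg_eqI, clarify)
    fix v :: "'b mod_ring" and w
    have "coeff (x * 1) (v, w) = (\<Sum>j\<le>length w. if j = length w then coeff x (v, w) else 0)"
      unfolding coeff_times by (intro sum.cong refl) (auto simp: coeff_one)
    then show "coeff (x * 1) (v, w) = coeff x (v, w)" by simp
  qed
  show "(0 :: ('a, 'b) path_alg) \<noteq> 1"
    by (metis coeff_one coeff_zero zero_neq_one)
qed (auto intro!: path_alg_eqI simp: coeff_times sum.distrib algebra_simps)

end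

lift_definition basis_path :: "'m::nontriv path \<Rightarrow> ('k::field, 'm) path_alg"
  is "\<lambda>p. Poly_Mapping.single p 1" .

lift_definition scale_path :: "'k::field \<Rightarrow> ('k, 'm::nontriv) path_alg \<Rightarrow> ('k, 'm) path_alg"
  is "\<lambda>c. Poly_Mapping.map ((*) c)" .

lemma coeff_basis_path: "coeff (basis_path p) q = (if p = q then 1 else 0)"
  by transfer (simp add: lookup_single when_def)

lemma coeff_scale_path [simp]: "coeff (scale_path c x) p = c * coeff x p"
  by transfer (simp add: Poly_Mapping.map.rep_eq when_def)

lemma scale_path_mult_left: "scale_path c x * y = scale_path c (x * y)"
  by (auto intro!: path_alg_eqI simp: coeff_times sum_distrib_left mult.assoc)

lemma scale_path_mult_right: "x * scale_path c y = scale_path c (x * y)"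
  by (auto intro!: path_alg_eqI simp: coeff_times sum_distrib_left mult.left_commute)

definition vertex_path :: "'m::nontriv mod_ring \<Rightarrow> ('k::field, 'm) path_alg" where
  "vertex_path i = basis_path (i, [])"

definition path_arrow :: "'m::nontriv mod_ring \<Rightarrow> ('k::field, 'm) path_alg" where
  "path_arrow i = basis_path (i, [Fwd])"

definition path_bar_arrow :: "'m::nontriv mod_ring \<Rightarrow> ('k::field, 'm) path_alg" where
  "path_bar_arrow i = basis_path (i + 1, [Bwd])"

lemma basis_path_mult:
  "basis_path p * basis_path q =
     (if path_target p = fst q then basis_path (fst p, snd p @ snd q) else 0)"
proof (rule path_alg_eqI, clarify)
  fix v :: "'b mod_ring" and w
  obtain s s' t t' where pq: "p = (s, s')" "q = (t, t')" by (cases p, cases q)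
  let ?c = "if s = v \<and> w = s' @ t' \<and> path_target (s, s') = t then 1 else (0 :: 'a)"
  have "coeff (basis_path p * basis_path q) (v, w) =
          (\<Sum>j\<le>length w. if j = length s' then ?c else 0)"
    unfolding coeff_times
  proof (rule sum.cong)
    fix j assume j: "j \<in> {..length w}"
    show "coeff (basis_path p) (v, take j w) *
        coeff (basis_path q) (path_target (v, take j w), drop j w) =
        (if j = length s' then ?c else 0)"
    proof (cases "j = length s' \<and> w = s' @ t'")
      case True
      then show ?thesis by (simp add: coeff_basis_path pq del: path_target.simps)
    next
      case False
      then have "\<not> (s' = take j w \<and> t' = drop j w)"
        using j by (metis append_take_drop_id atMost_iff length_take min.absorb2)
      then have "coeff (basis_path p) (v, take j w) *
        coeff (basis_path q) (path_target (v, take j w), drop j w) = (0 :: 'a)"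
        unfolding coeff_basis_path pq prod.inject
        by (cases "s' = take j w"; cases "t' = drop j w") (simp_all del: path_target.simps)
      moreover have "(if j = length s' then ?c else 0) = 0" using False by auto
      ultimately show ?thesis by (simp only:)
    qed
  qed simp
  also have "\<dots> = (if length s' \<le> length w then ?c else 0)" by simp
  also have "\<dots> = coeff (if path_target p = fst q then basis_path (fst p, snd p @ snd q) else 0) (v, w)"
    unfolding pq fst_conv snd_conv if_distrib[of "\<lambda>x. coeff x _"] coeff_basis_path coeff_zero prod.inject
    by (cases "s = v"; cases "s' @ t' = w") (auto simp del: path_target.simps)
  finally show "coeff (basis_path p * basis_path q) (v, w) =
    coeff (if path_target p = fst q then basis_path (fst p, snd p @ snd q) else 0 :: ('a, 'b) path_alg) (v, w)" .
qed

lemma vertex_path_mult: "vertex_path i * vertex_path j = (if i = j then vertex_path i else 0)"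
  by (simp add: vertex_path_def basis_path_mult)

lemma sum_vertex_path: "(\<Sum>i\<in>UNIV. vertex_path i) = (1 :: ('k::field, 'm::nontriv) path_alg)"
proof (rule path_alg_eqI, clarify)
  have *: "coeff (sum f A) p = (\<Sum>i\<in>A. coeff (f i) p)"
    for f :: "'m mod_ring \<Rightarrow> ('k, 'm) path_alg" and A p
    by (induction A rule: infinite_finite_induct) auto
  show "coeff (\<Sum>i\<in>UNIV. vertex_path i) (v, w) = coeff (1 :: ('k, 'm) path_alg) (v, w)" for v w
    by (auto simp: * vertex_path_def coeff_basis_path coeff_one)
qed

section \<open>The algebra \<open>A\<close>\<close>

inductive_set ideal_generated_by :: "'a::ring_1 set \<Rightarrow> 'a set" for S where
  zero: "0 \<in> ideal_generated_by S"
| gen: "x \<in> S \<Longrightarrow> x \<in> ideal_generated_by S"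
| add: "x \<in> ideal_generated_by S \<Longrightarrow> y \<in> ideal_generated_by S \<Longrightarrow> x + y \<in> ideal_generated_by S"
| left: "x \<in> ideal_generated_by S \<Longrightarrow> r * x \<in> ideal_generated_by S"
| right: "x \<in> ideal_generated_by S \<Longrightarrow> x * r \<in> ideal_generated_by S"

lemma ideal_generated_by_uminus: "x \<in> ideal_generated_by S \<Longrightarrow> - x \<in> ideal_generated_by S"
  using ideal_generated_by.left[of x S "- 1"] by simp

lemma ideal_generated_by_diff:
  "x \<in> ideal_generated_by S \<Longrightarrow> y \<in> ideal_generated_by S \<Longrightarrow> x - y \<in> ideal_generated_by S"
  using ideal_generated_by.add[of x S "- y"] ideal_generated_by_uminus[of y S] by simp

definition relations :: "nat \<Rightarrow> ('k::field, 'm::nontriv) path_alg set" where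
  "relations N =
     range (\<lambda>i. path_arrow i * path_arrow (i + 1)) \<union>
     range (\<lambda>i. path_bar_arrow (i + 1) * path_bar_arrow i) \<union>
     range (\<lambda>i. (path_arrow i * path_bar_arrow i) ^ N - (path_bar_arrow (i - 1) * path_arrow (i - 1)) ^ N)"

quotient_type (overloaded) ('k, 'n, 'm) alg = "('k::field, 'm::nontriv) path_alg"
  / "\<lambda>x y. x - y \<in> ideal_generated_by (relations CARD('n::finite))"
proof (rule equivpI)
  show "reflp (\<lambda>x y :: ('k, 'm) path_alg. x - y \<in> ideal_generated_by (relations CARD('n)))"
    by (simp add: reflp_def ideal_generated_by.zero)
  show "symp (\<lambda>x y :: ('k, 'm) path_alg. x - y \<in> ideal_generated_by (relations CARD('n)))"
    by (rule sympI) (drule ideal_generated_by_uminus, simp)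
  show "transp (\<lambda>x y :: ('k, 'm) path_alg. x - y \<in> ideal_generated_by (relations CARD('n)))"
  proof (rule transpI)
    fix x y z :: "('k, 'm) path_alg"
    assume "x - y \<in> ideal_generated_by (relations CARD('n))"
      "y - z \<in> ideal_generated_by (relations CARD('n))"
    from ideal_generated_by.add[OF this]
    show "x - z \<in> ideal_generated_by (relations CARD('n))" by simp
  qed
qed

lemma coeff_trivial_path_ideal:
  assumes "x \<in> ideal_generated_by (relations N)" "N > 0"
  shows "coeff x (v, []) = 0"
  using assms(1)
proof induction
  case (gen x)
  have *: "coeff (y ^ N) (v, []) = 0" if "coeff y (v, []) = 0" for y :: "('a, 'b) path_alg"
    using \<open>N > 0\<close> that by (cases N) (simp_all add: coeff_times)
  from gen show ?case
    unfolding relations_def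
    by (auto simp: coeff_times * path_arrow_def path_bar_arrow_def coeff_basis_path)
qed (simp_all add: coeff_times)

instantiation alg :: (field, finite, nontriv) ring_1
begin

lift_definition zero_alg :: "('a, 'b, 'c) alg" is 0 .
lift_definition one_alg :: "('a, 'b, 'c) alg" is 1 .
lift_definition plus_alg :: "('a, 'b, 'c) alg \<Rightarrow> ('a, 'b, 'c) alg \<Rightarrow> ('a, 'b, 'c) alg" is "(+)"
  by (drule (1) ideal_generated_by.add) (simp add: algebra_simps)
lift_definition minus_alg :: "('a, 'b, 'c) alg \<Rightarrow> ('a, 'b, 'c) alg \<Rightarrow> ('a, 'b, 'c) alg" is "(-)"
  by (drule (1) ideal_generated_by_diff) (simp add: algebra_simps)
lift_definition uminus_alg :: "('a, 'b, 'c) alg \<Rightarrow> ('a, 'b, 'c) alg" is uminus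
  by (drule ideal_generated_by_uminus) simp
lift_definition times_alg :: "('a, 'b, 'c) alg \<Rightarrow> ('a, 'b, 'c) alg \<Rightarrow> ('a, 'b, 'c) alg" is "(*)"
proof -
  fix x x' y y' :: "('a, 'c) path_alg"
  let ?I = "ideal_generated_by (relations CARD('b)) :: ('a, 'c) path_alg set"
  assume "x - x' \<in> ?I" "y - y' \<in> ?I"
  then have "(x - x') * y + x' * (y - y') \<in> ?I"
    by (intro ideal_generated_by.add ideal_generated_by.left ideal_generated_by.right)
  then show "x * y - x' * y' \<in> ?I"
    by (simp add: algebra_simps)
qed

instance
proof
  show "(0 :: ('a, 'b, 'c) alg) \<noteq> 1"
  proof (transfer, rule notI)
    assume "(0 :: ('a, 'c) path_alg) - 1 \<in> ideal_generated_by (relations CARD('b))"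
    from coeff_trivial_path_ideal[OF this] show False
      by (simp add: coeff_one)
  qed
qed (transfer, simp add: algebra_simps ideal_generated_by.zero)+

end

lift_definition scale_alg :: "'k::field \<Rightarrow> ('k, 'n::finite, 'm::nontriv) alg \<Rightarrow> ('k, 'n, 'm) alg"
  is scale_path
proof -
  fix c :: 'k and x y :: "('k, 'm) path_alg"
  assume "x - y \<in> ideal_generated_by (relations CARD('n))"
  then have "scale_path c 1 * (x - y) \<in> ideal_generated_by (relations CARD('n))"
    by (rule ideal_generated_by.left)
  also have "scale_path c 1 * (x - y) = scale_path c x - scale_path c y"
    by (auto intro!: path_alg_eqI simp: scale_path_mult_left algebra_simps)
  finally show "scale_path c x - scale_path c y \<in> ideal_generated_by (relations CARD('n))" .
qed

lemma vector_space_scale_alg: "vector_space (scale_alg :: 'k::field \<Rightarrow> ('k, 'n::finite, 'm::nontriv) alg \<Rightarrow> _)"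
proof -
  have eq: "u - v \<in> ideal_generated_by (relations CARD('n))" if "\<And>p. coeff u p = coeff v p"
    for u v :: "('k, 'm) path_alg"
    using path_alg_eqI[OF that] by (simp add: ideal_generated_by.zero)
  show ?thesis
    by standard (transfer, rule eq, simp add: algebra_simps)+
qed

lemma scale_alg_mult_left: "scale_alg c x * y = scale_alg c (x * y)"
  by transfer (simp add: scale_path_mult_left ideal_generated_by.zero)

lemma scale_alg_mult_right: "x * scale_alg c y = scale_alg c (x * y)"
  by transfer (simp add: scale_path_mult_right ideal_generated_by.zero)

lift_definition idem :: "'m::nontriv mod_ring \<Rightarrow> ('k::field, 'n::finite, 'm) alg" is vertex_path .
lift_definition arrow :: "'m::nontriv mod_ring \<Rightarrow> ('k::field, 'n::finite, 'm) alg" is path_arrow .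
lift_definition bar_arrow :: "'m::nontriv mod_ring \<Rightarrow> ('k::field, 'n::finite, 'm) alg" is path_bar_arrow .

lemma idem_mult: "idem i * idem j = (if i = j then idem i else 0)"
  by transfer (simp add: vertex_path_mult ideal_generated_by.zero)

lemma idem_mult_assoc: "idem i * (idem j * x) = (if i = j then idem i * x else 0)"
  by (simp add: mult.assoc[symmetric] idem_mult)

lemma arrow_parallel: "idem j * arrow i = (if j = i then arrow i else 0)"
    "arrow i * idem j = (if j = i + 1 then arrow i else 0)"
  by (transfer, auto simp: path_arrow_def vertex_path_def basis_path_mult ideal_generated_by.zero)+

lemma bar_arrow_parallel: "idem j * bar_arrow i = (if j = i + 1 then bar_arrow i else 0)"
    "bar_arrow i * idem j = (if j = i then bar_arrow i else 0)"
  by (transfer, auto simp: path_bar_arrow_def vertex_path_def basis_path_mult ideal_generated_by.zero)+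

lifting_forget path_alg.lifting
lifting_forget alg.lifting

section \<open>The Gerstenhaber bracket on Hochschild cohomology\<close>

text \<open>
  In this section \<open>s\<close> is the scalar multiplication of an algebra. A cochain of degree \<open>n\<close> is
  a multilinear function of the lists of length \<open>n\<close>, set to \<open>0\<close> on all other lists.
\<close>

definition multilinear ::
  "('k::field \<Rightarrow> 'a \<Rightarrow> 'a::ab_group_add) \<Rightarrow> ('k \<Rightarrow> 'b \<Rightarrow> 'b::ab_group_add) \<Rightarrow> nat \<Rightarrow> ('a list \<Rightarrow> 'b) \<Rightarrow> bool"
where
  "multilinear s t n f \<longleftrightarrow>
     (\<forall>xs ys. length xs + 1 + length ys = n \<longrightarrow> Vector_Spaces.linear s t (\<lambda>x. f (xs @ x # ys)))"

definition cochains :: "('k::field \<Rightarrow> 'a \<Rightarrow> 'a::ring_1) \<Rightarrow> nat \<Rightarrow> ('a list \<Rightarrow> 'a) set" where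
  "cochains s n = {f. multilinear s s n f \<and> (\<forall>xs. length xs \<noteq> n \<longrightarrow> f xs = 0)}"

definition hoch_diff :: "nat \<Rightarrow> ('a list \<Rightarrow> 'a) \<Rightarrow> 'a list \<Rightarrow> 'a::ring_1" where
  "hoch_diff n f xs = (if length xs \<noteq> n + 1 then 0 else
     hd xs * f (tl xs)
     + (\<Sum>i<n. (- 1) ^ (i + 1) * f (take i xs @ [xs ! i * xs ! (i + 1)] @ drop (i + 2) xs))
     + (- 1) ^ (n + 1) * f (butlast xs) * last xs)"

definition cocycles :: "('k::field \<Rightarrow> 'a \<Rightarrow> 'a::ring_1) \<Rightarrow> nat \<Rightarrow> ('a list \<Rightarrow> 'a) set" where
  "cocycles s n = {f \<in> cochains s n. hoch_diff n f = (\<lambda>_. 0)}"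

definition coboundaries :: "('k::field \<Rightarrow> 'a \<Rightarrow> 'a::ring_1) \<Rightarrow> nat \<Rightarrow> ('a list \<Rightarrow> 'a) set" where
  "coboundaries s n = (case n of 0 \<Rightarrow> {\<lambda>_. 0} | Suc k \<Rightarrow> hoch_diff k ` cochains s k)"

definition cohomologous ::
  "('k::field \<Rightarrow> 'a \<Rightarrow> 'a::ring_1) \<Rightarrow> nat \<Rightarrow> (('a list \<Rightarrow> 'a) \<times> ('a list \<Rightarrow> 'a)) set" where
  "cohomologous s n =
     {(f, g). f \<in> cocycles s n \<and> g \<in> cocycles s n \<and> (\<lambda>xs. f xs - g xs) \<in> coboundaries s n}"

definition HH :: "('k::field \<Rightarrow> 'a \<Rightarrow> 'a::ring_1) \<Rightarrow> nat \<Rightarrow> ('a list \<Rightarrow> 'a) set set" where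
  "HH s n = cocycles s n // cohomologous s n"

definition HH_class ::
  "('k::field \<Rightarrow> 'a \<Rightarrow> 'a::ring_1) \<Rightarrow> nat \<Rightarrow> ('a list \<Rightarrow> 'a) \<Rightarrow> ('a list \<Rightarrow> 'a) set" where
  "HH_class s n f = cohomologous s n `` {f}"

definition HH_zero :: "('k::field \<Rightarrow> 'a \<Rightarrow> 'a::ring_1) \<Rightarrow> nat \<Rightarrow> ('a list \<Rightarrow> 'a) set" where
  "HH_zero s n = HH_class s n (\<lambda>_. 0)"

text \<open>
  In the signs below, \<open>n - 1\<close> and \<open>q - 1\<close> are replaced by the numbers \<open>n + 1\<close> and \<open>q + 1\<close> of the same
  parity, since \<open>n\<close> and \<open>q\<close> may be \<open>0\<close>. For \<open>n = q = 0\<close> the bracket is \<open>0\<close> and nominally has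
  degree \<open>-1\<close>, which appears here as the degree \<open>n + q - 1 = 0\<close>.
\<close>

definition circ ::
  "nat \<Rightarrow> nat \<Rightarrow> ('a list \<Rightarrow> 'a) \<Rightarrow> ('a list \<Rightarrow> 'a) \<Rightarrow> 'a list \<Rightarrow> 'a::ring_1" where
  "circ n q f g xs = (if length xs + 1 \<noteq> n + q then 0 else
     (\<Sum>i = 1..n. (- 1) ^ ((q + 1) * (i - 1)) *
        f (take (i - 1) xs @ [g (take q (drop (i - 1) xs))] @ drop (i - 1 + q) xs)))"

definition gerstenhaber ::
  "nat \<Rightarrow> nat \<Rightarrow> ('a list \<Rightarrow> 'a) \<Rightarrow> ('a list \<Rightarrow> 'a) \<Rightarrow> 'a list \<Rightarrow> 'a::ring_1" where
  "gerstenhaber n q f g xs =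
     circ n q f g xs - (- 1) ^ ((n + 1) * (q + 1)) * circ q n g f xs"

definition HH_bracket ::
  "('k::field \<Rightarrow> 'a \<Rightarrow> 'a::ring_1) \<Rightarrow> nat \<Rightarrow> nat \<Rightarrow>
     ('a list \<Rightarrow> 'a) set \<Rightarrow> ('a list \<Rightarrow> 'a) set \<Rightarrow> ('a list \<Rightarrow> 'a) set" where
  "HH_bracket s n q X Y = (\<Union>f\<in>X. \<Union>g\<in>Y. HH_class s (n + q - 1) (gerstenhaber n q f g))"

section \<open>The bimodules \<open>P\<^sub>n\<close>\<close>

definition path_arrows :: "('k::field, 'm::nontriv) path_alg" where
  "path_arrows = (\<Sum>i\<in>UNIV. path_arrow i)"

definition path_bar_arrows :: "('k::field, 'm::nontriv) path_alg" where
  "path_bar_arrows = (\<Sum>i\<in>UNIV. path_bar_arrow i)"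

text \<open>
  The element \<open>g\<^sup>n\<^bsub>r,i\<^esub>\<close> of the path algebra. Multiplication by the sum of all arrows selects the
  unique arrow that composes. For \<open>r < 0\<close> and for \<open>r > n\<close> the recursion yields \<open>0\<close>.
\<close>

primrec path_g :: "nat \<Rightarrow> nat \<Rightarrow> int \<Rightarrow> 'm mod_ring \<Rightarrow> ('k::field, 'm::nontriv) path_alg" where
  "path_g N 0 r i = (if r = 0 then vertex_path i else 0)"
| "path_g N (Suc k) r i = (let n = Suc k; a = path_arrows; b = path_bar_arrows in
     if int n - 2 * r > 0 then
       path_g N k r i * a + (- 1) ^ n * (path_g N k (r - 1) i * (b * (a * b) ^ (N - 1)))
     else if int n - 2 * r < 0 then
       path_g N k r i * (a * (b * a) ^ (N - 1)) + (- 1) ^ n * (path_g N k (r - 1) i * b)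
     else
       path_g N k r i * (a * (b * a) ^ (N - 1)) + path_g N k (r - 1) i * (b * (a * b) ^ (N - 1)))"

lemma coeff_sum [simp]: "coeff (sum f S) p = (\<Sum>i\<in>S. coeff (f i) p)"
  for f :: "'i \<Rightarrow> ('k::field, 'm::nontriv) path_alg"
  by (induction S rule: infinite_finite_induct) auto

lemma coeff_path_arrows:
  "coeff path_arrows (v, w) = (if w = [Fwd] then 1 else 0)"
  "coeff path_bar_arrows (v, w) = (if w = [Bwd] then 1 else 0)"
proof -
  have "i + 1 = v \<longleftrightarrow> i = v - 1" for i by auto
  then show "coeff path_arrows (v, w) = (if w = [Fwd] then 1 else 0)"
    "coeff path_bar_arrows (v, w) = (if w = [Bwd] then 1 else 0)"
    unfolding path_arrows_def path_bar_arrows_def path_arrow_def path_bar_arrow_def coeff_sum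
      coeff_basis_path prod.inject
    by (cases "w = [Fwd]"; cases "w = [Bwd]"; simp)+
qed

definition displaces :: "('k::field, 'm::nontriv) path_alg \<Rightarrow> int \<Rightarrow> bool" where
  "displaces x d \<longleftrightarrow> (\<forall>v w. coeff x (v, w) \<noteq> 0 \<longrightarrow> sum_list (map shift w) = d)"

lemma displaces_mult:
  assumes "displaces x d" "displaces y d'" "e = d + d'"
  shows "displaces (x * y) e"
  unfolding displaces_def
proof (intro allI impI)
  fix v w assume "coeff (x * y) (v, w) \<noteq> 0"
  then obtain j where
    "coeff x (v, take j w) * coeff y (path_target (v, take j w), drop j w) \<noteq> 0"
    unfolding coeff_times by (rule sum.not_neutral_contains_not_neutral)
  then have "sum_list (map shift (take j w)) = d" "sum_list (map shift (drop j w)) = d'"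
    using assms(1,2) unfolding displaces_def mult_eq_0_iff by blast+
  moreover have "sum_list (map shift (take j w @ drop j w)) =
      sum_list (map shift (take j w)) + (sum_list (map shift (drop j w)) :: int)"
    by (simp only: map_append sum_list_append)
  ultimately show "sum_list (map shift w) = e"
    unfolding append_take_drop_id assms(3) by (simp only:)
qed

lemma displaces_add: "displaces x d \<Longrightarrow> displaces y d \<Longrightarrow> displaces (x + y) d"
  unfolding displaces_def coeff_plus by (metis add_0)

lemma displaces_arrows:
  "displaces path_arrows 1" "displaces path_bar_arrows (- 1)" "displaces 1 0" "displaces 0 d"
  by (auto simp: displaces_def coeff_path_arrows coeff_one split: if_splits)

lemma displaces_power: "displaces x 0 \<Longrightarrow> displaces (x ^ l) 0"
proof (induction l)
  case (Suc l)
  then show ?case unfolding power_Suc by (intro displaces_mult[of x 0 "x ^ l" 0]) simp_all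
qed (simp add: displaces_arrows)

lemma displaces_sign: "displaces x d \<Longrightarrow> displaces ((- 1) ^ n * x) d"
  by (cases "even n") (simp_all add: displaces_def)

lemma displaces_path_g: "displaces (path_g N n r i) (int n - 2 * r)"
proof (induction n arbitrary: r)
  case 0
  show ?case by (auto simp: displaces_def vertex_path_def coeff_basis_path)
next
  case (Suc n)
  have ab: "displaces ((path_arrows * path_bar_arrows) ^ l) 0" for l
    by (rule displaces_power, rule displaces_mult[OF displaces_arrows(1,2)]) simp
  have ba: "displaces ((path_bar_arrows * path_arrows) ^ l) 0" for l
    by (rule displaces_power, rule displaces_mult[OF displaces_arrows(2,1)]) simp
  have A: "displaces (path_arrows * (path_bar_arrows * path_arrows) ^ l) 1" for l
    by (rule displaces_mult[OF displaces_arrows(1) ba]) simp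
  have B: "displaces (path_bar_arrows * (path_arrows * path_bar_arrows) ^ l) (- 1)" for l
    by (rule displaces_mult[OF displaces_arrows(2) ab]) simp
  have L: "displaces (path_g N n r i * x) (int (Suc n) - 2 * r)" if "displaces x 1"
    for x :: "('a, 'b) path_alg"
    by (rule displaces_mult[OF Suc.IH that]) simp
  have R: "displaces (path_g N n (r - 1) i * x) (int (Suc n) - 2 * r)" if "displaces x (- 1)"
    for x :: "('a, 'b) path_alg"
    by (rule displaces_mult[OF Suc.IH that]) simp
  have ite: "displaces (if c then x else y) d" if "displaces x d" "displaces y d"
    for c d and x y :: "('a, 'b) path_alg"
    using that by simp
  show ?case
    unfolding path_g.simps Let_def
    by (intro ite displaces_add displaces_sign L R A B displaces_arrows(1,2))
qed

lemma path_g_source: "vertex_path i * path_g N n r i = path_g N n r i"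
proof (induction n arbitrary: r)
  case (Suc n)
  define P where "P x \<longleftrightarrow> vertex_path i * x = x" for x :: "('a, 'b) path_alg"
  have add: "P (x + y)" if "P x" "P y" for x y using that by (simp add: P_def distrib_left)
  have ite: "P (if c then x else y)" if "P x" "P y" for c x y using that by simp
  have sign: "P ((- 1) ^ k * x)" if "P x" for k x using that by (cases "even k") (simp_all add: P_def)
  have g: "P (path_g N n r' i * x)" for r' x by (simp add: P_def Suc.IH mult.assoc[symmetric])
  have "P (path_g N (Suc n) r i)"
    unfolding path_g.simps Let_def by (intro ite add sign g)
  then show ?case by (simp add: P_def)
qed (simp add: vertex_path_mult)

lemma coeff_mult_arrows:
  "coeff (x * path_arrows) (v, w @ [s]) = (if s = Fwd then coeff x (v, w) else 0)"
  "coeff (x * path_bar_arrows) (v, w @ [s]) = (if s = Bwd then coeff x (v, w) else 0)"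
proof -
  have *: "(\<Sum>j\<le>length (w @ [s]). coeff x (v, take j (w @ [s])) * (if drop j (w @ [s]) = [c] then 1 else 0))
      = (if s = c then coeff x (v, w) else 0)" for c
  proof -
    have "coeff x (v, take j (w @ [s])) * (if drop j (w @ [s]) = [c] then 1 else 0) =
        (if j = length w then (if s = c then coeff x (v, w) else 0) else 0)"
      if "j \<le> length (w @ [s])" for j
    proof (cases "j = length w")
      case False
      then have "length (drop j (w @ [s])) \<noteq> 1" using that by simp
      then have "drop j (w @ [s]) \<noteq> [c]" by (metis length_Cons list.size(3) One_nat_def)
      then show ?thesis using False by (simp only: if_False mult_zero_right)
    qed simp
    then show ?thesis by simp
  qed
  show "coeff (x * path_arrows) (v, w @ [s]) = (if s = Fwd then coeff x (v, w) else 0)"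
    "coeff (x * path_bar_arrows) (v, w @ [s]) = (if s = Bwd then coeff x (v, w) else 0)"
    unfolding coeff_times coeff_path_arrows by (rule *)+
qed

lemma path_g_nonzero:
  assumes "0 \<le> r" "r \<le> int n"
  shows "path_g N n r i \<noteq> (0 :: ('k::field, 'm::nontriv) path_alg)"
  using assms
proof (induction n arbitrary: r)
  case 0
  have "coeff (vertex_path i :: ('k, 'm) path_alg) (i, []) \<noteq> 0"
    by (simp add: vertex_path_def coeff_basis_path)
  then show ?case using 0 by auto
next
  case (Suc n)
  let ?a = "path_arrows :: ('k, 'm) path_alg" and ?b = "path_bar_arrows :: ('k, 'm) path_alg"
  have witness: "\<exists>v w. coeff x (v, w) \<noteq> 0" if "x \<noteq> 0" for x :: "('k, 'm) path_alg"
    using that path_alg_eqI[of x 0] by auto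
  have na: "x * ?a \<noteq> 0" and nb: "x * ?b \<noteq> 0" if x: "x \<noteq> 0" for x
  proof -
    from witness[OF x] obtain v w where vw: "coeff x (v, w) \<noteq> 0" by blast
    then have "coeff (x * ?a) (v, w @ [Fwd]) \<noteq> 0" "coeff (x * ?b) (v, w @ [Bwd]) \<noteq> 0"
      by (simp_all add: coeff_mult_arrows)
    then show "x * ?a \<noteq> 0" "x * ?b \<noteq> 0" by (metis coeff_zero)+
  qed
  have nab: "x * (?a * ?b) ^ l \<noteq> 0" if "x \<noteq> 0" for x l
    using that
  proof (induction l arbitrary: x)
    case (Suc l)
    from Suc.IH[OF nb[OF na[OF Suc.prems]]] show ?case by (simp only: power_Suc mult.assoc not_False_eq_True)
  qed simp
  have shift: "y * (z * y) ^ l = (y * z) ^ l * y" for y z :: "('k, 'm) path_alg" and l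
  proof (induction l)
    case (Suc l)
    have "y * (z * y) ^ Suc l = y * z * (y * (z * y) ^ l)" by (simp only: power_Suc mult.assoc)
    also have "\<dots> = (y * z) ^ Suc l * y" by (simp only: Suc.IH power_Suc mult.assoc)
    finally show ?case .
  qed simp
  have ends_a: "y * ?a + z * ?b \<noteq> 0" if y: "y \<noteq> 0" for y z
  proof -
    from witness[OF y] obtain v w where "coeff y (v, w) \<noteq> 0" by blast
    then have "coeff (y * ?a + z * ?b) (v, w @ [Fwd]) \<noteq> 0" by (simp add: coeff_mult_arrows)
    then show ?thesis by (metis coeff_zero)
  qed
  have ends_b: "y * ?a + z * ?b \<noteq> 0" if z: "z \<noteq> 0" for y z
  proof -
    from witness[OF z] obtain v w where "coeff z (v, w) \<noteq> 0" by blast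
    then have "coeff (y * ?a + z * ?b) (v, w @ [Bwd]) \<noteq> 0" by (simp add: coeff_mult_arrows)
    then show ?thesis by (metis coeff_zero)
  qed
  have sign: "(- 1) ^ k * x \<noteq> 0" if "x \<noteq> 0" for k and x :: "('k, 'm) path_alg"
    using that by (cases "even k") simp_all
  consider "int (Suc n) - 2 * r > 0" | "int (Suc n) - 2 * r < 0" | "int (Suc n) - 2 * r = 0"
    by linarith
  then show ?case
  proof cases
    case 1
    then have "path_g N n r i \<noteq> (0 :: ('k, 'm) path_alg)" using Suc by (intro Suc.IH) auto
    from ends_a[OF this] show ?thesis
      using 1 by (simp only: path_g.simps Let_def if_True shift mult.assoc[symmetric] not_False_eq_True)
  next
    case 2
    then have "path_g N n (r - 1) i \<noteq> (0 :: ('k, 'm) path_alg)" using Suc by (intro Suc.IH) auto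
    moreover have "\<not> int (Suc n) - 2 * r > 0" using 2 by simp
    ultimately show ?thesis
      using 2 ends_b[OF sign] by (simp only: path_g.simps Let_def if_True if_False shift mult.assoc[symmetric] not_False_eq_True)
  next
    case 3
    then have "path_g N n r i \<noteq> (0 :: ('k, 'm) path_alg)" using Suc by (intro Suc.IH) auto
    from ends_a[OF nab[OF this]] show ?thesis
      unfolding path_g.simps Let_def 3 by (simp only: less_irrefl if_False shift mult.assoc[symmetric] not_False_eq_True)
  qed
qed

text \<open>
  Thus the \<open>g\<^sup>n\<^bsub>r,i\<^esub>\<close> with \<open>0 \<le> r \<le> n\<close> are nonzero and homogeneous with respect to the source of paths
  and their displacement \<open>n - 2r\<close>, hence linearly independent for fixed \<open>n\<close>; the target is
  \<open>i + n - 2r\<close>. In the following \<open>g\<^sup>n\<^bsub>r,i\<^esub>\<close> is represented by its label \<open>(n, r, i)\<close> with \<open>r \<le> n\<close>, so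
  that the labels of degree \<open>n\<close> form the basis \<open>\<B>\<^sub>n\<close>. All \<open>P\<^sub>n = A \<otimes>\<^sub>E k\<B>\<^sub>n \<otimes>\<^sub>E A\<close> are realized
  inside one bimodule \<open>bimod\<close>, the quotient of the free vector space on all triples \<open>(x, g, y)\<close> by
  the relations of the tensor product; \<open>P\<^sub>n\<close> is its subspace \<open>component n\<close>.
\<close>

type_synonym 'm label = "nat \<times> nat \<times> 'm mod_ring"

fun source :: "'m::nontriv label \<Rightarrow> 'm mod_ring" where
  "source (n, r, i) = i"

fun target :: "'m::nontriv label \<Rightarrow> 'm mod_ring" where
  "target (n, r, i) = i + of_nat n - 2 * of_nat r"

definition free_scale :: "'k::field \<Rightarrow> ('x \<Rightarrow>\<^sub>0 'k) \<Rightarrow> ('x \<Rightarrow>\<^sub>0 'k)" where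
  "free_scale c = Poly_Mapping.map ((*) c)"

lemma lookup_free_scale [simp]:
  "Poly_Mapping.lookup (free_scale c u) t = c * Poly_Mapping.lookup u t"
  by (simp add: free_scale_def Poly_Mapping.map.rep_eq when_def)

interpretation free: vector_space free_scale
  by standard (auto intro!: poly_mapping_eqI simp: lookup_add algebra_simps)

definition lin_ext ::
  "('k::field \<Rightarrow> 'v \<Rightarrow> 'v::ab_group_add) \<Rightarrow> ('x \<Rightarrow> 'v) \<Rightarrow> ('x \<Rightarrow>\<^sub>0 'k) \<Rightarrow> 'v" where
  "lin_ext s F u = (\<Sum>t\<in>Poly_Mapping.keys u. s (Poly_Mapping.lookup u t) (F t))"

definition balanced ::
  "('k::field \<Rightarrow> 'v \<Rightarrow> 'v::ab_group_add) \<Rightarrow>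
     (('k, 'n::finite, 'm::nontriv) alg \<times> 'm label \<times> ('k, 'n, 'm) alg \<Rightarrow> 'v) \<Rightarrow> bool" where
  "balanced s F \<longleftrightarrow>
     (\<forall>x x' g y. F (x + x', g, y) = F (x, g, y) + F (x', g, y)) \<and>
     (\<forall>x g y y'. F (x, g, y + y') = F (x, g, y) + F (x, g, y')) \<and>
     (\<forall>c x g y. F (scale_alg c x, g, y) = s c (F (x, g, y))) \<and>
     (\<forall>c x g y. F (x, g, scale_alg c y) = s c (F (x, g, y))) \<and>
     (\<forall>x j g y. F (x * idem j, g, y) = (if j = source g then F (x, g, y) else 0)) \<and>
     (\<forall>x j g y. F (x, g, idem j * y) = (if j = target g then F (x, g, y) else 0))"

context
  fixes s :: "'k::field \<Rightarrow> 'v::ab_group_add \<Rightarrow> 'v"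
  assumes vs: "vector_space s"
begin

interpretation vs: vector_space s by (rule vs)

lemma lin_ext_superset:
  assumes "finite S" "Poly_Mapping.keys u \<subseteq> S"
  shows "lin_ext s F u = (\<Sum>t\<in>S. s (Poly_Mapping.lookup u t) (F t))"
  unfolding lin_ext_def
  by (rule sum.mono_neutral_left) (use assms in \<open>auto simp: in_keys_iff\<close>)

lemma lin_ext_add: "lin_ext s F (u + v) = lin_ext s F u + lin_ext s F v"
proof -
  let ?S = "Poly_Mapping.keys u \<union> Poly_Mapping.keys v"
  have "lin_ext s F (u + v) = (\<Sum>t\<in>?S. s (Poly_Mapping.lookup (u + v) t) (F t))"
    by (rule lin_ext_superset) (auto simp: Poly_Mapping.keys_add)
  also have "\<dots> = (\<Sum>t\<in>?S. s (Poly_Mapping.lookup u t) (F t)) + (\<Sum>t\<in>?S. s (Poly_Mapping.lookup v t) (F t))"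
    by (simp add: lookup_add vs.scale_left_distrib sum.distrib)
  also have "\<dots> = lin_ext s F u + lin_ext s F v"
    by (simp add: lin_ext_superset[symmetric])
  finally show ?thesis .
qed

lemma lin_ext_scale: "lin_ext s F (free_scale c u) = s c (lin_ext s F u)"
proof -
  have "lin_ext s F (free_scale c u) =
          (\<Sum>t\<in>Poly_Mapping.keys u. s (Poly_Mapping.lookup (free_scale c u) t) (F t))"
    by (rule lin_ext_superset) (auto simp: in_keys_iff)
  then show ?thesis by (simp add: lin_ext_def vs.scale_sum_right)
qed

lemma lin_ext_diff: "lin_ext s F (u - v) = lin_ext s F u - lin_ext s F v"
  using lin_ext_add[of F "u - v" v] by simp

lemma lin_ext_zero [simp]: "lin_ext s F 0 = 0"
  by (simp add: lin_ext_def)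

lemma lin_ext_single [simp]: "lin_ext s F (Poly_Mapping.single t c) = s c (F t)"
  by (simp add: lin_ext_def)

end

definition triple :: "'a \<Rightarrow> 'b \<Rightarrow> 'c \<Rightarrow> ('a \<times> 'b \<times> 'c \<Rightarrow>\<^sub>0 'k::field)" where
  "triple x g y = Poly_Mapping.single (x, g, y) 1"

inductive_set tensor_relations ::
  "((('k::field, 'n::finite, 'm::nontriv) alg \<times> 'm label \<times> ('k, 'n, 'm) alg) \<Rightarrow>\<^sub>0 'k) set" where
  add_left: "triple (x + x') g y - (triple x g y + triple x' g y) \<in> tensor_relations"
| add_right: "triple x g (y + y') - (triple x g y + triple x g y') \<in> tensor_relations"
| scale_left: "triple (scale_alg c x) g y - free_scale c (triple x g y) \<in> tensor_relations"
| scale_right: "triple x g (scale_alg c y) - free_scale c (triple x g y) \<in> tensor_relations"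
| idem_left: "triple (x * idem j) g y - (if j = source g then triple x g y else 0) \<in> tensor_relations"
| idem_right: "triple x g (idem j * y) - (if j = target g then triple x g y else 0) \<in> tensor_relations"

lemma lin_ext_balanced:
  assumes "vector_space s" "balanced s F" "u - v \<in> module.span free_scale tensor_relations"
  shows "lin_ext s F u = lin_ext s F v"
proof -
  interpret vs: vector_space s by fact
  note le = lin_ext_add[OF assms(1)] lin_ext_diff[OF assms(1)] lin_ext_scale[OF assms(1)]
    lin_ext_single[OF assms(1)] lin_ext_zero[OF assms(1)]
  have rel: "lin_ext s F w = 0" if "w \<in> tensor_relations" for w
    using that
  proof cases
  qed (use assms(2) in \<open>simp_all add: triple_def le balanced_def del: split_paired_All\<close>)
  have "lin_ext s F w = 0" if "w \<in> module.span free_scale tensor_relations" for w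
    using that by (induction rule: free.span_induct_alt) (auto simp: le rel)
  from this[OF assms(3)] show ?thesis by (simp add: le)
qed

quotient_type (overloaded) ('k, 'n, 'm) bimod =
    "(('k::field, 'n::finite, 'm::nontriv) alg \<times> 'm label \<times> ('k, 'n, 'm) alg) \<Rightarrow>\<^sub>0 'k"
  / "\<lambda>u v. u - v \<in> module.span free_scale tensor_relations"
proof (rule equivpI)
  show "reflp (\<lambda>u v :: (('k, 'n, 'm) alg \<times> 'm label \<times> ('k, 'n, 'm) alg) \<Rightarrow>\<^sub>0 'k.
      u - v \<in> free.span tensor_relations)"
    by (simp add: reflp_def free.span_zero)
  show "symp (\<lambda>u v :: (('k, 'n, 'm) alg \<times> 'm label \<times> ('k, 'n, 'm) alg) \<Rightarrow>\<^sub>0 'k.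
      u - v \<in> free.span tensor_relations)"
    by (rule sympI) (drule free.span_neg, simp)
  show "transp (\<lambda>u v :: (('k, 'n, 'm) alg \<times> 'm label \<times> ('k, 'n, 'm) alg) \<Rightarrow>\<^sub>0 'k.
      u - v \<in> free.span tensor_relations)"
    by (rule transpI) (drule (1) free.span_add, simp)
qed

instantiation bimod :: (field, finite, nontriv) ab_group_add
begin

lift_definition zero_bimod :: "('a, 'b, 'c) bimod" is 0 .
lift_definition plus_bimod :: "('a, 'b, 'c) bimod \<Rightarrow> ('a, 'b, 'c) bimod \<Rightarrow> ('a, 'b, 'c) bimod" is "(+)"
  by (drule (1) free.span_add) (simp add: algebra_simps)
lift_definition minus_bimod :: "('a, 'b, 'c) bimod \<Rightarrow> ('a, 'b, 'c) bimod \<Rightarrow> ('a, 'b, 'c) bimod" is "(-)"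
  by (drule (1) free.span_diff) (simp add: algebra_simps)
lift_definition uminus_bimod :: "('a, 'b, 'c) bimod \<Rightarrow> ('a, 'b, 'c) bimod" is uminus
  by (drule free.span_neg) simp

instance
  by standard (transfer, simp add: algebra_simps free.span_zero)+

end

lift_definition scale_bimod ::
  "'k::field \<Rightarrow> ('k, 'n::finite, 'm::nontriv) bimod \<Rightarrow> ('k, 'n, 'm) bimod" is free_scale
  by (drule free.span_scale) (simp add: free.scale_right_diff_distrib)

lift_definition tensor ::
  "('k::field, 'n::finite, 'm::nontriv) alg \<Rightarrow> 'm label \<Rightarrow> ('k, 'n, 'm) alg \<Rightarrow> ('k, 'n, 'm) bimod"
  is "\<lambda>x g y. triple x g y" .

lemma vector_space_scale_bimod:
  "vector_space (scale_bimod :: 'k::field \<Rightarrow> ('k, 'n::finite, 'm::nontriv) bimod \<Rightarrow> _)"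
  by standard (transfer, simp add: algebra_simps free.span_zero)+

lemma balanced_tensor: "balanced scale_bimod (\<lambda>(x, g, y). tensor x g y)"
  unfolding balanced_def prod.case
  by (intro conjI allI; transfer; rule free.span_base; rule tensor_relations.intros)

lemmas tensor_add_left = balanced_tensor[unfolded balanced_def prod.case, THEN conjunct1, rule_format]
lemmas tensor_add_right =
  balanced_tensor[unfolded balanced_def prod.case, THEN conjunct2, THEN conjunct1, rule_format]
lemmas tensor_scale_left =
  balanced_tensor[unfolded balanced_def prod.case, THEN conjunct2, THEN conjunct2, THEN conjunct1, rule_format]
lemmas tensor_scale_right =
  balanced_tensor[unfolded balanced_def prod.case, THEN conjunct2, THEN conjunct2, THEN conjunct2,
    THEN conjunct1, rule_format]
lemmas tensor_idem_left =
  balanced_tensor[unfolded balanced_def prod.case, THEN conjunct2, THEN conjunct2, THEN conjunct2,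
    THEN conjunct2, THEN conjunct1, rule_format]
lemmas tensor_idem_right =
  balanced_tensor[unfolded balanced_def prod.case, THEN conjunct2, THEN conjunct2, THEN conjunct2,
    THEN conjunct2, THEN conjunct2, rule_format]

lemma bimod_induct [case_names zero add tensor]:
  fixes p :: "('k::field, 'n::finite, 'm::nontriv) bimod"
  assumes zero: "P 0" and add: "\<And>p q. P p \<Longrightarrow> P q \<Longrightarrow> P (p + q)" and tensor: "\<And>x g y. P (tensor x g y)"
  shows "P p"
proof -
  let ?A = "abs_bimod :: _ \<Rightarrow> ('k, 'n, 'm) bimod"
  have "P (?A u)" for u
  proof (induction u rule: Poly_Mapping.update_induct)
    case const
    show ?case using zero unfolding zero_bimod.abs_eq .
  next
    case (update u t c)
    obtain x g y where t: "t = (x, g, y)" by (cases t)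
    have "Poly_Mapping.update t c u = free_scale c (triple x g y) + u"
    proof (rule poly_mapping_eqI)
      fix k
      show "Poly_Mapping.lookup (Poly_Mapping.update t c u) k =
              Poly_Mapping.lookup (free_scale c (triple x g y) + u) k"
        using update.hyps
        by (cases "k = t") (simp_all add: lookup_update lookup_add triple_def lookup_single t in_keys_iff)
    qed
    then have "?A (Poly_Mapping.update t c u) = scale_bimod c (tensor x g y) + ?A u"
      by (simp only: plus_bimod.abs_eq scale_bimod.abs_eq tensor.abs_eq)
    also have "scale_bimod c (tensor x g y) = tensor (scale_alg c x) g y"
      by (simp only: tensor_scale_left)
    finally have "?A (Poly_Mapping.update t c u) = tensor (scale_alg c x) g y + ?A u" .
    then show ?case using add[OF tensor update.IH] by (simp only:)
  qed
  then have "P (?A (rep_bimod p))" .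
  then show ?thesis unfolding Quotient3_abs_rep[OF Quotient3_bimod] .
qed

lift_definition left_mult ::
  "('k::field, 'n::finite, 'm::nontriv) alg \<Rightarrow> ('k, 'n, 'm) bimod \<Rightarrow> ('k, 'n, 'm) bimod"
  is "\<lambda>z. lin_ext scale_bimod (\<lambda>(x, g, y). tensor (z * x) g y)"
  by (rule lin_ext_balanced[OF vector_space_scale_bimod])
     (simp_all add: balanced_def distrib_left scale_alg_mult_right mult.assoc[symmetric]
        tensor_add_left tensor_add_right tensor_scale_left tensor_scale_right
        tensor_idem_left tensor_idem_right del: split_paired_All)

lift_definition right_mult ::
  "('k::field, 'n::finite, 'm::nontriv) bimod \<Rightarrow> ('k, 'n, 'm) alg \<Rightarrow> ('k, 'n, 'm) bimod"
  is "\<lambda>u z. lin_ext scale_bimod (\<lambda>(x, g, y). tensor x g (y * z)) u"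
  by (rule ext, rule lin_ext_balanced[OF vector_space_scale_bimod])
     (simp_all add: balanced_def distrib_right scale_alg_mult_left mult.assoc
        tensor_add_left tensor_add_right tensor_scale_left tensor_scale_right
        tensor_idem_left tensor_idem_right del: split_paired_All)

interpretation alg: vector_space "scale_alg :: 'k::field \<Rightarrow> ('k, 'n::finite, 'm::nontriv) alg \<Rightarrow> _"
  by (rule vector_space_scale_alg)

interpretation bimod: vector_space "scale_bimod :: 'k::field \<Rightarrow> ('k, 'n::finite, 'm::nontriv) bimod \<Rightarrow> _"
  by (rule vector_space_scale_bimod)

lemma left_mult_tensor [simp]: "left_mult z (tensor x g y) = tensor (z * x) g y"
  by (simp add: tensor.abs_eq left_mult.abs_eq triple_def lin_ext_single[OF vector_space_scale_bimod])

lemma right_mult_tensor [simp]: "right_mult (tensor x g y) z = tensor x g (y * z)"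
  by (simp add: tensor.abs_eq right_mult.abs_eq triple_def lin_ext_single[OF vector_space_scale_bimod])

lemma abs_bimod_cases: obtains u where "p = abs_bimod u"
  by (rule that[of "rep_bimod p"]) (simp only: Quotient3_abs_rep[OF Quotient3_bimod])

lemma left_mult_linear [simp]:
  "left_mult z (p + q) = left_mult z p + left_mult z q"
  "left_mult z (scale_bimod c p) = scale_bimod c (left_mult z p)"
  "left_mult z 0 = 0"
proof -
  obtain u where u: "p = abs_bimod u" by (rule abs_bimod_cases)
  obtain v where v: "q = abs_bimod v" by (rule abs_bimod_cases)
  note p = u v
  show "left_mult z (p + q) = left_mult z p + left_mult z q"
    by (simp only: p plus_bimod.abs_eq left_mult.abs_eq lin_ext_add[OF vector_space_scale_bimod])
  show "left_mult z (scale_bimod c p) = scale_bimod c (left_mult z p)"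
    by (simp only: p scale_bimod.abs_eq left_mult.abs_eq lin_ext_scale[OF vector_space_scale_bimod])
  show "left_mult z 0 = 0"
    by (subst zero_bimod.abs_eq, subst left_mult.abs_eq, rule lin_ext_zero[OF vector_space_scale_bimod])
qed

lemma right_mult_linear [simp]:
  "right_mult (p + q) z = right_mult p z + right_mult q z"
  "right_mult (scale_bimod c p) z = scale_bimod c (right_mult p z)"
  "right_mult 0 z = 0"
proof -
  obtain u where u: "p = abs_bimod u" by (rule abs_bimod_cases)
  obtain v where v: "q = abs_bimod v" by (rule abs_bimod_cases)
  note p = u v
  show "right_mult (p + q) z = right_mult p z + right_mult q z"
    by (simp only: p plus_bimod.abs_eq right_mult.abs_eq lin_ext_add[OF vector_space_scale_bimod])
  show "right_mult (scale_bimod c p) z = scale_bimod c (right_mult p z)"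
    by (simp only: p scale_bimod.abs_eq right_mult.abs_eq lin_ext_scale[OF vector_space_scale_bimod])
  show "right_mult 0 z = 0"
    by (subst zero_bimod.abs_eq, subst right_mult.abs_eq, rule lin_ext_zero[OF vector_space_scale_bimod])
qed

lemma left_mult_sum [simp]: "left_mult z (sum f S) = (\<Sum>l\<in>S. left_mult z (f l))"
  by (induction S rule: infinite_finite_induct) simp_all

lemma right_mult_sum [simp]: "right_mult (sum f S) z = (\<Sum>l\<in>S. right_mult (f l) z)"
  by (induction S rule: infinite_finite_induct) simp_all

lemma left_mult_alg_add: "left_mult (z + z') p = left_mult z p + left_mult z' p"
  by (induction p rule: bimod_induct) (simp_all add: distrib_right tensor_add_left algebra_simps)

lemma right_mult_alg_add: "right_mult p (z + z') = right_mult p z + right_mult p z'"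
  by (induction p rule: bimod_induct) (simp_all add: distrib_left tensor_add_right algebra_simps)

lemma left_mult_alg_scale: "left_mult (scale_alg c z) p = scale_bimod c (left_mult z p)"
  by (induction p rule: bimod_induct)
     (simp_all add: scale_alg_mult_left tensor_scale_left bimod.scale_right_distrib)

lemma right_mult_alg_scale: "right_mult p (scale_alg c z) = scale_bimod c (right_mult p z)"
  by (induction p rule: bimod_induct)
     (simp_all add: scale_alg_mult_right tensor_scale_right bimod.scale_right_distrib)

lemma left_mult_assoc: "left_mult (x * z) p = left_mult x (left_mult z p)"
  by (induction p rule: bimod_induct) (simp_all add: mult.assoc)

lemma right_mult_assoc: "right_mult p (x * z) = right_mult (right_mult p x) z"
  by (induction p rule: bimod_induct) (simp_all add: mult.assoc)

lemma left_right_mult: "left_mult x (right_mult p z) = right_mult (left_mult x p) z"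
  by (induction p rule: bimod_induct) simp_all

definition component :: "nat \<Rightarrow> ('k::field, 'n::finite, 'm::nontriv) bimod set" where
  "component n = module.span scale_bimod {tensor x (n, r, i) y | x r i y. r \<le> n}"

section \<open>The differential\<close>

text \<open>
  The sums of all arrows. In a composite or in a tensor product over \<open>E\<close> they select the unique
  arrow that fits, e.g. \<open>1 \<otimes> g\<^sup>n\<^bsub>r,i\<^esub> \<otimes> arrows = 1 \<otimes> g\<^sup>n\<^bsub>r,i\<^esub> \<otimes> a\<^sub>t\<close> for \<open>t = target (n, r, i)\<close>.
\<close>

definition arrows :: "('k::field, 'n::finite, 'm::nontriv) alg" where
  "arrows = (\<Sum>i\<in>UNIV. arrow i)"

definition bar_arrows :: "('k::field, 'n::finite, 'm::nontriv) alg" where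
  "bar_arrows = (\<Sum>i\<in>UNIV. bar_arrow i)"

text \<open>The integer \<open>r\<close> may lie outside of \<open>{0..n}\<close>, in which case \<open>g\<^sup>n\<^bsub>r,i\<^esub> = 0\<close>.\<close>

definition gtensor ::
  "('k::field, 'n::finite, 'm::nontriv) alg \<Rightarrow> nat \<Rightarrow> int \<Rightarrow> 'm mod_ring \<Rightarrow> ('k, 'n, 'm) alg
     \<Rightarrow> ('k, 'n, 'm) bimod" where
  "gtensor x n r i y = (if 0 \<le> r \<and> r \<le> int n then tensor x (n, nat r, i) y else 0)"

definition signed :: "nat \<Rightarrow> ('k::field, 'n::finite, 'm::nontriv) bimod \<Rightarrow> ('k, 'n, 'm) bimod" where
  "signed e p = scale_bimod ((- 1) ^ e) p"

definition diff_gen ::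
  "nat \<Rightarrow> nat \<Rightarrow> 'm::nontriv mod_ring \<Rightarrow> ('k::field, 'n::finite, 'm) bimod" where
  "diff_gen n r i = (let N = CARD('n); a = arrows; b = bar_arrows; r' = int r in
     if n = 0 then 0
     else if n > 2 * r then
       gtensor 1 (n - 1) r' i a
       + signed (n + r) (gtensor a (n - 1) r' (i + 1) 1)
       + signed (n + r) (gtensor (b * (a * b) ^ (N - 1)) (n - 1) (r' - 1) (i - 1) 1)
       + signed n (gtensor 1 (n - 1) (r' - 1) i (b * (a * b) ^ (N - 1)))
     else if n < 2 * r then
       gtensor 1 (n - 1) r' i (a * (b * a) ^ (N - 1))
       + signed (n + r) (gtensor (a * (b * a) ^ (N - 1)) (n - 1) r' (i + 1) 1)
       + signed (n + r) (gtensor b (n - 1) (r' - 1) (i - 1) 1)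
       + signed n (gtensor 1 (n - 1) (r' - 1) i b)
     else
       (\<Sum>l<N.
          gtensor ((b * a) ^ l) (n - 1) r' i (a * (b * a) ^ (N - 1 - l))
          + signed (n div 2) (gtensor ((a * b) ^ l * a) (n - 1) r' (i + 1) ((a * b) ^ (N - 1 - l)))
          + signed (n div 2) (gtensor ((b * a) ^ l * b) (n - 1) (r' - 1) (i - 1) ((b * a) ^ (N - 1 - l)))
          + gtensor ((a * b) ^ l) (n - 1) (r' - 1) i (b * (a * b) ^ (N - 1 - l))))"

definition has_shift :: "('k::field, 'n::finite, 'm::nontriv) alg \<Rightarrow> 'm mod_ring \<Rightarrow> bool" where
  "has_shift w d \<longleftrightarrow> (\<forall>j. idem j * w = w * idem (j + d))"

lemma has_shift_one: "has_shift 1 0"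
  by (simp add: has_shift_def)

lemma has_shift_arrows: "has_shift arrows 1"
  by (simp add: has_shift_def arrows_def sum_distrib_left sum_distrib_right arrow_parallel)

lemma has_shift_bar_arrows: "has_shift bar_arrows (- 1)"
proof -
  have "(j = i + 1) = (i = j - 1)" for i j :: "'c mod_ring" by auto
  then show ?thesis
    by (simp add: has_shift_def bar_arrows_def sum_distrib_left sum_distrib_right bar_arrow_parallel)
qed

lemma has_shift_mult:
  assumes w: "has_shift w d" and w': "has_shift w' d'" and d: "d'' = d + d'"
  shows "has_shift (w * w') d''"
  unfolding has_shift_def
proof
  fix j
  have "idem j * (w * w') = w * (idem (j + d) * w')"
    using w by (simp only: has_shift_def mult.assoc[symmetric])
  also have "\<dots> = w * w' * idem (j + d'')"
    using w' by (simp only: has_shift_def d mult.assoc add.assoc)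
  finally show "idem j * (w * w') = w * w' * idem (j + d'')" .
qed

lemma has_shift_power: "has_shift w 0 \<Longrightarrow> has_shift (w ^ l) 0"
proof (induction l)
  case (Suc l)
  then show ?case unfolding power_Suc by (intro has_shift_mult[of w 0 "w ^ l" 0]) simp_all
qed (simp add: has_shift_one)

lemma has_shift_words:
  "has_shift ((arrows * bar_arrows) ^ l) 0"
  "has_shift ((bar_arrows * arrows) ^ l) 0"
  "has_shift (arrows * (bar_arrows * arrows) ^ l) 1"
  "has_shift (bar_arrows * (arrows * bar_arrows) ^ l) (- 1)"
  "has_shift ((arrows * bar_arrows) ^ l * arrows) 1"
  "has_shift ((bar_arrows * arrows) ^ l * bar_arrows) (- 1)"
proof -
  have ab: "has_shift ((arrows * bar_arrows) ^ l) 0" and ba: "has_shift ((bar_arrows * arrows) ^ l) 0"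
    by (rule has_shift_power, rule has_shift_mult[OF has_shift_arrows has_shift_bar_arrows], simp)
       (rule has_shift_power, rule has_shift_mult[OF has_shift_bar_arrows has_shift_arrows], simp)
  show "has_shift ((arrows * bar_arrows) ^ l) 0" by (rule ab)
  show "has_shift ((bar_arrows * arrows) ^ l) 0" by (rule ba)
  show "has_shift (arrows * (bar_arrows * arrows) ^ l) 1"
    by (rule has_shift_mult[OF has_shift_arrows ba]) simp
  show "has_shift (bar_arrows * (arrows * bar_arrows) ^ l) (- 1)"
    by (rule has_shift_mult[OF has_shift_bar_arrows ab]) simp
  show "has_shift ((arrows * bar_arrows) ^ l * arrows) 1"
    by (rule has_shift_mult[OF ab has_shift_arrows]) simp
  show "has_shift ((bar_arrows * arrows) ^ l * bar_arrows) (- 1)"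
    by (rule has_shift_mult[OF ba has_shift_bar_arrows]) simp
qed

lemma gtensor_idem_left:
  assumes "has_shift w d"
  shows "left_mult (idem j) (gtensor w n r i y) = (if j + d = i then gtensor w n r i y else 0)"
  unfolding gtensor_def by (simp add: assms[unfolded has_shift_def] tensor_idem_left)

lemma gtensor_idem_right:
  assumes "has_shift w d"
  shows "right_mult (gtensor x n r i w) (idem j) =
           (if j - d = i + of_nat n - 2 * of_int r then gtensor x n r i w else 0)"
proof -
  have "w * idem j = idem (j - d) * w"
    using assms by (simp add: has_shift_def)
  moreover have "(of_nat (nat r) :: 'c mod_ring) = of_int r" if "r \<ge> 0"
    using that by (metis of_int_of_nat_eq int_nat_eq)
  ultimately show ?thesis
    unfolding gtensor_def by (simp add: tensor_idem_right)
qed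

lemma diff_gen_idem_left:
  "left_mult (idem j) (diff_gen n r i) = (if j = source (n, r, i) then diff_gen n r i else 0)"
proof -
  define P where "P p \<longleftrightarrow> left_mult (idem j) p = (if j = i then p else 0)" for p :: "('a, 'b, 'c) bimod"
  have zero: "P 0" by (simp add: P_def)
  have add: "P (p + q)" if "P p" "P q" for p q using that by (simp add: P_def)
  have ite: "P (if c then p else q)" if "P p" "P q" for c p q using that by simp
  have sgn: "P (signed e p)" if "P p" for e p using that by (simp add: P_def signed_def)
  have sum: "P (\<Sum>l<N. f l)" if "\<And>l. P (f l)" for f and N :: nat
    by (induction N) (simp_all add: zero add that)
  have g0: "P (gtensor w n r i y)" if "has_shift w 0" for w n r y
    using gtensor_idem_left[OF that, of j n r i y] by (simp add: P_def)
  have g1: "P (gtensor w n r (i + 1) y)" if "has_shift w 1" for w n r y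
    using gtensor_idem_left[OF that, of j n r "i + 1" y] by (simp add: P_def)
  have g2: "P (gtensor w n r (i - 1) y)" if "has_shift w (- 1)" for w n r y
    using gtensor_idem_left[OF that, of j n r "i - 1" y] by (simp add: P_def)
  have "P (diff_gen n r i)"
    unfolding diff_gen_def Let_def
    by (intro zero ite add sgn sum g0 g1 g2 has_shift_one has_shift_arrows
          has_shift_bar_arrows has_shift_words)
  then show ?thesis by (simp add: P_def)
qed

lemma diff_gen_idem_right:
  "right_mult (diff_gen n r i) (idem j) = (if j = target (n, r, i) then diff_gen n r i else 0)"
proof -
  define P where "P p \<longleftrightarrow> right_mult p (idem j) = (if j = target (n, r, i) then p else 0)"
    for p :: "('a, 'b, 'c) bimod"
  have zero: "P 0" by (simp add: P_def)
  have add: "P (p + q)" if "P p" "P q" for p q using that by (simp add: P_def)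
  have ite: "P (if c then p else q)" if "P p" "P q" for c p q using that by simp
  have sgn: "P (signed e p)" if "P p" for e p using that by (simp add: P_def signed_def)
  have sum: "P (\<Sum>l<N. f l)" if "\<And>l. P (f l)" for f and N :: nat
    by (induction N) (simp_all add: zero add that)
  have n1: "(of_nat (n - 1) :: 'c mod_ring) = of_nat n - 1" if "n \<noteq> 0"
    using that by (simp add: of_nat_diff)
  have g: "P (gtensor x (n - 1) r' i' w)"
    if "n \<noteq> 0" "has_shift w d" "i' - 2 * of_int r' + d = i + 1 - 2 * of_nat r" for x w d r' i'
  proof -
    have "i' + of_nat (n - 1) - 2 * of_int r' = target (n, r, i) - d"
    proof -
      have i': "i' = i + 1 - 2 * of_nat r + 2 * of_int r' - d"
      proof -
        have "i' = (i' - 2 * of_int r' + d) + 2 * of_int r' - d" by (simp add: algebra_simps)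
        then show ?thesis unfolding that(3) .
      qed
      show ?thesis unfolding n1[OF that(1)] i' by (simp add: algebra_simps)
    qed
    then show ?thesis
      using gtensor_idem_right[OF that(2), of x "n - 1" r' i' j] by (simp add: P_def del: target.simps)
  qed
  have g1: "P (gtensor x (n - 1) (int r) i w)" if "n \<noteq> 0" "has_shift w 1" for x w
    by (rule g[OF that]) simp
  have g2: "P (gtensor x (n - 1) (int r) (i + 1) w)" if "n \<noteq> 0" "has_shift w 0" for x w
    by (rule g[OF that]) simp
  have g3: "P (gtensor x (n - 1) (int r - 1) (i - 1) w)" if "n \<noteq> 0" "has_shift w 0" for x w
    by (rule g[OF that]) (simp add: algebra_simps)
  have g4: "P (gtensor x (n - 1) (int r - 1) i w)" if "n \<noteq> 0" "has_shift w (- 1)" for x w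
    by (rule g[OF that]) (simp add: algebra_simps)
  have "P (diff_gen n r i)"
  proof (cases "n = 0")
    case True
    then show ?thesis by (simp add: diff_gen_def zero)
  next
    case False
    show ?thesis
      unfolding diff_gen_def Let_def
      by (intro zero ite add sgn sum False[THEN g1] False[THEN g2] False[THEN g3] False[THEN g4]
            has_shift_one has_shift_arrows has_shift_bar_arrows has_shift_words)
  qed
  then show ?thesis by (simp add: P_def)
qed

lift_definition differential ::
  "('k::field, 'n::finite, 'm::nontriv) bimod \<Rightarrow> ('k, 'n, 'm) bimod"
  is "lin_ext scale_bimod (\<lambda>(x, (n, r, i), y). left_mult x (right_mult (diff_gen n r i) y))"
proof (rule lin_ext_balanced[OF vector_space_scale_bimod])
  have "balanced scale_bimod
      (\<lambda>(x, g, y). left_mult x (right_mult (case g of (n, r, i) \<Rightarrow> diff_gen n r i) y) :: ('k, 'n, 'm) bimod)"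
    unfolding balanced_def prod.case
  proof (intro conjI allI)
    fix x :: "('k, 'n, 'm) alg" and y j and g :: "'m label"
    obtain n r i where g: "g = (n, r, i)" by (cases g)
    show "left_mult (x * idem j) (right_mult (case g of (n, r, i) \<Rightarrow> diff_gen n r i) y) =
        (if j = source g then left_mult x (right_mult (case g of (n, r, i) \<Rightarrow> diff_gen n r i) y) else 0)"
      by (simp add: g left_mult_assoc left_right_mult diff_gen_idem_left)
    show "left_mult x (right_mult (case g of (n, r, i) \<Rightarrow> diff_gen n r i) (idem j * y)) =
        (if j = target g then left_mult x (right_mult (case g of (n, r, i) \<Rightarrow> diff_gen n r i) y) else 0)"
      by (simp add: g right_mult_assoc diff_gen_idem_right)
  qed (simp_all add: left_mult_alg_add right_mult_alg_add left_mult_alg_scale right_mult_alg_scale)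
  then show "balanced scale_bimod
      (\<lambda>(x, (n, r, i), y). left_mult x (right_mult (diff_gen n r i) y) :: ('k, 'n, 'm) bimod)"
    by (simp add: case_prod_beta')
qed

lemma differential_tensor:
  "differential (tensor x (n, r, i) y) = left_mult x (right_mult (diff_gen n r i) y)"
  by (simp add: tensor.abs_eq differential.abs_eq triple_def lin_ext_single[OF vector_space_scale_bimod])

section \<open>Cochains on \<open>P\<^sub>n\<close> and their classes\<close>

text \<open>
  A function \<open>f\<close> on labels whose value at each \<open>g\<close> is parallel to \<open>g\<close> is an element of
  \<open>Hom\<^bsub>E\<^sup>e\<^esub>(k\<B>\<^sub>n, A)\<close>, and \<open>evaluate f\<close> is the corresponding \<open>A\<^sup>e\<close>-linear map
  \<open>x \<otimes> g \<otimes> y \<mapsto> x f(g) y\<close>. The idempotents do nothing for such an \<open>f\<close>; they make the definition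
  meaningful for all \<open>f\<close>.
\<close>

lift_definition evaluate ::
  "('m::nontriv label \<Rightarrow> ('k::field, 'n::finite, 'm) alg) \<Rightarrow> ('k, 'n, 'm) bimod \<Rightarrow> ('k, 'n, 'm) alg"
  is "\<lambda>f. lin_ext scale_alg (\<lambda>(x, g, y). x * idem (source g) * f g * idem (target g) * y)"
  by (rule lin_ext_balanced[OF vector_space_scale_alg])
     (simp_all add: balanced_def distrib_right distrib_left scale_alg_mult_left scale_alg_mult_right
        mult.assoc idem_mult_assoc del: split_paired_All source.simps target.simps)

lemma evaluate_tensor:
  "evaluate f (tensor x g y) = x * idem (source g) * f g * idem (target g) * y"
  by (simp add: tensor.abs_eq evaluate.abs_eq triple_def lin_ext_single[OF vector_space_scale_alg])

definition augmentation :: "('k::field, 'n::finite, 'm::nontriv) bimod \<Rightarrow> ('k, 'n, 'm) alg" where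
  "augmentation = evaluate (\<lambda>(n, r, i). if n = 0 \<and> r = 0 then 1 else 0)"

text \<open>
  A comparison map is a chain map from the bar resolution to \<open>P\<close> over the identity of \<open>A\<close>. An
  \<open>A\<^sup>e\<close>-linear map \<open>A\<^bsup>\<otimes>(n+2)\<^esup> \<rightarrow> P\<^sub>n\<close> is the same as a multilinear map
  \<open>(x\<^sub>1, \<dots>, x\<^sub>n) \<mapsto> \<pi> [x\<^sub>1, \<dots>, x\<^sub>n]\<close>, its value at \<open>1 \<otimes> x\<^sub>1 \<otimes> \<dots> \<otimes> x\<^sub>n \<otimes> 1\<close>; the length of the list gives
  the degree.
\<close>

definition comparison_map ::
  "(('k::field, 'n::finite, 'm::nontriv) alg list \<Rightarrow> ('k, 'n, 'm) bimod) \<Rightarrow> bool" where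
  "comparison_map \<pi> \<longleftrightarrow>
     (\<forall>n. multilinear scale_alg scale_bimod n \<pi>) \<and>
     (\<forall>xs. \<pi> xs \<in> component (length xs)) \<and>
     augmentation (\<pi> []) = 1 \<and>
     (\<forall>xs. xs \<noteq> [] \<longrightarrow>
        differential (\<pi> xs) =
          left_mult (hd xs) (\<pi> (tl xs))
          + (\<Sum>i<length xs - 1.
               signed (i + 1) (\<pi> (take i xs @ [xs ! i * xs ! (i + 1)] @ drop (i + 2) xs)))
          + signed (length xs) (right_mult (\<pi> (butlast xs)) (last xs)))"

text \<open>
  The map \<open>(g\<^sup>n\<^bsub>r,i\<^esub> \<parallel> u)\<close>, and the class in \<open>HH\<^sup>n(A)\<close> named by a cocycle on \<open>P\<^sub>n\<close>: the class of the
  bar cocycle obtained by composing with the comparison map.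
\<close>

definition par ::
  "nat \<Rightarrow> nat \<Rightarrow> 'm mod_ring \<Rightarrow> ('k::field, 'n::finite, 'm::nontriv) alg \<Rightarrow> 'm label \<Rightarrow> ('k, 'n, 'm) alg" where
  "par n r i u g = (if g = (n, r, i) then u else 0)"

definition class_via ::
  "(('k::field, 'n::finite, 'm::nontriv) alg list \<Rightarrow> ('k, 'n, 'm) bimod) \<Rightarrow> nat \<Rightarrow>
     ('m label \<Rightarrow> ('k, 'n, 'm) alg) \<Rightarrow> (('k, 'n, 'm) alg list \<Rightarrow> ('k, 'n, 'm) alg) set" where
  "class_via \<pi> n f = HH_class scale_alg n (\<lambda>xs. if length xs = n then evaluate f (\<pi> xs) else 0)"

definition central_class ::
  "('k::field, 'n::finite, 'm::nontriv) alg \<Rightarrow> (('k, 'n, 'm) alg list \<Rightarrow> ('k, 'n, 'm) alg) set" where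
  "central_class z = HH_class scale_alg 0 (\<lambda>xs. if xs = [] then z else 0)"

section \<open>The generators\<close>

definition eps :: "'m::nontriv mod_ring \<Rightarrow> ('k::field, 'n::finite, 'm) alg" where
  "eps i = (arrow i * bar_arrow i) ^ CARD('n)"

definition central_f :: "'m::nontriv mod_ring \<Rightarrow> ('k::field, 'n::finite, 'm) alg" where
  "central_f i = arrow i * bar_arrow i + bar_arrow i * arrow i"

definition gen_F :: "'m::nontriv mod_ring \<Rightarrow> 'm label \<Rightarrow> ('k::field, 'n::finite, 'm) alg" where
  "gen_F j g = par 2 1 j (arrow j * bar_arrow j) g + par 2 1 (j + 1) (- (bar_arrow j * arrow j)) g"

definition chi4 :: "'m::nontriv label \<Rightarrow> ('k::field, 'n::finite, 'm) alg" where
  "chi4 g = (\<Sum>i\<in>UNIV. par 4 2 i (idem i) g)"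

definition gen_phi :: "'m::nontriv label \<Rightarrow> ('k::field, 'n::finite, 'm) alg" where
  "gen_phi g = (\<Sum>i\<in>UNIV. par (CARD('m) - 1) (CARD('m) - 1) i
            ((arrow i * bar_arrow i) ^ (CARD('n) - 1) * arrow i) g)"

definition gen_psi :: "'m::nontriv label \<Rightarrow> ('k::field, 'n::finite, 'm) alg" where
  "gen_psi g = (\<Sum>i\<in>UNIV. par (CARD('m) - 1) 0 i
            ((bar_arrow (i - 1) * arrow (i - 1)) ^ (CARD('n) - 1) * bar_arrow (i - 1)) g)"

definition chi_plus :: "'m::nontriv label \<Rightarrow> ('k::field, 'n::finite, 'm) alg" where
  "chi_plus g = (\<Sum>i\<in>UNIV. par (2 * CARD('m)) 0 i (idem i) g)"

definition chi_minus :: "'m::nontriv label \<Rightarrow> ('k::field, 'n::finite, 'm) alg" where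
  "chi_minus g = (\<Sum>i\<in>UNIV. par (2 * CARD('m)) (2 * CARD('m)) i (idem i) g)"

text \<open>The listed generators, as pairs of a degree and a class of that degree.\<close>

definition generators ::
  "(('k::field, 'n::finite, 'm::nontriv) alg list \<Rightarrow> ('k, 'n, 'm) bimod) \<Rightarrow>
     (nat \<times> (('k, 'n, 'm) alg list \<Rightarrow> ('k, 'n, 'm) alg) set) set" where
  "generators \<pi> =
     {(0, central_class (eps i)) | i. True} \<union>
     {(0, central_class (central_f i)) | i. CARD('n) > 1} \<union>
     {(2, class_via \<pi> 2 (gen_F i)) | i. CARD('n) > 1} \<union>
     {(4, class_via \<pi> 4 chi4),
      (CARD('m) - 1, class_via \<pi> (CARD('m) - 1) gen_phi),
      (CARD('m) - 1, class_via \<pi> (CARD('m) - 1) gen_psi),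
      (2 * CARD('m), class_via \<pi> (2 * CARD('m)) chi_plus),
      (2 * CARD('m), class_via \<pi> (2 * CARD('m)) chi_minus)}"

end

theory Submission
  imports Defs "HOL-Library.Product_Plus"
begin

text \<open>
  The grading of \<open>A\<close> by the number of backward arrows and by the displacement along the quiver is respected by
  \<open>P\<close>, and every generator is represented by a homogeneous bar cocycle. Hence the bracket of two
  generators is a homogeneous cocycle of known degree and weight. Except for \<open>[F\<^bsub>2,j,1\<^esub>, f\<^sub>i]\<close> and
  \<open>[F\<^bsub>2,j,1\<^esub>, \<epsilon>\<^sub>i]\<close>, every cocycle on \<open>P\<close> of that degree and weight is a coboundary: in most cases
  \<open>A\<close> has no element of the required weight, and in the others the coefficients \<open>\<lambda>\<^sub>i\<close> of the cocycle
  satisfy \<open>\<lambda>\<^sub>i + \<lambda>\<^bsub>i+1\<^esub> = 0\<close> around a cycle of odd length, up to a coboundary.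

  The bracket \<open>[F\<^bsub>2,j,1\<^esub>, f\<^sub>i]\<close> is the class of the derivation \<open>x \<mapsto> F(f\<^sub>i, x) - F(x, f\<^sub>i)\<close>. It agrees on all
  arrows with the inner derivation given by \<open>F(a\<^sub>i, b\<^sub>i) + F(b\<^sub>i, a\<^sub>i)\<close>, where \<open>b\<^sub>i\<close> is the arrow opposite to
  \<open>a\<^sub>i\<close>. The central elements whose bracket with \<open>F\<close> vanishes form a subalgebra, which contains
  \<open>f\<^sub>i\<^sup>N = \<epsilon>\<^sub>i + \<epsilon>\<^bsub>i+1\<^esub>\<close> and therefore, since \<open>m\<close> is odd and \<open>2\<close> is invertible, also \<open>\<epsilon>\<^sub>i\<close>.
\<close>

section \<open>Multilinear maps and the bar differential\<close>

text \<open>The generators live on P, the bracket on bar cochains, and the only link is the given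
  \<open>\<pi>\<close>, of which just the defining equations of a comparison map are known; it need
  not respect weights. The bar resolution has an explicit contraction, which yields both a chain map
  \<iota> from P to it and a homotopy from \<iota> \<circ> \<pi> to the identity, so a bar cocycle
  may be tested on P. On P no contraction is at hand; there \<pi> \<circ> \<iota> is compared with
  the identity through a filtration by path length, up to degree 2m, the highest degree of a
  generator. This comparison is what permits replacing the cocycle of a generator by its component
  of the expected weight. Maps out of the bar resolution are handled as functions on lists, and
  \<iota> appears only through its effect on them, so that tensor powers of A never have to be
  formed. The invertibility of N enters where N equal summands of the differential of a middle label
  (n = 2r) are divided out. For the two exceptional brackets displacement is too coarse; this is why
  weights depend on a function \<xi> of the vertices.\<close>

definition lin :: "('k \<Rightarrow> 'a \<Rightarrow> 'a::ab_group_add) \<Rightarrow> ('k \<Rightarrow> 'b \<Rightarrow> 'b::ab_group_add) \<Rightarrow> ('a \<Rightarrow> 'b) \<Rightarrow> bool" where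
  "lin s t f \<longleftrightarrow> (\<forall>x y. f (x + y) = f x + f y) \<and> (\<forall>c x. f (s c x) = t c (f x))"

text \<open>Splitting off the first argument makes \<open>\<lambda>l. f (x # l)\<close> a cochain of
  lower degree, so statements about cochains go by induction on the degree. Like \<open>lin\<close>,
  this does not assert that the scalings are vector spaces, which
  \<open>Vector_Spaces.linear\<close> does.\<close>

primrec mlin ::
  "('k \<Rightarrow> 'a \<Rightarrow> 'a::ab_group_add) \<Rightarrow> ('k \<Rightarrow> 'b \<Rightarrow> 'b::ab_group_add) \<Rightarrow> nat \<Rightarrow> ('a list \<Rightarrow> 'b) \<Rightarrow> bool" where
  "mlin s t 0 f \<longleftrightarrow> True"
| "mlin s t (Suc n) f \<longleftrightarrow>
     (\<forall>r. length r = n \<longrightarrow> lin s t (\<lambda>x. f (x # r))) \<and> (\<forall>x. mlin s t n (\<lambda>l. f (x # l)))"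

lemma lin_0: "lin s t f \<Longrightarrow> f 0 = 0"
  unfolding lin_def by (metis add_cancel_right_right)

lemma lin_minus: "lin s t f \<Longrightarrow> f (- x) = - f x"
  using lin_0[of s t f] unfolding lin_def by (metis add.right_inverse add_eq_0_iff)

lemma lin_diff: "lin s t f \<Longrightarrow> f (x - y) = f x - f y"
  using lin_minus[of s t f y] unfolding lin_def by (metis add_uminus_conv_diff)

lemma lin_sum: "lin s t f \<Longrightarrow> f (sum g I) = (\<Sum>i\<in>I. f (g i))"
  by (induction I rule: infinite_finite_induct) (auto simp: lin_0 lin_def)

lemma lin_compose: "lin s t f \<Longrightarrow> lin t u g \<Longrightarrow> lin s u (\<lambda>x. g (f x))"
  by (simp add: lin_def)

lemma multilinear_iff:
  assumes "vector_space s" "vector_space t"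
  shows "multilinear s t n f \<longleftrightarrow> mlin s t n f"
proof (induction n arbitrary: f)
  case 0
  show ?case by (simp add: multilinear_def)
next
  case (Suc n)
  have l: "Vector_Spaces.linear s t g \<longleftrightarrow> lin s t g" for g
    using assms by (simp add: Vector_Spaces.linear_iff lin_def)
  have "multilinear s t (Suc n) f \<longleftrightarrow>
      (\<forall>r. length r = n \<longrightarrow> lin s t (\<lambda>x. f (x # r))) \<and> (\<forall>x. multilinear s t n (\<lambda>l. f (x # l)))"
    unfolding multilinear_def l
  proof (intro iffI conjI allI impI)
    fix r :: "'b list"
    assume *: "\<forall>xs ys. length xs + 1 + length ys = Suc n \<longrightarrow> lin s t (\<lambda>x. f (xs @ x # ys))"
    show "lin s t (\<lambda>x. f (x # r))" if "length r = n"
      using *[rule_format, of "[]" r] that by simp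
    show "lin s t (\<lambda>y. f (x # xs @ y # ys))" if "length xs + 1 + length ys = n" for x xs ys
      using *[rule_format, of "x # xs" ys] that by simp
  next
    fix xs ys :: "'b list"
    assume *: "(\<forall>r. length r = n \<longrightarrow> lin s t (\<lambda>x. f (x # r))) \<and>
       (\<forall>x xs ys. length xs + 1 + length ys = n \<longrightarrow> lin s t (\<lambda>xa. f (x # xs @ xa # ys)))"
      and "length xs + 1 + length ys = Suc n"
    then show "lin s t (\<lambda>x. f (xs @ x # ys))" by (cases xs) auto
  qed
  then show ?case by (simp add: Suc.IH)
qed

lemma mlin_cong: "(\<And>l. length l = n \<Longrightarrow> f l = g l) \<Longrightarrow> mlin s t n f \<longleftrightarrow> mlin s t n g"
proof (induction n arbitrary: f g)
  case (Suc n)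
  have "mlin s t n (\<lambda>l. f (x # l)) \<longleftrightarrow> mlin s t n (\<lambda>l. g (x # l))" for x
    by (rule Suc.IH) (simp add: Suc.prems)
  then show ?case by (simp add: lin_def Suc.prems)
qed simp

lemma mlin_add:
  assumes "vector_space t"
  shows "mlin s t n f \<Longrightarrow> mlin s t n g \<Longrightarrow> mlin s t n (\<lambda>l. f l + g l)"
proof (induction n arbitrary: f g)
  case (Suc n)
  interpret vector_space t by (rule assms)
  show ?case using Suc by (auto simp: lin_def algebra_simps)
qed simp

lemma mlin_compose:
  "mlin s t n f \<Longrightarrow> lin t u g \<Longrightarrow> mlin s u n (\<lambda>l. g (f l))"
  by (induction n arbitrary: f) (auto intro: lin_compose)

lemma mlin_minus:
  assumes "vector_space t"
  shows "mlin s t n f \<Longrightarrow> mlin s t n (\<lambda>l. - f l)"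
proof -
  interpret vector_space t by (rule assms)
  assume "mlin s t n f"
  then show ?thesis by (rule mlin_compose) (simp_all add: lin_def)
qed

lemma mlin_diff:
  assumes "vector_space t"
  shows "mlin s t n f \<Longrightarrow> mlin s t n g \<Longrightarrow> mlin s t n (\<lambda>l. f l - g l)"
  using mlin_add[OF assms, of s n f "\<lambda>l. - g l"] mlin_minus[OF assms, of s n g] by simp

lemma mlin_zero: "vector_space t \<Longrightarrow> mlin s t n (\<lambda>l. 0)"
proof (induction n)
  case (Suc n)
  then interpret vector_space t by simp
  show ?case using Suc by (simp add: lin_def)
qed simp

lemma mlin_sum:
  assumes "vector_space t"
  shows "(\<And>i. i \<in> I \<Longrightarrow> mlin s t n (f i)) \<Longrightarrow> mlin s t n (\<lambda>l. \<Sum>i\<in>I. f i l)"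
  by (induction I rule: infinite_finite_induct) (simp_all add: mlin_zero[OF assms] mlin_add[OF assms])

lemma mlin_Cons: "mlin s t (Suc n) f \<Longrightarrow> mlin s t n (\<lambda>l. f (x # l))"
  by simp

lemma mlin_SucI:
  "(\<And>r. length r = n \<Longrightarrow> lin s t (\<lambda>x. f (x # r))) \<Longrightarrow> (\<And>x. mlin s t n (\<lambda>l. f (x # l)))
    \<Longrightarrow> mlin s t (Suc n) f"
  by simp

text \<open>A map of right modules on the bar resolution is given by its values
  \<open>H [x0, ..., xn]\<close> at x0 \<otimes> ... \<otimes> xn \<otimes> 1, and this is its
  composite with the bar differential. In the last term the right factor xn leaves the list and acts
  through \<open>rm\<close>.\<close>

fun bar_diff :: "('v \<Rightarrow> 'a \<Rightarrow> 'v) \<Rightarrow> ('a::ring_1 list \<Rightarrow> 'v::ab_group_add) \<Rightarrow> 'a list \<Rightarrow> 'v" where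
  "bar_diff rm H [] = 0"
| "bar_diff rm H [x] = rm (H []) x"
| "bar_diff rm H (x # y # r) = H (x * y # r) - bar_diff rm (\<lambda>l. H (x # l)) (y # r)"

definition alt_sign :: "nat \<Rightarrow> 'v::ab_group_add \<Rightarrow> 'v" where
  "alt_sign i v = (if even i then v else - v)"

lemma alt_sign_Suc [simp]: "alt_sign (Suc i) v = - alt_sign i v"
  by (simp add: alt_sign_def)

lemma alt_sign_0 [simp]: "alt_sign 0 v = v"
  by (simp add: alt_sign_def)

lemma alt_sign_ring: "alt_sign i (x :: 'a::ring_1) = (- 1) ^ i * x"
  by (simp add: alt_sign_def)

lemma bar_diff_sum:
  "length xs = Suc n \<Longrightarrow> bar_diff rm H xs =
     (\<Sum>i<n. alt_sign i (H (take i xs @ [xs ! i * xs ! (i + 1)] @ drop (i + 2) xs)))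
     + alt_sign n (rm (H (butlast xs)) (last xs))"
proof (induction n arbitrary: xs H)
  case 0
  then show ?case by (auto simp: length_Suc_conv)
next
  case (Suc n)
  then obtain x y r where xs: "xs = x # y # r" by (metis length_Suc_conv)
  have IH: "bar_diff rm (\<lambda>l. H (x # l)) (y # r) =
    (\<Sum>i<n. alt_sign i (H (x # take i (y # r) @ [(y # r) ! i * r ! i] @ drop (i + 1) r)))
     + alt_sign n (rm (H (x # butlast (y # r))) (last (y # r)))"
    using Suc.IH[of "y # r" "\<lambda>l. H (x # l)"] Suc.prems by (simp add: xs)
  show ?case
    unfolding xs bar_diff.simps IH sum.lessThan_Suc_shift
    by (simp add: sum_negf)
qed

lemma hoch_diff_bar_diff:
  "length xs = n + 1 \<Longrightarrow> hoch_diff n G xs = hd xs * G (tl xs) - bar_diff (*) G xs"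
  by (simp add: hoch_diff_def bar_diff_sum alt_sign_ring sum_negf mult.assoc)

lemma hoch_diff_wrong_length: "length xs \<noteq> n + 1 \<Longrightarrow> hoch_diff n G xs = 0"
  by (simp add: hoch_diff_def)

lemma bar_diff_cong:
  "(\<And>l. Suc (length l) = length xs \<Longrightarrow> f l = g l) \<Longrightarrow> bar_diff rm f xs = bar_diff rm g xs"
proof (induction rm f xs arbitrary: g rule: bar_diff.induct)
  case (3 rm H x y r)
  have "bar_diff rm (\<lambda>l. H (x # l)) (y # r) = bar_diff rm (\<lambda>l. g (x # l)) (y # r)"
    by (rule "3.IH") (simp add: "3.prems")
  then show ?case by (simp add: "3.prems")
qed simp_all

text \<open>A bimodule is not needed: the left action enters the bar complex only through the algebra.\<close>

locale right_module =
  fixes sA :: "'k::field \<Rightarrow> 'a::ring_1 \<Rightarrow> 'a" and sV :: "'k \<Rightarrow> 'v::ab_group_add \<Rightarrow> 'v"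
    and rm :: "'v \<Rightarrow> 'a \<Rightarrow> 'v"
  assumes vsA: "vector_space sA" and vsV: "vector_space sV"
    and sA_left: "sA c x * y = sA c (x * y)" and sA_right: "x * sA c y = sA c (x * y)"
    and rm_add: "rm (v + w) x = rm v x + rm w x" "rm v (x + y) = rm v x + rm v y"
    and rm_scale: "rm (sV c v) x = sV c (rm v x)" "rm v (sA c x) = sV c (rm v x)"
    and rm_assoc: "rm (rm v x) y = rm v (x * y)" and rm_one: "rm v 1 = v"
begin

sublocale A: vector_space sA by (rule vsA)
sublocale V: vector_space sV by (rule vsV)

lemma lin_rm: "lin sA sV (rm v)" "lin sV sV (\<lambda>v. rm v x)"
  by (simp_all add: lin_def rm_add rm_scale)

lemmas rm_zero = lin_rm(1)[THEN lin_0] lin_rm(2)[THEN lin_0]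

lemma lin_mult: "lin sA sA (\<lambda>x. x * y)" "lin sA sA (\<lambda>x. y * x)"
  by (simp_all add: lin_def algebra_simps sA_left sA_right)

lemma bar_diff_lin:
  "bar_diff rm (\<lambda>l. f l + g l) xs = bar_diff rm f xs + bar_diff rm g xs"
  "bar_diff rm (\<lambda>l. sV c (f l)) xs = sV c (bar_diff rm f xs)"
proof -
  show "bar_diff rm (\<lambda>l. f l + g l) xs = bar_diff rm f xs + bar_diff rm g xs"
    by (induction xs arbitrary: f g rule: induct_list012) (simp_all add: rm_add)
  show "bar_diff rm (\<lambda>l. sV c (f l)) xs = sV c (bar_diff rm f xs)"
    by (induction xs arbitrary: f rule: induct_list012)
       (simp_all add: rm_scale V.scale_right_diff_distrib)
qed

lemma bar_diff_zero: "bar_diff rm (\<lambda>l. 0) xs = 0"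
  using bar_diff_lin(2)[of 0 "\<lambda>l. 0"] by simp

lemma bar_diff_diff: "bar_diff rm (\<lambda>l. f l - g l) xs = bar_diff rm f xs - bar_diff rm g xs"
  using bar_diff_lin(1)[of "\<lambda>l. f l - g l" g xs] by simp

lemma mlin_bar_diff: "mlin sA sV n H \<Longrightarrow> mlin sA sV (Suc n) (bar_diff rm H)"
proof (induction n arbitrary: H)
  case 0
  show ?case by (simp add: lin_rm)
next
  case (Suc n)
  show ?case
  proof (rule mlin_SucI)
    fix r :: "'a list" assume "length r = Suc n"
    then obtain y t where r: "r = y # t" "length t = n" by (metis length_Suc_conv)
    have H: "lin sA sV (\<lambda>x. H (x # t))" using Suc.prems r by simp
    have H': "lin sA sV (\<lambda>x. H (x # l))" if "length l = n" for l using Suc.prems that by simp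
    have "bar_diff rm (\<lambda>l. H ((x + x') # l)) r = bar_diff rm (\<lambda>l. H (x # l) + H (x' # l)) r" for x x'
      by (rule bar_diff_cong) (use H' r in \<open>simp add: lin_def\<close>)
    moreover have "bar_diff rm (\<lambda>l. H (sA c x # l)) r = bar_diff rm (\<lambda>l. sV c (H (x # l))) r" for c x
      by (rule bar_diff_cong) (use H' r in \<open>simp add: lin_def\<close>)
    ultimately show "lin sA sV (\<lambda>x. bar_diff rm H (x # r))"
      using H r by (simp add: lin_def distrib_right sA_left bar_diff_lin algebra_simps V.scale_right_diff_distrib)
  next
    fix x
    have 1: "mlin sA sV (Suc n) (\<lambda>l. H (x * hd l # tl l))"
      using Suc.prems by (simp add: lin_def distrib_left sA_right)
    have 2: "mlin sA sV (Suc n) (\<lambda>l. H (x * hd l # tl l) - bar_diff rm (\<lambda>l. H (x # l)) l)"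
      using 1 Suc.IH[of "\<lambda>l. H (x # l)"] Suc.prems by (intro mlin_diff[OF vsV]) simp_all
    show "mlin sA sV (Suc n) (\<lambda>l. bar_diff rm H (x # l))"
      by (rule mlin_cong[THEN iffD2, OF _ 2]) (auto simp: length_Suc_conv)
  qed
qed

lemma bar_diff_left:
  "bar_diff rm (\<lambda>l. H (x * hd l # tl l)) (y # z # r) = bar_diff rm H (x * y # z # r)"
  by (simp add: mult.assoc)

text \<open>Multiplying the first two entries commutes with the differential of the remaining list,
  so these terms cancel between the inner and the outer differential; what remains is the claim for
  \<open>\<lambda>l. H (x # l)\<close>. With only two entries the claim is associativity of the
  right action.\<close>

lemma bar_diff_bar_diff:
  "length xs \<ge> 2 \<Longrightarrow> bar_diff rm (bar_diff rm H) xs = 0"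
proof (induction xs arbitrary: H)
  case (Cons x t)
  then obtain y r where t: "t = y # r" by (cases t) auto
  show ?case
  proof (cases r)
    case Nil
    then show ?thesis by (simp add: t rm_assoc)
  next
    case (Cons z u)
    have "bar_diff rm (\<lambda>l. bar_diff rm H (x # l)) t
        = bar_diff rm (\<lambda>l. H (x * hd l # tl l) - bar_diff rm (\<lambda>l. H (x # l)) l) t"
      by (rule bar_diff_cong) (auto simp: t Cons length_Suc_conv)
    also have "\<dots> = bar_diff rm (\<lambda>l. H (x * hd l # tl l)) t"
      using Cons.IH[of "\<lambda>l. H (x # l)"] by (simp add: bar_diff_diff t Cons)
    finally show ?thesis by (simp add: t Cons mult.assoc)
  qed
qed simp

end

section \<open>The bracket on Hochschild classes\<close>

lemma circ_0: "circ 0 q f g xs = 0"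
  by (simp add: circ_def)

text \<open>The insertion into the first slot is split from the others, which are insertions into
  \<open>\<lambda>l. f (hd xs # l)\<close>. This turns the bookkeeping of signs into an induction on
  n.\<close>

lemma circ_Suc:
  fixes f :: "'a::ring_1 list \<Rightarrow> 'a"
  assumes "length xs = n + q"
  shows "circ (Suc n) q f g xs = f (g (take q xs) # drop q xs)
           + (- 1) ^ (q + 1) * circ n q (\<lambda>l. f (hd xs # l)) g (tl xs)"
proof (cases n)
  case 0
  then show ?thesis using assms by (simp add: circ_def)
next
  case (Suc k)
  then obtain x t where xs: "xs = x # t" using assms by (cases xs) auto
  let ?T = "\<lambda>i. (- 1) ^ ((q + 1) * (i - 1)) *
        f (take (i - 1) xs @ [g (take q (drop (i - 1) xs))] @ drop (i - 1 + q) xs)"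
  have "circ (Suc n) q f g xs = (\<Sum>i\<in>{1..Suc n}. ?T i)"
    using assms by (simp add: circ_def)
  also have "\<dots> = ?T 1 + (\<Sum>i\<in>{Suc 1..Suc n}. ?T i)"
    by (rule sum.atLeast_Suc_atMost) simp
  also have "(\<Sum>i\<in>{Suc 1..Suc n}. ?T i) = (\<Sum>i\<in>{1..n}. ?T (Suc i))"
    by (rule sum.shift_bounds_cl_Suc_ivl)
  also have "(\<Sum>i\<in>{1..n}. ?T (Suc i)) = (- 1) ^ (q + 1) * circ n q (\<lambda>l. f (hd xs # l)) g (tl xs)"
  proof -
    have C: "circ n q (\<lambda>l. f (hd xs # l)) g (tl xs) = (\<Sum>i = 1..n. (- 1) ^ ((q + 1) * (i - 1)) *
        f (x # take (i - 1) t @ [g (take q (drop (i - 1) t))] @ drop (i - 1 + q) t))"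
      using assms Suc by (simp add: circ_def xs)
    show ?thesis
      unfolding C sum_distrib_left
    proof (intro sum.cong refl)
      fix i assume "i \<in> {1..n}"
      then obtain j where i: "i = Suc j" by (cases i) auto
      have e: "(- 1 :: 'a) ^ ((q + 1) * Suc j) = (- 1) ^ (q + 1) * (- 1) ^ ((q + 1) * j)"
        by (simp only: mult_Suc_right power_add)
      show "?T (Suc i) = (- 1) ^ (q + 1) * ((- 1) ^ ((q + 1) * (i - 1)) *
        f (x # take (i - 1) t @ [g (take q (drop (i - 1) t))] @ drop (i - 1 + q) t))"
        unfolding i diff_Suc_1 e by (simp add: xs mult.assoc)
    qed
  qed
  finally show ?thesis by simp
qed

lemma circ_cong:
  assumes "\<And>l. length l = n \<Longrightarrow> f l = f' l" "\<And>l. length l = q \<Longrightarrow> g l = g' l"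
  shows "circ n q f g = circ n q f' g'"
proof
  fix xs show "circ n q f g xs = circ n q f' g' xs"
    unfolding circ_def using assms by (auto intro!: sum.cong)
qed

lemma circ_diff:
  "circ n q (\<lambda>l. f l - f' l) g xs = circ n q f g xs - circ n q f' g xs"
  by (simp add: circ_def sum_subtractf right_diff_distrib)

lemma circ_mult_left:
  "circ n q (\<lambda>l. x * f l) g xs = x * circ n q f g xs"
proof -
  have "(- 1) ^ k * (x * y) = x * ((- 1) ^ k * y)" for k and y :: 'a
    by (cases "even k") simp_all
  then show ?thesis by (simp add: circ_def sum_distrib_left)
qed

section \<open>The differential of the circle product\<close>

locale algebra_over_field = right_module s s "(*)" for s :: "'k::field \<Rightarrow> 'a::ring_1 \<Rightarrow> 'a"
begin

lemma lin_sign: "lin s s (\<lambda>x. (- 1) ^ n * x)"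
  by (rule lin_mult)

lemma circ_lin_left:
  assumes "\<And>r. length r = n \<Longrightarrow> lin s s (\<lambda>x. f x r)"
  shows "lin s s (\<lambda>x. circ n q (f x) g xs)"
proof (cases "length xs + 1 = n + q")
  case True
  have "lin s s (\<lambda>x. f x (take (i - 1) xs @ [g (take q (drop (i - 1) xs))] @ drop (i - 1 + q) xs))"
    if "i \<in> {1..n}" for i
    by (rule assms) (use that True in auto)
  then have "lin s s (\<lambda>x. \<Sum>i = 1..n. (- 1) ^ ((q + 1) * (i - 1)) *
      f x (take (i - 1) xs @ [g (take q (drop (i - 1) xs))] @ drop (i - 1 + q) xs))"
    by (auto simp: lin_def sum.distrib distrib_left A.scale_sum_right sA_right intro!: sum.cong)
  then show ?thesis using True by (simp add: circ_def)
next
  case False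
  then show ?thesis by (simp add: circ_def lin_def)
qed

lemma mlin_insert:
  "mlin s s q g \<Longrightarrow> mlin s s (Suc n) f \<Longrightarrow> mlin s s (n + q) (\<lambda>xs. f (g (take q xs) # drop q xs))"
proof (induction q arbitrary: g)
  case (Suc q)
  have "mlin s s (Suc (n + q)) (\<lambda>xs. f (g (take (Suc q) xs) # drop (Suc q) xs))"
  proof (rule mlin_SucI)
    fix r :: "'a list" assume r: "length r = n + q"
    have "lin s s (\<lambda>x. g (x # take q r))" "lin s s (\<lambda>x. f (x # drop q r))"
      using Suc.prems r by simp_all
    from lin_compose[OF this]
    show "lin s s (\<lambda>x. f (g (take (Suc q) (x # r)) # drop (Suc q) (x # r)))" by simp
  next
    fix x
    show "mlin s s (n + q) (\<lambda>l. f (g (take (Suc q) (x # l)) # drop (Suc q) (x # l)))"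
      using Suc.IH[of "\<lambda>l. g (x # l)"] Suc.prems by simp
  qed
  then show ?case by simp
qed simp

lemma mlin_circ:
  "mlin s s n f \<Longrightarrow> mlin s s q g \<Longrightarrow> Suc l = n + q \<Longrightarrow> mlin s s l (circ n q f g)"
proof (induction n arbitrary: f l)
  case 0
  then show ?case by (simp add: circ_0 mlin_zero[OF vsA])
next
  case (Suc n)
  then have l: "l = n + q" by simp
  have 1: "mlin s s l (\<lambda>xs. circ n q (\<lambda>l. f (hd xs # l)) g (tl xs))"
  proof (cases l)
    case (Suc k)
    show ?thesis
      unfolding Suc
    proof (rule mlin_SucI)
      show "lin s s (\<lambda>x. circ n q (\<lambda>l. f (hd (x # r) # l)) g (tl (x # r)))" for r
        using circ_lin_left[of n "\<lambda>x r. f (x # r)"] Suc.prems by simp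
      show "mlin s s k (\<lambda>l. circ n q (\<lambda>la. f (hd (x # l) # la)) g (tl (x # l)))" for x
        using Suc.IH[of "\<lambda>l. f (x # l)" k] Suc.prems Suc l by simp
    qed
  qed simp
  have "mlin s s l (\<lambda>xs. f (g (take q xs) # drop q xs)
           + (- 1) ^ (q + 1) * circ n q (\<lambda>l. f (hd xs # l)) g (tl xs))"
    using mlin_insert[of q g n f] Suc.prems 1 mlin_compose[OF 1 lin_sign[of "q + 1"]]
    by (intro mlin_add[OF vsA]) (simp_all add: l)
  then show ?case
    by (rule mlin_cong[THEN iffD2, rotated]) (simp add: circ_Suc l)
qed

text \<open>Products inside the block of g give \<open>hoch_diff q g\<close>, products behind it
  give \<open>bar_diff\<close> of f. The product of the block with its right neighbour occurs in
  both and cancels; the last summand removes the leading term of \<open>hoch_diff q g\<close>, which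
  has no counterpart on the left.\<close>

lemma bar_diff_insert:
  assumes f: "\<And>r. length r = n \<Longrightarrow> lin s s (\<lambda>x. f (x # r))" and xs: "length xs = Suc n + q"
  shows "bar_diff (*) (\<lambda>xs. f (g (take q xs) # drop q xs)) xs =
     - f (hoch_diff q g (take (Suc q) xs) # drop (Suc q) xs)
     + (- 1) ^ (q + 1) * bar_diff (*) f (g (take q xs) # drop q xs)
     + f (hd xs * g (take q (tl xs)) # drop (Suc q) xs)"
  using xs
proof (induction q arbitrary: g xs)
  case 0
  then obtain x r where r: "xs = x # r" "length r = n" by (auto simp: length_Suc_conv)
  have "f ((x * g [] - g [] * x) # r) = f (x * g [] # r) - f (g [] * x # r)"
    using lin_diff[OF f[OF r(2)]] .
  then show ?case by (simp add: r hoch_diff_bar_diff)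
next
  case (Suc q)
  then obtain x y t where xs: "xs = x # y # t" by (metis length_Suc_conv add_Suc_right add_Suc)
  let ?gx = "\<lambda>l. g (x # l)"
  have len: "length (drop q t) = n" "length (take q t) = q" using Suc.prems xs by auto
  have "bar_diff (*) (\<lambda>xs. f (?gx (take q xs) # drop q xs)) (y # t) =
     - f (hoch_diff q ?gx (take (Suc q) (y # t)) # drop (Suc q) (y # t))
     + (- 1) ^ (q + 1) * bar_diff (*) f (?gx (take q (y # t)) # drop q (y # t))
     + f (y * ?gx (take q t) # drop (Suc q) (y # t))"
    using Suc.IH[of "y # t" ?gx] Suc.prems by (simp add: xs)
  moreover have "hoch_diff q ?gx (y # take q t) = y * g (x # take q t) - bar_diff (*) ?gx (y # take q t)"
    using len by (subst hoch_diff_bar_diff) simp_all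
  moreover have "hoch_diff (Suc q) g (x # y # take q t) =
      x * g (y # take q t) - (g (x * y # take q t) - bar_diff (*) ?gx (y # take q t))"
    using len by (subst hoch_diff_bar_diff) simp_all
  moreover have fl: "f ((u - v) # drop q t) = f (u # drop q t) - f (v # drop q t)" for u v
    using lin_diff[OF f[OF len(1)]] .
  ultimately show ?case
    by (simp add: xs fl)
qed

lemma bar_diff_circ:
  assumes "mlin s s n f" "length xs = n + q"
  shows "bar_diff (*) (circ n q f g) xs =
     - circ n (Suc q) f (hoch_diff q g) xs
     + (- 1) ^ (q + 1) * circ (Suc n) q (bar_diff (*) f) g xs
     + (- 1) ^ (q * (n + 1)) * (f (take n xs) * g (drop n xs))"
  using assms
proof (induction n arbitrary: f xs)
  case 0
  have "circ 0 q f g = (\<lambda>_. 0)" by (rule ext) (rule circ_0)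
  then have "bar_diff (*) (circ 0 q f g) xs = 0"
    by (simp add: bar_diff_zero)
  moreover have "circ (Suc 0) q (bar_diff (*) f) g xs = f [] * g xs"
    using 0 by (simp add: circ_Suc circ_0)
  ultimately show ?case by (cases "even q") (simp_all add: circ_0 bar_diff_zero)
next
  case (Suc n)
  let ?s = "(- 1) ^ (q + 1) :: 'a"
  have ss: "?s * (?s * u) = u" for u by (cases "even q") simp_all
  have f: "\<And>r. length r = n \<Longrightarrow> lin s s (\<lambda>x. f (x # r))" using Suc.prems by simp
  from Suc.prems obtain x t where xs: "xs = x # t" "length t = n + q" by (cases xs) auto
  let ?fx = "\<lambda>l. f (x # l)" and ?P = "\<lambda>l. f (g (take q l) # drop q l)"
  let ?R = "\<lambda>l. circ n q (\<lambda>u. f (hd l # u)) g (tl l)"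
  have IH: "bar_diff (*) (circ n q ?fx g) t = - circ n (Suc q) ?fx (hoch_diff q g) t
     + ?s * circ (Suc n) q (bar_diff (*) ?fx) g t
     + (- 1) ^ (q * (n + 1)) * (f (x # take n t) * g (drop n t))"
    by (rule Suc.IH) (use Suc.prems xs in simp_all)
  have "bar_diff (*) (circ (Suc n) q f g) xs = bar_diff (*) (\<lambda>l. ?P l + ?s * ?R l) xs"
    by (rule bar_diff_cong) (use xs in \<open>simp add: circ_Suc\<close>)
  also have "\<dots> = bar_diff (*) ?P xs + ?s * bar_diff (*) ?R xs"
  proof -
    have "bar_diff (*) (\<lambda>l. ?s * ?R l) xs = ?s * bar_diff (*) ?R xs"
      using bar_diff_lin(2)[of "(- 1) ^ (q + 1)" ?R xs] bar_diff_diff[of "\<lambda>_. 0" ?R xs]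
      by (cases "even q") (simp_all add: bar_diff_zero)
    then show ?thesis by (simp only: bar_diff_lin(1))
  qed
  also have "?s * bar_diff (*) ?R xs =
     ?s * circ n q (\<lambda>u. f (x * hd t # u)) g (tl t) - ?s * bar_diff (*) (circ n q ?fx g) t"
  proof (cases t)
    case Nil
    then show ?thesis using xs by (simp add: circ_0 bar_diff_zero)
  next
    case (Cons y r)
    then show ?thesis using xs by (simp add: right_diff_distrib)
  qed
  finally have L: "bar_diff (*) (circ (Suc n) q f g) xs = bar_diff (*) ?P xs
     + (?s * circ n q (\<lambda>u. f (x * hd t # u)) g (tl t) - ?s * bar_diff (*) (circ n q ?fx g) t)" .
  have P: "bar_diff (*) ?P xs =
     - f (hoch_diff q g (take (Suc q) xs) # drop (Suc q) xs)
     + ?s * bar_diff (*) f (g (take q xs) # drop q xs)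
     + f (x * g (take q t) # drop q t)"
    using bar_diff_insert[of n f xs q g] f xs by simp
  have C1: "circ (Suc n) (Suc q) f (hoch_diff q g) xs =
      f (hoch_diff q g (take (Suc q) xs) # drop (Suc q) xs) - ?s * circ n (Suc q) ?fx (hoch_diff q g) t"
    using xs circ_Suc[of xs n "Suc q" f "hoch_diff q g"] by simp
  have C2: "circ (Suc n) q (\<lambda>l. f (x * hd l # tl l)) g t =
      f (x * g (take q t) # drop q t) + ?s * circ n q (\<lambda>u. f (x * hd t # u)) g (tl t)"
    using xs circ_Suc[of t n q "\<lambda>l. f (x * hd l # tl l)" g] by simp
  have "circ (Suc n) q (\<lambda>l. bar_diff (*) f (x # l)) g =
      circ (Suc n) q (\<lambda>l. f (x * hd l # tl l) - bar_diff (*) ?fx l) g"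
    by (rule circ_cong) (auto simp: length_Suc_conv)
  then have C3: "circ (Suc n) q (\<lambda>l. bar_diff (*) f (x # l)) g t =
      circ (Suc n) q (\<lambda>l. f (x * hd l # tl l)) g t - circ (Suc n) q (bar_diff (*) ?fx) g t"
    by (simp add: circ_diff)
  have C4: "circ (Suc (Suc n)) q (bar_diff (*) f) g xs = bar_diff (*) f (g (take q xs) # drop q xs)
      + ?s * circ (Suc n) q (\<lambda>l. bar_diff (*) f (x # l)) g t"
    using xs circ_Suc[of xs "Suc n" q "bar_diff (*) f" g] by simp
  have r: "(- 1) ^ (q * (Suc n + 1)) * (f (take (Suc n) xs) * g (drop (Suc n) xs)) =
      - ?s * ((- 1) ^ (q * (n + 1)) * (f (x # take n t) * g (drop n t)))"
    using xs by (simp add: power_add mult.assoc)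
  show ?case
    unfolding L P C4 C3 C2 C1 IH r
    by (cases "even q") (simp_all add: algebra_simps)
qed

text \<open>Where the inserted g becomes an outer factor of \<open>hoch_diff n f\<close>, cup
  products of f and g in both orders arise to which nothing on the left corresponds; the last two
  summands correct for this.\<close>

lemma hoch_diff_circ:
  assumes "mlin s s n f" "length xs = n + q"
  shows "hoch_diff (n + q - 1) (circ n q f g) xs =
     circ n (Suc q) f (hoch_diff q g) xs
     + (- 1) ^ (q + 1) * circ (Suc n) q (hoch_diff n f) g xs
     - (- 1) ^ (q + 1) * (g (take q xs) * f (drop q xs))
     - (- 1) ^ (q * (n + 1)) * (f (take n xs) * g (drop n xs))"
proof (cases "n + q = 0")
  case True
  then show ?thesis using assms by (simp add: circ_0 hoch_diff_def circ_Suc)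
next
  case False
  then obtain x t where xs: "xs = x # t" "length t = n + q - 1" using assms(2) by (cases xs) auto
  let ?s = "(- 1) ^ (q + 1) :: 'a"
  have ss: "?s * (?s * u) = u" for u by (cases "even q") simp_all
  have "circ (Suc n) q (hoch_diff n f) g =
      circ (Suc n) q (\<lambda>l. hd l * f (tl l) - bar_diff (*) f l) g"
    by (rule circ_cong) (simp_all add: hoch_diff_bar_diff)
  then have 1: "circ (Suc n) q (hoch_diff n f) g xs =
      circ (Suc n) q (\<lambda>l. hd l * f (tl l)) g xs - circ (Suc n) q (bar_diff (*) f) g xs"
    by (simp add: circ_diff)
  have 2: "circ (Suc n) q (\<lambda>l. hd l * f (tl l)) g xs =
      g (take q xs) * f (drop q xs) + ?s * (x * circ n q f g t)"
    using assms(2) by (simp add: circ_Suc circ_mult_left xs(1))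
  have "hoch_diff (n + q - 1) (circ n q f g) xs = x * circ n q f g t - bar_diff (*) (circ n q f g) xs"
    using xs by (subst hoch_diff_bar_diff) simp_all
  then show ?thesis
    unfolding 1 2 bar_diff_circ[OF assms] right_diff_distrib distrib_left ss
    by (simp add: algebra_simps)
qed


text \<open>\<open>K\<close> extends f to a left linear function of one more entry. For such
  functions the Hochschild differential becomes \<open>bar_diff\<close>, and putting 1 in front
  recovers the original values.\<close>

lemma hoch_diff_hoch_diff:
  fixes f :: "'a list \<Rightarrow> 'a"
  shows "hoch_diff (Suc n) (hoch_diff n f) = (\<lambda>_. 0)"
proof
  fix xs
  show "hoch_diff (Suc n) (hoch_diff n f) xs = 0"
  proof (cases "length xs = Suc (Suc n)")
    case True
    then obtain x y r where xs: "xs = x # y # r" by (metis length_Suc_conv)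
    define K where "K l = hd l * f (tl l)" for l
    have K: "bar_diff (*) K (z # u # t) = z * u * f t - z * bar_diff (*) f (u # t)" for z u t
    proof -
      have "bar_diff (*) (\<lambda>l. z * f l) v = z * bar_diff (*) f v" for v
        by (induction v arbitrary: f rule: induct_list012) (simp_all add: right_diff_distrib mult.assoc)
      then show ?thesis by (simp add: K_def)
    qed
    have HK: "hd l * hoch_diff n f (tl l) = bar_diff (*) K l" if l: "length l = Suc (Suc n)" for l
    proof -
      obtain z u t where "l = z # u # t" using l by (metis length_Suc_conv)
      then show ?thesis using l by (simp only: K) (simp add: hoch_diff_bar_diff right_diff_distrib mult.assoc)
    qed
    have "hoch_diff (Suc n) (hoch_diff n f) xs
        = bar_diff (*) (\<lambda>l. hd l * hoch_diff n f (tl l)) (1 # xs)"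
      using True by (subst hoch_diff_bar_diff) (simp_all add: xs)
    also have "\<dots> = bar_diff (*) (bar_diff (*) K) (1 # xs)"
      by (rule bar_diff_cong) (rule HK, use True in simp)
    also have "\<dots> = 0" by (rule bar_diff_bar_diff) (simp add: xs)
    finally show ?thesis .
  qed (simp add: hoch_diff_wrong_length)
qed

section \<open>Cocycles, coboundaries and their classes\<close>

lemma cochains_iff: "f \<in> cochains s n \<longleftrightarrow> mlin s s n f \<and> (\<forall>xs. length xs \<noteq> n \<longrightarrow> f xs = 0)"
  by (simp add: cochains_def multilinear_iff[OF vsA vsA])

lemma cochains_add: "f \<in> cochains s n \<Longrightarrow> g \<in> cochains s n \<Longrightarrow> (\<lambda>xs. f xs + g xs) \<in> cochains s n"
  by (simp add: cochains_iff mlin_add[OF vsA])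

lemma cochains_minus: "f \<in> cochains s n \<Longrightarrow> (\<lambda>xs. - f xs) \<in> cochains s n"
  by (simp add: cochains_iff mlin_minus[OF vsA])

lemma cochains_zero: "(\<lambda>xs. 0) \<in> cochains s n"
  by (simp add: cochains_iff mlin_zero[OF vsA])

lemma hoch_diff_add:
  fixes f g :: "'a list \<Rightarrow> 'a"
  shows "hoch_diff n (\<lambda>xs. f xs + g xs) xs = hoch_diff n f xs + hoch_diff n g xs"
proof (cases "length xs = n + 1")
  case True
  then show ?thesis unfolding hoch_diff_bar_diff[OF True] bar_diff_lin(1) by (simp add: algebra_simps)
qed (simp add: hoch_diff_wrong_length)

lemma hoch_diff_minus:
  fixes f :: "'a list \<Rightarrow> 'a"
  shows "hoch_diff n (\<lambda>xs. - f xs) xs = - hoch_diff n f xs"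
  using hoch_diff_add[of n f "\<lambda>xs. - f xs" xs] hoch_diff_add[of n "\<lambda>_. 0" "\<lambda>_. 0" xs]
  by (simp add: eq_neg_iff_add_eq_0 add.commute)

lemma hoch_diff_zero: "hoch_diff n (\<lambda>_ :: 'a list. 0 :: 'a) = (\<lambda>_. 0)"
  using hoch_diff_add[of n "\<lambda>_. 0" "\<lambda>_. 0"] by auto

lemma cochains_hoch_diff: "f \<in> cochains s n \<Longrightarrow> hoch_diff n f \<in> cochains s (Suc n)"
proof -
  assume f: "f \<in> cochains s n"
  have 1: "mlin s s (Suc n) (\<lambda>l. hd l * f (tl l))"
  proof (rule mlin_SucI)
    show "mlin s s n (\<lambda>l. hd (x # l) * f (tl (x # l)))" for x
      using mlin_compose[of s s n f s "(*) x"] lin_mult(2)[of x] f by (simp add: cochains_iff)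
  qed (simp add: lin_mult)
  have "mlin s s (Suc n) (bar_diff (*) f)"
    using f by (intro mlin_bar_diff) (simp add: cochains_iff)
  from mlin_diff[OF vsA 1 this]
  have "mlin s s (Suc n) (\<lambda>l. hd l * f (tl l) - bar_diff (*) f l)" .
  then have "mlin s s (Suc n) (hoch_diff n f)"
    by (rule mlin_cong[THEN iffD2, rotated]) (simp add: hoch_diff_bar_diff)
  then show ?thesis by (simp add: cochains_iff hoch_diff_wrong_length)
qed

lemma coboundaries_add:
  assumes "f \<in> coboundaries s n" "g \<in> coboundaries s n"
  shows "(\<lambda>xs. f xs + g xs) \<in> coboundaries s n"
proof (cases n)
  case (Suc k)
  then obtain f' g' where "f' \<in> cochains s k" "g' \<in> cochains s k" "f = hoch_diff k f'" "g = hoch_diff k g'"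
    using assms by (auto simp: coboundaries_def)
  moreover have "(\<lambda>xs. hoch_diff k f' xs + hoch_diff k g' xs) = hoch_diff k (\<lambda>xs. f' xs + g' xs)"
    by (rule ext) (rule hoch_diff_add[symmetric])
  ultimately show ?thesis
    using Suc cochains_add[of f' k g'] by (simp add: coboundaries_def)
qed (use assms in \<open>simp add: coboundaries_def\<close>)

lemma coboundaries_minus:
  assumes "f \<in> coboundaries s n"
  shows "(\<lambda>xs. - f xs) \<in> coboundaries s n"
proof (cases n)
  case (Suc k)
  then obtain f' where "f' \<in> cochains s k" "f = hoch_diff k f'"
    using assms by (auto simp: coboundaries_def)
  moreover have "(\<lambda>xs. - hoch_diff k f' xs) = hoch_diff k (\<lambda>xs. - f' xs)"
    by (rule ext) (rule hoch_diff_minus[symmetric])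
  ultimately show ?thesis
    using Suc cochains_minus[of f' k] by (simp add: coboundaries_def)
qed (use assms in \<open>simp add: coboundaries_def\<close>)

lemma coboundaries_diff:
  "f \<in> coboundaries s n \<Longrightarrow> g \<in> coboundaries s n \<Longrightarrow> (\<lambda>xs. f xs - g xs) \<in> coboundaries s n"
  using coboundaries_add[of f n "\<lambda>xs. - g xs"] coboundaries_minus[of g n] by simp

lemma coboundaries_zero: "(\<lambda>_. 0) \<in> coboundaries s n"
  by (cases n) (auto simp: coboundaries_def image_iff hoch_diff_zero intro!: bexI[OF _ cochains_zero])

lemma cocycles_zero: "(\<lambda>_. 0) \<in> cocycles s n"
  by (simp add: cocycles_def hoch_diff_zero cochains_zero)

lemma cocycles_diff:
  "f \<in> cocycles s n \<Longrightarrow> g \<in> cocycles s n \<Longrightarrow> (\<lambda>xs. f xs - g xs) \<in> cocycles s n"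
  using cochains_add[of f n "\<lambda>xs. - g xs"] cochains_minus[of g n]
    hoch_diff_add[of n f "\<lambda>xs. - g xs"] hoch_diff_minus[of n g]
  by (simp add: cocycles_def fun_eq_iff)

lemma coboundaries_cocycles: "f \<in> coboundaries s n \<Longrightarrow> f \<in> cocycles s n"
  by (cases n) (auto simp: coboundaries_def cocycles_def cochains_zero hoch_diff_zero
      hoch_diff_hoch_diff cochains_hoch_diff)

lemma HH_class_coboundary:
  assumes "f \<in> coboundaries s n"
  shows "HH_class s n f = HH_zero s n"
proof -
  have f: "f \<in> cocycles s n" by (rule coboundaries_cocycles[OF assms])
  have "(\<lambda>xs. f xs - g xs) \<in> coboundaries s n \<longleftrightarrow> (\<lambda>xs. 0 - g xs) \<in> coboundaries s n" for g
    using coboundaries_diff[OF _ assms, of "\<lambda>xs. f xs - g xs"] coboundaries_add[OF assms, of "\<lambda>xs. 0 - g xs"]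
    by auto
  then show ?thesis using f
    by (auto simp: HH_zero_def HH_class_def cohomologous_def cocycles_zero)
qed

lemma mem_HH_class: "g \<in> HH_class s n f \<longleftrightarrow>
    f \<in> cocycles s n \<and> g \<in> cocycles s n \<and> (\<lambda>xs. f xs - g xs) \<in> coboundaries s n"
  by (simp add: HH_class_def cohomologous_def)

lemma gerstenhaber_cochains:
  assumes "f \<in> cochains s n" "g \<in> cochains s q" "n + q \<noteq> 0"
  shows "gerstenhaber n q f g \<in> cochains s (n + q - 1)"
proof -
  have "mlin s s (n + q - 1) (circ n q f g)" "mlin s s (n + q - 1) (circ q n g f)"
    using assms by (auto simp: cochains_iff intro!: mlin_circ)
  then have "mlin s s (n + q - 1) (gerstenhaber n q f g)"
    unfolding gerstenhaber_def
    by (intro mlin_diff[OF vsA] mlin_compose[OF _ lin_sign])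
  moreover have "gerstenhaber n q f g xs = 0" if "length xs \<noteq> n + q - 1" for xs
    using that assms(3) by (simp add: gerstenhaber_def circ_def)
  ultimately show ?thesis by (simp add: cochains_iff)
qed

text \<open>The cup products that spoil the formula for \<open>circ\<close> occur in both halves of
  the bracket, and its sign is the one for which they cancel.\<close>

lemma hoch_diff_gerstenhaber:
  assumes f: "f \<in> cochains s n" and g: "g \<in> cochains s q" and nq: "n + q \<noteq> 0"
  shows "hoch_diff (n + q - 1) (gerstenhaber n q f g) xs =
     gerstenhaber n (Suc q) f (hoch_diff q g) xs
     + (- 1) ^ (q + 1) * gerstenhaber (Suc n) q (hoch_diff n f) g xs"
proof (cases "length xs = n + q")
  case True
  have f': "mlin s s n f" and g': "mlin s s q g" using f g by (simp_all add: cochains_iff)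
  let ?e = "(- 1) ^ ((n + 1) * (q + 1)) :: 'a"
  have e0: "hoch_diff (n + q - 1) (gerstenhaber n q f g) xs =
      hoch_diff (n + q - 1) (circ n q f g) xs - ?e * hoch_diff (n + q - 1) (circ q n g f) xs"
  proof (cases "even ((n + 1) * (q + 1))")
    case True
    then have "gerstenhaber n q f g = (\<lambda>xs. circ n q f g xs + - circ q n g f xs)"
      by (auto simp: gerstenhaber_def)
    then show ?thesis using True by (simp only: hoch_diff_add hoch_diff_minus) auto
  next
    case False
    then have "gerstenhaber n q f g = (\<lambda>xs. circ n q f g xs + circ q n g f xs)"
      by (auto simp: gerstenhaber_def)
    then show ?thesis using False by (simp only: hoch_diff_add) auto
  qed
  have e1: "hoch_diff (n + q - 1) (circ q n g f) xs = hoch_diff (q + n - 1) (circ q n g f) xs"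
    by (simp only: add.commute)
  have e2: "length xs = q + n" using True by simp
  show ?thesis
    unfolding e0 e1 hoch_diff_circ[OF f' True, of g] hoch_diff_circ[OF g' e2, of f]
    unfolding gerstenhaber_def
    by (cases "even n"; cases "even q") (simp_all add: algebra_simps)
next
  case False
  then show ?thesis using nq
    by (simp add: hoch_diff_wrong_length gerstenhaber_def circ_def)
qed

lemma circ_diff_right:
  assumes "mlin s s n f"
  shows "circ n q f (\<lambda>l. g l - g' l) xs = circ n q f g xs - circ n q f g' xs"
proof (cases "length xs + 1 = n + q")
  case True
  have "f (ys @ (u - v) # zs) = f (ys @ u # zs) - f (ys @ v # zs)" if "length ys + 1 + length zs = n"
    for ys zs u v
    using assms that multilinear_iff[OF vsA vsA, of n f] lin_diff[of s s "\<lambda>x. f (ys @ x # zs)" u v]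
    by (simp add: multilinear_def Vector_Spaces.linear_iff lin_def)
  then show ?thesis using True
    by (auto simp: circ_def sum_subtractf[symmetric] right_diff_distrib[symmetric] intro!: sum.cong)
qed (simp add: circ_def)

lemma gerstenhaber_diff:
  "gerstenhaber n q (\<lambda>xs. f xs - f' xs) g xs = gerstenhaber n q f g xs - gerstenhaber n q f' g xs"
  if "mlin s s q g"
  by (simp add: gerstenhaber_def circ_diff circ_diff_right[OF that] algebra_simps)

lemma gerstenhaber_swap:
  fixes f g :: "'a list \<Rightarrow> 'a"
  shows "gerstenhaber q n g f xs = - ((- 1) ^ ((n + 1) * (q + 1)) * gerstenhaber n q f g xs)"
  by (cases "even ((n + 1) * (q + 1))") (simp_all add: gerstenhaber_def mult.commute)

lemma coboundaries_sign:
  "f \<in> coboundaries s n \<Longrightarrow> (\<lambda>xs. (- 1) ^ k * f xs) \<in> coboundaries s n"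
  by (cases "even k") (simp_all add: coboundaries_minus)

text \<open>For f = dh and dg = 0 the derivation property reads d[h, g] = \<plusminus>[f, g]. The
  bound on n + q leaves [h, g] in a degree that is at least 0.\<close>

lemma gerstenhaber_coboundary_left:
  assumes f: "f \<in> coboundaries s n" and g: "g \<in> cocycles s q" and nq: "n + q > 1"
  shows "gerstenhaber n q f g \<in> coboundaries s (n + q - 1)"
proof (cases n)
  case 0
  then have "f = (\<lambda>_. 0)" using f by (simp add: coboundaries_def)
  moreover have "gerstenhaber n q (\<lambda>_. 0) g = (\<lambda>_. 0)"
    using gerstenhaber_diff[of q g n "\<lambda>_. 0" "\<lambda>_. 0"] g by (auto simp: cocycles_def cochains_iff)
  ultimately show ?thesis by (simp add: coboundaries_zero)
next
  case (Suc k)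
  then obtain h where h: "h \<in> cochains s k" "f = hoch_diff k h"
    using f by (auto simp: coboundaries_def)
  have g': "g \<in> cochains s q" "hoch_diff q g = (\<lambda>_. 0)" using g by (simp_all add: cocycles_def)
  have z: "gerstenhaber k (Suc q) h (\<lambda>_. 0) xs = 0" for xs
    using circ_diff_right[of k h "Suc q" "\<lambda>_. 0" "\<lambda>_. 0" xs] circ_diff[of "Suc q" k "\<lambda>_. 0" "\<lambda>_. 0" h xs] h
    by (simp add: gerstenhaber_def cochains_iff)
  have kq: "k + q \<noteq> 0" using nq Suc by simp
  have eq: "hoch_diff (k + q - 1) (gerstenhaber k q h g) xs = (- 1) ^ (q + 1) * gerstenhaber n q f g xs" for xs
    using hoch_diff_gerstenhaber[OF h(1) g'(1) kq, of xs] by (simp add: z g' h Suc)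
  have "(\<lambda>xs. (- 1) ^ (q + 1) * gerstenhaber n q f g xs) \<in> coboundaries s (n + q - 1)"
  proof -
    have "hoch_diff (k + q - 1) (gerstenhaber k q h g) \<in> coboundaries s (n + q - 1)"
      using gerstenhaber_cochains[OF h(1) g'(1) kq] kq by (cases "k + q") (auto simp: coboundaries_def Suc)
    moreover have "hoch_diff (k + q - 1) (gerstenhaber k q h g)
        = (\<lambda>xs. (- 1) ^ (q + 1) * gerstenhaber n q f g xs)"
      by (rule ext) (rule eq)
    ultimately show ?thesis by simp
  qed
  from coboundaries_sign[OF this, of "q + 1"] show ?thesis
    by (cases "even q") simp_all
qed

lemma gerstenhaber_coboundary_swap:
  assumes "gerstenhaber n q f g \<in> coboundaries s (n + q - 1)"
  shows "gerstenhaber q n g f \<in> coboundaries s (q + n - 1)"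
proof -
  have "gerstenhaber q n g f = (\<lambda>xs. - ((- 1) ^ ((n + 1) * (q + 1)) * gerstenhaber n q f g xs))"
    by (rule ext) (rule gerstenhaber_swap)
  then show ?thesis
    using coboundaries_minus[OF coboundaries_sign[OF assms]]
    by (simp only: add.commute[of q n])
qed

text \<open>\<open>HH_bracket\<close> is a union over all pairs of representatives, so each pair has
  to give the zero class. The representatives are exchanged one at a time, the second one after the
  arguments are swapped.\<close>

lemma HH_bracket_eq_zero:
  assumes f: "f \<in> cocycles s p" and g: "g \<in> cocycles s q"
    and fg: "gerstenhaber p q f g \<in> coboundaries s (p + q - 1)" and pq: "p + q \<noteq> 1"
  shows "HH_bracket s p q (HH_class s p f) (HH_class s q g) = HH_zero s (p + q - 1)"
proof -
  have *: "gerstenhaber p q f' g' \<in> coboundaries s (p + q - 1)"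
    if f': "f' \<in> HH_class s p f" and g': "g' \<in> HH_class s q g" for f' g'
  proof (cases "p + q = 0")
    case True
    then have "gerstenhaber p q f' g' = (\<lambda>_. 0)" by (auto simp: gerstenhaber_def circ_def)
    then show ?thesis by (simp add: coboundaries_zero)
  next
    case False
    then have pq: "p + q > 1" "q + p > 1" using pq by linarith+
    have c: "f' \<in> cocycles s p" "g' \<in> cocycles s q"
      "(\<lambda>xs. f xs - f' xs) \<in> coboundaries s p" "(\<lambda>xs. g xs - g' xs) \<in> coboundaries s q"
      using f' g' by (simp_all add: mem_HH_class)
    have 1: "gerstenhaber p q (\<lambda>xs. f xs - f' xs) g \<in> coboundaries s (p + q - 1)"
      by (rule gerstenhaber_coboundary_left[OF c(3) g pq(1)])
    have 2: "gerstenhaber q p (\<lambda>xs. g xs - g' xs) f' \<in> coboundaries s (q + p - 1)"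
      by (rule gerstenhaber_coboundary_left[OF c(4) c(1) pq(2)])
    have e1: "gerstenhaber p q (\<lambda>xs. f xs - f' xs) g = (\<lambda>xs. gerstenhaber p q f g xs - gerstenhaber p q f' g xs)"
      using g by (intro ext gerstenhaber_diff) (simp add: cocycles_def cochains_iff)
    have e2: "gerstenhaber q p (\<lambda>xs. g xs - g' xs) f' = (\<lambda>xs. gerstenhaber q p g f' xs - gerstenhaber q p g' f' xs)"
      using c(1) by (intro ext gerstenhaber_diff) (simp add: cocycles_def cochains_iff)
    have "gerstenhaber p q f' g \<in> coboundaries s (p + q - 1)"
      using coboundaries_diff[OF fg 1] by (simp add: e1)
    from coboundaries_diff[OF gerstenhaber_coboundary_swap[OF this] 2]
    have "gerstenhaber q p g' f' \<in> coboundaries s (q + p - 1)" by (simp add: e2)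
    then show ?thesis by (rule gerstenhaber_coboundary_swap)
  qed
  have "f \<in> HH_class s p f" "g \<in> HH_class s q g"
    using f g by (simp_all add: mem_HH_class coboundaries_zero)
  then show ?thesis
    unfolding HH_bracket_def using * HH_class_coboundary by fastforce
qed

end

section \<open>The normal form basis of the algebra\<close>

primrec flip :: "step \<Rightarrow> step" where
  "flip Fwd = Bwd"
| "flip Bwd = Fwd"

primrec alternating :: "step \<Rightarrow> nat \<Rightarrow> step list" where
  "alternating s 0 = []"
| "alternating s (Suc n) = s # alternating (flip s) n"

lemma flip_flip [simp]: "flip (flip s) = s"
  by (cases s) simp_all

lemma flip_neq [simp]: "flip s \<noteq> s" "s \<noteq> flip s"
  by (cases s; simp)+

lemma shift_flip [simp]: "shift s + (shift (flip s) + x) = (x :: 'a::ring_1)"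
  by (cases s) simp_all

lemma shift_flip_0 [simp]: "shift s + shift (flip s) = (0 :: 'a::ring_1)"
  by (cases s) simp_all

lemma length_alternating [simp]: "length (alternating s n) = n"
  by (induction n arbitrary: s) simp_all

lemma alternating_add: "alternating s (a + b) = alternating s a @ alternating (if even a then s else flip s) b"
  by (induction a arbitrary: s) simp_all

lemma alternating_inject: "n > 0 \<Longrightarrow> alternating s n = alternating s' n \<longleftrightarrow> s = s'"
  by (cases n) auto

lemma take_alternating: "take j (alternating s n) = alternating s (min j n)"
proof (induction n arbitrary: s j)
  case (Suc n)
  then show ?case by (cases j) simp_all
qed simp

lemma drop_alternating: "drop j (alternating s n) = alternating (if even j then s else flip s) (n - j)"
proof (induction n arbitrary: s j)
  case (Suc n)
  then show ?case by (cases j) simp_all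
qed simp

lemma step_cases: "s = Fwd \<or> s = Bwd"
  by (cases s) simp_all

lemma not_alternating:
  "w = alternating (hd w) (length w) \<or> (\<exists>u s v. w = u @ [s, s] @ v)"
proof (induction w)
  case (Cons s w)
  show ?case
  proof (cases w)
    case Nil
    then show ?thesis by simp
  next
    case (Cons t v)
    from Cons.IH show ?thesis
    proof
      assume w: "w = alternating (hd w) (length w)"
      show ?thesis
      proof (cases "t = s")
        case True
        then have "s # w = [] @ [s, s] @ v" by (simp add: Cons)
        then show ?thesis by blast
      next
        case False
        then have "hd w = flip s" using Cons by (cases s; cases t) simp_all
        then show ?thesis using w by simp
      qed
    next
      assume "\<exists>u s v. w = u @ [s, s] @ v"
      then obtain u s' v where "w = u @ [s', s'] @ v" by blast
      then have "s # w = (s # u) @ [s', s'] @ v" by simp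
      then show ?thesis by blast
    qed
  qed
qed simp

context
  includes alg.lifting
begin

lift_definition path_elem :: "'m::nontriv path \<Rightarrow> ('k::field, 'n::finite, 'm) alg" is basis_path .

lemma path_elem_mult:
  "path_elem p * path_elem q = (if path_target p = fst q then path_elem (fst p, snd p @ snd q) else 0)"
  unfolding path_elem.abs_eq times_alg.abs_eq basis_path_mult
  by (simp add: zero_alg.abs_eq[symmetric] del: path_target.simps)

lemma idem_path_elem: "idem i = path_elem (i, [])"
  by (simp add: path_elem.abs_eq idem.abs_eq vertex_path_def)

lemma arrow_path_elem: "arrow i = path_elem (i, [Fwd])"
  by (simp add: path_elem.abs_eq arrow.abs_eq path_arrow_def)

lemma bar_arrow_path_elem: "bar_arrow i = path_elem (i + 1, [Bwd])"
  by (simp add: path_elem.abs_eq bar_arrow.abs_eq path_bar_arrow_def)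

lemma abs_alg_eqI:
  "x - y \<in> relations CARD('n) \<Longrightarrow> (abs_alg x :: ('k::field, 'n::finite, 'm::nontriv) alg) = abs_alg y"
  by (simp add: alg.abs_eq_iff ideal_generated_by.gen)

lemma arrow_arrow: "(arrow i * arrow (i + 1) :: ('k::field, 'n::finite, 'm::nontriv) alg) = 0"
  unfolding arrow.abs_eq times_alg.abs_eq zero_alg.abs_eq
  by (rule abs_alg_eqI) (simp add: relations_def)

lemma bar_arrow_bar_arrow: "(bar_arrow (i + 1) * bar_arrow i :: ('k::field, 'n::finite, 'm::nontriv) alg) = 0"
  unfolding bar_arrow.abs_eq times_alg.abs_eq zero_alg.abs_eq
  by (rule abs_alg_eqI) (simp add: relations_def)

lemma socle_eq:
  "((arrow i * bar_arrow i) ^ CARD('n) :: ('k::field, 'n::finite, 'm::nontriv) alg) =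
    (bar_arrow (i - 1) * arrow (i - 1)) ^ CARD('n)"
proof -
  have "abs_alg x ^ k = (abs_alg (x ^ k) :: ('k, 'n, 'm) alg)" for x k
    by (induction k) (simp_all add: one_alg.abs_eq times_alg.abs_eq)
  then show ?thesis
    unfolding bar_arrow.abs_eq arrow.abs_eq times_alg.abs_eq
    by (simp, intro abs_alg_eqI) (simp add: relations_def)
qed

end

context
  includes path_alg.lifting
begin

lemma path_alg_induct:
  fixes x :: "('k::field, 'm::nontriv) path_alg"
  assumes "P 0" "\<And>x y. P x \<Longrightarrow> P y \<Longrightarrow> P (x + y)" "\<And>c p. P (scale_path c (basis_path p))"
  shows "P x"
proof -
  have "P (Abs_path_alg u)" for u
  proof (induction u rule: Poly_Mapping.update_induct)
    case const
    show ?case using assms(1) by (simp add: zero_path_alg_def)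
  next
    case (update u t c)
    have "Abs_path_alg (Poly_Mapping.update t c u) = scale_path c (basis_path t) + Abs_path_alg u"
    proof (rule path_alg_eqI)
      fix p
      have "coeff (Abs_path_alg v) p = Poly_Mapping.lookup v p" for v :: "'m path \<Rightarrow>\<^sub>0 'k"
        by (simp add: coeff.abs_eq eq_onp_def)
      then show "coeff (Abs_path_alg (Poly_Mapping.update t c u)) p
          = coeff (scale_path c (basis_path t) + Abs_path_alg u) p"
        using update.hyps
        by (cases "p = t") (simp_all add: coeff_basis_path lookup_update in_keys_iff)
    qed
    then show ?case using assms(2)[OF assms(3) update.IH] by simp
  qed
  from this[of "Rep_path_alg x"] show ?thesis by (simp add: Rep_path_alg_inverse)
qed

end

context
  includes alg.lifting
begin

lemma alg_induct [case_names zero add path]: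
  fixes x :: "('k::field, 'n::finite, 'm::nontriv) alg"
  assumes "P 0" "\<And>x y. P x \<Longrightarrow> P y \<Longrightarrow> P (x + y)" "\<And>c p. P (scale_alg c (path_elem p))"
  shows "P x"
proof -
  have "P (abs_alg u)" for u
  proof (induction u rule: path_alg_induct)
    case 1
    show ?case using assms(1) by (simp add: zero_alg_def)
  next
    case (2 x y)
    then show ?case using assms(2) by (metis plus_alg.abs_eq)
  next
    case (3 c p)
    then show ?case using assms(3) by (metis scale_alg.abs_eq path_elem.abs_eq)
  qed
  from this[of "rep_alg x"] show ?thesis
    by (metis Quotient3_abs_rep[OF Quotient3_alg])
qed

section \<open>Independence of the alternating paths\<close>

lemma path_arrow_power:
  fixes i :: "'m::nontriv mod_ring"
  assumes "k > 0"
  shows "(path_arrow i * path_bar_arrow i) ^ k = (basis_path (i, alternating Fwd (2 * k)) :: ('k::field, 'm) path_alg)"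
    and "(path_bar_arrow (i - 1) * path_arrow (i - 1)) ^ k = (basis_path (i, alternating Bwd (2 * k)) :: ('k, 'm) path_alg)"
proof -
  have *: "path_arrow i * path_bar_arrow i = (basis_path (i, [Fwd, Bwd]) :: ('k, 'm) path_alg)"
    "path_bar_arrow (i - 1) * path_arrow (i - 1) = (basis_path (i, [Bwd, Fwd]) :: ('k, 'm) path_alg)"
    by (simp_all add: path_arrow_def path_bar_arrow_def basis_path_mult)
  have "basis_path (i, [s, flip s]) ^ k = (basis_path (i, alternating s (2 * k)) :: ('k, 'm) path_alg)" for s
    using assms
  proof (induction k rule: nat_induct_non_zero)
    case (Suc k)
    then show ?case using shift_flip[of s "0 :: 'm mod_ring"]
      by (simp add: basis_path_mult)
  qed (simp add: numeral_2_eq_2)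
  from this[of Fwd] this[of Bwd] show
    "(path_arrow i * path_bar_arrow i) ^ k = (basis_path (i, alternating Fwd (2 * k)) :: ('k, 'm) path_alg)"
    "(path_bar_arrow (i - 1) * path_arrow (i - 1)) ^ k = (basis_path (i, alternating Bwd (2 * k)) :: ('k, 'm) path_alg)"
    unfolding * by simp_all
qed

text \<open>These functionals vanish on the relations, and they still do after multiplication:
  factors of an alternating word alternate, a proper factor of a word of length at most 2N is
  shorter than 2N, and so the element of the ideal contributes only when the other factor is
  trivial. This uses the first claim in the proof of the second, hence the common induction.\<close>

lemma coeff_alternating_ideal:
  assumes "x \<in> ideal_generated_by (relations N)" "N > 0"
  shows "L < 2 * N \<Longrightarrow> coeff x (v, alternating s L) = 0"
    and "coeff x (v, alternating Fwd (2 * N)) + coeff x (v, alternating Bwd (2 * N)) = 0"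
proof -
  have sq: "path_arrow i * path_arrow (i + 1) = basis_path (i, [Fwd, Fwd])"
    "path_bar_arrow (i + 1) * path_bar_arrow i = basis_path (i + 2, [Bwd, Bwd])" for i :: "'b mod_ring"
    by (simp_all add: path_arrow_def path_bar_arrow_def basis_path_mult add.commute)
  have na: "alternating s L \<noteq> [t, t]" for s t L
  proof
    assume *: "alternating s L = [t, t]"
    then have "L = 2" by (metis length_alternating length_Cons list.size(3) One_nat_def Suc_1)
    then show False using * by (simp add: numeral_2_eq_2) (metis flip_neq(1))
  qed
  have "(\<forall>L s v. L < 2 * N \<longrightarrow> coeff x (v, alternating s L) = 0) \<and>
      (\<forall>v. coeff x (v, alternating Fwd (2 * N)) + coeff x (v, alternating Bwd (2 * N)) = 0)"
    using assms(1)
  proof induction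
    case (gen x)
    have len: "alternating s L \<noteq> alternating t (2 * N)" if "L < 2 * N" for L s t
      using that by (metis length_alternating less_irrefl)
    from gen consider i where "x = basis_path (i, [Fwd, Fwd])" | i where "x = basis_path (i + 2, [Bwd, Bwd])"
      | i where "x = basis_path (i, alternating Fwd (2 * N)) - basis_path (i, alternating Bwd (2 * N))"
      unfolding relations_def sq path_arrow_power[OF assms(2)] by blast
    then show ?case
    proof cases
      case 3
      have "alternating Fwd (2 * N) \<noteq> alternating Bwd (2 * N)"
        using assms(2) by (simp add: alternating_inject)
      then show ?thesis
        unfolding 3 by (simp add: coeff_basis_path len[symmetric])
    qed (simp_all add: coeff_basis_path na[symmetric])
  next
    case (left x r)
    have z: "coeff (r * x) (v, alternating s L) = coeff r (v, []) * coeff x (v, alternating s L)"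
      if "L \<le> 2 * N" for L s v
    proof -
      have "coeff r (v, take j (alternating s L)) *
          coeff x (path_target (v, take j (alternating s L)), drop j (alternating s L)) =
          (if j = 0 then coeff r (v, []) * coeff x (v, alternating s L) else 0)" if "j \<le> L" for j
        using left.IH that \<open>L \<le> 2 * N\<close> by (auto simp: drop_alternating simp del: path_target.simps) auto
      then show ?thesis by (simp add: coeff_times del: path_target.simps)
    qed
    show ?case using left.IH by (auto simp: z distrib_left[symmetric])
  next
    case (right x r)
    have z: "coeff (x * r) (v, alternating s L) =
        coeff x (v, alternating s L) * coeff r (path_target (v, alternating s L), [])"
      if "L \<le> 2 * N" for L s v
    proof -
      have "coeff x (v, take j (alternating s L)) *
          coeff r (path_target (v, take j (alternating s L)), drop j (alternating s L)) =
          (if j = L then coeff x (v, alternating s L) * coeff r (path_target (v, alternating s L), []) else 0)"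
        if "j \<le> L" for j
        using right.IH that \<open>L \<le> 2 * N\<close> by (auto simp: take_alternating simp del: path_target.simps)
      then show ?thesis by (simp add: coeff_times del: path_target.simps)
    qed
    \<comment> \<open>Both alternating words of length 2N are closed, so they meet the same
      coefficient of r.\<close>
    have t: "path_target (v, alternating s (2 * k)) = v" for v :: "'b mod_ring" and s k
      by (induction k arbitrary: v s) (simp_all add: shift_flip)
    show ?case using right.IH by (auto simp: z t distrib_right[symmetric] simp del: path_target.simps)
  next
    case (add x y)
    have "coeff (x + y) (v, u) + coeff (x + y) (v, w) =
        (coeff x (v, u) + coeff x (v, w)) + (coeff y (v, u) + coeff y (v, w))" for v u w
      by (simp add: algebra_simps)
    then show ?case using add by (simp only:) simp
  qed simp_all
  then show "L < 2 * N \<Longrightarrow> coeff x (v, alternating s L) = 0"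
    "coeff x (v, alternating Fwd (2 * N)) + coeff x (v, alternating Bwd (2 * N)) = 0"
    by blast+
qed

text \<open>Coordinates with respect to the alternating paths. At length 2N the two alternating
  words from i are equal in A, so only the sum of their coefficients is well defined.\<close>

lift_definition coeff_at :: "'m::nontriv mod_ring \<Rightarrow> step \<Rightarrow> nat \<Rightarrow> ('k::field, 'n::finite, 'm) alg \<Rightarrow> 'k"
  is "\<lambda>i s L x. if L < 2 * CARD('n) then coeff x (i, alternating s L)
    else if L = 2 * CARD('n) then coeff x (i, alternating Fwd L) + coeff x (i, alternating Bwd L) else 0"
proof -
  fix i :: "'m mod_ring" and s L and x y :: "('k, 'm) path_alg"
  assume I: "x - y \<in> ideal_generated_by (relations CARD('n))"
  have N: "CARD('n) > 0" by simp
  show "(if L < 2 * CARD('n) then coeff x (i, alternating s L)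
      else if L = 2 * CARD('n) then coeff x (i, alternating Fwd L) + coeff x (i, alternating Bwd L) else 0) =
     (if L < 2 * CARD('n) then coeff y (i, alternating s L)
      else if L = 2 * CARD('n) then coeff y (i, alternating Fwd L) + coeff y (i, alternating Bwd L) else 0)"
    using coeff_alternating_ideal(1)[OF I N, of L i s] coeff_alternating_ideal(2)[OF I N, of i]
    by (auto simp: algebra_simps)
qed

lemma coeff_at_add: "coeff_at i s L (x + y) = coeff_at i s L x + coeff_at i s L y"
proof -
  obtain u v where "x = abs_alg u" "y = abs_alg v" by (metis Quotient3_abs_rep[OF Quotient3_alg])
  then show ?thesis by (simp add: plus_alg.abs_eq coeff_at.abs_eq)
qed

lemma coeff_at_scale: "coeff_at i s L (scale_alg c x) = c * coeff_at i s L x"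
proof -
  obtain u where "x = abs_alg u" by (metis Quotient3_abs_rep[OF Quotient3_alg])
  then show ?thesis by (simp add: scale_alg.abs_eq coeff_at.abs_eq distrib_left)
qed

lemma coeff_at_path_elem:
  "coeff_at i s L (path_elem (j, w) :: ('k::field, 'n::finite, 'm::nontriv) alg) =
    (if j = i \<and> length w = L \<and> L \<le> 2 * CARD('n) \<and>
        (if L < 2 * CARD('n) then w = alternating s L else w = alternating Fwd L \<or> w = alternating Bwd L)
     then 1 else 0)"
proof -
  have "alternating Fwd (2 * CARD('n)) \<noteq> alternating Bwd (2 * CARD('n))"
    by (simp add: alternating_inject)
  then show ?thesis
    by (auto simp: coeff_at.abs_eq path_elem.abs_eq coeff_basis_path)
qed

end

section \<open>Reduction of paths to alternating ones\<close>

lemma arrow_bar_arrow_power: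
  fixes i :: "'m::nontriv mod_ring"
  assumes "k > 0"
  shows "(arrow i * bar_arrow i) ^ k = (path_elem (i, alternating Fwd (2 * k)) :: ('k::field, 'n::finite, 'm) alg)"
    and "(bar_arrow (i - 1) * arrow (i - 1)) ^ k = (path_elem (i, alternating Bwd (2 * k)) :: ('k, 'n, 'm) alg)"
proof -
  have *: "arrow i * bar_arrow i = (path_elem (i, [Fwd, Bwd]) :: ('k, 'n, 'm) alg)"
    "bar_arrow (i - 1) * arrow (i - 1) = (path_elem (i, [Bwd, Fwd]) :: ('k, 'n, 'm) alg)"
    by (simp_all add: arrow_path_elem bar_arrow_path_elem path_elem_mult)
  have "path_elem (i, [s, flip s]) ^ k = (path_elem (i, alternating s (2 * k)) :: ('k, 'n, 'm) alg)" for s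
    using assms
  proof (induction k rule: nat_induct_non_zero)
    case (Suc k)
    then show ?case using shift_flip[of s "0 :: 'm mod_ring"]
      by (simp add: path_elem_mult)
  qed (simp add: numeral_2_eq_2)
  from this[of Fwd] this[of Bwd] show
    "(arrow i * bar_arrow i) ^ k = (path_elem (i, alternating Fwd (2 * k)) :: ('k, 'n, 'm) alg)"
    "(bar_arrow (i - 1) * arrow (i - 1)) ^ k = (path_elem (i, alternating Bwd (2 * k)) :: ('k, 'n, 'm) alg)"
    unfolding * by simp_all
qed

lemma path_elem_socle:
  "(path_elem (i, alternating s (2 * CARD('n))) :: ('k::field, 'n::finite, 'm::nontriv) alg) =
    path_elem (i, alternating Fwd (2 * CARD('n)))"
  using socle_eq[of i, where 'k = 'k and 'n = 'n] by (cases s) (simp_all add: arrow_bar_arrow_power)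

lemma path_elem_square:
  fixes i :: "'m::nontriv mod_ring"
  shows "(path_elem (i, u @ [s, s] @ v) :: ('k::field, 'n::finite, 'm) alg) = 0"
proof -
  have split: "(path_elem (i, a @ b) :: ('k, 'n, 'm) alg) = path_elem (i, a) * path_elem (path_target (i, a), b)" for i a b
    by (simp add: path_elem_mult)
  have *: "(path_elem (i, [s, s]) :: ('k, 'n, 'm) alg) = 0" for i
    using arrow_arrow[of i, where 'k = 'k and 'n = 'n] bar_arrow_bar_arrow[of "i - 2", where 'k = 'k and 'n = 'n]
    by (cases s) (simp_all add: arrow_path_elem bar_arrow_path_elem path_elem_mult)
  show ?thesis
    unfolding split[of i u] split[of _ "[s, s]" v] * by simp
qed

text \<open>The first 2N letters may be replaced by the other alternating word of that length. Its
  last letter then agrees with the next one, and a repeated letter makes the path 0.\<close>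

lemma path_elem_long:
  assumes "L > 2 * CARD('n)"
  shows "(path_elem (i, alternating s L) :: ('k::field, 'n::finite, 'm::nontriv) alg) = 0"
proof -
  define M where "M = 2 * CARD('n)"
  obtain k where "CARD('n) = Suc k" using gr0_implies_Suc[of "CARD('n)"] by auto
  then have M: "even M" "M = Suc (Suc (2 * k))" by (simp_all add: M_def)
  have "L = M + Suc (L - M - 1)" using assms by (simp add: M_def)
  then have "alternating s L = alternating s M @ [s] @ alternating (flip s) (L - M - 1)"
    using M(1) alternating_add[of s M "Suc (L - M - 1)"] by simp
  then have "(path_elem (i, alternating s L) :: ('k, 'n, 'm) alg)
      = path_elem (i, alternating s M) * path_elem (path_target (i, alternating s M), [s] @ alternating (flip s) (L - M - 1))"
    by (simp add: path_elem_mult)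
  also have "(path_elem (i, alternating s M) :: ('k, 'n, 'm) alg) = path_elem (i, alternating (flip s) M)"
    unfolding M_def using path_elem_socle[of i s, where 'k = 'k and 'n = 'n] path_elem_socle[of i "flip s", where 'k = 'k and 'n = 'n] by simp
  also have "alternating (flip s) M = alternating (flip s) (Suc (2 * k)) @ [s]"
    using alternating_add[of "flip s" "Suc (2 * k)" 1] by (simp add: M(2))
  also have "path_elem (i, alternating (flip s) (Suc (2 * k)) @ [s]) *
      path_elem (path_target (i, alternating s M), [s] @ alternating (flip s) (L - M - 1)) =
      (if path_target (i, alternating (flip s) (Suc (2 * k)) @ [s]) = path_target (i, alternating s M)
       then path_elem (i, alternating (flip s) (Suc (2 * k)) @ [s, s] @ alternating (flip s) (L - M - 1))
       else (0 :: ('k, 'n, 'm) alg))"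
    by (simp add: path_elem_mult del: path_target.simps)
  also have "\<dots> = 0" by (simp only: path_elem_square if_cancel)
  finally show ?thesis .
qed

text \<open>In the lengths 0 and 2N both values of s name the same element, hence the choice of
  \<open>Fwd\<close>.\<close>

definition normal_words :: "'n::finite itself \<Rightarrow> ('m::nontriv mod_ring \<times> step \<times> nat) set" where
  "normal_words _ = {(i, s, L). L \<le> 2 * CARD('n) \<and> (L = 0 \<or> L = 2 * CARD('n) \<longrightarrow> s = Fwd)}"

lemma finite_step_UNIV: "finite (UNIV :: step set)"
proof -
  have "(UNIV :: step set) = {Fwd, Bwd}" using step_cases by auto
  then show ?thesis by (metis finite.emptyI finite.insertI)
qed

lemma finite_normal_words: "finite (normal_words TYPE('n::finite) :: ('m::nontriv mod_ring \<times> _) set)"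
proof (rule finite_subset)
  show "(normal_words TYPE('n) :: ('m mod_ring \<times> _) set) \<subseteq> UNIV \<times> UNIV \<times> {..2 * CARD('n)}"
    by (auto simp: normal_words_def)
qed (simp add: finite_step_UNIV)

text \<open>
  Weights are pairs. The first component counts the returns to the left; the second one is a sum over
  the arrows crossed, counted with sign. For \<open>\<xi> = (\<lambda>_. 1)\<close> it is the displacement.
\<close>

fun weight :: "('m::nontriv mod_ring \<Rightarrow> int) \<Rightarrow> 'm path \<Rightarrow> int \<times> int" where
  "weight \<xi> (v, []) = 0"
| "weight \<xi> (v, Fwd # w) = (0, \<xi> v) + weight \<xi> (v + 1, w)"
| "weight \<xi> (v, Bwd # w) = (1, - \<xi> (v - 1)) + weight \<xi> (v - 1, w)"

lemma weight_append: "weight \<xi> (v, u @ w) = weight \<xi> (v, u) + weight \<xi> (path_target (v, u), w)"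
proof (induction u arbitrary: v)
  case (Cons s u)
  then show ?case by (cases s) (simp_all add: algebra_simps)
qed (simp add: zero_prod_def)

lemma weight_alternating:
  "weight \<xi> (v, alternating s (2 * k)) = (int k, 0)"
  "weight \<xi> (v, alternating Fwd (Suc (2 * k))) = (int k, \<xi> v)"
  "weight \<xi> (v, alternating Bwd (Suc (2 * k))) = (int k + 1, - \<xi> (v - 1))"
proof -
  show *: "weight \<xi> (v, alternating s (2 * k)) = (int k, 0)" for v s
    by (induction k arbitrary: v) (use step_cases[of s] in \<open>auto simp: zero_prod_def\<close>)
  show "weight \<xi> (v, alternating Fwd (Suc (2 * k))) = (int k, \<xi> v)"
    "weight \<xi> (v, alternating Bwd (Suc (2 * k))) = (int k + 1, - \<xi> (v - 1))"
    by (simp_all add: *)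
qed

text \<open>The weight is carried along because both alternating words of length 2N have weight (N,
  0), whatever \<xi> is; this is why every \<xi> gives a grading of A.\<close>

lemma path_elem_normal_form:
  "(path_elem (i, w) :: ('k::field, 'n::finite, 'm::nontriv) alg) = 0 \<or>
    (\<exists>s. (i, s, length w) \<in> normal_words TYPE('n) \<and>
      (path_elem (i, w) :: ('k, 'n, 'm) alg) = path_elem (i, alternating s (length w)) \<and>
      weight \<xi> (i, w) = weight \<xi> (i, alternating s (length w)))"
proof (cases "w = alternating (hd w) (length w) \<and> length w \<le> 2 * CARD('n)")
  case True
  define L where "L = length w"
  consider "L = 0" | "0 < L" "L < 2 * CARD('n)" | "L = 2 * CARD('n)" using True unfolding L_def by linarith
  then show ?thesis
  proof cases
    case 2
    have w: "w = alternating (hd w) L" using True by (simp add: L_def)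
    have "(i, hd w, L) \<in> normal_words TYPE('n)" using 2 by (auto simp: normal_words_def)
    then show ?thesis using w by (metis L_def)
  next
    case 3
    have "(path_elem (i, w) :: ('k, 'n, 'm) alg) = path_elem (i, alternating Fwd L)"
      using True path_elem_socle[of i "hd w", where 'k = 'k and 'n = 'n] by (metis 3 L_def)
    moreover have "weight \<xi> (i, w) = weight \<xi> (i, alternating Fwd L)"
      using True 3 weight_alternating(1)[of \<xi> i _ "CARD('n)"] by (metis L_def)
    ultimately show ?thesis using 3 by (auto simp: normal_words_def L_def[symmetric])
  qed (use True in \<open>auto simp: normal_words_def L_def\<close>)
next
  case False
  then consider "\<exists>u s v. w = u @ [s, s] @ v" | "w = alternating (hd w) (length w)" "length w > 2 * CARD('n)"
    using not_alternating[of w] by fastforce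
  then show ?thesis
  proof cases
    case 2
    then show ?thesis using path_elem_long by metis
  qed (use path_elem_square in blast)
qed

lemma coeff_at_normal:
  assumes "(j, t, M) \<in> normal_words TYPE('n)" "(i, s, L) \<in> normal_words TYPE('n)"
  shows "coeff_at i s L (path_elem (j, alternating t M) :: ('k::field, 'n::finite, 'm::nontriv) alg) =
    (if (j, t, M) = (i, s, L) then 1 else 0)"
  using assms by (auto simp: coeff_at_path_elem normal_words_def alternating_inject)

lemma lin_coeff_at: "lin scale_alg (*) (coeff_at i s L)"
  by (simp add: lin_def coeff_at_add coeff_at_scale)

lemmas coeff_at_0 [simp] = lin_0[OF lin_coeff_at]

section \<open>Homogeneous components of elements\<close>

definition weight_part ::
  "('m::nontriv mod_ring \<Rightarrow> int) \<Rightarrow> int \<times> int \<Rightarrow> ('k::field, 'n::finite, 'm) alg \<Rightarrow> ('k, 'n, 'm) alg" where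
  "weight_part \<xi> v x = (\<Sum>(i, s, L) | (i, s, L) \<in> normal_words TYPE('n) \<and> weight \<xi> (i, alternating s L) = v.
      scale_alg (coeff_at i s L x) (path_elem (i, alternating s L)))"

interpretation alg_module: algebra_over_field "scale_alg :: 'k::field \<Rightarrow> ('k, 'n::finite, 'm::nontriv) alg \<Rightarrow> _"
  by (unfold_locales; simp add: scale_alg_mult_left scale_alg_mult_right algebra_simps
      alg.scale_left_distrib alg.scale_right_distrib)

lemma lin_weight_part: "lin scale_alg scale_alg (weight_part \<xi> v)"
  unfolding lin_def weight_part_def
  by (auto simp: coeff_at_add coeff_at_scale alg.scale_left_distrib sum.distrib case_prod_beta'
      alg.scale_sum_right)

lemma weight_part_path_elem: "weight_part \<xi> v (path_elem p) = (if weight \<xi> p = v then path_elem p else 0)"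
proof -
  obtain i w where p: "p = (i, w)" by (cases p)
  have fin: "finite {(i :: 'c mod_ring, s, L). (i, s, L) \<in> normal_words TYPE('b) \<and> P i s L}" for P
    by (rule finite_subset[OF _ finite_normal_words[where 'n = 'b]]) auto
  consider "(path_elem (i, w) :: ('a, 'b, 'c) alg) = 0"
    | s where "(i, s, length w) \<in> normal_words TYPE('b)"
      "(path_elem (i, w) :: ('a, 'b, 'c) alg) = path_elem (i, alternating s (length w))"
      "weight \<xi> (i, w) = weight \<xi> (i, alternating s (length w))"
    using path_elem_normal_form[of i w \<xi>] by blast
  then show ?thesis
  proof cases
    case 1
    then show ?thesis using lin_0[OF lin_weight_part] by (simp add: p)
  next
    case 2
    have "weight_part \<xi> v (path_elem (i, w) :: ('a, 'b, 'c) alg) =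
      (\<Sum>b | b \<in> normal_words TYPE('b) \<and> weight \<xi> (fst b, alternating (fst (snd b)) (snd (snd b))) = v.
        if b = (i, s, length w) then path_elem (i, alternating s (length w)) else 0)"
      unfolding weight_part_def 2(2)
      by (intro sum.cong) (auto simp: coeff_at_normal[OF 2(1)] split: if_splits)
    also have "\<dots> = (if weight \<xi> (i, w) = v then path_elem (i, alternating s (length w)) else 0)"
      by (subst sum.delta) (use 2 finite_normal_words in auto)
    finally show ?thesis using 2(2) by (simp add: p)
  qed
qed

abbreviation homogeneous ::
  "('m::nontriv mod_ring \<Rightarrow> int) \<Rightarrow> int \<times> int \<Rightarrow> ('k::field, 'n::finite, 'm) alg \<Rightarrow> bool" where
  "homogeneous \<xi> v x \<equiv> weight_part \<xi> v x = x"

lemmas weight_part_add = lin_weight_part[unfolded lin_def, THEN conjunct1, rule_format]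
lemmas weight_part_scale = lin_weight_part[unfolded lin_def, THEN conjunct2, rule_format]
lemmas weight_part_0 [simp] = lin_0[OF lin_weight_part]
lemmas weight_part_minus = lin_minus[OF lin_weight_part]
lemmas weight_part_diff = lin_diff[OF lin_weight_part]
lemmas weight_part_sum = lin_sum[OF lin_weight_part]

lemma weight_part_weight_part:
  "weight_part \<xi> v (weight_part \<xi> w x) = (if v = w then weight_part \<xi> v x else 0)"
  by (induction x rule: alg_induct)
     (auto simp: weight_part_add weight_part_scale weight_part_path_elem)

lemma homogeneous_weight_part:
  "homogeneous \<xi> v x \<Longrightarrow> weight_part \<xi> w x = (if w = v then x else 0)"
  by (metis weight_part_weight_part)

definition weights :: "'n::finite itself \<Rightarrow> ('m::nontriv mod_ring \<Rightarrow> int) \<Rightarrow> (int \<times> int) set" where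
  "weights _ \<xi> = (\<lambda>(i, s, L). weight \<xi> (i, alternating s L)) ` normal_words TYPE('n)"

lemma finite_weights: "finite (weights TYPE('n::finite) \<xi>)"
  by (simp add: weights_def finite_normal_words)

lemma weight_part_eq_0:
  "v \<notin> weights TYPE('n) \<xi> \<Longrightarrow> weight_part \<xi> v (x :: ('k::field, 'n::finite, 'm::nontriv) alg) = 0"
  unfolding weight_part_def weights_def by (rule sum.neutral) force

lemma sum_weight_part:
  fixes x :: "('k::field, 'n::finite, 'm::nontriv) alg"
  shows "(\<Sum>v\<in>weights TYPE('n) \<xi>. weight_part \<xi> v x) = x"
proof (induction x rule: alg_induct)
  case (path c p)
  have "(\<Sum>v\<in>weights TYPE('n) \<xi>. weight_part \<xi> v (path_elem p :: ('k, 'n, 'm) alg)) = path_elem p"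
  proof (cases "(path_elem p :: ('k, 'n, 'm) alg) = 0")
    case False
    then have "weight \<xi> p \<in> weights TYPE('n) \<xi>"
      using path_elem_normal_form[of "fst p" "snd p" \<xi>, where 'k = 'k and 'n = 'n]
      by (force simp: weights_def)
    then show ?thesis by (simp add: weight_part_path_elem finite_weights if_distrib cong: if_cong)
  qed simp
  then show ?case by (simp add: weight_part_scale alg.scale_sum_right[symmetric])
qed (simp_all add: weight_part_add sum.distrib)

lemma homogeneous_mult:
  assumes "homogeneous \<xi> v x" "homogeneous \<xi> w y"
  shows "homogeneous \<xi> (v + w) (x * y)"
proof -
  have "homogeneous \<xi> (v + w) (weight_part \<xi> v x * weight_part \<xi> w y)"
  proof (induction x rule: alg_induct)
    case (path c p)
    show ?case
    proof (induction y rule: alg_induct)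
      case (path d q)
      have "homogeneous \<xi> (weight \<xi> p + weight \<xi> q) (path_elem p * path_elem q :: ('a, 'b, 'c) alg)"
        by (cases p; cases q) (simp add: path_elem_mult weight_part_path_elem weight_append del: path_target.simps)
      then show ?case
        by (auto simp: weight_part_scale scale_alg_mult_left scale_alg_mult_right weight_part_path_elem)
    qed (simp_all add: weight_part_add distrib_left)
  qed (simp_all add: weight_part_add distrib_right)
  then show ?thesis using assms by simp
qed

lemma weight_part_mult_left:
  fixes x :: "('k::field, 'n::finite, 'm::nontriv) alg"
  assumes x: "homogeneous \<xi> u x"
  shows "weight_part \<xi> (u + v) (x * y) = x * weight_part \<xi> v y"
proof -
  have "weight_part \<xi> (u + v) (x * y) = (\<Sum>w\<in>weights TYPE('n) \<xi>. weight_part \<xi> (u + v) (x * weight_part \<xi> w y))"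
    by (subst sum_weight_part[of \<xi> y, symmetric]) (simp add: sum_distrib_left weight_part_sum)
  also have "\<dots> = (\<Sum>w\<in>weights TYPE('n) \<xi>. if w = v then x * weight_part \<xi> v y else 0)"
  proof (rule sum.cong[OF refl])
    fix w
    have "homogeneous \<xi> (u + w) (x * weight_part \<xi> w y)"
      by (rule homogeneous_mult[OF x]) (simp add: weight_part_weight_part)
    from homogeneous_weight_part[OF this]
    show "weight_part \<xi> (u + v) (x * weight_part \<xi> w y) = (if w = v then x * weight_part \<xi> v y else 0)"
      by simp
  qed
  also have "\<dots> = x * weight_part \<xi> v y"
    by (simp add: finite_weights weight_part_eq_0)
  finally show ?thesis .
qed

lemma weight_part_mult_right:
  fixes x :: "('k::field, 'n::finite, 'm::nontriv) alg"
  assumes x: "homogeneous \<xi> u x"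
  shows "weight_part \<xi> (v + u) (y * x) = weight_part \<xi> v y * x"
proof -
  have "weight_part \<xi> (v + u) (y * x) = (\<Sum>w\<in>weights TYPE('n) \<xi>. weight_part \<xi> (v + u) (weight_part \<xi> w y * x))"
    by (subst sum_weight_part[of \<xi> y, symmetric]) (simp add: sum_distrib_right weight_part_sum)
  also have "\<dots> = (\<Sum>w\<in>weights TYPE('n) \<xi>. if w = v then weight_part \<xi> v y * x else 0)"
  proof (rule sum.cong[OF refl])
    fix w
    have "homogeneous \<xi> (w + u) (weight_part \<xi> w y * x)"
      by (rule homogeneous_mult[OF _ x]) (simp add: weight_part_weight_part)
    from homogeneous_weight_part[OF this]
    show "weight_part \<xi> (v + u) (weight_part \<xi> w y * x) = (if w = v then weight_part \<xi> v y * x else 0)"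
      by simp
  qed
  also have "\<dots> = weight_part \<xi> v y * x"
    by (simp add: finite_weights weight_part_eq_0)
  finally show ?thesis .
qed

text \<open>Multiplication by this element continues every path by w, from whatever vertex it has
  reached. It turns computations with the differential into computations with words.\<close>

definition word_sum :: "step list \<Rightarrow> ('k::field, 'n::finite, 'm::nontriv) alg" where
  "word_sum w = (\<Sum>i\<in>UNIV. path_elem (i, w))"

lemma path_target_eq_iff: "path_target (i, w) = j \<longleftrightarrow> i = j - sum_list (map shift w)"
  by (auto simp: algebra_simps)

lemma path_elem_word_sum:
  "path_elem p * word_sum w = path_elem (fst p, snd p @ w)"
  by (simp add: word_sum_def sum_distrib_left path_elem_mult if_distrib del: path_target.simps)

lemma word_sum_path_elem:
  "word_sum w * path_elem (i, u) = path_elem (i - sum_list (map shift w), w @ u)"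
  by (simp add: word_sum_def sum_distrib_right path_elem_mult path_target_eq_iff if_distrib
      del: path_target.simps cong: if_cong)

lemma word_sum_mult: "word_sum u * word_sum w = word_sum (u @ w)"
proof -
  have "word_sum u * word_sum w = (\<Sum>i\<in>UNIV. path_elem (i, u) * word_sum w)"
    by (simp add: word_sum_def[of u] sum_distrib_right)
  then show ?thesis by (simp add: path_elem_word_sum) (simp add: word_sum_def)
qed

lemma idem_word_sum: "idem i * word_sum w = path_elem (i, w)"
  by (simp add: idem_path_elem path_elem_word_sum)

lemma word_sum_idem: "word_sum w * idem i = path_elem (i - sum_list (map shift w), w)"
  by (simp add: idem_path_elem word_sum_path_elem)

lemma word_sum_Nil: "word_sum [] = 1"
proof -
  have "word_sum [] * x = x" for x :: "('a, 'b, 'c) alg"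
    by (induction x rule: alg_induct)
       (use word_sum_path_elem[of "[]", where 'a = 'a and 'b = 'b and 'c = 'c] in
         \<open>auto simp: distrib_left scale_alg_mult_right\<close>)
  from this[of 1] show ?thesis by simp
qed

lemma arrows_word_sum: "arrows = word_sum [Fwd]"
  by (simp add: arrows_def word_sum_def arrow_path_elem)

lemma bar_arrows_word_sum: "bar_arrows = word_sum [Bwd]"
proof -
  have "(\<Sum>i\<in>UNIV. path_elem (i + 1, [Bwd]) :: ('a, 'b, 'c) alg) = (\<Sum>i\<in>UNIV. path_elem (i, [Bwd]))"
    by (rule sum.reindex_bij_witness[of _ "\<lambda>i. i - 1" "\<lambda>i. i + 1"]) auto
  then show ?thesis
    by (simp add: bar_arrows_def word_sum_def bar_arrow_path_elem)
qed

lemma word_sum_power: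
  "word_sum [s, flip s] ^ l = word_sum (alternating s (2 * l))"
  by (induction l) (simp_all add: word_sum_Nil word_sum_mult)

lemma word_sum_diff_words:
  "(arrows * bar_arrows) ^ l = word_sum (alternating Fwd (2 * l))"
  "(bar_arrows * arrows) ^ l = word_sum (alternating Bwd (2 * l))"
  "arrows * (bar_arrows * arrows) ^ l = word_sum (alternating Fwd (Suc (2 * l)))"
  "bar_arrows * (arrows * bar_arrows) ^ l = word_sum (alternating Bwd (Suc (2 * l)))"
  "(arrows * bar_arrows) ^ l * arrows = word_sum (alternating Fwd (Suc (2 * l)))"
  "(bar_arrows * arrows) ^ l * bar_arrows = word_sum (alternating Bwd (Suc (2 * l)))"
proof -
  have *: "(arrows * bar_arrows) ^ l = word_sum (alternating Fwd (2 * l))"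
    "(bar_arrows * arrows) ^ l = word_sum (alternating Bwd (2 * l))"
    using word_sum_power[of Fwd l] word_sum_power[of Bwd l]
    by (simp_all add: arrows_word_sum bar_arrows_word_sum word_sum_mult)
  have **: "alternating s (2 * l) @ [s] = s # alternating (flip s) (2 * l)" for s
    using alternating_add[of s "2 * l" 1] by simp
  show "(arrows * bar_arrows) ^ l = word_sum (alternating Fwd (2 * l))"
    "(bar_arrows * arrows) ^ l = word_sum (alternating Bwd (2 * l))"
    "arrows * (bar_arrows * arrows) ^ l = word_sum (alternating Fwd (Suc (2 * l)))"
    "bar_arrows * (arrows * bar_arrows) ^ l = word_sum (alternating Bwd (Suc (2 * l)))"
    "(arrows * bar_arrows) ^ l * arrows = word_sum (alternating Fwd (Suc (2 * l)))"
    "(bar_arrows * arrows) ^ l * bar_arrows = word_sum (alternating Bwd (Suc (2 * l)))"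
    unfolding * by (simp_all add: arrows_word_sum bar_arrows_word_sum word_sum_mult **)
qed

lemma word_sum_eq_0:
  "word_sum (u @ [s, s] @ v) = 0"
  unfolding word_sum_def path_elem_square by simp

lemma word_sum_long:
  "L > 2 * CARD('n) \<Longrightarrow> (word_sum (alternating s L) :: ('k::field, 'n::finite, 'm::nontriv) alg) = 0"
  unfolding word_sum_def by (simp add: path_elem_long)

lemma word_sum_socle:
  "(word_sum (alternating s (2 * CARD('n))) :: ('k::field, 'n::finite, 'm::nontriv) alg)
    = word_sum (alternating t (2 * CARD('n)))"
  unfolding word_sum_def path_elem_socle[of _ s] path_elem_socle[of _ t] ..

section \<open>The resolution is a complex\<close>

abbreviation alt_word :: "step \<Rightarrow> nat \<Rightarrow> ('k::field, 'n::finite, 'm::nontriv) alg" where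
  "alt_word s L \<equiv> word_sum (alternating s L)"

lemma alt_word_mult:
  "alt_word s a * alt_word t b =
     (if a = 0 then alt_word t b else if b = 0 \<or> t = (if even a then s else flip s) then alt_word s (a + b) else 0)"
proof (cases "a = 0 \<or> b = 0")
  case True
  then show ?thesis by (auto simp: word_sum_Nil)
next
  case False
  let ?u = "if even a then s else flip s"
  obtain a' where a: "a = Suc a'" using False by (cases a) auto
  obtain b' where b: "b = Suc b'" using False by (cases b) auto
  show ?thesis
  proof (cases "t = ?u")
    case True
    then show ?thesis using False by (simp add: word_sum_mult alternating_add)
  next
    case tu: False
    have "t = flip ?u" using tu by (cases s; cases t) (auto split: if_splits)
    moreover have "alternating s a = alternating s a' @ [flip ?u]"
      using alternating_add[of s a' 1] by (simp add: a)
    ultimately have "alternating s a @ alternating t b = alternating s a' @ [t, t] @ alternating (flip t) b'"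
      by (simp add: b)
    then have "word_sum (alternating s a) * word_sum (alternating t b) = (0 :: ('a, 'b, 'c) alg)"
      unfolding word_sum_mult by (simp only: word_sum_eq_0)
    then show ?thesis using False tu by simp
  qed
qed

lemma alt_word_0: "alt_word s 0 = 1"
  by (simp add: word_sum_Nil)

lemma tensor_zero [simp]: "tensor 0 g y = 0" "tensor x g 0 = 0"
  using tensor_add_left[of 0 0 g y] tensor_add_right[of x g 0 0] by simp_all

lemma gtensor_zero [simp]: "gtensor 0 n r i y = 0" "gtensor x n r i 0 = 0"
  by (simp_all add: gtensor_def)

lemma left_mult_gtensor [simp]: "left_mult z (gtensor x n r i y) = gtensor (z * x) n r i y"
  and right_mult_gtensor [simp]: "right_mult (gtensor x n r i y) z = gtensor x n r i (y * z)"
  by (simp_all add: gtensor_def)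

lemma left_mult_minus [simp]: "left_mult z (- p) = - left_mult z p"
  using left_mult_linear(1)[of z p "- p"] by (simp add: eq_neg_iff_add_eq_0 add.commute)

lemma right_mult_minus [simp]: "right_mult (- p) z = - right_mult p z"
  using right_mult_linear(1)[of p "- p" z] by (simp add: eq_neg_iff_add_eq_0 add.commute)

lemma mult_bimod_diff [simp]:
  "left_mult z (p - q) = left_mult z p - left_mult z q"
  "right_mult (p - q) z = right_mult p z - right_mult q z"
  using left_mult_linear(1)[of z "p - q" q] right_mult_linear(1)[of "p - q" q z] by simp_all

lemma signed_eq: "signed e p = (if even e then p else - p)"
  by (simp add: signed_def)

text \<open>The index is an integer and values outside 0..n give 0, as for \<open>gtensor\<close>,
  so that the terms with r - 1 < 0 or r > n require no separate treatment.\<close>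

definition boundary :: "nat \<Rightarrow> int \<Rightarrow> 'm::nontriv mod_ring \<Rightarrow> ('k::field, 'n::finite, 'm) bimod" where
  "boundary n r i = (if 0 \<le> r \<and> r \<le> int n then diff_gen n (nat r) i else 0)"

definition sign_if :: "bool \<Rightarrow> 'v::ab_group_add \<Rightarrow> 'v" where
  "sign_if c v = (if c then v else - v)"

lemma diff_gen_words:
  "diff_gen (Suc n) r i = (let N = CARD('n); r' = int r in
     if Suc n > 2 * r then
       gtensor 1 n r' i (word_sum [Fwd])
       + signed (Suc n + r) (gtensor (word_sum [Fwd]) n r' (i + 1) 1)
       + signed (Suc n + r) (gtensor (alt_word Bwd (Suc (2 * (N - 1)))) n (r' - 1) (i - 1) 1)
       + signed (Suc n) (gtensor 1 n (r' - 1) i (alt_word Bwd (Suc (2 * (N - 1)))))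
     else if Suc n < 2 * r then
       gtensor 1 n r' i (alt_word Fwd (Suc (2 * (N - 1))))
       + signed (Suc n + r) (gtensor (alt_word Fwd (Suc (2 * (N - 1)))) n r' (i + 1) 1)
       + signed (Suc n + r) (gtensor (word_sum [Bwd]) n (r' - 1) (i - 1) 1)
       + signed (Suc n) (gtensor 1 n (r' - 1) i (word_sum [Bwd]))
     else
       (\<Sum>l<N.
          gtensor (alt_word Bwd (2 * l)) n r' i (alt_word Fwd (Suc (2 * (N - 1 - l))))
          + signed (Suc n div 2) (gtensor (alt_word Fwd (Suc (2 * l))) n r' (i + 1) (alt_word Fwd (2 * (N - 1 - l))))
          + signed (Suc n div 2) (gtensor (alt_word Bwd (Suc (2 * l))) n (r' - 1) (i - 1) (alt_word Bwd (2 * (N - 1 - l))))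
          + gtensor (alt_word Fwd (2 * l)) n (r' - 1) i (alt_word Bwd (Suc (2 * (N - 1 - l))))) ::
     ('k::field, 'n::finite, 'm::nontriv) bimod)"
proof -
  have *: "alternating s (2 * l) @ [s] = s # alternating (flip s) (2 * l)" for s l
    using alternating_add[of s "2 * l" 1] by simp
  show ?thesis
    unfolding diff_gen_def Let_def word_sum_diff_words(1,2) arrows_word_sum bar_arrows_word_sum
    by (simp add: word_sum_mult * word_sum_power[of Fwd, simplified] word_sum_power[of Bwd, simplified])
qed

lemma boundary_pos:
  assumes "int (Suc n) > 2 * r"
  shows "(boundary (Suc n) r i :: ('k::field, 'n::finite, 'm::nontriv) bimod) =
    gtensor 1 n r i (alt_word Fwd 1)
    + sign_if (even (int (Suc n) + r)) (gtensor (alt_word Fwd 1) n r (i + 1) 1)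
    + sign_if (even (int (Suc n) + r)) (gtensor (alt_word Bwd (2 * CARD('n) - 1)) n (r - 1) (i - 1) 1)
    + sign_if (even (Suc n)) (gtensor 1 n (r - 1) i (alt_word Bwd (2 * CARD('n) - 1)))"
proof (cases "r < 0")
  case True
  then show ?thesis by (simp add: boundary_def gtensor_def sign_if_def)
next
  case False
  have N: "2 * CARD('n) - 1 = Suc (2 * (CARD('n) - 1))"
    using zero_less_card_finite[where 'a = 'n] by linarith
  have "even (Suc n + nat r) \<longleftrightarrow> even (int (Suc n) + r)"
    using False by (auto simp: even_nat_iff)
  moreover have "2 * nat r < Suc n" using False assms by linarith
  ultimately show ?thesis using False assms unfolding N
    by (simp add: boundary_def diff_gen_words Let_def signed_eq sign_if_def)
qed

lemma boundary_neg:
  assumes "int (Suc n) < 2 * r"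
  shows "(boundary (Suc n) r i :: ('k::field, 'n::finite, 'm::nontriv) bimod) =
    gtensor 1 n r i (alt_word Fwd (2 * CARD('n) - 1))
    + sign_if (even (int (Suc n) + r)) (gtensor (alt_word Fwd (2 * CARD('n) - 1)) n r (i + 1) 1)
    + sign_if (even (int (Suc n) + r)) (gtensor (alt_word Bwd 1) n (r - 1) (i - 1) 1)
    + sign_if (even (Suc n)) (gtensor 1 n (r - 1) i (alt_word Bwd 1))"
proof (cases "r > int (Suc n)")
  case True
  then show ?thesis by (simp add: boundary_def gtensor_def sign_if_def)
next
  case False
  have N: "2 * CARD('n) - 1 = Suc (2 * (CARD('n) - 1))"
    using zero_less_card_finite[where 'a = 'n] by linarith
  have "even (Suc n + nat r) \<longleftrightarrow> even (int (Suc n) + r)"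
    using assms by (auto simp: even_nat_iff)
  moreover have "\<not> Suc n > 2 * nat r" "Suc n < 2 * nat r" using assms by linarith+
  ultimately show ?thesis using False assms unfolding N
    by (simp add: boundary_def diff_gen_words Let_def signed_eq sign_if_def)
qed

lemma boundary_mid:
  assumes "int (Suc n) = 2 * r"
  shows "(boundary (Suc n) r i :: ('k::field, 'n::finite, 'm::nontriv) bimod) =
    (\<Sum>l<CARD('n). gtensor (alt_word Bwd (2 * l)) n r i (alt_word Fwd (Suc (2 * (CARD('n) - 1 - l)))))
    + sign_if (even r) (\<Sum>l<CARD('n). gtensor (alt_word Fwd (Suc (2 * l))) n r (i + 1) (alt_word Fwd (2 * (CARD('n) - 1 - l))))
    + sign_if (even r) (\<Sum>l<CARD('n). gtensor (alt_word Bwd (Suc (2 * l))) n (r - 1) (i - 1) (alt_word Bwd (2 * (CARD('n) - 1 - l))))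
    + (\<Sum>l<CARD('n). gtensor (alt_word Fwd (2 * l)) n (r - 1) i (alt_word Bwd (Suc (2 * (CARD('n) - 1 - l)))))"
proof -
  obtain q where q: "r = int q" "Suc n = 2 * q"
    using assms by (metis of_nat_eq_iff of_nat_mult of_nat_numeral zero_le_imp_eq_int
        mult_2 zero_le_double_add_iff_zero_le_single_add of_nat_0_le_iff)
  then have "even (Suc n div 2) \<longleftrightarrow> even r" "\<not> Suc n > 2 * nat r" "\<not> Suc n < 2 * nat r" "0 \<le> r" "r \<le> int (Suc n)"
    by simp_all
  then show ?thesis
    by (simp add: boundary_def diff_gen_words Let_def signed_eq sign_if_def sum.distrib sum_negf
      del: alternating.simps)
qed

lemma differential_linear:
  "differential (p + q) = differential p + differential q"
  "differential (scale_bimod c p) = scale_bimod c (differential p)"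
proof -
  obtain u where u: "p = abs_bimod u" by (rule abs_bimod_cases)
  obtain v where v: "q = abs_bimod v" by (rule abs_bimod_cases)
  show "differential (p + q) = differential p + differential q"
    by (simp only: u v plus_bimod.abs_eq differential.abs_eq lin_ext_add[OF vector_space_scale_bimod])
  show "differential (scale_bimod c p) = scale_bimod c (differential p)"
    by (simp only: u scale_bimod.abs_eq differential.abs_eq lin_ext_scale[OF vector_space_scale_bimod])
qed

lemma lin_differential: "lin scale_bimod scale_bimod differential"
  by (simp add: lin_def differential_linear)

lemmas differential_0 [simp] = lin_0[OF lin_differential]
lemmas differential_minus [simp] = lin_minus[OF lin_differential]
lemmas differential_diff [simp] = lin_diff[OF lin_differential]
lemmas differential_sum = lin_sum[OF lin_differential]

lemma differential_gtensor:
  "differential (gtensor x n r i y) = left_mult x (right_mult (boundary n r i) y)"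
  by (simp add: gtensor_def boundary_def differential_tensor)

lemma sign_if_0 [simp]: "sign_if c 0 = 0"
  by (simp add: sign_if_def)

lemma sign_if_linear [simp]:
  "left_mult z (sign_if c p) = sign_if c (left_mult z p)"
  "right_mult (sign_if c p) z = sign_if c (right_mult p z)"
  "differential (sign_if c p) = sign_if c (differential p)"
  by (simp_all add: sign_if_def)

lemma sum_telescope_words:
  fixes g :: "nat \<Rightarrow> 'v::ab_group_add"
  shows "(\<Sum>l<n. g (Suc l)) - (\<Sum>l<n. g l) = g n - g 0"
  by (metis sum_subtractf sum_lessThan_telescope)

lemma alt_word_top:
  "(alt_word Bwd (2 * CARD('n)) :: ('k::field, 'n::finite, 'm::nontriv) alg) = alt_word Fwd (2 * CARD('n))"
  by (rule word_sum_socle)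

lemma sum_sign_if: "(\<Sum>l\<in>S. sign_if c (f l)) = sign_if c (\<Sum>l\<in>S. f l)"
  by (simp add: sign_if_def sum_negf)

lemma sum_only_last: "(\<And>l. l < k \<Longrightarrow> f l = 0) \<Longrightarrow> (\<Sum>l<Suc k. f l) = (f k :: 'v::comm_monoid_add)"
  by (simp add: sum.neutral)

lemma sum_only_first: "(\<And>l. 0 < l \<Longrightarrow> f l = 0) \<Longrightarrow> (\<Sum>l<Suc k. f l) = (f 0 :: 'v::comm_monoid_add)"
  by (simp add: sum.lessThan_Suc_shift sum.neutral del: sum.lessThan_Suc)

text \<open>The products that occur next to the middle. In each of the four sums over l all
  summands, one, or none survive, depending on where the word goes on alternating.\<close>

lemma boundary_mid_mult:
  assumes c: "int (Suc n) = 2 * r" and k: "CARD('n) = Suc k"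
  shows
    "right_mult (boundary (Suc n) r i :: ('k::field, 'n::finite, 'm::nontriv) bimod) (alt_word Fwd 1) =
      sign_if (even r) (\<Sum>l<Suc k. gtensor (alt_word Fwd (Suc (2 * l))) n r (i + 1) (alt_word Fwd (Suc (2 * (k - l)))))
      + sign_if (even r) (gtensor (alt_word Bwd (Suc (2 * k))) n (r - 1) (i - 1) (alt_word Fwd 1))
      + (\<Sum>l<Suc k. gtensor (alt_word Fwd (2 * l)) n (r - 1) i (alt_word Bwd (2 * (Suc k - l))))"
    "left_mult (alt_word Fwd 1) (boundary (Suc n) r i :: ('k, 'n, 'm) bimod) =
      (\<Sum>l<Suc k. gtensor (alt_word Fwd (Suc (2 * l))) n r i (alt_word Fwd (Suc (2 * (k - l)))))
      + sign_if (even r) (\<Sum>l<Suc k. gtensor (alt_word Fwd (2 * Suc l)) n (r - 1) (i - 1) (alt_word Bwd (2 * (Suc k - Suc l))))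
      + gtensor (alt_word Fwd 1) n (r - 1) i (alt_word Bwd (Suc (2 * k)))"
    "right_mult (boundary (Suc n) r i :: ('k, 'n, 'm) bimod) (alt_word Bwd 1) =
      (\<Sum>l<Suc k. gtensor (alt_word Bwd (2 * l)) n r i (alt_word Fwd (2 * (Suc k - l))))
      + sign_if (even r) (gtensor (alt_word Fwd (Suc (2 * k))) n r (i + 1) (alt_word Bwd 1))
      + sign_if (even r) (\<Sum>l<Suc k. gtensor (alt_word Bwd (Suc (2 * l))) n (r - 1) (i - 1) (alt_word Bwd (Suc (2 * (k - l)))))"
    "left_mult (alt_word Bwd 1) (boundary (Suc n) r i :: ('k, 'n, 'm) bimod) =
      gtensor (alt_word Bwd 1) n r i (alt_word Fwd (Suc (2 * k)))
      + sign_if (even r) (\<Sum>l<Suc k. gtensor (alt_word Bwd (2 * Suc l)) n r (i + 1) (alt_word Fwd (2 * (Suc k - Suc l))))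
      + (\<Sum>l<Suc k. gtensor (alt_word Bwd (Suc (2 * l))) n (r - 1) i (alt_word Bwd (Suc (2 * (k - l)))))"
proof -
  have a: "Suc (Suc (2 * (k - l))) = 2 * (Suc k - l)" if "l < Suc k" for l using that by simp
  show "right_mult (boundary (Suc n) r i :: ('k::field, 'n::finite, 'm::nontriv) bimod) (alt_word Fwd 1) =
      sign_if (even r) (\<Sum>l<Suc k. gtensor (alt_word Fwd (Suc (2 * l))) n r (i + 1) (alt_word Fwd (Suc (2 * (k - l)))))
      + sign_if (even r) (gtensor (alt_word Bwd (Suc (2 * k))) n (r - 1) (i - 1) (alt_word Fwd 1))
      + (\<Sum>l<Suc k. gtensor (alt_word Fwd (2 * l)) n (r - 1) i (alt_word Bwd (2 * (Suc k - l))))"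
  proof -
    have s1: "(\<Sum>l<Suc k. gtensor (alt_word Bwd (2 * l)) n r i (alt_word Fwd (Suc (2 * (Suc k - 1 - l))) * alt_word Fwd 1)) =
        (0 :: ('k, 'n, 'm) bimod)"
      by (rule sum.neutral) (simp add: alt_word_mult del: alternating.simps)
    have s2: "(\<Sum>l<Suc k. gtensor (alt_word Fwd (Suc (2 * l))) n r (i + 1) (alt_word Fwd (2 * (Suc k - 1 - l)) * alt_word Fwd 1)) =
        (\<Sum>l<Suc k. gtensor (alt_word Fwd (Suc (2 * l))) n r (i + 1) (alt_word Fwd (Suc (2 * (k - l)))) :: ('k, 'n, 'm) bimod)"
      by (rule sum.cong) (simp_all add: alt_word_mult del: alternating.simps)
    have s3: "(\<Sum>l<Suc k. gtensor (alt_word Bwd (Suc (2 * l))) n (r - 1) (i - 1) (alt_word Bwd (2 * (Suc k - 1 - l)) * alt_word Fwd 1)) =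
        (gtensor (alt_word Bwd (Suc (2 * k))) n (r - 1) (i - 1) (alt_word Fwd 1) :: ('k, 'n, 'm) bimod)"
      by (subst sum_only_last) (simp_all add: alt_word_mult del: alternating.simps sum.lessThan_Suc)
    have s4: "(\<Sum>l<Suc k. gtensor (alt_word Fwd (2 * l)) n (r - 1) i (alt_word Bwd (Suc (2 * (Suc k - 1 - l))) * alt_word Fwd 1)) =
        (\<Sum>l<Suc k. gtensor (alt_word Fwd (2 * l)) n (r - 1) i (alt_word Bwd (2 * (Suc k - l))) :: ('k, 'n, 'm) bimod)"
      by (rule sum.cong) (use a in \<open>simp_all add: alt_word_mult del: alternating.simps\<close>)
    show ?thesis
      unfolding boundary_mid[OF c] k right_mult_linear right_mult_sum sign_if_linear right_mult_gtensor s1 s2 s3 s4 by simp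
  qed
  show "left_mult (alt_word Fwd 1) (boundary (Suc n) r i :: ('k, 'n, 'm) bimod) =
      (\<Sum>l<Suc k. gtensor (alt_word Fwd (Suc (2 * l))) n r i (alt_word Fwd (Suc (2 * (k - l)))))
      + sign_if (even r) (\<Sum>l<Suc k. gtensor (alt_word Fwd (2 * Suc l)) n (r - 1) (i - 1) (alt_word Bwd (2 * (Suc k - Suc l))))
      + gtensor (alt_word Fwd 1) n (r - 1) i (alt_word Bwd (Suc (2 * k)))"
    unfolding boundary_mid[OF c] k
    by (simp add: alt_word_mult sum_only_first del: alternating.simps sum.lessThan_Suc cong: sum.cong)
  show "right_mult (boundary (Suc n) r i :: ('k, 'n, 'm) bimod) (alt_word Bwd 1) =
      (\<Sum>l<Suc k. gtensor (alt_word Bwd (2 * l)) n r i (alt_word Fwd (2 * (Suc k - l))))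
      + sign_if (even r) (gtensor (alt_word Fwd (Suc (2 * k))) n r (i + 1) (alt_word Bwd 1))
      + sign_if (even r) (\<Sum>l<Suc k. gtensor (alt_word Bwd (Suc (2 * l))) n (r - 1) (i - 1) (alt_word Bwd (Suc (2 * (k - l)))))"
  proof -
    have s1: "(\<Sum>l<Suc k. gtensor (alt_word Bwd (2 * l)) n r i (alt_word Fwd (Suc (2 * (Suc k - 1 - l))) * alt_word Bwd 1)) =
        (\<Sum>l<Suc k. gtensor (alt_word Bwd (2 * l)) n r i (alt_word Fwd (2 * (Suc k - l))) :: ('k, 'n, 'm) bimod)"
      by (rule sum.cong) (use a in \<open>simp_all add: alt_word_mult del: alternating.simps\<close>)
    have s2: "(\<Sum>l<Suc k. gtensor (alt_word Fwd (Suc (2 * l))) n r (i + 1) (alt_word Fwd (2 * (Suc k - 1 - l)) * alt_word Bwd 1)) =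
        (gtensor (alt_word Fwd (Suc (2 * k))) n r (i + 1) (alt_word Bwd 1) :: ('k, 'n, 'm) bimod)"
      by (subst sum_only_last) (simp_all add: alt_word_mult del: alternating.simps sum.lessThan_Suc)
    have s3: "(\<Sum>l<Suc k. gtensor (alt_word Bwd (Suc (2 * l))) n (r - 1) (i - 1) (alt_word Bwd (2 * (Suc k - 1 - l)) * alt_word Bwd 1)) =
        (\<Sum>l<Suc k. gtensor (alt_word Bwd (Suc (2 * l))) n (r - 1) (i - 1) (alt_word Bwd (Suc (2 * (k - l)))) :: ('k, 'n, 'm) bimod)"
      by (rule sum.cong) (simp_all add: alt_word_mult del: alternating.simps)
    have s4: "(\<Sum>l<Suc k. gtensor (alt_word Fwd (2 * l)) n (r - 1) i (alt_word Bwd (Suc (2 * (Suc k - 1 - l))) * alt_word Bwd 1)) =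
        (0 :: ('k, 'n, 'm) bimod)"
      by (rule sum.neutral) (simp add: alt_word_mult del: alternating.simps)
    show ?thesis
      unfolding boundary_mid[OF c] k right_mult_linear right_mult_sum sign_if_linear right_mult_gtensor s1 s2 s3 s4 by simp
  qed
  show "left_mult (alt_word Bwd 1) (boundary (Suc n) r i :: ('k, 'n, 'm) bimod) =
      gtensor (alt_word Bwd 1) n r i (alt_word Fwd (Suc (2 * k)))
      + sign_if (even r) (\<Sum>l<Suc k. gtensor (alt_word Bwd (2 * Suc l)) n r (i + 1) (alt_word Fwd (2 * (Suc k - Suc l))))
      + (\<Sum>l<Suc k. gtensor (alt_word Bwd (Suc (2 * l))) n (r - 1) i (alt_word Bwd (Suc (2 * (k - l)))))"
    unfolding boundary_mid[OF c] k
    by (simp add: alt_word_mult sum_only_first del: alternating.simps sum.lessThan_Suc cong: sum.cong)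
qed

lemma mult_one_bimod [simp]: "left_mult 1 p = p" "right_mult p 1 = p"
  by (induction p rule: bimod_induct) simp_all

lemma boundary_boundary:
  "differential (boundary (Suc (Suc n)) r i) = (0 :: ('k::field, 'n::finite, 'm::nontriv) bimod)"
proof -
  obtain k where k: "CARD('n) = Suc k" using gr0_implies_Suc[of "CARD('n)"] by auto
  have M: "2 * CARD('n) - 1 = Suc (2 * k)" by (simp add: k)
  have top: "(alt_word Bwd (Suc (Suc (2 * k))) :: ('k, 'n, 'm) alg) = alt_word Fwd (Suc (Suc (2 * k)))"
    using alt_word_top[where 'k = 'k and 'n = 'n and 'm = 'm] by (simp add: k del: alternating.simps)
  have long: "(alt_word s L :: ('k, 'n, 'm) alg) = 0" if "L > Suc (Suc (2 * k))" for s L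
    using that by (simp add: word_sum_long k del: alternating.simps)
  note calc = differential_linear(1) differential_gtensor alt_word_mult alt_word_0 k
  \<comment> \<open>The shape of the differential depends on the side of n = 2r on which a label
    lies. The composite meets (n + 2, r), (n + 1, r) and (n + 1, r - 1), and at most one of these is
    a middle label.\<close>
  consider "int n \<ge> 2 * r" | "int n = 2 * r - 1" | "int n = 2 * r - 2" | "int n = 2 * r - 3" | "int n \<le> 2 * r - 4"
    by linarith
  then show ?thesis
  proof cases
    case 1
    then have c: "int (Suc (Suc n)) > 2 * r" "int (Suc n) > 2 * r" "int (Suc n) > 2 * (r - 1)" by simp_all
    show ?thesis
      unfolding boundary_pos[OF c(1)] M
      using 1
      by (simp add: calc boundary_pos[OF c(2), unfolded M] boundary_pos[OF c(3), unfolded M] top long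
          sign_if_def del: alternating.simps)
  next
    case 5
    then have c: "int (Suc (Suc n)) < 2 * r" "int (Suc n) < 2 * r" "int (Suc n) < 2 * (r - 1)" by simp_all
    show ?thesis
      unfolding boundary_neg[OF c(1)] M
      using 5
      by (simp add: calc boundary_neg[OF c(2), unfolded M] boundary_neg[OF c(3), unfolded M] top long
          sign_if_def del: alternating.simps)
  next
    case 2
    then have c: "int (Suc (Suc n)) > 2 * r" "int (Suc n) = 2 * r" "int (Suc n) > 2 * (r - 1)" by simp_all
    \<comment> \<open>The two products with the middle boundary contain the same sum, once with the
      index shifted. They differ by the end terms, which cancel against the words of length 2N
      coming from the index r - 1.\<close>
    define g :: "nat \<Rightarrow> ('k, 'n, 'm) bimod" where
      "g l = gtensor (alt_word Fwd (2 * l)) n (r - 1) i (alt_word Bwd (2 * (Suc k - l)))" for l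
    have tel: "(\<Sum>l<Suc k. g (Suc l)) = (\<Sum>l<Suc k. g l) + g (Suc k) - g 0"
      using sum_telescope_words[of g "Suc k"] by (simp add: algebra_simps)
    note mid = boundary_mid_mult(1,2)[OF c(2) k]
    have mid'': "right_mult (boundary (Suc n) r i :: ('k, 'n, 'm) bimod) (alt_word Fwd 1) =
      sign_if (even r) (\<Sum>l<Suc k. gtensor (alt_word Fwd (Suc (2 * l))) n r (i + 1) (alt_word Fwd (Suc (2 * (k - l)))))
      + sign_if (even r) (gtensor (alt_word Bwd (Suc (2 * k))) n (r - 1) (i - 1) (alt_word Fwd 1))
      + (\<Sum>l<Suc k. g l)"
      unfolding mid(1) g_def by simp
    have e: "even (int (Suc (Suc n)) + r) \<longleftrightarrow> odd r" and n: "odd n" using 2 by presburger+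
    have mid': "left_mult (alt_word Fwd 1) (boundary (Suc n) r (i + 1) :: ('k, 'n, 'm) bimod) =
      (\<Sum>l<Suc k. gtensor (alt_word Fwd (Suc (2 * l))) n r (i + 1) (alt_word Fwd (Suc (2 * (k - l)))))
      + sign_if (even r) (\<Sum>l<Suc k. g (Suc l))
      + gtensor (alt_word Fwd 1) n (r - 1) (i + 1) (alt_word Bwd (Suc (2 * k)))"
      unfolding mid(2) g_def by simp
    have gg: "g 0 = gtensor 1 n (r - 1) i (alt_word Fwd (Suc (Suc (2 * k))))"
       "g (Suc k) = gtensor (alt_word Fwd (Suc (Suc (2 * k)))) n (r - 1) i 1"
      by (simp_all add: g_def alt_word_0 top del: alternating.simps)
    show ?thesis
      unfolding boundary_pos[OF c(1)] M e
      using 2 n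
      by (simp add: differential_linear(1) differential_gtensor k mid'' mid' tel gg
          boundary_pos[OF c(3), unfolded M] alt_word_mult top long sign_if_def alt_word_0
          del: alternating.simps sum.lessThan_Suc One_nat_def)
  next
    case 3
    then have c: "int (Suc (Suc n)) = 2 * r" "int (Suc n) < 2 * r" "int (Suc n) > 2 * (r - 1)" by simp_all
    have e: "even (int (Suc n) + r) \<longleftrightarrow> odd r" "even (int (Suc n) + (r - 1)) \<longleftrightarrow> even r" "odd (Suc n)"
      using 3 by presburger+
    have neg: "(boundary (Suc n) r j :: ('k, 'n, 'm) bimod) =
        gtensor 1 n r j (alt_word Fwd (Suc (2 * k)))
        + sign_if (odd r) (gtensor (alt_word Fwd (Suc (2 * k))) n r (j + 1) 1)
        + sign_if (odd r) (gtensor (alt_word Bwd 1) n (r - 1) (j - 1) 1)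
        - gtensor 1 n (r - 1) j (alt_word Bwd 1)" for j
      unfolding boundary_neg[OF c(2)] M e(1) using e(3) by (simp add: sign_if_def)
    have pos: "(boundary (Suc n) (r - 1) j :: ('k, 'n, 'm) bimod) =
        gtensor 1 n (r - 1) j (alt_word Fwd 1)
        + sign_if (even r) (gtensor (alt_word Fwd 1) n (r - 1) (j + 1) 1)
        + sign_if (even r) (gtensor (alt_word Bwd (Suc (2 * k))) n (r - 2) (j - 1) 1)
        - gtensor 1 n (r - 2) j (alt_word Bwd (Suc (2 * k)))" for j
      unfolding boundary_pos[OF c(3)] M e(2) using e(3) by (simp add: sign_if_def)
    define g h :: "nat \<Rightarrow> ('k, 'n, 'm) bimod" where
      "g l = gtensor (alt_word Bwd (2 * l)) n (r - 1) i (alt_word Bwd (2 * (Suc k - l)))" and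
      "h l = gtensor (alt_word Fwd (2 * l)) n (r - 1) i (alt_word Fwd (2 * (Suc k - l)))" for l
    define S1 S2 :: "('k, 'n, 'm) bimod" where
      "S1 = (\<Sum>l<Suc k. gtensor (alt_word Bwd (Suc (2 * l))) n (r - 1) (i - 1) (alt_word Fwd (Suc (2 * (k - l)))))" and
      "S2 = (\<Sum>l<Suc k. gtensor (alt_word Fwd (Suc (2 * l))) n (r - 1) (i + 1) (alt_word Bwd (Suc (2 * (k - l)))))"
    have a: "Suc (Suc (2 * (k - l))) = 2 * (Suc k - l)" if "l < Suc k" for l using that by simp
    have M1: "differential (\<Sum>l<Suc k. gtensor (alt_word Bwd (2 * l)) (Suc n) r i (alt_word Fwd (Suc (2 * (k - l))))) =
        sign_if (odd r) (gtensor (alt_word Fwd (Suc (2 * k))) n r (i + 1) (alt_word Fwd (Suc (2 * k))))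
        + sign_if (odd r) S1 - (\<Sum>l<Suc k. g l)"
    proof -
      have "differential (gtensor (alt_word Bwd (2 * l)) (Suc n) r i (alt_word Fwd (Suc (2 * (k - l)))) :: ('k, 'n, 'm) bimod) =
          sign_if (odd r) (if l = 0 then gtensor (alt_word Fwd (Suc (2 * k))) n r (i + 1) (alt_word Fwd (Suc (2 * k))) else 0) + sign_if (odd r) (gtensor (alt_word Bwd (Suc (2 * l))) n (r - 1) (i - 1) (alt_word Fwd (Suc (2 * (k - l))))) - g l" if "l < Suc k" for l
        unfolding differential_gtensor neg
        using that a[OF that] by (auto simp: alt_word_mult g_def h_def add.commute[of i]
            simp del: alternating.simps)
      then show ?thesis
        unfolding differential_sum S1_def S2_def
        by (subst sum.cong[OF refl], simp only: lessThan_iff)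
           (simp only: sum.distrib sum_subtractf sum_sign_if sum.delta' sum.delta finite_lessThan lessThan_iff zero_less_Suc lessI if_True)
    qed
    have M2: "differential (\<Sum>l<Suc k. gtensor (alt_word Fwd (Suc (2 * l))) (Suc n) r (i + 1) (alt_word Fwd (2 * (k - l)))) =
        gtensor (alt_word Fwd (Suc (2 * k))) n r (i + 1) (alt_word Fwd (Suc (2 * k)))
        + sign_if (odd r) (\<Sum>l<Suc k. h (Suc l)) - S2"
    proof -
      have "differential (gtensor (alt_word Fwd (Suc (2 * l))) (Suc n) r (i + 1) (alt_word Fwd (2 * (k - l))) :: ('k, 'n, 'm) bimod) =
          (if l = k then gtensor (alt_word Fwd (Suc (2 * k))) n r (i + 1) (alt_word Fwd (Suc (2 * k))) else 0) + sign_if (odd r) (h (Suc l)) - gtensor (alt_word Fwd (Suc (2 * l))) n (r - 1) (i + 1) (alt_word Bwd (Suc (2 * (k - l))))" if "l < Suc k" for l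
        unfolding differential_gtensor neg
        using that a[OF that] by (auto simp: alt_word_mult g_def h_def add.commute[of i]
            simp del: alternating.simps)
      then show ?thesis
        unfolding differential_sum S1_def S2_def
        by (subst sum.cong[OF refl], simp only: lessThan_iff)
           (simp only: sum.distrib sum_subtractf sum_sign_if sum.delta' sum.delta finite_lessThan lessThan_iff zero_less_Suc lessI if_True)
    qed
    have M3: "differential (\<Sum>l<Suc k. gtensor (alt_word Bwd (Suc (2 * l))) (Suc n) (r - 1) (i - 1) (alt_word Bwd (2 * (k - l)))) =
        S1 + sign_if (even r) (\<Sum>l<Suc k. g (Suc l))
        - gtensor (alt_word Bwd (Suc (2 * k))) n (r - 2) (i - 1) (alt_word Bwd (Suc (2 * k)))"
    proof -
      have "differential (gtensor (alt_word Bwd (Suc (2 * l))) (Suc n) (r - 1) (i - 1) (alt_word Bwd (2 * (k - l))) :: ('k, 'n, 'm) bimod) =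
          gtensor (alt_word Bwd (Suc (2 * l))) n (r - 1) (i - 1) (alt_word Fwd (Suc (2 * (k - l)))) + sign_if (even r) (g (Suc l)) - (if l = k then gtensor (alt_word Bwd (Suc (2 * k))) n (r - 2) (i - 1) (alt_word Bwd (Suc (2 * k))) else 0)" if "l < Suc k" for l
        unfolding differential_gtensor pos
        using that a[OF that] by (auto simp: alt_word_mult g_def h_def add.commute[of i]
            simp del: alternating.simps)
      then show ?thesis
        unfolding differential_sum S1_def S2_def
        by (subst sum.cong[OF refl], simp only: lessThan_iff)
           (simp only: sum.distrib sum_subtractf sum_sign_if sum.delta' sum.delta finite_lessThan lessThan_iff zero_less_Suc lessI if_True)
    qed
    have M4: "differential (\<Sum>l<Suc k. gtensor (alt_word Fwd (2 * l)) (Suc n) (r - 1) i (alt_word Bwd (Suc (2 * (k - l))))) =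
        (\<Sum>l<Suc k. h l) + sign_if (even r) S2
        + sign_if (even r) (gtensor (alt_word Bwd (Suc (2 * k))) n (r - 2) (i - 1) (alt_word Bwd (Suc (2 * k))))"
    proof -
      have "differential (gtensor (alt_word Fwd (2 * l)) (Suc n) (r - 1) i (alt_word Bwd (Suc (2 * (k - l)))) :: ('k, 'n, 'm) bimod) =
          h l + sign_if (even r) (gtensor (alt_word Fwd (Suc (2 * l))) n (r - 1) (i + 1) (alt_word Bwd (Suc (2 * (k - l))))) + sign_if (even r) (if l = 0 then gtensor (alt_word Bwd (Suc (2 * k))) n (r - 2) (i - 1) (alt_word Bwd (Suc (2 * k))) else 0)" if "l < Suc k" for l
        unfolding differential_gtensor pos
        using that a[OF that] by (auto simp: alt_word_mult g_def h_def add.commute[of i]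
            simp del: alternating.simps)
      then show ?thesis
        unfolding differential_sum S1_def S2_def
        by (subst sum.cong[OF refl], simp only: lessThan_iff)
           (simp only: sum.distrib sum_subtractf sum_sign_if sum.delta' sum.delta finite_lessThan lessThan_iff zero_less_Suc lessI if_True)
    qed
    \<comment> \<open>At both ends of the telescoping sums a word has length 2N, where the two
      alternating words agree.\<close>
    have gh: "g 0 = h 0" "g (Suc k) = h (Suc k)"
      by (simp_all add: g_def h_def alt_word_0 top del: alternating.simps)
    have tel: "(\<Sum>l<Suc k. g (Suc l)) = (\<Sum>l<Suc k. g l) + g (Suc k) - g 0"
      "(\<Sum>l<Suc k. h (Suc l)) = (\<Sum>l<Suc k. h l) + h (Suc k) - h 0"
      using sum_telescope_words[of g "Suc k"] sum_telescope_words[of h "Suc k"] by (simp_all add: algebra_simps)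
    have k1: "Suc k - 1 - l = k - l" for l by simp
    show ?thesis
      unfolding boundary_mid[OF c(1)] k k1 differential_linear sign_if_linear M1 M2 M3 M4 tel gh
      by (simp add: sign_if_def del: sum.lessThan_Suc)
  next
    case 4
    then have c: "int (Suc (Suc n)) < 2 * r" "int (Suc n) < 2 * r" "int (Suc n) = 2 * (r - 1)" by simp_all
    define g :: "nat \<Rightarrow> ('k, 'n, 'm) bimod" where
      "g l = gtensor (alt_word Bwd (2 * l)) n (r - 1) i (alt_word Fwd (2 * (Suc k - l)))" for l
    have tel: "(\<Sum>l<Suc k. g (Suc l)) = (\<Sum>l<Suc k. g l) + g (Suc k) - g 0"
      using sum_telescope_words[of g "Suc k"] by (simp add: algebra_simps)
    note mid = boundary_mid_mult(3,4)[OF c(3) k]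
    have e: "even (int (Suc (Suc n)) + r) \<longleftrightarrow> odd r" and n: "odd n" using 4 by presburger+
    have mid': "right_mult (boundary (Suc n) (r - 1) i :: ('k, 'n, 'm) bimod) (alt_word Bwd 1) =
      (\<Sum>l<Suc k. g l)
      + sign_if (odd r) (gtensor (alt_word Fwd (Suc (2 * k))) n (r - 1) (i + 1) (alt_word Bwd 1))
      + sign_if (odd r) (\<Sum>l<Suc k. gtensor (alt_word Bwd (Suc (2 * l))) n (r - 2) (i - 1) (alt_word Bwd (Suc (2 * (k - l)))))"
      "left_mult (alt_word Bwd 1) (boundary (Suc n) (r - 1) (i - 1) :: ('k, 'n, 'm) bimod) =
      gtensor (alt_word Bwd 1) n (r - 1) (i - 1) (alt_word Fwd (Suc (2 * k)))
      + sign_if (odd r) (\<Sum>l<Suc k. g (Suc l))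
      + (\<Sum>l<Suc k. gtensor (alt_word Bwd (Suc (2 * l))) n (r - 2) (i - 1) (alt_word Bwd (Suc (2 * (k - l)))))"
      unfolding mid g_def by simp_all
    have gg: "g 0 = gtensor 1 n (r - 1) i (alt_word Fwd (Suc (Suc (2 * k))))"
       "g (Suc k) = gtensor (alt_word Fwd (Suc (Suc (2 * k)))) n (r - 1) i 1"
      by (simp_all add: g_def alt_word_0 top del: alternating.simps)
    show ?thesis
      unfolding boundary_neg[OF c(1)] M e
      using 4 n
      by (simp add: differential_linear(1) differential_gtensor k mid' tel gg
          boundary_neg[OF c(2), unfolded M] alt_word_mult top long sign_if_def alt_word_0
          del: alternating.simps sum.lessThan_Suc One_nat_def)
  qed
qed

section \<open>Comparison with the bar resolution\<close>

lemma differential_diff_gen: "differential (diff_gen (Suc (Suc n)) r i) = 0"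
proof (cases "r \<le> Suc (Suc n)")
  case True
  then show ?thesis using boundary_boundary[of n "int r" i] by (simp add: boundary_def)
next
  case False
  then show ?thesis by (simp add: diff_gen_words gtensor_def signed_def)
qed

lemma gtensor_component: "gtensor x n r i y \<in> component n"
proof (cases "0 \<le> r \<and> r \<le> int n")
  case True
  then have "tensor x (n, nat r, i) y \<in> {tensor x (n, r, i) y | x r i y. r \<le> n}" by fastforce
  then show ?thesis using True by (simp add: gtensor_def component_def bimod.span_base)
next
  case False
  then have "gtensor x n r i y = 0" by (auto simp: gtensor_def)
  then show ?thesis by (simp add: component_def bimod.span_zero)
qed

lemma component_closed:
  "0 \<in> component n" "p \<in> component n \<Longrightarrow> q \<in> component n \<Longrightarrow> p + q \<in> component n"
  "p \<in> component n \<Longrightarrow> q \<in> component n \<Longrightarrow> p - q \<in> component n"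
  "p \<in> component n \<Longrightarrow> signed e p \<in> component n"
  "(\<And>l. l \<in> S \<Longrightarrow> f l \<in> component n) \<Longrightarrow> sum f S \<in> component n"
  by (simp_all add: component_def signed_def bimod.span_zero bimod.span_add bimod.span_diff bimod.span_scale bimod.span_sum)

lemma diff_gen_component: "diff_gen (Suc n) r i \<in> component n"
  unfolding diff_gen_words Let_def
  by (simp add: component_closed gtensor_component)

lemma component_induct [consumes 1, case_names zero add scale tensor]:
  assumes "p \<in> component n" "P 0" "\<And>p q. P p \<Longrightarrow> P q \<Longrightarrow> P (p + q)" "\<And>c p. P p \<Longrightarrow> P (scale_bimod c p)"
    "\<And>x r i y. r \<le> n \<Longrightarrow> P (tensor x (n, r, i) y)"
  shows "P p"
proof -
  have "p \<in> bimod.span {tensor x (n, r, i) y | x r i y. r \<le> n}" using assms(1) by (simp add: component_def)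
  then show ?thesis
  proof (induction rule: bimod.span_induct_alt)
    case (step c p q)
    then show ?case using assms(3-5) by blast
  qed (rule assms(2))
qed

lemma component_mult: "p \<in> component n \<Longrightarrow> left_mult x (right_mult p y) \<in> component n"
proof (induction rule: component_induct)
  case (tensor x' r i y')
  have "gtensor (x * x') n (int r) i (y' * y) \<in> component n" by (rule gtensor_component)
  then show ?case using tensor by (simp add: gtensor_def)
qed (simp_all add: component_closed(1,2), simp add: component_def bimod.span_scale)

lemma lin_evaluate: "lin scale_bimod scale_alg (evaluate f)"
  unfolding lin_def
proof (intro conjI allI)
  fix p q :: "('a, 'b, 'c) bimod" and c
  obtain u where u: "p = abs_bimod u" by (rule abs_bimod_cases)
  obtain v where v: "q = abs_bimod v" by (rule abs_bimod_cases)
  show "evaluate f (p + q) = evaluate f p + evaluate f q"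
    by (simp only: u v plus_bimod.abs_eq evaluate.abs_eq lin_ext_add[OF vector_space_scale_alg])
  show "evaluate f (scale_bimod c p) = scale_alg c (evaluate f p)"
    by (simp only: u scale_bimod.abs_eq evaluate.abs_eq lin_ext_scale[OF vector_space_scale_alg])
qed

lemmas evaluate_0 [simp] = lin_0[OF lin_evaluate]
lemmas evaluate_add = lin_evaluate[unfolded lin_def, THEN conjunct1, rule_format]
lemmas evaluate_scale = lin_evaluate[unfolded lin_def, THEN conjunct2, rule_format]
lemmas evaluate_minus = lin_minus[OF lin_evaluate]
lemmas evaluate_diff = lin_diff[OF lin_evaluate]
lemmas evaluate_sum = lin_sum[OF lin_evaluate]

lemma evaluate_mult: "evaluate f (left_mult x (right_mult p y)) = x * evaluate f p * y"
  by (induction p rule: bimod_induct)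
     (simp_all add: evaluate_add evaluate_tensor distrib_left distrib_right mult.assoc)

lemma differential_mult: "differential (left_mult x (right_mult p y)) = left_mult x (right_mult (differential p) y)"
proof (induction p rule: bimod_induct)
  case (tensor x' g y')
  then show ?case
    by (cases g) (simp add: differential_tensor left_mult_assoc right_mult_assoc left_right_mult)
qed (simp_all add: differential_linear)

lemma diff_gen_idem:
  "left_mult (x * idem (source g)) (right_mult (diff_gen (fst g) (fst (snd g)) (snd (snd g))) (idem (target g) * y)) =
    left_mult x (right_mult (diff_gen (fst g) (fst (snd g)) (snd (snd g))) y)"
proof -
  obtain n r i where g: "g = (n, r, i)" by (cases g)
  show ?thesis
    unfolding g fst_conv snd_conv right_mult_assoc diff_gen_idem_right left_mult_assoc
    by (simp add: left_right_mult diff_gen_idem_left)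
qed

lemma path_elem_idem:
  "path_elem p * idem j = (if path_target p = j then path_elem p else 0)"
  "idem j * path_elem p = (if fst p = j then path_elem p else 0)"
  by (cases p; simp add: idem_path_elem path_elem_mult)+

lemma augmentation_boundary: "augmentation (diff_gen (Suc 0) r i) = 0"
proof -
  have N: "CARD('b) - Suc 0 + (CARD('b) - Suc 0) = 2 * (CARD('b) - Suc 0)" by simp
  consider "r = 0" | "r = 1" | "r > 1" by linarith
  then show ?thesis
  proof cases
    case 1
    then show ?thesis
      by (simp add: diff_gen_words signed_eq gtensor_def augmentation_def evaluate_add evaluate_minus evaluate_diff
          evaluate_tensor idem_mult idem_mult_assoc mult.assoc idem_word_sum word_sum_idem path_elem_idem)
  next
    case 2
    then show ?thesis
      by (simp add: diff_gen_words signed_eq gtensor_def augmentation_def evaluate_add evaluate_minus evaluate_diff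
          evaluate_tensor idem_mult idem_mult_assoc mult.assoc idem_word_sum word_sum_idem path_elem_idem)
  next
    case 3
    then show ?thesis
      by (simp add: diff_gen_words gtensor_def signed_def augmentation_def)
  qed
qed

lemma lin_mult_bimod:
  "lin scale_bimod scale_bimod (left_mult x)" "lin scale_bimod scale_bimod (\<lambda>p. right_mult p x)"
  by (simp_all add: lin_def)

section \<open>The chain map \<iota> from P to the bar resolution\<close>

locale alg_right_module = right_module "scale_alg :: 'k::field \<Rightarrow> ('k, 'n::finite, 'm::nontriv) alg \<Rightarrow> _" sV rm
  for sV :: "'k::field \<Rightarrow> 'v::ab_group_add \<Rightarrow> 'v" and rm :: "'v \<Rightarrow> ('k, 'n::finite, 'm::nontriv) alg \<Rightarrow> 'v"

text \<open>
  A function \<open>\<Phi>\<close> on pairs \<open>(x, g)\<close>, linear in \<open>x\<close>, is extended to a map of right modules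
  \<open>x \<otimes> g \<otimes> y \<mapsto> \<Phi> x g \<cdot> y\<close>; the idempotents make it balanced over \<open>E\<close>.
\<close>

definition lift_right :: "('k::field \<Rightarrow> 'v \<Rightarrow> 'v::ab_group_add) \<Rightarrow> ('v \<Rightarrow> ('k, 'n::finite, 'm::nontriv) alg \<Rightarrow> 'v) \<Rightarrow>
    (('k, 'n, 'm) alg \<Rightarrow> 'm label \<Rightarrow> 'v) \<Rightarrow> ('k, 'n, 'm) bimod \<Rightarrow> 'v" where
  "lift_right sV rm \<Phi> p =
     lin_ext sV (\<lambda>(x, g, y). rm (\<Phi> (x * idem (source g)) g) (idem (target g) * y)) (rep_bimod p)"

text \<open>
  A chain map \<open>\<iota>\<close> from \<open>P\<close> to the bar resolution is given by \<open>\<iota> (1 \<otimes> g \<otimes> 1) = 1 \<otimes> \<iota> (\<partial> g)\<close>. It is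
  only used through the functionals on the bar resolution: \<open>pull_gen n H x g\<close> is the value at
  \<open>\<iota> (x \<otimes> g \<otimes> 1)\<close> of the map of right modules \<open>x\<^sub>0 \<otimes> \<dots> \<otimes> x\<^bsub>n+1\<^esub> \<mapsto> H [x\<^sub>0, \<dots>, x\<^sub>n] \<cdot> x\<^bsub>n+1\<^esub>\<close>.
\<close>

primrec pull_gen :: "('k::field \<Rightarrow> 'v \<Rightarrow> 'v::ab_group_add) \<Rightarrow> ('v \<Rightarrow> ('k, 'n::finite, 'm::nontriv) alg \<Rightarrow> 'v) \<Rightarrow>
    nat \<Rightarrow> (('k, 'n, 'm) alg list \<Rightarrow> 'v) \<Rightarrow> ('k, 'n, 'm) alg \<Rightarrow> 'm label \<Rightarrow> 'v" where
  "pull_gen sV rm 0 H x g = H [x]"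
| "pull_gen sV rm (Suc n) H x g =
     lift_right sV rm (pull_gen sV rm n (\<lambda>l. H (x # l))) (diff_gen (Suc n) (fst (snd g)) (snd (snd g)))"

definition pull :: "('k::field \<Rightarrow> 'v \<Rightarrow> 'v::ab_group_add) \<Rightarrow> ('v \<Rightarrow> ('k, 'n::finite, 'm::nontriv) alg \<Rightarrow> 'v) \<Rightarrow>
    nat \<Rightarrow> (('k, 'n, 'm) alg list \<Rightarrow> 'v) \<Rightarrow> ('k, 'n, 'm) bimod \<Rightarrow> 'v" where
  "pull sV rm n H = lift_right sV rm (pull_gen sV rm n H)"

text \<open>The homotopy from \<iota> \<circ> \<pi> to the identity that the contraction z \<mapsto>
  1 \<otimes> z of the bar resolution provides: h (x \<otimes> y) = x \<otimes> (1 - \<iota> \<circ>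
  \<pi> - h \<circ> d) (1 \<otimes> y) with the bar differential d, where the summand 1 stands for 1
  \<otimes> y itself. What is recorded is the value of H at the result.\<close>

primrec bar_homotopy :: "('k::field \<Rightarrow> 'v \<Rightarrow> 'v::ab_group_add) \<Rightarrow> ('v \<Rightarrow> ('k, 'n::finite, 'm::nontriv) alg \<Rightarrow> 'v) \<Rightarrow>
    (('k, 'n, 'm) alg list \<Rightarrow> ('k, 'n, 'm) bimod) \<Rightarrow> nat \<Rightarrow> (('k, 'n, 'm) alg list \<Rightarrow> 'v) \<Rightarrow>
    ('k, 'n, 'm) alg list \<Rightarrow> 'v" where
  "bar_homotopy sV rm \<pi> 0 H l = H (hd l # 1 # tl l) - pull sV rm 0 (\<lambda>t. H (hd l # t)) (\<pi> (tl l))"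
| "bar_homotopy sV rm \<pi> (Suc n) H l = H (hd l # 1 # tl l) - pull sV rm (Suc n) (\<lambda>t. H (hd l # t)) (\<pi> (tl l))
     - bar_diff rm (bar_homotopy sV rm \<pi> n (\<lambda>t. H (hd l # t))) (1 # tl l)"

context alg_right_module
begin

abbreviation "lft \<equiv> lift_right sV rm"
abbreviation "pg \<equiv> pull_gen sV rm"
abbreviation "pl \<equiv> pull sV rm"

lemma lift_right_abs:
  assumes "\<And>g. lin scale_alg sV (\<lambda>x. \<Phi> x g)"
  shows "lft \<Phi> (abs_bimod u) =
    lin_ext sV (\<lambda>(x, g, y). rm (\<Phi> (x * idem (source g)) g) (idem (target g) * y)) u"
proof -
  have lin: "\<Phi> (x + y) g = \<Phi> x g + \<Phi> y g" "\<Phi> (scale_alg c x) g = sV c (\<Phi> x g)" for x y c g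
    using assms by (simp_all add: lin_def)
  have z: "\<Phi> 0 g = 0" for g using lin_0[OF assms] .
  have bal: "balanced sV (\<lambda>(x, g, y). rm (\<Phi> (x * idem (source g)) g) (idem (target g) * y))"
    unfolding balanced_def prod.case
    by (auto simp: distrib_left distrib_right lin rm_add rm_scale scale_alg_mult_left scale_alg_mult_right
        mult.assoc idem_mult idem_mult_assoc z rm_zero simp del: source.simps target.simps)
  have "abs_bimod (rep_bimod (abs_bimod u)) = abs_bimod u" by (rule Quotient3_abs_rep[OF Quotient3_bimod])
  then have "rep_bimod (abs_bimod u) - u \<in> module.span free_scale tensor_relations"
    by (simp add: bimod.abs_eq_iff)
  from lin_ext_balanced[OF vsV bal this] show ?thesis by (simp add: lift_right_def)
qed

lemma lin_lift_right:
  assumes "\<And>g. lin scale_alg sV (\<lambda>x. \<Phi> x g)"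
  shows "lin scale_bimod sV (lft \<Phi>)"
  unfolding lin_def
proof (intro conjI allI)
  fix p q :: "('k, 'n, 'm) bimod" and c
  obtain u where u: "p = abs_bimod u" by (rule abs_bimod_cases)
  obtain v where v: "q = abs_bimod v" by (rule abs_bimod_cases)
  show "lft \<Phi> (p + q) = lft \<Phi> p + lft \<Phi> q"
    by (simp only: u v plus_bimod.abs_eq lift_right_abs[OF assms] lin_ext_add[OF vsV])
  show "lft \<Phi> (scale_bimod c p) = sV c (lft \<Phi> p)"
    by (simp only: u scale_bimod.abs_eq lift_right_abs[OF assms] lin_ext_scale[OF vsV])
qed

lemma lift_right_tensor:
  assumes "\<And>g. lin scale_alg sV (\<lambda>x. \<Phi> x g)"
  shows "lft \<Phi> (tensor x g y) = rm (\<Phi> (x * idem (source g)) g) (idem (target g) * y)"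
  unfolding tensor.abs_eq lift_right_abs[OF assms] by (simp add: triple_def lin_ext_single[OF vsV])

lemma lift_right_add: "lft (\<lambda>x g. \<Phi> x g + \<Psi> x g) p = lft \<Phi> p + lft \<Psi> p"
  by (simp add: lift_right_def lin_ext_def rm_add V.scale_right_distrib sum.distrib case_prod_beta')

lemma lift_right_diff: "lft (\<lambda>x g. \<Phi> x g - \<Psi> x g) p = lft \<Phi> p - lft \<Psi> p"
  using lift_right_add[of "\<lambda>x g. \<Phi> x g - \<Psi> x g" \<Psi> p] by simp

lemma lift_right_scale: "lft (\<lambda>x g. sV c (\<Phi> x g)) p = sV c (lft \<Phi> p)"
  by (simp add: lift_right_def lin_ext_def rm_scale V.scale_sum_right case_prod_beta' mult.commute)

lemma lift_right_mult:
  assumes "\<And>g. lin scale_alg sV (\<lambda>x. \<Phi> x g)"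
  shows "lft \<Phi> (right_mult p z) = rm (lft \<Phi> p) z"
    and "lft \<Phi> (left_mult z p) = lft (\<lambda>x. \<Phi> (z * x)) p"
proof -
  note L = lin_lift_right[OF assms]
  show "lft \<Phi> (right_mult p z) = rm (lft \<Phi> p) z"
    by (induction p rule: bimod_induct)
       (use L in \<open>simp_all add: lin_0[OF L] lin_def rm_zero rm_add lift_right_tensor[OF assms] rm_assoc mult.assoc\<close>)
  have a: "\<And>g. lin scale_alg sV (\<lambda>x. \<Phi> (z * x) g)"
    using lin_compose[OF lin_mult(2) assms] .
  note L' = lin_lift_right[OF a]
  show "lft \<Phi> (left_mult z p) = lft (\<lambda>x. \<Phi> (z * x)) p"
    by (induction p rule: bimod_induct)
       (use L L' in \<open>simp_all add: lin_0[OF L] lin_0[OF L'] lin_def lift_right_tensor[OF assms]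
          lift_right_tensor[OF a] mult.assoc\<close>)
qed

lemma pull_gen_cong:
  "(\<And>l. length l = Suc n \<Longrightarrow> H l = H' l) \<Longrightarrow> pg n H = pg n H'"
proof (induction n arbitrary: H H')
  case (Suc n)
  have "pg n (\<lambda>l. H (x # l)) = pg n (\<lambda>l. H' (x # l))" for x
    by (rule Suc.IH) (simp add: Suc.prems)
  then show ?case by (intro ext) simp
qed (intro ext, simp)

lemma pull_cong:
  "(\<And>l. length l = Suc n \<Longrightarrow> H l = H' l) \<Longrightarrow> pl n H = pl n H'"
  unfolding pull_def by (subst pull_gen_cong) auto

lemma pull_gen_add: "pg n (\<lambda>l. H l + H' l) = (\<lambda>x g. pg n H x g + pg n H' x g)"
  by (induction n arbitrary: H H') (intro ext, simp add: lift_right_add)+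

lemma pull_gen_scale: "pg n (\<lambda>l. sV c (H l)) = (\<lambda>x g. sV c (pg n H x g))"
  by (induction n arbitrary: H) (intro ext, simp add: lift_right_scale)+

lemma pull_add: "pl n (\<lambda>l. H l + H' l) p = pl n H p + pl n H' p"
  unfolding pull_def pull_gen_add by (rule lift_right_add)

lemma pull_scale: "pl n (\<lambda>l. sV c (H l)) p = sV c (pl n H p)"
  unfolding pull_def pull_gen_scale by (rule lift_right_scale)

lemma pull_diff: "pl n (\<lambda>l. H l - H' l) p = pl n H p - pl n H' p"
  using pull_add[of n "\<lambda>l. H l - H' l" H' p] by simp

lemma pull_gen_diff: "pg n (\<lambda>l. H l - H' l) x g = pg n H x g - pg n H' x g"
  using fun_cong[OF fun_cong[OF pull_gen_add[of n "\<lambda>l. H l - H' l" H']], of x g] by simp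

lemma pull_zero: "pl n (\<lambda>l. 0) p = 0"
  using pull_diff[of n "\<lambda>l. 0" "\<lambda>l. 0" p] by simp

lemma lin_pull_gen: "mlin scale_alg sV (Suc n) H \<Longrightarrow> lin scale_alg sV (\<lambda>x. pg n H x g)"
proof (cases n)
  case (Suc k)
  assume H: "mlin scale_alg sV (Suc n) H"
  have 1: "pg k (\<lambda>l. H ((x + y) # l)) = pg k (\<lambda>l. H (x # l) + H (y # l))" for x y
    by (rule pull_gen_cong) (use H in \<open>simp add: Suc lin_def\<close>)
  have 2: "pg k (\<lambda>l. H (scale_alg c x # l)) = pg k (\<lambda>l. sV c (H (x # l)))" for x c
    by (rule pull_gen_cong) (use H in \<open>simp add: Suc lin_def\<close>)
  show ?thesis
    unfolding lin_def Suc
    by (simp add: 1 2 pull_gen_add pull_gen_scale lift_right_add lift_right_scale)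
qed simp

lemma lin_pull: "mlin scale_alg sV (Suc n) H \<Longrightarrow> lin scale_bimod sV (pl n H)"
  unfolding pull_def by (rule lin_lift_right) (rule lin_pull_gen)

lemma pull_tensor:
  "mlin scale_alg sV (Suc n) H \<Longrightarrow>
    pl n H (tensor x g y) = rm (pg n H (x * idem (source g)) g) (idem (target g) * y)"
  unfolding pull_def by (rule lift_right_tensor) (rule lin_pull_gen)

lemma pull_right_mult: "mlin scale_alg sV (Suc n) H \<Longrightarrow> pl n H (right_mult p z) = rm (pl n H p) z"
  unfolding pull_def by (rule lift_right_mult) (rule lin_pull_gen)

lemma pull_gen_mult_left: "pg n (\<lambda>l. H (z * hd l # tl l)) x g = pg n H (z * x) g"
  by (cases n) simp_all

lemma pull_left_mult:
  "mlin scale_alg sV (Suc n) H \<Longrightarrow> pl n H (left_mult z p) = pl n (\<lambda>l. H (z * hd l # tl l)) p"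
proof -
  assume H: "mlin scale_alg sV (Suc n) H"
  have "pg n (\<lambda>l. H (z * hd l # tl l)) = (\<lambda>x. pg n H (z * x))"
    by (intro ext) (simp add: pull_gen_mult_left)
  then show ?thesis
    unfolding pull_def using lift_right_mult(2)[OF lin_pull_gen[OF H]] by simp
qed

text \<open>The lowest degree of the chain map property: \<iota> commutes with the
  augmentations.\<close>

lemma pull_augmentation:
  assumes "p \<in> component 0"
  shows "pl 0 (bar_diff rm H) p = rm (H []) (augmentation p)"
  using assms
proof (induction rule: component_induct)
  have m: "mlin scale_alg sV (Suc 0) (bar_diff rm H)" by (rule mlin_bar_diff) simp
  note L = lin_pull[OF m]
  {
    case zero
    show ?case by (simp add: augmentation_def lin_0[OF L] rm_zero)
  next
    case (add p q)
    then show ?case using L by (simp add: augmentation_def lin_def rm_add evaluate_add)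
  next
    case (scale c p)
    then show ?case using L by (simp add: augmentation_def lin_def rm_scale evaluate_scale)
  next
    case (tensor x r i y)
    then show ?case
      by (simp add: pull_tensor[OF m] rm_assoc augmentation_def evaluate_tensor mult.assoc idem_mult_assoc)
  }
qed

text \<open>\<iota> commutes with the differentials. Since \<iota> (1 \<otimes> g \<otimes> 1) = 1
  \<otimes> \<iota> (\<partial> g), the bar differential of it is \<iota> (\<partial> g) - 1
  \<otimes> d (\<iota> (\<partial> g)). By induction the second term is 1 \<otimes> \<iota>
  (\<partial> (\<partial> g)) = 0; in the lowest degree it vanishes by the augmentation.\<close>

lemma pull_gen_bar_diff:
  "mlin scale_alg sV (Suc n) H \<Longrightarrow>
    pg (Suc n) (bar_diff rm H) x g = pl n H (left_mult x (diff_gen (Suc n) (fst (snd g)) (snd (snd g))))"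
proof (induction n arbitrary: H x g)
  case (0 H x g)
  let ?p = "diff_gen (Suc 0) (fst (snd g)) (snd (snd g)) :: ('k, 'n, 'm) bimod"
  have eq: "pg 0 (\<lambda>l. bar_diff rm H (x # l)) = (\<lambda>x' g'. pg 0 (\<lambda>l. H (x * hd l # tl l)) x' g'
      - pg 0 (bar_diff rm (\<lambda>l. H (x # l))) x' g')"
    by (intro ext) simp
  have "pg (Suc 0) (bar_diff rm H) x g = pl 0 (\<lambda>l. H (x * hd l # tl l)) ?p - pl 0 (bar_diff rm (\<lambda>l. H (x # l))) ?p"
    unfolding pull_gen.simps(2) eq pull_def lift_right_diff ..
  moreover have "pl 0 (bar_diff rm (\<lambda>l. H (x # l))) ?p = 0"
    by (subst pull_augmentation) (simp_all add: diff_gen_component augmentation_boundary rm_zero)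
  ultimately show ?case using pull_left_mult[OF 0] by simp
next
  case (Suc n H x g)
  let ?p = "diff_gen (Suc (Suc n)) (fst (snd g)) (snd (snd g)) :: ('k, 'n, 'm) bimod"
  let ?Hx = "\<lambda>l. H (x # l)"
  have Hx: "mlin scale_alg sV (Suc n) ?Hx" using Suc.prems by simp
  have "pg (Suc n) (\<lambda>l. bar_diff rm H (x # l)) = pg (Suc n) (\<lambda>l. H (x * hd l # tl l) - bar_diff rm ?Hx l)"
    by (rule pull_gen_cong) (auto simp: length_Suc_conv)
  then have "pg (Suc (Suc n)) (bar_diff rm H) x g =
      pl (Suc n) (\<lambda>l. H (x * hd l # tl l) - bar_diff rm ?Hx l) ?p"
    by (simp add: pull_def del: pull_gen.simps) (simp only: pull_gen.simps(2))
  then have 1: "pg (Suc (Suc n)) (bar_diff rm H) x g =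
      pl (Suc n) (\<lambda>l. H (x * hd l # tl l)) ?p - pl (Suc n) (bar_diff rm ?Hx) ?p"
    by (simp only: pull_diff)
  have m: "mlin scale_alg sV (Suc (Suc n)) (bar_diff rm ?Hx)" by (rule mlin_bar_diff[OF Hx])
  have "pl (Suc n) (bar_diff rm ?Hx) p = pl n ?Hx (differential p)" if "p \<in> component (Suc n)" for p
    using that
  proof (induction rule: component_induct)
    case zero
    show ?case by (simp add: lin_0[OF lin_pull[OF m]] lin_0[OF lin_pull[OF Hx]])
  next
    case (add p q)
    then show ?case using lin_pull[OF m] lin_pull[OF Hx] by (simp add: lin_def differential_linear)
  next
    case (scale c p)
    then show ?case using lin_pull[OF m] lin_pull[OF Hx] by (simp add: lin_def differential_linear)
  next
    case (tensor y r i z)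
    have "pl (Suc n) (bar_diff rm ?Hx) (tensor y (Suc n, r, i) z) =
       pl n ?Hx (left_mult (y * idem (source (Suc n, r, i))) (right_mult (diff_gen (Suc n) r i) (idem (target (Suc n, r, i)) * z)))"
      unfolding pull_tensor[OF m] Suc.IH[OF Hx]
      by (simp add: pull_right_mult[OF Hx] left_right_mult)
    then show ?case
      using diff_gen_idem[of y "(Suc n, r, i)" z] by (simp only: fst_conv snd_conv differential_tensor)
  qed
  from this[OF diff_gen_component] have "pl (Suc n) (bar_diff rm ?Hx) ?p = 0"
    by (simp add: differential_diff_gen lin_0[OF lin_pull[OF Hx]])
  then show ?case using 1 pull_left_mult[OF Suc.prems] by simp
qed

lemma pull_bar_diff:
  assumes H: "mlin scale_alg sV (Suc n) H" and "p \<in> component (Suc n)"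
  shows "pl (Suc n) (bar_diff rm H) p = pl n H (differential p)"
  using assms(2)
proof (induction rule: component_induct)
  have m: "mlin scale_alg sV (Suc (Suc n)) (bar_diff rm H)" by (rule mlin_bar_diff[OF H])
  {
    case zero
    show ?case by (simp add: lin_0[OF lin_pull[OF m]] lin_0[OF lin_pull[OF H]])
  next
    case (add p q)
    then show ?case using lin_pull[OF m] lin_pull[OF H] by (simp add: lin_def differential_linear)
  next
    case (scale c p)
    then show ?case using lin_pull[OF m] lin_pull[OF H] by (simp add: lin_def differential_linear)
  next
    case (tensor y r i z)
    have "pl (Suc n) (bar_diff rm H) (tensor y (Suc n, r, i) z) =
       pl n H (left_mult (y * idem (source (Suc n, r, i))) (right_mult (diff_gen (Suc n) r i) (idem (target (Suc n, r, i)) * z)))"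
      unfolding pull_tensor[OF m] pull_gen_bar_diff[OF H]
      by (simp add: pull_right_mult[OF H] left_right_mult)
    then show ?case
      using diff_gen_idem[of y "(Suc n, r, i)" z] by (simp only: fst_conv snd_conv differential_tensor)
  }
qed

lemma bar_homotopy_cong:
  "(\<And>l. length l = Suc (Suc n) \<Longrightarrow> H l = H' l) \<Longrightarrow> length l = Suc n \<Longrightarrow>
    bar_homotopy sV rm \<pi> n H l = bar_homotopy sV rm \<pi> n H' l"
proof (induction n arbitrary: H H' l)
  case 0
  have "pl 0 (\<lambda>t. H (hd l # t)) = pl 0 (\<lambda>t. H' (hd l # t))"
    by (rule pull_cong) (simp add: 0)
  then show ?case using 0 by simp
next
  case (Suc n)
  have "pl (Suc n) (\<lambda>t. H (hd l # t)) = pl (Suc n) (\<lambda>t. H' (hd l # t))"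
    by (rule pull_cong) (simp add: Suc.prems)
  moreover have "bar_diff rm (bar_homotopy sV rm \<pi> n (\<lambda>t. H (hd l # t))) (1 # tl l) =
      bar_diff rm (bar_homotopy sV rm \<pi> n (\<lambda>t. H' (hd l # t))) (1 # tl l)"
    by (rule bar_diff_cong, rule Suc.IH) (use Suc.prems in auto)
  ultimately show ?case using Suc.prems by simp
qed

lemma bar_homotopy_add:
  "bar_homotopy sV rm \<pi> n (\<lambda>l. H l + H' l) = (\<lambda>l. bar_homotopy sV rm \<pi> n H l + bar_homotopy sV rm \<pi> n H' l)"
  by (induction n arbitrary: H H') (intro ext, simp add: pull_add bar_diff_lin)+

lemma bar_homotopy_scale:
  "bar_homotopy sV rm \<pi> n (\<lambda>l. sV c (H l)) = (\<lambda>l. sV c (bar_homotopy sV rm \<pi> n H l))"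
  by (induction n arbitrary: H)
     (intro ext, simp add: pull_scale bar_diff_lin V.scale_right_diff_distrib)+

lemma bar_homotopy_diff:
  "bar_homotopy sV rm \<pi> n (\<lambda>l. H l - H' l) l = bar_homotopy sV rm \<pi> n H l - bar_homotopy sV rm \<pi> n H' l"
  using fun_cong[OF bar_homotopy_add[of \<pi> n "\<lambda>l. H l - H' l" H'], of l] by simp

lemma bar_homotopy_zero: "bar_homotopy sV rm \<pi> n (\<lambda>l. 0) l = 0"
  using bar_homotopy_diff[of \<pi> n "\<lambda>l. 0" "\<lambda>l. 0" l] by simp

lemma bar_homotopy_mult_left:
  "bar_homotopy sV rm \<pi> n (\<lambda>l. H (z * hd l # tl l)) (u # v) = bar_homotopy sV rm \<pi> n H (z * u # v)"
  by (cases n) simp_all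

end

text \<open>All constructions with functions on lists are natural in the module of values. The
  homomorphisms used are \<open>evaluate f\<close>, left multiplications,
  \<open>differential\<close> and pulled back maps.\<close>

locale right_module_hom =
  M: alg_right_module sV rm + M': alg_right_module sV' rm'
  for sV :: "'k::field \<Rightarrow> 'v::ab_group_add \<Rightarrow> 'v" and rm :: "'v \<Rightarrow> ('k, 'n::finite, 'm::nontriv) alg \<Rightarrow> 'v"
    and sV' :: "'k::field \<Rightarrow> 'w::ab_group_add \<Rightarrow> 'w" and rm' :: "'w \<Rightarrow> ('k, 'n::finite, 'm::nontriv) alg \<Rightarrow> 'w" +
  fixes \<theta> :: "'v \<Rightarrow> 'w"
  assumes lin_hom: "lin sV sV' \<theta>" and hom_rm: "\<theta> (rm v x) = rm' (\<theta> v) x"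
begin

lemma hom_bar_diff: "\<theta> (bar_diff rm H xs) = bar_diff rm' (\<lambda>l. \<theta> (H l)) xs"
  by (induction xs arbitrary: H rule: induct_list012)
     (simp_all add: lin_0[OF lin_hom] lin_diff[OF lin_hom] hom_rm)

lemma hom_lift_right: "\<theta> (lift_right sV rm \<Phi> p) = lift_right sV' rm' (\<lambda>x g. \<theta> (\<Phi> x g)) p"
  unfolding lift_right_def lin_ext_def lin_sum[OF lin_hom]
  using lin_hom by (intro sum.cong refl) (auto simp: lin_def hom_rm)

lemma hom_pull_gen: "\<theta> (pull_gen sV rm n H x g) = pull_gen sV' rm' n (\<lambda>l. \<theta> (H l)) x g"
  by (induction n arbitrary: H x g) (simp_all add: hom_lift_right)

lemma hom_pull: "\<theta> (pull sV rm n H p) = pull sV' rm' n (\<lambda>l. \<theta> (H l)) p"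
  by (simp add: pull_def hom_lift_right hom_pull_gen)

lemma hom_bar_homotopy: "\<theta> (bar_homotopy sV rm \<pi> n H l) = bar_homotopy sV' rm' \<pi> n (\<lambda>l. \<theta> (H l)) l"
proof (induction n arbitrary: H l)
  case (Suc n)
  have "\<theta> (bar_homotopy sV rm \<pi> (Suc n) H l) = \<theta> (H (hd l # 1 # tl l))
     - pull sV' rm' (Suc n) (\<lambda>t. \<theta> (H (hd l # t))) (\<pi> (tl l))
     - bar_diff rm' (\<lambda>t. \<theta> (bar_homotopy sV rm \<pi> n (\<lambda>t. H (hd l # t)) t)) (1 # tl l)"
    by (simp add: lin_diff[OF lin_hom] hom_pull hom_bar_diff)
  then show ?case by (simp add: Suc.IH)
qed (simp add: lin_diff[OF lin_hom] hom_pull)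

end

lemma right_module_alg: "right_module scale_alg scale_alg (*)"
  by (unfold_locales; simp add: scale_alg_mult_left scale_alg_mult_right algebra_simps)

interpretation AA: alg_right_module scale_alg "(*)"
  by (simp add: alg_right_module_def right_module_alg)

interpretation BB: alg_right_module scale_bimod right_mult
  by (unfold_locales; simp add: scale_alg_mult_left scale_alg_mult_right algebra_simps
      right_mult_alg_add right_mult_alg_scale right_mult_assoc)

context
  fixes \<pi> :: "('k::field, 'n::finite, 'm::nontriv) alg list \<Rightarrow> ('k, 'n, 'm) bimod"
  assumes \<pi>: "comparison_map \<pi>"
begin

lemma mlin_comparison: "mlin scale_alg scale_bimod n \<pi>"
  using \<pi> by (simp add: comparison_map_def multilinear_iff vector_space_scale_alg vector_space_scale_bimod)

lemma comparison_component: "\<pi> xs \<in> component (length xs)"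
  using \<pi> by (simp add: comparison_map_def)

lemma comparison_augmentation: "augmentation (\<pi> []) = 1"
  using \<pi> by (simp add: comparison_map_def)

lemma differential_comparison:
  "differential (\<pi> (x # r)) = left_mult x (\<pi> r) - bar_diff right_mult \<pi> (x # r)"
proof -
  have s: "alt_sign i p = signed i p" for i and p :: "('k, 'n, 'm) bimod"
    by (simp add: alt_sign_def signed_eq)
  have "differential (\<pi> (x # r)) = left_mult x (\<pi> r)
          + (\<Sum>i<length r. signed (i + 1) (\<pi> (take i (x # r) @ [(x # r) ! i * (x # r) ! (i + 1)] @ drop (i + 2) (x # r))))
          + signed (Suc (length r)) (right_mult (\<pi> (butlast (x # r))) (last (x # r)))"
    using \<pi> by (simp add: comparison_map_def)
  moreover have "signed (Suc i) p = - signed i p" for i and p :: "('k, 'n, 'm) bimod"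
    by (simp add: signed_eq)
  ultimately show ?thesis
    by (subst bar_diff_sum[of _ "length r"]) (simp_all add: s sum_negf)
qed

end

section \<open>The homotopy on the bar resolution\<close>

context alg_right_module
begin

lemma hom_self: "right_module_hom scale_bimod right_mult sV rm \<theta>"
  if "lin scale_bimod sV \<theta>" "\<And>v x. \<theta> (right_mult v x) = rm (\<theta> v) x"
  using that by (unfold_locales) auto

lemma bar_diff_pull_comparison:
  assumes \<pi>: "comparison_map \<pi>" and K: "mlin scale_alg sV (Suc n) K" and l: "length r = n"
  shows "bar_diff rm (\<lambda>l. pl n K (left_mult (hd l) (\<pi> (tl l)))) (1 # x # r) = pl n K (differential (\<pi> (x # r)))"
proof -
  interpret h: right_module_hom scale_bimod right_mult sV rm "pl n K"
    by (rule hom_self[OF lin_pull[OF K] pull_right_mult[OF K]])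
  show ?thesis
    by (simp add: differential_comparison[OF \<pi>] lin_diff[OF lin_pull[OF K]] h.hom_bar_diff)
qed

theorem bar_homotopy:
  assumes \<pi>: "comparison_map \<pi>"
  shows "mlin scale_alg sV (Suc n) H \<Longrightarrow> length l = Suc n \<Longrightarrow>
    H l - pl n H (left_mult (hd l) (\<pi> (tl l))) = bar_homotopy sV rm \<pi> n (bar_diff rm H) l
      + (case n of 0 \<Rightarrow> 0 | Suc k \<Rightarrow> bar_diff rm (bar_homotopy sV rm \<pi> k H) l)"
proof (induction n arbitrary: H l)
  case (0 H l)
  then obtain x where l: "l = [x]" by (auto simp: length_Suc_conv)
  have p: "\<pi> [] \<in> component 0" using comparison_component[OF \<pi>, of "[]"] by simp
  have "pl 0 (\<lambda>t. bar_diff rm H (x # t)) (\<pi> []) = pl 0 (\<lambda>t. H (x * hd t # tl t) - bar_diff rm (\<lambda>l. H (x # l)) t) (\<pi> [])"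
    by (rule arg_cong[OF pull_cong, of _ _ _ "\<lambda>f. f _"]) (auto simp: length_Suc_conv)
  then have "pl 0 (\<lambda>t. bar_diff rm H (x # t)) (\<pi> []) = pl 0 H (left_mult x (\<pi> [])) - H [x]"
    using pull_augmentation[OF p] pull_left_mult[OF 0(1)]
    by (simp add: pull_diff comparison_augmentation[OF \<pi>] rm_one)
  then show ?case by (simp add: l rm_one)
next
  case (Suc n H l)
  obtain x y r where l: "l = x # y # r" "length r = n" using Suc.prems by (metis length_Suc_conv)
  let ?xs = "y # r" and ?K = "\<lambda>l. H (x # l)" and ?Hx = "\<lambda>l. H (x * hd l # tl l)"
  let ?h = "bar_homotopy sV rm \<pi>"
  have K: "mlin scale_alg sV (Suc n) ?K" using Suc.prems by simp
  have px: "\<pi> ?xs \<in> component (Suc n)" using comparison_component[OF \<pi>, of ?xs] l by simp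
  have e: "bar_diff rm H (x # t) = ?Hx t - bar_diff rm ?K t" if "length t = Suc m" for t m
    using that by (auto simp: length_Suc_conv)
  have 1: "bar_diff rm H (x # 1 # ?xs) = H l - bar_diff rm ?K (1 # ?xs)"
    by (simp add: l)
  have "pl (Suc n) (\<lambda>t. bar_diff rm H (x # t)) = pl (Suc n) (\<lambda>t. ?Hx t - bar_diff rm ?K t)"
    by (rule pull_cong) (rule e)
  then have 2: "pl (Suc n) (\<lambda>t. bar_diff rm H (x # t)) (\<pi> ?xs) =
      pl (Suc n) H (left_mult x (\<pi> ?xs)) - pl (Suc n) (bar_diff rm ?K) (\<pi> ?xs)"
    using pull_left_mult[OF Suc.prems(1)] by (simp add: pull_diff)
  have "bar_diff rm (?h n (\<lambda>t. bar_diff rm H (x # t))) (1 # ?xs) =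
      bar_diff rm (\<lambda>l. ?h n ?Hx l - ?h n (bar_diff rm ?K) l) (1 # ?xs)"
  proof (rule bar_diff_cong)
    fix t :: "('k, 'n, 'm) alg list" assume "Suc (length t) = length (1 # ?xs)"
    then have "length t = Suc n" using l by simp
    then have "?h n (\<lambda>t. bar_diff rm H (x # t)) t = ?h n (\<lambda>t. ?Hx t - bar_diff rm ?K t) t"
      by (intro bar_homotopy_cong e) auto
    then show "?h n (\<lambda>t. bar_diff rm H (x # t)) t = ?h n ?Hx t - ?h n (bar_diff rm ?K) t"
      by (simp add: bar_homotopy_diff)
  qed
  moreover have "bar_diff rm (?h n ?Hx) (1 # ?xs) = bar_diff rm (\<lambda>l. ?h n H (x * hd l # tl l)) (1 # ?xs)"
  proof (rule bar_diff_cong)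
    fix t :: "('k, 'n, 'm) alg list" assume "Suc (length t) = length (1 # ?xs)"
    then obtain u v where "t = u # v" by (cases t) auto
    then show "?h n ?Hx t = ?h n H (x * hd t # tl t)" by (simp add: bar_homotopy_mult_left)
  qed
  ultimately have 3: "bar_diff rm (?h n (\<lambda>t. bar_diff rm H (x # t))) (1 # ?xs) =
      bar_diff rm (?h n H) l - bar_diff rm (?h n (bar_diff rm ?K)) (1 # ?xs)"
    using bar_diff_left[of "?h n H" x 1 y r] by (simp add: bar_diff_diff l del: bar_diff.simps)
  \<comment> \<open>This is d (1 - \<iota> \<circ> \<pi>) = d h d at 1 \<otimes> xs \<otimes> 1:
    \<iota> \<circ> \<pi> commutes with d, the induction hypothesis replaces 1 - \<iota> \<circ>
    \<pi> by d h + h d, and d d = 0.\<close>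
  have "bar_diff rm ?K (1 # ?xs) - pl (Suc n) (bar_diff rm ?K) (\<pi> ?xs) =
      bar_diff rm (\<lambda>t. ?K t - pl n ?K (left_mult (hd t) (\<pi> (tl t)))) (1 # ?xs)"
    unfolding pull_bar_diff[OF K px] bar_diff_diff bar_diff_pull_comparison[OF \<pi> K l(2)] ..
  also have "\<dots> = bar_diff rm (\<lambda>t. ?h n (bar_diff rm ?K) t
      + (case n of 0 \<Rightarrow> 0 | Suc k \<Rightarrow> bar_diff rm (?h k ?K) t)) (1 # ?xs)"
    by (rule bar_diff_cong, rule Suc.IH[OF K]) (use l in simp)
  also have "\<dots> = bar_diff rm (?h n (bar_diff rm ?K)) (1 # ?xs)"
    by (cases n) (simp_all add: bar_diff_lin(1) bar_diff_bar_diff bar_diff_zero l del: bar_diff.simps bar_homotopy.simps)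
  finally have 4: "bar_diff rm ?K (1 # ?xs) - pl (Suc n) (bar_diff rm ?K) (\<pi> ?xs) =
     bar_diff rm (?h n (bar_diff rm ?K)) (1 # ?xs)" .
  have "?h (Suc n) (bar_diff rm H) l = bar_diff rm H (x # 1 # ?xs)
      - pl (Suc n) (\<lambda>t. bar_diff rm H (x # t)) (\<pi> ?xs)
      - bar_diff rm (?h n (\<lambda>t. bar_diff rm H (x # t))) (1 # ?xs)"
    by (simp only: bar_homotopy.simps l list.sel)
  also have "\<dots> = H l - pl (Suc n) H (left_mult x (\<pi> ?xs)) - bar_diff rm (?h n H) l
      - (bar_diff rm ?K (1 # ?xs) - pl (Suc n) (bar_diff rm ?K) (\<pi> ?xs) - bar_diff rm (?h n (bar_diff rm ?K)) (1 # ?xs))"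
    unfolding 1 2 3 by (simp only: algebra_simps)
  finally show ?case unfolding 4 by (simp add: l del: bar_diff.simps bar_homotopy.simps)
qed

lemma mlin_bar_homotopy:
  assumes \<pi>: "comparison_map \<pi>"
  shows "mlin scale_alg sV (Suc (Suc n)) H \<Longrightarrow> mlin scale_alg sV (Suc n) (bar_homotopy sV rm \<pi> n H)"
proof (induction n arbitrary: H)
  case (0 H)
  have a: "pl 0 (\<lambda>t. H ((x + y) # t)) = pl 0 (\<lambda>t. H (x # t) + H (y # t))"
    "pl 0 (\<lambda>t. H (scale_alg c x # t)) = pl 0 (\<lambda>t. sV c (H (x # t)))" for x y c
    by (rule pull_cong, use 0 in \<open>simp add: lin_def\<close>)+
  show ?case using 0 a
    by (simp add: lin_def pull_add pull_scale V.scale_right_diff_distrib)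
next
  case (Suc n H)
  have a: "pl (Suc n) (\<lambda>t. H ((x + y) # t)) = pl (Suc n) (\<lambda>t. H (x # t) + H (y # t))"
    "pl (Suc n) (\<lambda>t. H (scale_alg c x # t)) = pl (Suc n) (\<lambda>t. sV c (H (x # t)))" for x y c
    by (rule pull_cong, use Suc.prems in \<open>simp add: lin_def\<close>)+
  show ?case
  proof (rule mlin_SucI)
    fix r :: "('k, 'n, 'm) alg list" assume r: "length r = Suc n"
    have b: "bar_diff rm (bar_homotopy sV rm \<pi> n (\<lambda>t. H ((x + y) # t))) (1 # r) =
        bar_diff rm (bar_homotopy sV rm \<pi> n (\<lambda>t. H (x # t) + H (y # t))) (1 # r)"
      "bar_diff rm (bar_homotopy sV rm \<pi> n (\<lambda>t. H (scale_alg c x # t))) (1 # r) =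
        bar_diff rm (bar_homotopy sV rm \<pi> n (\<lambda>t. sV c (H (x # t)))) (1 # r)" for x y c
      by (rule bar_diff_cong, rule bar_homotopy_cong, use Suc.prems r in \<open>auto simp: lin_def\<close>)+
    have "lin scale_alg sV (\<lambda>x. H (x # 1 # r))" using Suc.prems r by simp
    then show "lin scale_alg sV (\<lambda>x. bar_homotopy sV rm \<pi> (Suc n) H (x # r))"
      by (simp add: lin_def a b pull_add pull_scale bar_homotopy_add bar_homotopy_scale bar_diff_lin
          V.scale_right_diff_distrib del: bar_diff.simps)
  next
    fix x
    let ?K = "\<lambda>t. H (x # t)"
    have K: "mlin scale_alg sV (Suc (Suc n)) ?K" by (rule mlin_Cons[OF Suc.prems])
    have 1: "mlin scale_alg sV (Suc n) (\<lambda>l. H (x # 1 # l))"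
      by (rule mlin_Cons[OF K])
    have 2: "mlin scale_alg sV (Suc n) (\<lambda>l. pl (Suc n) ?K (\<pi> l))"
      by (rule mlin_compose[OF mlin_comparison[OF \<pi>] lin_pull[OF K]])
    have 3: "mlin scale_alg sV (Suc n) (\<lambda>l. bar_diff rm (bar_homotopy sV rm \<pi> n ?K) (1 # l))"
      by (rule mlin_Cons) (rule mlin_bar_diff[OF Suc.IH[OF K]])
    show "mlin scale_alg sV (Suc n) (\<lambda>l. bar_homotopy sV rm \<pi> (Suc n) H (x # l))"
      using mlin_diff[OF vsV mlin_diff[OF vsV 1 2] 3] by (simp only: bar_homotopy.simps list.sel)
  qed
qed

end

text \<open>The bimodule map on the bar resolution that belongs to the cochain G.\<close>

definition left_ext :: "('a list \<Rightarrow> 'a::ring_1) \<Rightarrow> 'a list \<Rightarrow> 'a" where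
  "left_ext G l = hd l * G (tl l)"

lemma mlin_left_ext: "mlin scale_alg scale_alg n G \<Longrightarrow> mlin scale_alg scale_alg (Suc n) (left_ext G)"
proof (rule mlin_SucI)
  fix x :: "('a, 'b, 'c) alg"
  assume "mlin scale_alg scale_alg n G"
  then show "mlin scale_alg scale_alg n (\<lambda>l. left_ext G (x # l))"
    unfolding left_ext_def list.sel by (rule mlin_compose) (rule alg_module.lin_mult(2))
qed (simp add: left_ext_def alg_module.lin_mult)

lemma right_module_hom_alg:
  "lin scale_alg scale_alg \<theta> \<Longrightarrow> (\<And>v x. \<theta> (v * x) = \<theta> v * x) \<Longrightarrow>
    right_module_hom scale_alg (*) scale_alg (*) (\<theta> :: ('k::field, 'n::finite, 'm::nontriv) alg \<Rightarrow> _)"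
  by unfold_locales

lemma right_module_hom_left: "right_module_hom scale_alg (*) scale_alg (*) ((*) z)"
  by (rule right_module_hom_alg) (simp_all add: alg_module.lin_mult mult.assoc)

lemma bar_diff_left_ext:
  assumes "length r = n"
  shows "bar_diff (*) (left_ext G) (x # y # r) = x * hoch_diff n G (y # r :: ('k::field, 'n::finite, 'm::nontriv) alg list)"
proof -
  interpret h: right_module_hom scale_alg "(*)" scale_alg "(*)" "(*) x :: ('k, 'n, 'm) alg \<Rightarrow> _"
    by (rule right_module_hom_left)
  show ?thesis using assms
    by (simp add: hoch_diff_bar_diff left_ext_def h.hom_bar_diff[symmetric] algebra_simps del: bar_diff.simps(2,3))
       (simp add: left_ext_def h.hom_bar_diff[symmetric] algebra_simps del: bar_diff.simps(2))
qed

abbreviation "pull_alg \<equiv> pull scale_alg (*)"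

text \<open>G \<circ> \<iota> as a function of labels; in the other direction,
  \<open>bar_rep \<pi> n f\<close> is f \<circ> \<pi>.\<close>

definition pull_cochain :: "nat \<Rightarrow> (('k::field, 'n::finite, 'm::nontriv) alg list \<Rightarrow> ('k, 'n, 'm) alg) \<Rightarrow> 'm label \<Rightarrow> ('k, 'n, 'm) alg" where
  "pull_cochain n G g = pull_gen scale_alg (*) n (left_ext G) 1 g"

lemma pull_left_ext:
  assumes "mlin scale_alg scale_alg n G"
  shows "pull_alg n (left_ext G) p = evaluate (pull_cochain n G) (p :: ('k::field, 'n::finite, 'm::nontriv) bimod)"
proof (induction p rule: bimod_induct)
  have m: "mlin scale_alg scale_alg (Suc n) (left_ext G)" by (rule mlin_left_ext[OF assms])
  note L = AA.lin_pull[OF m]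
  {
    case zero
    show ?case by (simp add: lin_0[OF L])
  next
    case (add p q)
    then show ?case using L by (simp add: lin_def evaluate_add)
  next
    case (tensor x g y)
    let ?z = "x * idem (source g)"
    interpret h: right_module_hom scale_alg "(*)" scale_alg "(*)" "(*) ?z :: ('k, 'n, 'm) alg \<Rightarrow> _"
      by (rule right_module_hom_left)
    have "pull_gen scale_alg (*) n (left_ext G) ?z g = pull_gen scale_alg (*) n (\<lambda>l. left_ext G (?z * hd l # tl l)) 1 g"
      by (simp add: AA.pull_gen_mult_left)
    also have "\<dots> = ?z * pull_cochain n G g"
      unfolding pull_cochain_def h.hom_pull_gen
      by (rule fun_cong[OF fun_cong[OF AA.pull_gen_cong]]) (simp add: left_ext_def mult.assoc)
    finally show ?case by (simp add: AA.pull_tensor[OF m] evaluate_tensor mult.assoc)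
  }
qed

definition bar_rep :: "(('k::field, 'n::finite, 'm::nontriv) alg list \<Rightarrow> ('k, 'n, 'm) bimod) \<Rightarrow> nat \<Rightarrow>
     ('m label \<Rightarrow> ('k, 'n, 'm) alg) \<Rightarrow> ('k, 'n, 'm) alg list \<Rightarrow> ('k, 'n, 'm) alg" where
  "bar_rep \<pi> n f xs = (if length xs = n then evaluate f (\<pi> xs) else 0)"

section \<open>Transfer of cocycles between P and the bar resolution\<close>

context
  fixes \<pi> :: "('k::field, 'n::finite, 'm::nontriv) alg list \<Rightarrow> ('k, 'n, 'm) bimod"
  assumes \<pi>: "comparison_map \<pi>"
begin

lemma bar_rep_cochains: "bar_rep \<pi> n f \<in> cochains scale_alg n"
proof -
  have "mlin scale_alg scale_alg n (\<lambda>xs. evaluate f (\<pi> xs))"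
    by (rule mlin_compose[OF mlin_comparison[OF \<pi>] lin_evaluate])
  then have "mlin scale_alg scale_alg n (bar_rep \<pi> n f)"
    by (rule mlin_cong[THEN iffD2, rotated]) (simp add: bar_rep_def)
  then show ?thesis by (simp add: alg_module.cochains_iff bar_rep_def)
qed

lemma hoch_diff_bar_rep:
  assumes "length xs = Suc n"
  shows "hoch_diff n (bar_rep \<pi> n f) xs = evaluate f (differential (\<pi> xs))"
proof -
  obtain x r where xs: "xs = x # r" "length r = n" using assms by (auto simp: length_Suc_conv)
  interpret h: right_module_hom scale_bimod right_mult scale_alg "(*)" "evaluate f :: ('k, 'n, 'm) bimod \<Rightarrow> _"
    by (rule AA.hom_self[OF lin_evaluate]) (use evaluate_mult[of f 1] in simp)
  have "bar_diff (*) (bar_rep \<pi> n f) xs = bar_diff (*) (\<lambda>l. evaluate f (\<pi> l)) xs"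
    by (rule bar_diff_cong) (simp add: bar_rep_def xs)
  moreover have "evaluate f (left_mult x p) = x * evaluate f p" for p
    using evaluate_mult[of f x p 1] by simp
  ultimately show ?thesis
    using xs by (simp add: hoch_diff_bar_diff differential_comparison[OF \<pi>] evaluate_diff h.hom_bar_diff
        bar_rep_def)
qed

lemma bar_rep_cocycles:
  assumes "\<And>p. p \<in> component (Suc n) \<Longrightarrow> evaluate f (differential p) = 0"
  shows "bar_rep \<pi> n f \<in> cocycles scale_alg n"
proof -
  have "hoch_diff n (bar_rep \<pi> n f) xs = 0" for xs
  proof (cases "length xs = Suc n")
    case True
    then show ?thesis using hoch_diff_bar_rep[OF True] assms comparison_component[OF \<pi>, of xs] by simp
  qed (simp add: hoch_diff_def)
  then show ?thesis by (auto simp: cocycles_def bar_rep_cochains)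
qed

text \<open>In the homotopy formula for a cocycle the term G d h vanishes, and G h d is the
  Hochschild differential of K.\<close>

lemma cocycle_homotopy:
  assumes G: "G \<in> cocycles scale_alg (Suc n)"
  shows "\<exists>K\<in>cochains scale_alg n. \<forall>xs. length xs = Suc n \<longrightarrow>
    G xs - evaluate (pull_cochain (Suc n) G) (\<pi> xs) = hoch_diff n K xs"
proof -
  let ?H = "left_ext G" and ?h = "bar_homotopy scale_alg (*) \<pi> n (left_ext G)"
  have mG: "mlin scale_alg scale_alg (Suc n) G" and dG: "hoch_diff (Suc n) G = (\<lambda>_. 0)"
    using G by (simp_all add: cocycles_def alg_module.cochains_iff)
  note mH = mlin_left_ext[OF mG]
  define K where "K v = (if length v = n then ?h (1 # v) else 0)" for v
  have mh: "mlin scale_alg scale_alg (Suc n) ?h" by (rule AA.mlin_bar_homotopy[OF \<pi> mH])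
  have "mlin scale_alg scale_alg n K"
    by (rule mlin_cong[THEN iffD2, OF _ mlin_Cons[OF mh, of 1]]) (simp add: K_def)
  then have K: "K \<in> cochains scale_alg n" by (simp add: alg_module.cochains_iff K_def)
  \<comment> \<open>The homotopy is left linear in the first entry, so it is determined by K, its
    value at first entry 1.\<close>
  have left: "?h (u # v) = left_ext K (u # v)" if "length v = n" for u v
  proof -
    interpret h: right_module_hom scale_alg "(*)" scale_alg "(*)" "(*) u :: ('k, 'n, 'm) alg \<Rightarrow> _"
      by (rule right_module_hom_left)
    have "?h (u # v) = bar_homotopy scale_alg (*) \<pi> n (\<lambda>l. ?H (u * hd l # tl l)) (1 # v)"
      by (simp add: AA.bar_homotopy_mult_left)
    also have "\<dots> = u * ?h (1 # v)"
      unfolding h.hom_bar_homotopy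
      by (rule AA.bar_homotopy_cong) (simp_all add: left_ext_def mult.assoc that)
    finally show ?thesis by (simp add: left_ext_def K_def that)
  qed
  have "G xs - evaluate (pull_cochain (Suc n) G) (\<pi> xs) = hoch_diff n K xs" if xs: "length xs = Suc n" for xs :: "('k, 'n, 'm) alg list"
  proof -
    obtain y r where y: "xs = y # r" "length r = n" using xs by (auto simp: length_Suc_conv)
    have z: "bar_homotopy scale_alg (*) \<pi> (Suc n) (bar_diff (*) ?H) (1 # xs) = bar_homotopy scale_alg (*) \<pi> (Suc n) (\<lambda>l. 0) (1 # xs)"
    proof (rule AA.bar_homotopy_cong)
      fix l :: "('k, 'n, 'm) alg list" assume "length l = Suc (Suc (Suc n))"
      then obtain a b c where "l = a # b # c" "length c = Suc n" by (auto simp: length_Suc_conv)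
      then show "bar_diff (*) ?H l = 0" by (simp add: bar_diff_left_ext dG del: bar_diff.simps)
    qed (simp add: xs)
    have "?H (1 # xs) - pull_alg (Suc n) ?H (left_mult (hd (1 # xs)) (\<pi> (tl (1 # xs)))) =
        bar_homotopy scale_alg (*) \<pi> (Suc n) (bar_diff (*) ?H) (1 # xs)
        + (case Suc n of 0 \<Rightarrow> 0 | Suc k \<Rightarrow> bar_diff (*) (bar_homotopy scale_alg (*) \<pi> k ?H) (1 # xs))"
      by (rule AA.bar_homotopy[OF \<pi> mH]) (simp add: xs)
    then have "G xs - evaluate (pull_cochain (Suc n) G) (\<pi> xs) = bar_diff (*) ?h (1 # xs)"
      unfolding z AA.bar_homotopy_zero by (simp add: pull_left_ext[OF mG] left_ext_def)
    also have "\<dots> = bar_diff (*) (left_ext K) (1 # xs)"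
    proof (rule bar_diff_cong)
      fix l :: "('k, 'n, 'm) alg list" assume "Suc (length l) = length (1 # xs)"
      then obtain u v where "l = u # v" "length v = n" using xs by (cases l) auto
      then show "?h l = left_ext K l" by (simp add: left)
    qed
    also have "\<dots> = hoch_diff n K xs" using y by (simp add: bar_diff_left_ext del: bar_diff.simps)
    finally show ?thesis .
  qed
  then show ?thesis using K by blast
qed

text \<open>G differs from (G \<circ> \<iota>) \<circ> \<pi> by a coboundary, and if G \<circ>
  \<iota> = k \<circ> \<partial>, this composite is itself the coboundary of k \<circ>
  \<pi>.\<close>

lemma coboundary_if_pull_coboundary:
  fixes G :: "('k, 'n, 'm) alg list \<Rightarrow> ('k, 'n, 'm) alg"
  assumes G: "G \<in> cocycles scale_alg (Suc n)"
    and k: "\<And>p. p \<in> component (Suc n) \<Longrightarrow> evaluate (pull_cochain (Suc n) G) p = evaluate k (differential p)"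
  shows "G \<in> coboundaries scale_alg (Suc n)"
proof -
  obtain K where K: "K \<in> cochains scale_alg n" "\<And>xs. length xs = Suc n \<Longrightarrow>
      G xs - evaluate (pull_cochain (Suc n) G) (\<pi> xs) = hoch_diff n K xs"
    using cocycle_homotopy[OF G] by blast
  let ?L = "\<lambda>xs. K xs + bar_rep \<pi> n k xs"
  have "G xs = hoch_diff n ?L xs" for xs
  proof (cases "length xs = Suc n")
    case True
    then have "G xs = hoch_diff n K xs + evaluate k (differential (\<pi> xs))"
      using K(2)[OF True] k comparison_component[OF \<pi>, of xs] by (simp add: algebra_simps)
    then show ?thesis by (simp add: alg_module.hoch_diff_add hoch_diff_bar_rep[OF True])
  next
    case False
    then show ?thesis using G by (simp add: hoch_diff_def cocycles_def alg_module.cochains_iff)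
  qed
  moreover have "?L \<in> cochains scale_alg n" by (rule alg_module.cochains_add[OF K(1) bar_rep_cochains])
  ultimately show ?thesis unfolding coboundaries_def by auto
qed

text \<open>The endomorphism \<pi> \<circ> \<iota> of P: \<open>pull\<close> is applied to the
  function of lists that belongs to \<pi>.\<close>

definition phi :: "nat \<Rightarrow> ('k, 'n, 'm) bimod \<Rightarrow> ('k, 'n, 'm) bimod" where
  "phi n = pull scale_bimod right_mult n (\<lambda>l. left_mult (hd l) (\<pi> (tl l)))"

lemma mlin_left_comparison:
  "mlin scale_alg scale_bimod (Suc n) (\<lambda>l. left_mult (hd l) (\<pi> (tl l)))"
proof (rule mlin_SucI)
  show "mlin scale_alg scale_bimod n (\<lambda>l. left_mult (hd (x # l)) (\<pi> (tl (x # l))))" for x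
    unfolding list.sel by (rule mlin_compose[OF mlin_comparison[OF \<pi>] lin_mult_bimod(1)])
qed (simp add: lin_def left_mult_alg_add left_mult_alg_scale)

lemma lin_phi: "lin scale_bimod scale_bimod (phi n)"
  unfolding phi_def by (rule BB.lin_pull[OF mlin_left_comparison])

lemma phi_mult: "phi n (left_mult x (right_mult p y)) = left_mult x (right_mult (phi n p) y)"
proof -
  interpret h: right_module_hom scale_bimod right_mult scale_bimod right_mult "left_mult x :: ('k, 'n, 'm) bimod \<Rightarrow> _"
    by (rule BB.hom_self[OF lin_mult_bimod(1)]) (simp add: left_right_mult)
  have "phi n (left_mult x q) = left_mult x (phi n q)" for q
    unfolding phi_def BB.pull_left_mult[OF mlin_left_comparison] h.hom_pull
    by (simp add: left_mult_assoc)
  then show ?thesis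
    by (simp add: phi_def BB.pull_right_mult[OF mlin_left_comparison])
qed

lemma evaluate_phi: "evaluate f (phi n p) = evaluate (pull_cochain n (bar_rep \<pi> n f)) p"
proof -
  interpret h: right_module_hom scale_bimod right_mult scale_alg "(*)" "evaluate f :: ('k, 'n, 'm) bimod \<Rightarrow> _"
    by (rule AA.hom_self[OF lin_evaluate]) (use evaluate_mult[of f 1] in simp)
  have "evaluate f (left_mult x q) = x * evaluate f q" for x q
    using evaluate_mult[of f x q 1] by simp
  then have "evaluate f (phi n p) = pull_alg n (\<lambda>l. hd l * evaluate f (\<pi> (tl l))) p"
    unfolding phi_def h.hom_pull by simp
  also have "\<dots> = pull_alg n (left_ext (bar_rep \<pi> n f)) p"
    by (rule arg_cong[OF AA.pull_cong, of _ _ _ "\<lambda>f. f p"]) (simp add: left_ext_def bar_rep_def)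
  also have "\<dots> = evaluate (pull_cochain n (bar_rep \<pi> n f)) p"
    using bar_rep_cochains by (intro pull_left_ext) (simp add: alg_module.cochains_iff)
  finally show ?thesis .
qed

lemma differential_phi:
  assumes "p \<in> component (Suc n)"
  shows "differential (phi (Suc n) p) = phi n (differential p)"
proof -
  interpret h: right_module_hom scale_bimod right_mult scale_bimod right_mult "differential :: ('k, 'n, 'm) bimod \<Rightarrow> _"
    by (rule BB.hom_self[OF lin_differential]) (use differential_mult[of 1] in simp)
  have e: "differential (left_mult (hd l) (\<pi> (tl l))) = bar_diff right_mult (\<lambda>l. left_mult (hd l) (\<pi> (tl l))) l"
    if l: "length l = Suc (Suc n)" for l :: "('k, 'n, 'm) alg list"
  proof -
    obtain x y r where l: "l = x # y # r" using l by (metis length_Suc_conv)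
    interpret h': right_module_hom scale_bimod right_mult scale_bimod right_mult "left_mult x :: ('k, 'n, 'm) bimod \<Rightarrow> _"
      by (rule BB.hom_self[OF lin_mult_bimod(1)]) (simp add: left_right_mult)
    show ?thesis
      using differential_mult[of x "\<pi> (y # r)" 1]
      by (simp add: l differential_comparison[OF \<pi>] h'.hom_bar_diff[symmetric] left_mult_assoc del: bar_diff.simps(2))
  qed
  have "differential (phi (Suc n) p) = pull scale_bimod right_mult (Suc n) (bar_diff right_mult (\<lambda>l. left_mult (hd l) (\<pi> (tl l)))) p"
    unfolding phi_def h.hom_pull by (rule arg_cong[OF BB.pull_cong, of _ _ _ "\<lambda>f. f p"]) (rule e)
  also have "\<dots> = phi n (differential p)"
    unfolding phi_def by (rule BB.pull_bar_diff[OF mlin_left_comparison assms])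
  finally show ?thesis .
qed

lemma phi_component: "phi n p \<in> component n"
proof -
  have l: "lift_right scale_bimod right_mult \<Phi> q \<in> component n"
    if "\<And>x g. \<Phi> x g \<in> component n" for \<Phi> and q :: "('k, 'n, 'm) bimod"
  proof -
    have "scale_bimod c (right_mult (\<Phi> x g) y) \<in> component n" for c x g y
      using component_mult[OF that[of x g], of 1 y] by (simp add: component_def bimod.span_scale)
    then show ?thesis
      unfolding lift_right_def lin_ext_def by (intro component_closed(5)) (simp add: case_prod_beta')
  qed
  have g: "pull_gen scale_bimod right_mult k H x g \<in> component n"
    if "\<And>l. length l = Suc k \<Longrightarrow> H l \<in> component n" for k H g and x :: "('k, 'n, 'm) alg"
    using that by (induction k arbitrary: H x g) (auto intro: l)
  have "left_mult (hd l) (\<pi> (tl l)) \<in> component n" if "length l = Suc n" for l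
    using component_mult[OF comparison_component[OF \<pi>, of "tl l"], of "hd l" 1] that by simp
  then show ?thesis unfolding phi_def pull_def by (intro l g)
qed

lemma augmentation_phi:
  assumes "p \<in> component 0"
  shows "augmentation (phi 0 p) = augmentation p"
  using assms
proof (induction rule: component_induct)
  case zero
  show ?case by (simp add: lin_0[OF lin_phi])
next
  case (add p q)
  then show ?case using lin_phi by (simp add: lin_def augmentation_def evaluate_add)
next
  case (scale c p)
  then show ?case using lin_phi by (simp add: lin_def augmentation_def evaluate_scale)
next
  case (tensor x r i y)
  have "augmentation (left_mult u (right_mult q v)) = u * augmentation q * v" for u v and q :: "('k, 'n, 'm) bimod"
    by (simp add: augmentation_def evaluate_mult)
  moreover have "phi 0 (tensor x (0, r, i) y) = left_mult (x * idem i) (right_mult (\<pi> []) (idem (i - 2 * of_nat r) * y))"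
    unfolding phi_def BB.pull_tensor[OF mlin_left_comparison] by (simp add: left_right_mult)
  ultimately show ?case using tensor
    by (simp add: comparison_augmentation[OF \<pi>, unfolded augmentation_def] augmentation_def evaluate_tensor mult.assoc idem_mult_assoc)
qed

definition psi :: "nat \<Rightarrow> ('k, 'n, 'm) bimod \<Rightarrow> ('k, 'n, 'm) bimod" where
  "psi n p = phi n p - p"

lemma lin_psi: "lin scale_bimod scale_bimod (psi n)"
  using lin_phi[of n] by (simp add: psi_def lin_def bimod.scale_right_diff_distrib)

lemma psi_mult: "psi n (left_mult x (right_mult p y)) = left_mult x (right_mult (psi n p) y)"
  by (simp add: psi_def phi_mult)

lemma differential_psi: "p \<in> component (Suc n) \<Longrightarrow> differential (psi (Suc n) p) = psi n (differential p)"
  by (simp add: psi_def differential_phi)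

lemma psi_component: "p \<in> component n \<Longrightarrow> psi n p \<in> component n"
  by (simp add: psi_def phi_component component_closed)

end

section \<open>The length filtration\<close>

text \<open>The lengths to the left and to the right of the label are counted together. As A has no
  nonzero path longer than 2N, everything of total length above 4N is 0.\<close>

definition filtration :: "nat \<Rightarrow> nat \<Rightarrow> ('k::field, 'n::finite, 'm::nontriv) bimod set" where
  "filtration k n = bimod.span {tensor (path_elem p) (n, r, i) (path_elem q) | p q r i.
     r \<le> n \<and> length (snd p) + length (snd q) \<ge> k}"

lemma filtration_closed:
  "0 \<in> filtration k n" "p \<in> filtration k n \<Longrightarrow> q \<in> filtration k n \<Longrightarrow> p + q \<in> filtration k n"
  "p \<in> filtration k n \<Longrightarrow> q \<in> filtration k n \<Longrightarrow> p - q \<in> filtration k n"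
  "p \<in> filtration k n \<Longrightarrow> scale_bimod c p \<in> filtration k n"
  "p \<in> filtration k n \<Longrightarrow> signed e p \<in> filtration k n"
  "(\<And>l. l \<in> S \<Longrightarrow> f l \<in> filtration k n) \<Longrightarrow> sum f S \<in> filtration k n"
  by (simp_all add: filtration_def signed_def bimod.span_zero bimod.span_add bimod.span_diff
      bimod.span_scale bimod.span_sum)

lemma filtration_base:
  "r \<le> n \<Longrightarrow> length (snd p) + length (snd q) \<ge> k \<Longrightarrow> tensor (path_elem p) (n, r, i) (path_elem q) \<in> filtration k n"
  unfolding filtration_def by (rule bimod.span_base) blast

lemma filtration_induct [consumes 1, case_names zero add scale tensor]:
  assumes "p \<in> filtration k n" "P 0" "\<And>p q. P p \<Longrightarrow> P q \<Longrightarrow> P (p + q)" "\<And>c p. P p \<Longrightarrow> P (scale_bimod c p)"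
    "\<And>p q r i. r \<le> n \<Longrightarrow> length (snd p) + length (snd q) \<ge> k \<Longrightarrow>
      P (tensor (path_elem p) (n, r, i) (path_elem q))"
  shows "P p"
  using assms(1) unfolding filtration_def
proof (induction rule: bimod.span_induct_alt)
  case (step c p q)
  then show ?case using assms(3-5) by blast
qed (rule assms(2))

lemma filtration_antimono: "k' \<le> k \<Longrightarrow> filtration k n \<subseteq> filtration k' n"
  unfolding filtration_def by (rule bimod.span_mono) fastforce

lemma path_elem_zero_long:
  "length (snd p) > 2 * CARD('n) \<Longrightarrow> (path_elem p :: ('k::field, 'n::finite, 'm::nontriv) alg) = 0"
  using path_elem_normal_form[of "fst p" "snd p" "\<lambda>_. 0", where 'k = 'k and 'n = 'n]
  by (auto simp: normal_words_def)

lemma filtration_zero: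
  assumes "p \<in> (filtration (4 * CARD('n) + 1) n :: ('k::field, 'n::finite, 'm::nontriv) bimod set)"
  shows "p = 0"
  using assms
proof (induction rule: filtration_induct)
  case (tensor p q r i)
  then have "length (snd p) > 2 * CARD('n) \<or> length (snd q) > 2 * CARD('n)" by linarith
  then have "(path_elem p :: ('k, 'n, 'm) alg) = 0 \<or> (path_elem q :: ('k, 'n, 'm) alg) = 0"
    using path_elem_zero_long by blast
  then show ?case by auto
qed simp_all

lemma component_subset_filtration: "component n \<subseteq> filtration 0 n"
proof
  fix p :: "('a, 'b, 'c) bimod" assume "p \<in> component n"
  then show "p \<in> filtration 0 n"
  proof (induction rule: component_induct)
    case (tensor x r i y)
    show ?case
    proof (induction x rule: alg_induct)
      case (path c p)
      show ?case
      proof (induction y rule: alg_induct)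
        case (path d q)
        show ?case using tensor
          by (simp add: tensor_scale_left tensor_scale_right filtration_closed filtration_base)
      qed (simp_all add: filtration_closed tensor_add_right)
    qed (simp_all add: filtration_closed tensor_add_left)
  qed (simp_all add: filtration_closed)
qed

lemma filtration_mult:
  assumes "q \<in> filtration k n"
  shows "left_mult (path_elem u) (right_mult q (path_elem v)) \<in> filtration (length (snd u) + k + length (snd v)) n"
  using assms
proof (induction rule: filtration_induct)
  case (tensor p q r i)
  show ?case
  proof (cases "path_target u = fst p \<and> path_target q = fst v")
    case True
    then show ?thesis using tensor
      by (simp add: path_elem_mult filtration_base del: path_target.simps)
  qed (auto simp: path_elem_mult filtration_closed simp del: path_target.simps)
qed (simp_all add: filtration_closed)

lemma filtration_gtensor:
  "gtensor (word_sum u) n r i (word_sum v) \<in> filtration (length u + length v) n"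
proof (cases "0 \<le> r \<and> r \<le> int n")
  case True
  have "tensor (path_elem (a, u)) (n, nat r, i) (word_sum v) \<in> filtration (length u + length v) n" for a
    unfolding word_sum_def lin_sum[of scale_alg scale_bimod "tensor x g" for x g, unfolded lin_def,
        OF conjI, OF allI[OF allI[OF tensor_add_right]] allI[OF allI[OF tensor_scale_right]]]
    using True by (intro filtration_closed filtration_base) auto
  then have "tensor (word_sum u) (n, nat r, i) (word_sum v) \<in> filtration (length u + length v) n"
    unfolding word_sum_def[of u] lin_sum[of scale_alg scale_bimod "\<lambda>x. tensor x g y" for g y, unfolded lin_def,
        OF conjI, OF allI[OF allI[OF tensor_add_left]] allI[OF allI[OF tensor_scale_left]]]
    by (intro filtration_closed)
  then show ?thesis using True by (simp add: gtensor_def)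
next
  case False
  then show ?thesis by (auto simp: gtensor_def filtration_closed)
qed

text \<open>The bound 1 is the minimality of the resolution. For a middle label all terms have total
  length 2N - 1, and \<open>psi_step\<close> depends on this.\<close>

lemma diff_gen_filtration:
  "(diff_gen (Suc n) r i :: ('k::field, 'n::finite, 'm::nontriv) bimod)
    \<in> filtration (if Suc n = 2 * r then 2 * CARD('n) - 1 else 1) n"
proof -
  have N: "2 * CARD('n) - 1 = Suc (2 * (CARD('n) - 1))"
    using zero_less_card_finite[where 'a = 'n] by linarith
  have g: "(gtensor (word_sum u) n r i (word_sum v) :: ('k, 'n, 'm) bimod) \<in> filtration k n"
    if "k \<le> length u + length v" for k u v r i
    using filtration_gtensor filtration_antimono[OF that] by blast
  have one: "(1 :: ('k, 'n, 'm) alg) = word_sum []" by (simp add: word_sum_Nil)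
  show ?thesis
    unfolding diff_gen_words Let_def N one
    by (auto intro!: filtration_closed g simp del: alternating.simps)
qed

section \<open>Coefficients of 1 \<otimes> g \<otimes> w\<close>

lemma coeff_at_idem:
  "coeff_at i s 0 (x * idem j) = (if j = i then coeff_at i s 0 x else 0)"
  "coeff_at i s L (idem j * x) = (if j = i then coeff_at i s L x else 0)"
proof -
  show "coeff_at i s 0 (x * idem j) = (if j = i then coeff_at i s 0 x else 0)"
  proof (induction x rule: alg_induct)
    case (path c p)
    then show ?case
      by (cases p) (auto simp: scale_alg_mult_left path_elem_idem coeff_at_scale coeff_at_path_elem)
  qed (auto simp: distrib_right coeff_at_add)
  show "coeff_at i s L (idem j * x) = (if j = i then coeff_at i s L x else 0)"
  proof (induction x rule: alg_induct)
    case (path c p)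
    then show ?case
      by (cases p) (auto simp: scale_alg_mult_right path_elem_idem coeff_at_scale coeff_at_path_elem)
  qed (auto simp: distrib_left coeff_at_add)
qed

text \<open>The coefficient of \<open>1 \<otimes> g \<otimes> w\<close>, where \<open>w\<close> is the alternating word of length \<open>L\<close> starting with \<open>s\<close>.\<close>

definition coeff_bimod :: "'m::nontriv label \<Rightarrow> step \<Rightarrow> nat \<Rightarrow> ('k::field, 'n::finite, 'm) bimod \<Rightarrow> 'k" where
  "coeff_bimod g s L p = lin_ext (*) (\<lambda>(x, g', y).
     if g' = g then coeff_at (source g) Fwd 0 x * coeff_at (target g) s L y else 0) (rep_bimod p)"

lemma vector_space_field: "vector_space ((*) :: 'k::field \<Rightarrow> 'k \<Rightarrow> 'k)"
  by standard (simp_all add: algebra_simps)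

lemma coeff_bimod_abs:
  "coeff_bimod g s L (abs_bimod u) = lin_ext (*) (\<lambda>(x, g', y).
     if g' = g then coeff_at (source g) Fwd 0 x * coeff_at (target g) s L y else 0) u"
proof -
  have bal: "balanced (*) (\<lambda>(x, g', y).
     if g' = g then coeff_at (source g) Fwd 0 x * coeff_at (target g) s L y else 0)"
    unfolding balanced_def prod.case
    by (auto simp: coeff_at_add coeff_at_scale coeff_at_idem algebra_simps simp del: source.simps target.simps)
  have "abs_bimod (rep_bimod (abs_bimod u)) = abs_bimod u" by (rule Quotient3_abs_rep[OF Quotient3_bimod])
  then have "rep_bimod (abs_bimod u) - u \<in> module.span free_scale tensor_relations"
    by (simp add: bimod.abs_eq_iff)
  from lin_ext_balanced[OF vector_space_field bal this] show ?thesis by (simp add: coeff_bimod_def)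
qed

lemma lin_coeff_bimod: "lin scale_bimod (*) (coeff_bimod g s L)"
  unfolding lin_def
proof (intro conjI allI)
  fix p q :: "('a, 'b, 'c) bimod" and c
  obtain u where u: "p = abs_bimod u" by (rule abs_bimod_cases)
  obtain v where v: "q = abs_bimod v" by (rule abs_bimod_cases)
  show "coeff_bimod g s L (p + q) = coeff_bimod g s L p + coeff_bimod g s L q"
    by (simp only: u v plus_bimod.abs_eq coeff_bimod_abs lin_ext_add[OF vector_space_field])
  show "coeff_bimod g s L (scale_bimod c p) = c * coeff_bimod g s L p"
    by (simp only: u scale_bimod.abs_eq coeff_bimod_abs lin_ext_scale[OF vector_space_field])
qed

lemmas coeff_bimod_0 [simp] = lin_0[OF lin_coeff_bimod]
lemmas coeff_bimod_add = lin_coeff_bimod[unfolded lin_def, THEN conjunct1, rule_format]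
lemmas coeff_bimod_scale = lin_coeff_bimod[unfolded lin_def, THEN conjunct2, rule_format]
lemmas coeff_bimod_diff = lin_diff[OF lin_coeff_bimod]
lemmas coeff_bimod_sum = lin_sum[OF lin_coeff_bimod]

lemma coeff_bimod_tensor:
  "coeff_bimod g s L (tensor x g' y) =
    (if g' = g then coeff_at (source g) Fwd 0 x * coeff_at (target g) s L y else 0)"
  unfolding tensor.abs_eq coeff_bimod_abs by (simp add: triple_def lin_ext_single[OF vector_space_field])

lemma coeff_bimod_filtration:
  assumes "p \<in> filtration k n" "L < k" "L < 2 * CARD('n)"
  shows "coeff_bimod g s L (p :: ('k::field, 'n::finite, 'm::nontriv) bimod) = 0"
  using assms(1)
proof (induction rule: filtration_induct)
  case (tensor p q r i)
  then show ?case using assms(2,3)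
    by (cases p; cases q; cases g)
       (auto simp: coeff_bimod_tensor coeff_at_path_elem simp del: source.simps target.simps)
qed (simp_all add: coeff_bimod_add coeff_bimod_scale)

lemma coeff_at_word_sum:
  fixes x :: "('k::field, 'n::finite, 'm::nontriv) alg"
  shows "w \<noteq> [] \<Longrightarrow> coeff_at i Fwd 0 (x * word_sum w) = 0"
    and "0 < L \<Longrightarrow> L < 2 * CARD('n) \<Longrightarrow> coeff_at i s L (alt_word (flip s) (Suc L') * x) = 0"
    and "L < 2 * CARD('n) \<Longrightarrow> coeff_at i s L (alt_word s L * x) =
      coeff_at (i + sum_list (map shift (alternating s L))) Fwd 0 x"
proof -
  show "coeff_at i Fwd 0 (x * word_sum w) = 0" if "w \<noteq> []"
  proof (induction x rule: alg_induct)
    case (path c p)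
    then show ?case using that
      by (simp add: scale_alg_mult_left path_elem_word_sum coeff_at_scale coeff_at_path_elem)
  qed (simp_all add: distrib_right coeff_at_add)
  show "coeff_at i s L (alt_word (flip s) (Suc L') * x) = 0" if "0 < L" "L < 2 * CARD('n)"
  proof (induction x rule: alg_induct)
    case (path c p)
    obtain j w where p: "p = (j, w)" by (cases p)
    have "alternating (flip s) (Suc L') @ w \<noteq> alternating s L"
      using that(1) by (cases L) auto
    then show ?case using that
      by (simp add: p scale_alg_mult_right word_sum_path_elem coeff_at_scale coeff_at_path_elem del: alternating.simps)
  qed (simp_all add: distrib_left coeff_at_add)
  show "coeff_at i s L (alt_word s L * x) = coeff_at (i + sum_list (map shift (alternating s L))) Fwd 0 x"
    if "L < 2 * CARD('n)"
  proof (induction x rule: alg_induct)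
    case (path c p)
    obtain j w where p: "p = (j, w)" by (cases p)
    show ?case using that
      by (auto simp add: p scale_alg_mult_right word_sum_path_elem coeff_at_scale coeff_at_path_elem)
  qed (simp_all add: distrib_left coeff_at_add)
qed

lemma shift_alternating_odd: "sum_list (map shift (alternating s (Suc (2 * k)))) = (shift s :: 'a::ring_1)"
proof -
  have "sum_list (map shift (alternating s (2 * k))) = (0 :: 'a)" for s
    by (induction k) (simp_all add: shift_flip_0)
  then show ?thesis by simp
qed

text \<open>
  Every coefficient of \<open>1 \<otimes> g \<otimes> 1\<close> can be read off from the differential. This makes up for the
  minimality argument, in which the linear terms of the differential are inspected.
\<close>

lemma coeff_bimod_differential:
  assumes r': "r' \<le> Suc n"
  shows "\<exists>g s L \<sigma>. (\<sigma> :: 'k::field) \<noteq> 0 \<and> L = (if Suc n = 2 * r' then 2 * CARD('n) - 1 else 1) \<and>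
     (\<forall>p :: ('k, 'n::finite, 'm::nontriv) bimod. p \<in> component (Suc n) \<longrightarrow>
        coeff_bimod g s L (differential p) = \<sigma> * coeff_bimod (Suc n, r', j) Fwd 0 p)"
proof -
  obtain k where k: "CARD('n) = Suc k" using gr0_implies_Suc[of "CARD('n)"] by auto
  \<comment> \<open>(n, \<rho>, j), s and L describe one term 1 \<otimes> g \<otimes> w of the
    differential of (n + 1, r', j): the one where w is a single arrow, or for a middle label the one
    with l = 0 that begins with \<open>Fwd\<close>. Its sign is \<sigma>.\<close>
  define s where "s = (if Suc n < 2 * r' then Bwd else Fwd)"
  define \<rho> where "\<rho> = (if Suc n < 2 * r' then r' - 1 else r')"
  define L where "L = (if Suc n = 2 * r' then 2 * CARD('n) - 1 else 1)"
  define \<sigma> :: 'k where "\<sigma> = (if Suc n < 2 * r' then (- 1) ^ Suc n else 1)"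
  have L: "0 < L" "L < 2 * CARD('n)" by (auto simp: L_def k)
  obtain l where l: "L = Suc (2 * l)" by (rule that[of "if Suc n = 2 * r' then k else 0"]) (simp add: L_def k)
  have tgt: "target (n, \<rho>, j) + sum_list (map shift (alternating s L)) = target (Suc n, r', j)"
  proof -
    have "(of_nat (r' - 1) :: 'm mod_ring) = of_nat r' - 1" if "Suc n < 2 * r'"
      using that by (simp add: of_nat_diff)
    then show ?thesis
      unfolding l shift_alternating_odd by (simp add: s_def \<rho>_def algebra_simps)
  qed
  have gt: "coeff_bimod (n, \<rho>, j) s L (gtensor (x * u) n r i y) = 0"
    if "\<And>i. coeff_at i Fwd 0 (x * u) = 0" for x u y :: "('k, 'n, 'm) alg" and r i
    by (simp add: gtensor_def coeff_bimod_tensor that)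
  have gt': "coeff_bimod (n, \<rho>, j) s L (gtensor x n r i (v * y)) = 0"
    if "\<And>i. coeff_at i s L (v * y) = 0" for x v y :: "('k, 'n, 'm) alg" and r i
    by (simp add: gtensor_def coeff_bimod_tensor that)
  have "coeff_bimod (n, \<rho>, j) s L (differential p) = \<sigma> * coeff_bimod (Suc n, r', j) Fwd 0 p"
    if "p \<in> component (Suc n)" for p :: "('k, 'n, 'm) bimod"
    using that
  proof (induction rule: component_induct)
    case (tensor x r i y)
    let ?c = "coeff_bimod (n, \<rho>, j) s L :: ('k, 'n, 'm) bimod \<Rightarrow> 'k"
    have \<rho>n: "\<rho> \<le> n" using r' by (auto simp: \<rho>_def)
    \<comment> \<open>The functional sees only terms with a trivial path on the left and a right
      factor that begins with s.\<close>
    have left0: "?c (gtensor (x * word_sum w) n a b z) = 0" if "w \<noteq> []" for w a b z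
      by (rule gt) (simp add: coeff_at_word_sum(1)[OF that])
    have right0: "?c (gtensor x n a b (alt_word (flip s) (Suc M) * y)) = 0" for M a b
      by (rule gt') (rule coeff_at_word_sum(2)[OF L])
    have miss: "?c (gtensor z n a b v) = 0" if "a \<noteq> int \<rho> \<or> b \<noteq> j" for z a b v
      using that by (auto simp: gtensor_def coeff_bimod_tensor)
    have hit: "?c (gtensor x n (int \<rho>) j (alt_word s L * y)) = coeff_bimod (Suc n, r', j) Fwd 0 (tensor x (Suc n, r', j) y)"
      using \<rho>n coeff_at_word_sum(3)[OF L(2), of "target (n, \<rho>, j)" s y, unfolded tgt]
      by (simp add: gtensor_def coeff_bimod_tensor del: target.simps)
    have R: "coeff_bimod (Suc n, r', j) Fwd 0 (tensor x (Suc n, r, i) y) =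
        (if r = r' \<and> i = j then coeff_bimod (Suc n, r', j) Fwd 0 (tensor x (Suc n, r', j) y) else 0)"
      by (simp add: coeff_bimod_tensor)
    have one: "2 * CARD('n) - 1 = Suc (2 * k)" by (simp add: k)
    consider "Suc n > 2 * r" | "Suc n < 2 * r" | "Suc n = 2 * r" by linarith
    then show ?case
    proof cases
      case 1
      have "?c (differential (tensor x (Suc n, r, i) y)) =
          ?c (gtensor x n (int r) i (alt_word Fwd (Suc 0) * y))
          + (- 1) ^ Suc n * ?c (gtensor x n (int r - 1) i (alt_word Bwd (Suc (2 * k)) * y))"
        using 1 unfolding differential_tensor diff_gen_words Let_def k
        by (simp add: signed_def coeff_bimod_add coeff_bimod_diff coeff_bimod_scale left0)
      moreover have "?c (gtensor x n (int r - 1) i (alt_word Bwd (Suc (2 * k)) * y)) = 0"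
      proof (cases "s = Fwd")
        case True
        then show ?thesis using right0[of "int r - 1" i "2 * k"] by simp
      next
        case False
        then show ?thesis using 1 r' by (intro miss) (auto simp: s_def \<rho>_def split: if_splits)
      qed
      moreover have "?c (gtensor x n (int r) i (alt_word Fwd (Suc 0) * y)) =
          \<sigma> * (if r = r' \<and> i = j then coeff_bimod (Suc n, r', j) Fwd 0 (tensor x (Suc n, r', j) y) else 0)"
      proof (cases "Suc n < 2 * r'")
        case True
        then have "s = Bwd" "r \<noteq> r'" using 1 by (auto simp: s_def)
        then show ?thesis using right0[of "int r" i 0] by simp
      next
        case False
        then have s: "s = Fwd" "\<rho> = r'" "\<sigma> = 1" by (auto simp: s_def \<rho>_def \<sigma>_def)
        show ?thesis
        proof (cases "r = r' \<and> i = j")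
          case True
          then show ?thesis using hit 1 s by (simp add: L_def)
        next
          case False
          then show ?thesis using s by (subst miss) auto
        qed
      qed
      ultimately show ?thesis unfolding R by simp
    next
      case 2
      have "?c (differential (tensor x (Suc n, r, i) y)) =
          ?c (gtensor x n (int r) i (alt_word Fwd (Suc (2 * k)) * y))
          + (- 1) ^ Suc n * ?c (gtensor x n (int r - 1) i (alt_word Bwd (Suc 0) * y))"
        using 2 unfolding differential_tensor diff_gen_words Let_def k
        by (simp add: signed_def coeff_bimod_add coeff_bimod_diff coeff_bimod_scale left0)
      moreover have "?c (gtensor x n (int r) i (alt_word Fwd (Suc (2 * k)) * y)) = 0"
      proof (cases "s = Bwd")
        case True
        then show ?thesis using right0[of "int r" i "2 * k"] by simp
      next
        case False
        then show ?thesis using 2 r' by (intro miss) (auto simp: s_def \<rho>_def split: if_splits)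
      qed
      moreover have "(- 1) ^ Suc n * ?c (gtensor x n (int r - 1) i (alt_word Bwd (Suc 0) * y)) =
          \<sigma> * (if r = r' \<and> i = j then coeff_bimod (Suc n, r', j) Fwd 0 (tensor x (Suc n, r', j) y) else 0)"
      proof (cases "Suc n < 2 * r'")
        case False
        then have "s = Fwd" "r \<noteq> r'" using 2 by (auto simp: s_def)
        then show ?thesis using right0[of "int r - 1" i 0] by simp
      next
        case True
        then have s: "s = Bwd" "\<rho> = r' - 1" "\<sigma> = (- 1) ^ Suc n" by (auto simp: s_def \<rho>_def \<sigma>_def)
        have \<rho>': "int \<rho> = int r' - 1" using True s by (simp add: of_nat_diff)
        show ?thesis
        proof (cases "r = r' \<and> i = j")
          case rj: True
          then show ?thesis using hit True s \<rho>' by (simp add: L_def)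
        next
          case False
          then show ?thesis using \<rho>' by (subst miss) auto
        qed
      qed
      ultimately show ?thesis unfolding R by simp
    next
      case 3
      have "?c (differential (tensor x (Suc n, r, i) y)) =
          (\<Sum>l<Suc k. ?c (gtensor (x * alt_word Bwd (2 * l)) n (int r) i (alt_word Fwd (Suc (2 * (Suc k - 1 - l))) * y))
            + ?c (gtensor (x * alt_word Fwd (2 * l)) n (int r - 1) i (alt_word Bwd (Suc (2 * (Suc k - 1 - l))) * y)))"
        using 3 unfolding differential_tensor diff_gen_words Let_def k
        by (simp add: signed_def coeff_bimod_add coeff_bimod_diff coeff_bimod_scale coeff_bimod_sum left0 del: alternating.simps(2) sum.lessThan_Suc)
           (simp add: left0 del: sum.lessThan_Suc)
      also have "\<dots> = ?c (gtensor (x * alt_word Bwd (2 * 0)) n (int r) i (alt_word Fwd (Suc (2 * (Suc k - 1 - 0))) * y))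
            + ?c (gtensor (x * alt_word Fwd (2 * 0)) n (int r - 1) i (alt_word Bwd (Suc (2 * (Suc k - 1 - 0))) * y))"
      proof (rule sum_only_first)
        fix l :: nat assume "0 < l"
        then have "alternating t (2 * l) \<noteq> []" for t by (metis length_alternating list.size(3) mult_is_0 neq0_conv zero_neq_numeral)
        then show "?c (gtensor (x * alt_word Bwd (2 * l)) n (int r) i (alt_word Fwd (Suc (2 * (Suc k - 1 - l))) * y))
            + ?c (gtensor (x * alt_word Fwd (2 * l)) n (int r - 1) i (alt_word Bwd (Suc (2 * (Suc k - 1 - l))) * y)) = 0"
          by (simp add: left0 del: alternating.simps)
      qed
      also have "\<dots> = ?c (gtensor x n (int r) i (alt_word Fwd (Suc (2 * k)) * y))
            + ?c (gtensor x n (int r - 1) i (alt_word Bwd (Suc (2 * k)) * y))"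
        by (simp add: word_sum_Nil)
      also have "?c (gtensor x n (int r - 1) i (alt_word Bwd (Suc (2 * k)) * y)) = 0"
      proof (cases "s = Fwd")
        case True
        then show ?thesis using right0[of "int r - 1" i "2 * k"] by simp
      next
        case False
        then show ?thesis using 3 r' by (intro miss) (auto simp: s_def \<rho>_def split: if_splits)
      qed
      also have "?c (gtensor x n (int r) i (alt_word Fwd (Suc (2 * k)) * y)) =
          \<sigma> * (if r = r' \<and> i = j then coeff_bimod (Suc n, r', j) Fwd 0 (tensor x (Suc n, r', j) y) else 0)"
      proof (cases "Suc n < 2 * r'")
        case True
        then have "s = Bwd" "r \<noteq> r'" using 3 by (auto simp: s_def)
        then show ?thesis using right0[of "int r" i "2 * k"] by simp
      next
        case False
        then have s: "s = Fwd" "\<rho> = r'" "\<sigma> = 1" by (auto simp: s_def \<rho>_def \<sigma>_def)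
        show ?thesis
        proof (cases "r = r' \<and> i = j")
          case True
          then have LL: "L = Suc (2 * k)" using 3 by (simp add: L_def k)
          show ?thesis using hit True s unfolding LL by (simp del: alternating.simps)
        next
          case False
          then show ?thesis using s by (subst miss) auto
        qed
      qed
      finally show ?thesis unfolding R by simp
    qed
  qed (simp_all add: differential_linear coeff_bimod_add coeff_bimod_scale algebra_simps)
  moreover have "\<sigma> \<noteq> 0" by (simp add: \<sigma>_def)
  ultimately show ?thesis using L_def by blast
qed

lemma coeff_bimod_one:
  "coeff_bimod (n, r', j) Fwd 0 (tensor 1 (n, r'', j') 1 :: ('k::field, 'n::finite, 'm::nontriv) bimod) =
      (if (r'', j') = (r', j) then 1 else 0)"
proof -
  have "coeff_at i Fwd 0 (1 :: ('k, 'n, 'm) alg) = 1" for i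
    using coeff_at_idem(1)[of i Fwd "1 :: ('k, 'n, 'm) alg" i]
    by (simp add: idem_path_elem coeff_at_path_elem)
  then show ?thesis by (auto simp: coeff_bimod_tensor)
qed

text \<open>Modulo \<open>filtration 1\<close> only the elements 1 \<otimes> g \<otimes> 1 remain,
  and D is the projection to their span.\<close>

lemma filtration_1I:
  assumes p: "p \<in> component n"
    and 0: "\<And>r i. r \<le> n \<Longrightarrow> coeff_bimod (n, r, i) Fwd 0 p = 0"
  shows "(p :: ('k::field, 'n::finite, 'm::nontriv) bimod) \<in> filtration 1 n"
proof -
  let ?G = "{..n} \<times> (UNIV :: 'm mod_ring set)"
  define D where "D p = (\<Sum>(r, i)\<in>?G. scale_bimod (coeff_bimod (n, r, i) Fwd 0 p) (tensor 1 (n, r, i) 1 :: ('k, 'n, 'm) bimod))"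
    for p :: "('k, 'n, 'm) bimod"
  have lin_D: "lin scale_bimod scale_bimod D"
    by (simp add: D_def lin_def coeff_bimod_add coeff_bimod_scale bimod.scale_left_distrib sum.distrib
        case_prod_beta' bimod.scale_sum_right)
  have "p - D p \<in> filtration 1 n"
    using p[THEN component_subset_filtration[THEN subsetD]]
  proof (induction rule: filtration_induct)
    case zero
    show ?case by (simp add: lin_0[OF lin_D] filtration_closed)
  next
    case (add p q)
    have "p + q - D (p + q) = (p - D p) + (q - D q)" using lin_D by (simp add: lin_def)
    then show ?case using add by (simp only: filtration_closed)
  next
    case (scale c p)
    have "scale_bimod c p - D (scale_bimod c p) = scale_bimod c (p - D p)"
      using lin_D by (simp add: lin_def bimod.scale_right_diff_distrib)
    then show ?case using scale by (simp only: filtration_closed)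
  next
    case (tensor u v r i)
    obtain a w b w' where uv: "u = (a, w)" "v = (b, w')" by (cases u, cases v)
    show ?case
    proof (cases "w = [] \<and> w' = []")
      case False
      have "coeff_bimod (n, r', j) Fwd 0 (tensor (path_elem u) (n, r, i) (path_elem v) :: ('k, 'n, 'm) bimod) = 0" for r' j
        using False by (auto simp: uv coeff_bimod_tensor coeff_at_path_elem)
      then have "D (tensor (path_elem u) (n, r, i) (path_elem v)) = 0" by (auto simp: D_def intro: sum.neutral)
      moreover have "1 \<le> length (snd u) + length (snd v)"
        using False by (cases w; cases w') (simp_all add: uv)
      ultimately show ?thesis
        using filtration_base[OF tensor(1), of 1 u v i] by simp
    next
      case True
      let ?t = "target (n, r, i)"
      have e: "path_elem u = (idem a :: ('k, 'n, 'm) alg)" "path_elem v = (idem b :: ('k, 'n, 'm) alg)"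
        using True by (simp_all add: uv idem_path_elem)
      have t: "tensor (idem a) (n, r, i) (idem b) =
          (if a = i \<and> b = ?t then tensor 1 (n, r, i) 1 else 0 :: ('k, 'n, 'm) bimod)"
        using tensor_idem_left[of 1 a "(n, r, i)" "idem b"] tensor_idem_right[of 1 "(n, r, i)" b 1]
        by (cases "a = i"; cases "b = ?t") (simp_all del: target.simps)
      have "D (tensor (idem a) (n, r, i) (idem b)) =
          (\<Sum>x\<in>?G. if x = (r, i) then tensor (idem a) (n, r, i) (idem b) else 0)"
        unfolding D_def by (rule sum.cong) (auto simp: coeff_bimod_one t split: if_splits simp del: target.simps)
      also have "\<dots> = tensor (idem a) (n, r, i) (idem b)"
        using tensor(1) by simp
      finally show ?thesis unfolding e by (simp add: filtration_closed)
    qed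
  qed
  moreover have "D p = 0" using 0 by (auto simp: D_def intro: sum.neutral)
  ultimately show ?thesis by simp
qed

lemma coeff_augmentation:
  assumes "p \<in> component 0"
  shows "coeff_at j Fwd 0 (augmentation p) = coeff_bimod (0, 0, j) Fwd 0 (p :: ('k::field, 'n::finite, 'm::nontriv) bimod)"
  using assms[THEN component_subset_filtration[THEN subsetD]]
proof (induction rule: filtration_induct)
  case (tensor u v r i)
  have [simp]: "path_target (j, []) = j" for j :: "'m mod_ring" by simp
  show ?case using tensor
    by (cases u; cases v)
       (auto simp: augmentation_def evaluate_tensor coeff_bimod_tensor coeff_at_path_elem path_elem_idem
          path_elem_mult idem_mult mult.assoc simp del: path_target.simps)
qed (simp_all add: augmentation_def coeff_at_add coeff_at_scale evaluate_add evaluate_scale coeff_bimod_add coeff_bimod_scale)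

lemma coeff_bimod_parallel:
  "coeff_bimod (n, r', j) Fwd 0 (left_mult (idem a) (right_mult p (idem b))) =
    (if j = a \<and> target (n, r', j) = b then coeff_bimod (n, r', j) Fwd 0 p else 0)"
proof (induction p rule: bimod_induct)
  case (tensor x g y)
  show ?case by (auto simp: coeff_bimod_tensor coeff_at_idem simp del: target.simps)
qed (auto simp: coeff_bimod_add simp del: target.simps)

context
  includes mod_ring.lifting
begin

lemma of_int_mod_ring_eq_0_iff: "(of_int k :: 'm::nontriv mod_ring) = 0 \<longleftrightarrow> int CARD('m) dvd k"
proof -
  have "to_int_mod_ring (of_int_mod_ring k :: 'm mod_ring) = k mod int CARD('m)"
    by (simp add: to_int_mod_ring.rep_eq of_int_mod_ring.rep_eq)
  then show ?thesis
    unfolding of_int_of_int_mod_ring by (metis dvd_eq_mod_eq_0 to_int_mod_ring_hom.hom_0_iff)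
qed

end

text \<open>For a label parallel to the middle one, m divides 2 (r' - r), hence r' - r as m is odd,
  while the absolute value of r' - r is at most n/2 < m. In degree n = 2m this breaks down: r = 0, m
  and 2m have the same target.\<close>

lemma target_eq_mid:
  fixes i :: "'m::nontriv mod_ring"
  assumes "odd CARD('m)" "n = 2 * r'" "target (n, r', i) = target (n, r, i)" "r \<le> n"
    "n < 2 * CARD('m)"
  shows "r = r'"
proof -
  have "(of_int (2 * (int r' - int r)) :: 'm mod_ring) = 0"
    using assms(2,3) by (simp add: algebra_simps)
  then have "int CARD('m) dvd 2 * (int r' - int r)"
    by (simp only: of_int_mod_ring_eq_0_iff)
  then have "int CARD('m) dvd int r' - int r"
    using assms(1) coprime_dvd_mult_right_iff[of "int CARD('m)" 2 "int r' - int r"] by simp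
  moreover have "\<bar>int r' - int r\<bar> < int CARD('m)" using assms(2,4,5) by linarith
  ultimately show ?thesis
    by (metis abs_of_nat dvd_imp_le_int eq_iff_diff_eq_0 linorder_not_le of_nat_eq_iff)
qed

lemma tensor_one_component: "r \<le> n \<Longrightarrow> tensor 1 (n, r, i) 1 \<in> component n"
  using gtensor_component[of 1 n "int r" i 1] by (simp add: gtensor_def)

lemma evaluate_eqI:
  fixes \<theta> :: "('k::field, 'n::finite, 'm::nontriv) bimod \<Rightarrow> ('k, 'n, 'm) alg"
  assumes "\<And>p q. \<theta> (p + q) = \<theta> p + \<theta> q" "\<And>x p y. \<theta> (left_mult x (right_mult p y)) = x * \<theta> p * y"
  shows "\<theta> p = evaluate (\<lambda>g. \<theta> (tensor 1 g 1)) p"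
proof (induction p rule: bimod_induct)
  case zero
  show ?case using assms(1)[of 0 0] by simp
next
  case (tensor x g y)
  have "tensor x g y = left_mult (x * idem (source g)) (right_mult (tensor 1 g 1) (idem (target g) * y))"
    using tensor_idem_left[of x "source g" g y] tensor_idem_right[of "x * idem (source g)" g "target g" y]
    by (simp del: source.simps target.simps)
  then have "\<theta> (tensor x g y) = x * idem (source g) * \<theta> (tensor 1 g 1) * (idem (target g) * y)"
    using assms(2) by metis
  then show ?case by (simp add: evaluate_tensor mult.assoc)
qed (simp add: assms(1) evaluate_add)

section \<open>Nilpotence of \<psi> = \<pi> \<circ> \<iota> - 1\<close>

context
  fixes \<pi> :: "('k::field, 'n::finite, 'm::nontriv) alg list \<Rightarrow> ('k, 'n, 'm) bimod"
  assumes \<pi>: "comparison_map \<pi>" and m: "odd CARD('m)"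
begin

lemma psi_filtration:
  assumes "\<And>r i. r \<le> n \<Longrightarrow> psi \<pi> n (tensor 1 (n, r, i) 1) \<in> filtration 1 n" "q \<in> filtration k n"
  shows "psi \<pi> n q \<in> filtration (Suc k) n"
  using assms(2)
proof (induction rule: filtration_induct)
  case (tensor u v r i)
  have "psi \<pi> n (tensor (path_elem u) (n, r, i) (path_elem v)) =
      left_mult (path_elem u) (right_mult (psi \<pi> n (tensor 1 (n, r, i) 1)) (path_elem v))"
    using psi_mult[OF \<pi>, of n "path_elem u" "tensor 1 (n, r, i) 1" "path_elem v"] by simp
  also have "\<dots> \<in> filtration (length (snd u) + 1 + length (snd v)) n"
    by (rule filtration_mult[OF assms(1)[OF tensor(1)]])
  also have "\<dots> \<subseteq> filtration (Suc k) n"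
    by (rule filtration_antimono) (use tensor(2) in simp)
  finally show ?case .
qed (use lin_psi[OF \<pi>, of n] in \<open>simp_all add: lin_0[OF lin_psi[OF \<pi>]] lin_def filtration_closed\<close>)

lemma component_scale: "p \<in> component n \<Longrightarrow> scale_bimod c p \<in> component n"
  by (simp add: component_def bimod.span_scale)

text \<open>A coefficient of 1 \<otimes> g \<otimes> 1 in \<psi> of a label would show up in its
  differential at length L. But \<partial> \<psi> = \<psi> \<partial>, the differential of the label
  lies in \<open>filtration L\<close>, and \<psi> raises the filtration by one. The assumption
  \<open>mid\<close> excludes the combination of L = 2N - 1 with a label whose differential is only
  known to start at length 1.\<close>

lemma psi_step:
  assumes IH: "\<And>r i. r \<le> n \<Longrightarrow> psi \<pi> n (tensor 1 (n, r, i) 1) \<in> filtration 1 n"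
    and r: "r \<le> Suc n" "r' \<le> Suc n" and mid: "Suc n \<noteq> 2 * r' \<or> Suc n = 2 * r"
  shows "coeff_bimod (Suc n, r', j) Fwd 0 (psi \<pi> (Suc n) (tensor 1 (Suc n, r, i) 1)) = 0"
proof -
  let ?t = "tensor 1 (Suc n, r, i) 1 :: ('k, 'n, 'm) bimod"
  obtain g s L \<sigma> where \<sigma>: "\<sigma> \<noteq> (0 :: 'k)" "L = (if Suc n = 2 * r' then 2 * CARD('n) - 1 else 1)"
    "\<And>p :: ('k, 'n, 'm) bimod. p \<in> component (Suc n) \<Longrightarrow>
        coeff_bimod g s L (differential p) = \<sigma> * coeff_bimod (Suc n, r', j) Fwd 0 p"
    using coeff_bimod_differential[OF r(2), of j, where 'k = 'k and 'n = 'n] by blast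
  have t: "?t \<in> component (Suc n)" by (rule tensor_one_component[OF r(1)])
  have N: "CARD('n) > 0" by simp
  have "differential ?t = diff_gen (Suc n) r i" by (simp add: differential_tensor)
  also have "\<dots> \<in> filtration L n"
  proof (cases "Suc n = 2 * r'")
    case True
    then show ?thesis using diff_gen_filtration[of n r i, where 'k = 'k and 'n = 'n] mid by (simp add: \<sigma>(2))
  next
    case False
    have "1 \<le> (if Suc n = 2 * r then 2 * CARD('n) - 1 else 1)"
      using N by (cases "CARD('n)") auto
    from filtration_antimono[OF this] show ?thesis
      using diff_gen_filtration[of n r i, where 'k = 'k and 'n = 'n] False by (auto simp add: \<sigma>(2))
  qed
  finally have "differential ?t \<in> filtration L n" .
  from psi_filtration[OF IH this] have "psi \<pi> n (differential ?t) \<in> filtration (Suc L) n" by simp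
  moreover have "L < 2 * CARD('n)" using N by (cases "CARD('n)") (auto simp: \<sigma>(2))
  ultimately have "coeff_bimod g s L (psi \<pi> n (differential ?t)) = 0"
    by (intro coeff_bimod_filtration[of _ "Suc L" n]) auto
  then have "coeff_bimod g s L (differential (psi \<pi> (Suc n) ?t)) = 0"
    by (simp add: differential_psi[OF \<pi> t])
  then show ?thesis using \<sigma>(1,3) psi_component[OF \<pi> t] by simp
qed

lemma psi_parallel:
  assumes "r' \<le> n" "\<not> (j = i \<and> target (n, r', j) = target (n, r, i))"
  shows "coeff_bimod (n, r', j) Fwd 0 (psi \<pi> n (tensor 1 (n, r, i) 1)) = 0"
proof -
  let ?t = "tensor 1 (n, r, i) 1 :: ('k, 'n, 'm) bimod"
  have "tensor (idem i) (n, r, i) (idem (target (n, r, i))) = (tensor 1 (n, r, i) (idem (target (n, r, i))) :: ('k, 'n, 'm) bimod)"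
    using tensor_idem_left[of "1 :: ('k, 'n, 'm) alg" i "(n, r, i)" "idem (target (n, r, i))"]
    by (simp del: target.simps)
  also have "\<dots> = ?t"
    using tensor_idem_right[of "1 :: ('k, 'n, 'm) alg" "(n, r, i)" "target (n, r, i)" 1]
    by (simp del: target.simps)
  finally have "?t = left_mult (idem i) (right_mult ?t (idem (target (n, r, i))))"
    by (simp del: target.simps)
  then have "psi \<pi> n ?t = left_mult (idem i) (right_mult (psi \<pi> n ?t) (idem (target (n, r, i))))"
    by (metis psi_mult[OF \<pi>])
  then have "coeff_bimod (n, r', j) Fwd 0 (psi \<pi> n ?t) =
      coeff_bimod (n, r', j) Fwd 0 (left_mult (idem i) (right_mult (psi \<pi> n ?t) (idem (target (n, r, i)))))"
    by (rule arg_cong)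
  also have "\<dots> = 0"
    unfolding coeff_bimod_parallel by (rule if_not_P) (rule assms(2))
  finally show ?thesis .
qed

text \<open>The coefficient left open by \<open>psi_step\<close>, that of a middle label in \<psi>
  of another label, is 0 because below degree 2m such labels are not parallel.\<close>

lemma psi_gen_filtration:
  "n < 2 * CARD('m) \<Longrightarrow> r \<le> n \<Longrightarrow> psi \<pi> n (tensor 1 (n, r, i) 1) \<in> filtration 1 n"
proof (induction n arbitrary: r i)
  case 0
  have t: "tensor 1 (0, 0, i) 1 \<in> (component 0 :: ('k, 'n, 'm) bimod set)"
    by (rule tensor_one_component) simp
  have "augmentation (psi \<pi> 0 (tensor 1 (0, 0, i) 1)) = 0"
    using augmentation_phi[OF \<pi> t] by (simp add: psi_def[OF \<pi>] augmentation_def evaluate_diff)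
  then have "coeff_bimod (0, 0, j) Fwd 0 (psi \<pi> 0 (tensor 1 (0, 0, i) 1)) = 0" for j
    using coeff_augmentation[OF psi_component[OF \<pi> t], of j] by simp
  then show ?case using 0 by (intro filtration_1I psi_component[OF \<pi>] tensor_one_component) simp_all
next
  case (Suc n)
  have IH: "psi \<pi> n (tensor 1 (n, r, i) 1) \<in> filtration 1 n" if "r \<le> n" for r i
    by (rule Suc.IH) (use Suc.prems that in auto)
  show ?case
  proof (rule filtration_1I)
    show "psi \<pi> (Suc n) (tensor 1 (Suc n, r, i) 1) \<in> component (Suc n)"
      by (intro psi_component[OF \<pi>] tensor_one_component Suc.prems)
    fix r' j assume r': "r' \<le> Suc n"
    show "coeff_bimod (Suc n, r', j) Fwd 0 (psi \<pi> (Suc n) (tensor 1 (Suc n, r, i) 1)) = 0"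
    proof (cases "Suc n = 2 * r' \<and> j = i \<and> target (Suc n, r', j) = target (Suc n, r, i)")
      case True
      then have "Suc n = 2 * r'" "target (Suc n, r', i) = target (Suc n, r, i)" by (auto simp del: target.simps)
      from target_eq_mid[OF m this Suc.prems(2,1)] have "r = r'" .
      then show ?thesis using True by (intro psi_step IH Suc.prems r') auto
    next
      case False
      then show ?thesis using psi_parallel[OF r'] psi_step[OF IH Suc.prems(2) r', of j i] by blast
    qed
  qed
qed

text \<open>In degree 2m the labels with r = 0 and r = 2m may be sent to multiples of a parallel
  middle label modulo \<open>filtration 1\<close>. The middle label itself is sent into
  \<open>filtration 1\<close>, so the second application succeeds.\<close>

lemma psi_psi_filtration:
  assumes n: "n \<le> 2 * CARD('m)" and r: "r \<le> n"
  shows "psi \<pi> n (psi \<pi> n (tensor 1 (n, r, i) 1)) \<in> filtration 1 n"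
proof (cases "n < 2 * CARD('m)")
  case True
  then have "psi \<pi> n (psi \<pi> n (tensor 1 (n, r, i) 1)) \<in> filtration (Suc 1) n"
    by (intro psi_filtration psi_gen_filtration r) auto
  then show ?thesis using filtration_antimono[of 1 "Suc 1" n] by auto
next
  case False
  then obtain k where k: "n = Suc k" "k < 2 * CARD('m)" using n by (cases n) auto
  let ?p = "psi \<pi> n (tensor 1 (n, r, i) 1)"
  have IH: "psi \<pi> k (tensor 1 (k, r, i) 1) \<in> filtration 1 k" if "r \<le> k" for r i
    by (rule psi_gen_filtration[OF k(2) that])
  have mid: "psi \<pi> n (tensor 1 (n, r', j) 1) \<in> filtration 1 n" if "n = 2 * r'" for r' j
  proof (rule filtration_1I)
    show "psi \<pi> n (tensor 1 (n, r', j) 1) \<in> component n"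
      by (rule psi_component[OF \<pi> tensor_one_component]) (simp add: that)
    show "coeff_bimod (n, r'', i) Fwd 0 (psi \<pi> n (tensor 1 (n, r', j) 1)) = 0" if "r'' \<le> n" for r'' i
      using psi_step[OF IH, of r' r'' i j] that \<open>n = 2 * r'\<close> k(1) by simp
  qed
  have p: "?p \<in> component n" by (intro psi_component[OF \<pi>] tensor_one_component r)
  \<comment> \<open>The part of ?p outside \<open>filtration 1\<close>; by \<open>psi_step\<close>
    only middle labels occur in it with a nonzero coefficient.\<close>
  define q where "q = (\<Sum>(r', j)\<in>{..n} \<times> UNIV. scale_bimod (coeff_bimod (n, r', j) Fwd 0 ?p) (tensor 1 (n, r', j) 1 :: ('k, 'n, 'm) bimod))"
  have "?p - q \<in> filtration 1 n"
  proof (rule filtration_1I)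
    show "?p - q \<in> component n"
      unfolding q_def
      by (intro component_closed p) (auto intro!: component_scale tensor_one_component)
    fix r' j assume r': "r' \<le> n"
    have "coeff_bimod (n, r', j) Fwd 0 q = (\<Sum>x\<in>{..n} \<times> UNIV.
        if x = (r', j) then coeff_bimod (n, r', j) Fwd 0 ?p else 0)"
      unfolding q_def coeff_bimod_sum by (intro sum.cong) (auto simp: coeff_bimod_scale coeff_bimod_one split: if_splits)
    then show "coeff_bimod (n, r', j) Fwd 0 (?p - q) = 0"
      using r' by (simp add: coeff_bimod_diff)
  qed
  then have "psi \<pi> n (?p - q) \<in> filtration 1 n"
  proof (induction rule: filtration_induct)
    case (tensor u v r i)
    have "psi \<pi> n (tensor (path_elem u) (n, r, i) (path_elem v)) =
        left_mult (path_elem u) (right_mult (psi \<pi> n (tensor 1 (n, r, i) 1)) (path_elem v))"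
      using psi_mult[OF \<pi>, of n "path_elem u" "tensor 1 (n, r, i) 1" "path_elem v"] by simp
    also have "\<dots> \<in> filtration (length (snd u) + 0 + length (snd v)) n"
      by (rule filtration_mult[OF component_subset_filtration[THEN subsetD]])
         (intro psi_component[OF \<pi>] tensor_one_component tensor)
    also have "\<dots> \<subseteq> filtration 1 n"
      by (rule filtration_antimono) (use tensor(2) in simp)
    finally show ?case .
  qed (use lin_psi[OF \<pi>, of n] in \<open>simp_all add: lin_0[OF lin_psi[OF \<pi>]] lin_def filtration_closed\<close>)
  moreover have "psi \<pi> n q \<in> filtration 1 n"
    unfolding q_def lin_sum[OF lin_psi[OF \<pi>]]
  proof (rule filtration_closed(6))
    fix x :: "nat \<times> 'm mod_ring" assume x: "x \<in> {..n} \<times> UNIV"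
    obtain r' j where x': "x = (r', j)" by (cases x)
    have r': "r' \<le> n" using x x' by simp
    have "coeff_bimod (n, r', j) Fwd 0 ?p = 0 \<or> n = 2 * r'"
      using psi_step[OF IH, of r r' j i] r r' k(1) by auto
    then have "psi \<pi> n (scale_bimod (coeff_bimod (n, r', j) Fwd 0 ?p) (tensor 1 (n, r', j) 1)) \<in> filtration 1 n"
      using mid[of r' j] lin_psi[OF \<pi>, of n] by (auto simp: lin_def lin_0[OF lin_psi[OF \<pi>]] filtration_closed)
    then show "psi \<pi> n (case x of (r', j) \<Rightarrow> scale_bimod (coeff_bimod (n, r', j) Fwd 0 ?p) (tensor 1 (n, r', j) 1)) \<in> filtration 1 n"
      by (simp add: x')
  qed
  ultimately have "psi \<pi> n (?p - q) + psi \<pi> n q \<in> filtration 1 n" by (rule filtration_closed)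
  then show ?thesis using lin_diff[OF lin_psi[OF \<pi>], of n ?p q] by simp
qed

lemma psi_nilpotent:
  assumes n: "n \<le> 2 * CARD('m)" and p: "p \<in> component n"
  shows "(psi \<pi> n ^^ (2 * (4 * CARD('n) + 1))) p = 0"
proof -
  \<comment> \<open>Two applications gain one unit of length. This explains the exponent: twice an
    index at which the filtration is 0.\<close>
  have step: "psi \<pi> n (psi \<pi> n q) \<in> filtration (Suc k) n" if "q \<in> filtration k n" for q k
    using that
  proof (induction rule: filtration_induct)
    case (tensor u v r i)
    have "psi \<pi> n (psi \<pi> n (tensor (path_elem u) (n, r, i) (path_elem v))) =
        left_mult (path_elem u) (right_mult (psi \<pi> n (psi \<pi> n (tensor 1 (n, r, i) 1))) (path_elem v))"
      using psi_mult[OF \<pi>, of n "path_elem u" "tensor 1 (n, r, i) 1" "path_elem v"] 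
      by (simp add: psi_mult[OF \<pi>])
    also have "\<dots> \<in> filtration (length (snd u) + 1 + length (snd v)) n"
      by (rule filtration_mult[OF psi_psi_filtration[OF n tensor(1)]])
    also have "\<dots> \<subseteq> filtration (Suc k) n"
      by (rule filtration_antimono) (use tensor(2) in simp)
    finally show ?case .
  qed (use lin_psi[OF \<pi>, of n] in \<open>simp_all add: lin_0[OF lin_psi[OF \<pi>]] lin_def filtration_closed\<close>)
  have "(psi \<pi> n ^^ (2 * k)) p \<in> filtration k n" for k
  proof (induction k)
    case 0
    then show ?case using p component_subset_filtration by auto
  next
    case (Suc k)
    then show ?case using step by simp
  qed
  from filtration_zero[OF this[of "4 * CARD('n) + 1"]] show ?thesis .
qed

text \<open>
  The chain map \<open>\<phi> = \<pi> \<circ> \<iota>\<close> is idempotent up to homotopy, because \<open>\<iota> \<circ> \<pi>\<close> is homotopic to the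
  identity of the bar resolution, and it is unipotent; hence it acts trivially on cohomology.
  So no exactness of the resolution has to be proved.
\<close>

lemma pull_bar_rep:
  fixes f :: "'m label \<Rightarrow> ('k, 'n, 'm) alg"
  assumes n: "Suc n \<le> 2 * CARD('m)"
    and f: "\<And>p :: ('k, 'n, 'm) bimod. p \<in> component (Suc (Suc n)) \<Longrightarrow> evaluate f (differential p) = 0"
  shows "\<exists>k. \<forall>p\<in>component (Suc n).
    evaluate (pull_cochain (Suc n) (bar_rep \<pi> (Suc n) f)) p - evaluate f p = evaluate k (differential p)"
proof -
  let ?psi = "psi \<pi> (Suc n)"
  \<comment> \<open>B \<theta> says that \<theta> is a coboundary on P.\<close>
  define B where "B \<theta> \<longleftrightarrow> (\<exists>k. \<forall>p\<in>component (Suc n). \<theta> p = evaluate k (differential p))"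
    for \<theta> :: "('k, 'n, 'm) bimod \<Rightarrow> ('k, 'n, 'm) alg"
  have B_diff: "B (\<lambda>p. \<theta> p - \<eta> p)" if th: "B \<theta>" "B \<eta>" for \<theta> \<eta>
  proof -
    obtain k l where kl: "\<forall>p\<in>component (Suc n). \<theta> p = evaluate k (differential p)"
      "\<forall>p\<in>component (Suc n). \<eta> p = evaluate l (differential p)" using th unfolding B_def by blast
    have e: "evaluate k p - evaluate l p = evaluate (\<lambda>g. evaluate k (tensor 1 g 1) - evaluate l (tensor 1 g 1)) p"
      for p :: "('k, 'n, 'm) bimod"
      by (rule evaluate_eqI[of "\<lambda>p. evaluate k p - evaluate l p"])
         (simp_all add: evaluate_add evaluate_mult algebra_simps)
    show ?thesis unfolding B_def using kl
      by (intro exI[of _ "\<lambda>g. evaluate k (tensor 1 g 1) - evaluate l (tensor 1 g 1)"]) (simp add: e[symmetric])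
  qed
  have zero: "evaluate (\<lambda>_. 0) p = 0" for p :: "('k, 'n, 'm) bimod"
    by (induction p rule: bimod_induct) (simp_all add: evaluate_add evaluate_tensor)
  have B_0: "B \<theta>" if "\<And>p. p \<in> component (Suc n) \<Longrightarrow> \<theta> p = 0" for \<theta>
    unfolding B_def using that by (intro exI[of _ "\<lambda>_. 0"]) (simp add: zero)
  \<comment> \<open>\<phi> and \<phi> \<circ> \<phi> agree on the cocycle f' up to a coboundary;
    with \<phi> = 1 + \<psi> their difference is -(\<psi> + \<psi> \<circ> \<psi>).\<close>
  have step_lemma: "B (\<lambda>p. evaluate f' (?psi p) + evaluate f' (?psi (?psi p)))"
    if f': "\<And>p :: ('k, 'n, 'm) bimod. p \<in> component (Suc (Suc n)) \<Longrightarrow> evaluate f' (differential p) = 0" for f'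
  proof -
    let ?F = "bar_rep \<pi> (Suc n) f'" and ?P = "phi \<pi> (Suc n)"
    have F: "?F \<in> cocycles scale_alg (Suc n)" by (rule bar_rep_cocycles[OF \<pi> f'])
    note mF = bar_rep_cochains[OF \<pi>, of "Suc n" f', unfolded alg_module.cochains_iff, THEN conjunct1]
    obtain K where K: "K \<in> cochains scale_alg n" "\<And>xs. length xs = Suc n \<Longrightarrow>
        ?F xs - evaluate (pull_cochain (Suc n) ?F) (\<pi> xs) = hoch_diff n K xs"
      using cocycle_homotopy[OF \<pi> F] by blast
    let ?F' = "bar_rep \<pi> (Suc n) (pull_cochain (Suc n) ?F)"
    note mF' = bar_rep_cochains[OF \<pi>, of "Suc n" "pull_cochain (Suc n) ?F", unfolded alg_module.cochains_iff, THEN conjunct1]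
    have mK: "mlin scale_alg scale_alg n K" using K(1) by (simp add: alg_module.cochains_iff)
    have "evaluate f' (?P p) - evaluate f' (?P (?P p)) = evaluate (pull_cochain n K) (differential p)"
      if p: "p \<in> component (Suc n)" for p
    proof -
      have "evaluate f' (?P p) - evaluate f' (?P (?P p)) =
          pull_alg (Suc n) (left_ext ?F) p - pull_alg (Suc n) (left_ext ?F') p"
        by (simp add: evaluate_phi[OF \<pi>] pull_left_ext[OF mF] pull_left_ext[OF mF'])
      also have "\<dots> = pull_alg (Suc n) (\<lambda>l. left_ext ?F l - left_ext ?F' l) p"
        by (simp add: AA.pull_diff)
      also have "\<dots> = pull_alg (Suc n) (bar_diff (*) (left_ext K)) p"
      proof (rule arg_cong[OF AA.pull_cong, of _ _ _ "\<lambda>f. f p"])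
        fix l :: "('k, 'n, 'm) alg list" assume "length l = Suc (Suc n)"
        then obtain x y r where l: "l = x # y # r" "length r = n" by (auto simp: length_Suc_conv)
        have "?F (y # r) - ?F' (y # r) = hoch_diff n K (y # r)"
          using K(2)[of "y # r"] l by (simp add: bar_rep_def)
        then show "left_ext ?F l - left_ext ?F' l = bar_diff (*) (left_ext K) l"
          using l by (simp add: bar_diff_left_ext left_ext_def right_diff_distrib[symmetric] del: bar_diff.simps)
      qed
      also have "\<dots> = evaluate (pull_cochain n K) (differential p)"
        by (simp add: AA.pull_bar_diff[OF mlin_left_ext[OF mK] p] pull_left_ext[OF mK])
      finally show ?thesis .
    qed
    moreover have "evaluate f' (?P p) - evaluate f' (?P (?P p)) = - (evaluate f' (?psi p) + evaluate f' (?psi (?psi p)))" for p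
    proof -
      have "?psi (?psi p) = ?P (?P p) - ?P p - ?P p + p"
        using lin_diff[OF lin_phi[OF \<pi>], of "Suc n"] by (simp add: psi_def[OF \<pi>])
      then show ?thesis by (simp add: psi_def[OF \<pi>] evaluate_diff evaluate_add)
    qed
    ultimately have "B (\<lambda>p. - (evaluate f' (?psi p) + evaluate f' (?psi (?psi p))))"
      unfolding B_def by metis
    from B_diff[OF B_0 this, of "\<lambda>p. 0"] show ?thesis by (simp only: diff_0 minus_minus)
  qed
  \<comment> \<open>Downward induction from the power of \<psi> that is 0: f \<circ> \<psi>^j is
    again a cocycle, so \<open>step_lemma\<close> passes from the exponent j + 2 to j + 1.\<close>
  have B_psi: "B (\<lambda>p. evaluate f ((?psi ^^ Suc j) p))" if "j \<le> 2 * (4 * CARD('n) + 1) - 1" for j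
    using that
  proof (induction rule: inc_induct)
    case base
    have "Suc (2 * (4 * CARD('n) + 1) - 1) = 2 * (4 * CARD('n) + 1)" by simp
    then show ?case
      by (intro B_0) (simp only: psi_nilpotent[OF n] evaluate_0)
  next
    case (step j)
    let ?f' = "\<lambda>g. evaluate f ((?psi ^^ j) (tensor 1 g 1))"
    have add: "(psi \<pi> k ^^ i) (p + q) = (psi \<pi> k ^^ i) p + (psi \<pi> k ^^ i) q" for k i p q
      using lin_psi[OF \<pi>, of k] by (induction i) (simp_all add: lin_def)
    have mult: "(psi \<pi> k ^^ i) (left_mult x (right_mult p y)) = left_mult x (right_mult ((psi \<pi> k ^^ i) p) y)" for k i x y p
      by (induction i) (simp_all add: psi_mult[OF \<pi>])
    have f': "evaluate f ((?psi ^^ j) p) = evaluate ?f' p" for p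
      by (rule evaluate_eqI) (simp_all add: add mult evaluate_add evaluate_mult)
    have comp: "(psi \<pi> k ^^ i) p \<in> component k" if "p \<in> component k" for k i p
      using that by (induction i) (simp_all add: psi_component[OF \<pi>])
    have "differential ((psi \<pi> (Suc (Suc n)) ^^ i) p) = (?psi ^^ i) (differential p)"
      if "p \<in> component (Suc (Suc n))" for i p
      using that by (induction i) (simp_all add: differential_psi[OF \<pi>] comp)
    then have "evaluate ?f' (differential p) = 0" if "p \<in> component (Suc (Suc n))" for p
      unfolding f'[symmetric] using f[OF comp[OF that]] that by metis
    from step_lemma[OF this]
    have "B (\<lambda>p. evaluate f ((?psi ^^ Suc j) p) + evaluate f ((?psi ^^ Suc (Suc j)) p))"
      unfolding f'[symmetric] by (simp add: funpow_swap1)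
    from B_diff[OF this step.IH] show ?case by simp
  qed
  have "evaluate (pull_cochain (Suc n) (bar_rep \<pi> (Suc n) f)) p - evaluate f p = evaluate f (?psi p)" for p
    by (simp add: evaluate_phi[OF \<pi>, symmetric] psi_def[OF \<pi>] evaluate_diff)
  then show ?thesis using B_psi[of 0] by (simp add: B_def)
qed

end

section \<open>Weights of the resolution and of cochains\<close>

text \<open>The weight of every path occurring in \<open>g\<^sup>n\<^bsub>r,i\<^esub>\<close>, which makes the differential homogeneous.\<close>

fun label_weight :: "'n::finite itself \<Rightarrow> ('m::nontriv mod_ring \<Rightarrow> int) \<Rightarrow> 'm label \<Rightarrow> int \<times> int" where
  "label_weight _ \<xi> (n, r, i) = (int (CARD('n) * min r (n - r)), 0) +
     weight \<xi> (i, if 2 * r \<le> n then replicate (n - 2 * r) Fwd else replicate (2 * r - n) Bwd)"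

definition homogeneous_part ::
  "('m::nontriv mod_ring \<Rightarrow> int) \<Rightarrow> nat \<Rightarrow> int \<times> int \<Rightarrow> ('k::field, 'n::finite, 'm) bimod set" where
  "homogeneous_part \<xi> n v = bimod.span {tensor x (n, r, i) y | x y r i u u'. r \<le> n \<and> homogeneous \<xi> u x \<and>
     homogeneous \<xi> u' y \<and> u + label_weight TYPE('n) \<xi> (n, r, i) + u' = v}"

lemma homogeneous_part_closed:
  "0 \<in> homogeneous_part \<xi> n v"
  "p \<in> homogeneous_part \<xi> n v \<Longrightarrow> q \<in> homogeneous_part \<xi> n v \<Longrightarrow> p + q \<in> homogeneous_part \<xi> n v"
  "p \<in> homogeneous_part \<xi> n v \<Longrightarrow> signed e p \<in> homogeneous_part \<xi> n v"
  "(\<And>l. l \<in> S \<Longrightarrow> f l \<in> homogeneous_part \<xi> n v) \<Longrightarrow> sum f S \<in> homogeneous_part \<xi> n v"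
  by (simp_all add: homogeneous_part_def signed_def bimod.span_zero bimod.span_add bimod.span_scale bimod.span_sum)

lemma homogeneous_part_induct [consumes 1, case_names zero add scale tensor]:
  assumes "p \<in> homogeneous_part \<xi> n v" "P (0 :: ('k::field, 'n::finite, 'm::nontriv) bimod)"
    "\<And>p q. P p \<Longrightarrow> P q \<Longrightarrow> P (p + q)" "\<And>c p. P p \<Longrightarrow> P (scale_bimod c p)"
    "\<And>x y r i u u'. r \<le> n \<Longrightarrow> homogeneous \<xi> u x \<Longrightarrow> homogeneous \<xi> u' y \<Longrightarrow>
      u + label_weight TYPE('n) \<xi> (n, r, i) + u' = v \<Longrightarrow> P (tensor x (n, r, i) y)"
  shows "P p"
  using assms(1) unfolding homogeneous_part_def
proof (induction rule: bimod.span_induct_alt)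
  case (step c p q)
  then show ?case using assms(3-5) by blast
qed (rule assms(2))

lemma tensor_homogeneous:
  "r \<le> n \<Longrightarrow> homogeneous \<xi> u x \<Longrightarrow> homogeneous \<xi> u' y \<Longrightarrow>
    u + label_weight TYPE('n) \<xi> (n, r, i) + u' = v \<Longrightarrow>
    (tensor x (n, r, i) y :: ('k::field, 'n::finite, 'm::nontriv) bimod) \<in> homogeneous_part \<xi> n v"
  unfolding homogeneous_part_def by (rule bimod.span_base) blast

lemma gtensor_homogeneous:
  assumes "0 \<le> \<rho> \<Longrightarrow> \<rho> \<le> int n \<Longrightarrow> weight \<xi> (j - sum_list (map shift u), u) +
      label_weight TYPE('n) \<xi> (n, nat \<rho>, j) + weight \<xi> (target (n, nat \<rho>, j), w) = v"
  shows "(gtensor (word_sum u) n \<rho> j (word_sum w) :: ('k::field, 'n::finite, 'm::nontriv) bimod)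
    \<in> homogeneous_part \<xi> n v"
proof (cases "0 \<le> \<rho> \<and> \<rho> \<le> int n")
  case True
  let ?g = "(n, nat \<rho>, j)"
  have "(tensor (word_sum u) ?g (word_sum w) :: ('k, 'n, 'm) bimod) =
      tensor (word_sum u * idem (source ?g)) ?g (idem (target ?g) * word_sum w)"
    by (simp only: tensor_idem_left tensor_idem_right if_True refl)
  also have "\<dots> = tensor (path_elem (j - sum_list (map shift u), u)) ?g (path_elem (target ?g, w))"
    by (simp add: word_sum_idem idem_word_sum)
  also have "\<dots> \<in> homogeneous_part \<xi> n v"
    by (rule tensor_homogeneous[OF _ _ _ assms]) (use True in \<open>auto simp: weight_part_path_elem\<close>)
  finally show ?thesis using True by (simp add: gtensor_def)
next
  case False
  then show ?thesis by (auto simp: gtensor_def homogeneous_part_closed)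
qed

lemma weight_replicate_snoc:
  "weight \<xi> (i, replicate (Suc d) Fwd) = weight \<xi> (i, replicate d Fwd) + (0, \<xi> (i + of_nat d))"
  "weight \<xi> (i, replicate (Suc d) Bwd) = weight \<xi> (i, replicate d Bwd) + (1, - \<xi> (i - of_nat d - 1))"
proof -
  show "weight \<xi> (i, replicate (Suc d) Fwd) = weight \<xi> (i, replicate d Fwd) + (0, \<xi> (i + of_nat d))"
    "weight \<xi> (i, replicate (Suc d) Bwd) = weight \<xi> (i, replicate d Bwd) + (1, - \<xi> (i - of_nat d - 1))"
    unfolding replicate_Suc replicate_append_same[symmetric] weight_append
    by (simp_all add: sum_list_replicate zero_prod_def)
qed

lemma label_weight_pos:
  "n = 2 * r + d \<Longrightarrow> label_weight TYPE('n::finite) \<xi> (n, r, i) = (int (CARD('n) * r), 0) + weight \<xi> (i, replicate d Fwd)"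
  by simp

lemma label_weight_neg:
  "2 * r = n + d \<Longrightarrow> label_weight TYPE('n::finite) \<xi> (n, r, i) = (int (CARD('n) * (n - r)), 0) + weight \<xi> (i, replicate d Bwd)"
  by (cases "d = 0") (simp_all add: min_def)

text \<open>A term of the differential consists of a label of lower degree and the path that
  completes it, on one side or on both, to a path of the kind occurring in g; so the weights match.
  In the cases \<open>pos\<close> and \<open>neg\<close>, d + 1 is the distance from the
  middle.\<close>

lemma diff_gen_homogeneous:
  assumes r: "r \<le> Suc n"
  shows "(diff_gen (Suc n) r i :: ('k::field, 'n::finite, 'm::nontriv) bimod)
    \<in> homogeneous_part \<xi> n (label_weight TYPE('n) \<xi> (Suc n, r, i))"
proof -
  obtain k where k: "CARD('n) = Suc k" using gr0_implies_Suc[of "CARD('n)"] by auto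
  have one: "(1 :: ('k, 'n, 'm) alg) = word_sum []" by (simp add: word_sum_Nil)
  have s0: "sum_list (map shift (alternating s (2 * l))) = (0 :: 'm mod_ring)" for s l
    by (induction l) simp_all
  note calc = weight_alternating shift_alternating_odd s0 k zero_prod_def
  consider (pos) d where "Suc n = 2 * r + Suc d" | (neg) d where "2 * r = Suc n + Suc d" | (mid) "Suc n = 2 * r"
  proof (cases "Suc n" "2 * r" rule: linorder_cases)
    case less
    then show ?thesis using neg[of "2 * r - Suc n - 1"] by simp
  next
    case equal
    then show ?thesis using mid by simp
  next
    case greater
    then show ?thesis using pos[of "Suc n - 2 * r - 1"] by simp
  qed
  then show ?thesis
  proof cases
    case pos
    then have n: "n = 2 * r + d" by simp
    define V where "V = label_weight TYPE('n) \<xi> (Suc n, r, i)"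
    have V: "V = (int (CARD('n) * r), 0) + weight \<xi> (i, replicate (Suc d) Fwd)"
      unfolding V_def by (rule label_weight_pos) (use pos in simp)
    have w0: "label_weight TYPE('n) \<xi> (n, r, j) = (int (CARD('n) * r), 0) + weight \<xi> (j, replicate d Fwd)" for j
      by (rule label_weight_pos[OF n])
    have w1: "label_weight TYPE('n) \<xi> (n, nat (int r - 1), j) =
        (int (CARD('n) * (r - 1)), 0) + weight \<xi> (j, replicate (Suc (Suc d)) Fwd)" if "r > 0" for j
    proof -
      have "nat (int r - 1) = r - 1" "n = 2 * (r - 1) + Suc (Suc d)" using n that by auto
      then show ?thesis using label_weight_pos by metis
    qed
    have t0: "target (n, r, j) = j + of_nat d" for j :: "'m mod_ring"
      by (simp add: n)
    have t1: "target (n, nat (int r - 1), j) = j + of_nat d + 2" if "r > 0" for j :: "'m mod_ring"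
    proof -
      obtain q where "r = Suc q" using \<open>r > 0\<close> by (cases r) auto
      then show ?thesis by (simp add: n nat_diff_distrib algebra_simps)
    qed
    have g1: "(gtensor (word_sum []) n (int r) i (word_sum [Fwd]) :: ('k, 'n, 'm) bimod) \<in> homogeneous_part \<xi> n V"
      by (rule gtensor_homogeneous)
         (simp add: V w0 t0 weight_replicate_snoc prod_eq_iff del: label_weight.simps target.simps replicate.simps)
    have g2: "(gtensor (word_sum [Fwd]) n (int r) (i + 1) (word_sum []) :: ('k, 'n, 'm) bimod) \<in> homogeneous_part \<xi> n V"
      by (rule gtensor_homogeneous)
         (simp add: V w0 t0 prod_eq_iff del: label_weight.simps target.simps)
    have g3: "(gtensor (alt_word Bwd (Suc (2 * k))) n (int r - 1) (i - 1) (word_sum []) :: ('k, 'n, 'm) bimod)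
        \<in> homogeneous_part \<xi> n V"
    proof (rule gtensor_homogeneous)
      assume "0 \<le> int r - 1"
      then obtain q where q: "r = Suc q" by (cases r) auto
      have r0: "r > 0" by (simp add: q)
      show "weight \<xi> (i - 1 - sum_list (map shift (alternating Bwd (Suc (2 * k)))), alternating Bwd (Suc (2 * k))) +
          label_weight TYPE('n) \<xi> (n, nat (int r - 1), i - 1) + weight \<xi> (target (n, nat (int r - 1), i - 1), []) = V"
        unfolding w1[OF r0] shift_alternating_odd weight_alternating V
        by (simp add: k q prod_eq_iff algebra_simps del: label_weight.simps target.simps)
    qed
    have g4: "(gtensor (word_sum []) n (int r - 1) i (alt_word Bwd (Suc (2 * k))) :: ('k, 'n, 'm) bimod)
        \<in> homogeneous_part \<xi> n V"
    proof (rule gtensor_homogeneous)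
      assume "0 \<le> int r - 1"
      then obtain q where q: "r = Suc q" by (cases r) auto
      have r0: "r > 0" by (simp add: q)
      show "weight \<xi> (i - sum_list (map shift []), []) +
          label_weight TYPE('n) \<xi> (n, nat (int r - 1), i) + weight \<xi> (target (n, nat (int r - 1), i), alternating Bwd (Suc (2 * k))) = V"
        unfolding w1[OF r0] t1[OF r0] weight_alternating V weight_replicate_snoc(1)[of _ _ "Suc d"]
        by (simp add: k q prod_eq_iff algebra_simps del: label_weight.simps target.simps replicate.simps)
    qed
    have c: "2 * r < Suc n" using pos by simp
    show ?thesis
      unfolding V_def[symmetric] diff_gen_words Let_def one k diff_Suc_1 if_P[OF c]
      by (intro homogeneous_part_closed g1 g2 g3 g4)
  next
    case neg
    define V where "V = label_weight TYPE('n) \<xi> (Suc n, r, i)"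
    have V: "V = (int (CARD('n) * (Suc n - r)), 0) + weight \<xi> (i, replicate (Suc d) Bwd)"
      unfolding V_def by (rule label_weight_neg) (use neg in simp)
    have w0: "label_weight TYPE('n) \<xi> (n, r, j) = (int (CARD('n) * (n - r)), 0) + weight \<xi> (j, replicate (Suc (Suc d)) Bwd)" for j
      by (rule label_weight_neg) (use neg in simp)
    have r1: "nat (int r - 1) = r - 1" "r > 0" using neg by auto
    have e: "Suc n - r = n - (r - 1)" using r1(2) by simp
    have w1: "label_weight TYPE('n) \<xi> (n, nat (int r - 1), j) =
        (int (CARD('n) * (Suc n - r)), 0) + weight \<xi> (j, replicate d Bwd)" for j
      unfolding r1(1) e by (rule label_weight_neg) (use neg r1 in simp)
    have "(of_nat (2 * r) :: 'm mod_ring) = of_nat (Suc n + Suc d)" by (simp only: neg)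
    then have nr: "2 * (of_nat r :: 'm mod_ring) = of_nat n + 2 + of_nat d" by simp
    have t0: "target (n, r, j) = j - of_nat d - 2" for j :: "'m mod_ring"
      by (simp add: nr)
    have t1: "target (n, nat (int r - 1), j) = j - of_nat d" for j :: "'m mod_ring"
    proof -
      have "(of_nat (r - 1) :: 'm mod_ring) = of_nat r - 1" using r1(2) by (simp add: of_nat_diff)
      then show ?thesis by (simp only: r1(1) target.simps right_diff_distrib nr) simp
    qed
    have g1: "(gtensor (word_sum []) n (int r) i (alt_word Fwd (Suc (2 * k))) :: ('k, 'n, 'm) bimod) \<in> homogeneous_part \<xi> n V"
    proof (rule gtensor_homogeneous)
      assume "int r \<le> int n"
      then have e: "Suc n - r = Suc (n - r)" by simp
      show "weight \<xi> (i - sum_list (map shift []), []) + label_weight TYPE('n) \<xi> (n, nat (int r), i) +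
          weight \<xi> (target (n, nat (int r), i), alternating Fwd (Suc (2 * k))) = V"
        unfolding nat_int w0 t0 weight_alternating V weight_replicate_snoc(2)[of _ _ "Suc d"] e
        by (simp add: k prod_eq_iff algebra_simps del: label_weight.simps target.simps replicate.simps)
    qed
    have g2: "(gtensor (alt_word Fwd (Suc (2 * k))) n (int r) (i + 1) (word_sum []) :: ('k, 'n, 'm) bimod) \<in> homogeneous_part \<xi> n V"
    proof (rule gtensor_homogeneous)
      assume "int r \<le> int n"
      then have e: "Suc n - r = Suc (n - r)" by simp
      show "weight \<xi> (i + 1 - sum_list (map shift (alternating Fwd (Suc (2 * k)))), alternating Fwd (Suc (2 * k))) +
          label_weight TYPE('n) \<xi> (n, nat (int r), i + 1) + weight \<xi> (target (n, nat (int r), i + 1), []) = V"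
        unfolding nat_int w0 t0 weight_alternating shift_alternating_odd V e
        by (simp add: k prod_eq_iff algebra_simps del: label_weight.simps target.simps)
    qed
    have g3: "(gtensor (word_sum [Bwd]) n (int r - 1) (i - 1) (word_sum []) :: ('k, 'n, 'm) bimod) \<in> homogeneous_part \<xi> n V"
      by (rule gtensor_homogeneous) (simp add: V w1 t1 prod_eq_iff del: label_weight.simps target.simps)
    have g4: "(gtensor (word_sum []) n (int r - 1) i (word_sum [Bwd]) :: ('k, 'n, 'm) bimod) \<in> homogeneous_part \<xi> n V"
      by (rule gtensor_homogeneous)
         (simp add: V w1 t1 weight_replicate_snoc prod_eq_iff del: label_weight.simps target.simps replicate.simps)
    have c: "\<not> 2 * r < Suc n" "Suc n < 2 * r" using neg by simp_all
    show ?thesis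
      unfolding V_def[symmetric] diff_gen_words Let_def one k diff_Suc_1 if_not_P[OF c(1)] if_P[OF c(2)]
      by (intro homogeneous_part_closed g1 g2 g3 g4)
  next
    case mid
    then obtain q where q: "r = Suc q" "n = Suc (2 * q)" by (cases r) auto
    define V where "V = label_weight TYPE('n) \<xi> (Suc n, r, i)"
    have V: "V = (int (CARD('n) * Suc q), 0)"
      unfolding V_def using label_weight_pos[of "Suc n" r 0 \<xi> i, where 'n = 'n] mid q by (simp add: zero_prod_def)
    have w0: "label_weight TYPE('n) \<xi> (n, nat (int r), j) = (int (CARD('n) * q), 0) + (1, - \<xi> (j - 1))" for j
      unfolding nat_int using label_weight_neg[of r n 1 \<xi> j, where 'n = 'n] q
      by (simp add: zero_prod_def del: label_weight.simps)
    have w1: "label_weight TYPE('n) \<xi> (n, nat (int r - 1), j) = (int (CARD('n) * q), 0) + (0, \<xi> j)" for j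
      using label_weight_pos[of n q 1 \<xi> j, where 'n = 'n] q
      by (simp add: zero_prod_def del: label_weight.simps)
    have t0: "target (n, nat (int r), j) = j - 1" and t1: "target (n, nat (int r - 1), j) = j + 1" for j :: "'m mod_ring"
      by (simp_all add: q algebra_simps)
    note calc = shift_alternating_odd s0 w0 w1 t0 t1 weight_alternating V
    have g: "(gtensor (alt_word Bwd (2 * l)) n (int r) i (alt_word Fwd (Suc (2 * (k - l)))) :: ('k, 'n, 'm) bimod) \<in> homogeneous_part \<xi> n V"
      "(gtensor (alt_word Fwd (Suc (2 * l))) n (int r) (i + 1) (alt_word Fwd (2 * (k - l))) :: ('k, 'n, 'm) bimod) \<in> homogeneous_part \<xi> n V"
      "(gtensor (alt_word Bwd (Suc (2 * l))) n (int r - 1) (i - 1) (alt_word Bwd (2 * (k - l))) :: ('k, 'n, 'm) bimod) \<in> homogeneous_part \<xi> n V"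
      "(gtensor (alt_word Fwd (2 * l)) n (int r - 1) i (alt_word Bwd (Suc (2 * (k - l)))) :: ('k, 'n, 'm) bimod) \<in> homogeneous_part \<xi> n V"
      if "l \<in> {..<Suc k}" for l
    proof -
      have l: "int (k - l) = int k - int l" using that by auto
      show "(gtensor (alt_word Bwd (2 * l)) n (int r) i (alt_word Fwd (Suc (2 * (k - l)))) :: ('k, 'n, 'm) bimod) \<in> homogeneous_part \<xi> n V"
        by (rule gtensor_homogeneous, unfold calc) (simp add: k l algebra_simps)
      show "(gtensor (alt_word Fwd (Suc (2 * l))) n (int r) (i + 1) (alt_word Fwd (2 * (k - l))) :: ('k, 'n, 'm) bimod) \<in> homogeneous_part \<xi> n V"
        by (rule gtensor_homogeneous, unfold calc) (simp add: k l algebra_simps)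
      show "(gtensor (alt_word Bwd (Suc (2 * l))) n (int r - 1) (i - 1) (alt_word Bwd (2 * (k - l))) :: ('k, 'n, 'm) bimod) \<in> homogeneous_part \<xi> n V"
        by (rule gtensor_homogeneous, unfold calc) (simp add: k l algebra_simps)
      show "(gtensor (alt_word Fwd (2 * l)) n (int r - 1) i (alt_word Bwd (Suc (2 * (k - l)))) :: ('k, 'n, 'm) bimod) \<in> homogeneous_part \<xi> n V"
        by (rule gtensor_homogeneous, unfold calc) (simp add: k l algebra_simps)
    qed
    have c: "\<not> 2 * r < Suc n" "\<not> Suc n < 2 * r" using mid by simp_all
    show ?thesis
      unfolding V_def[symmetric] diff_gen_words Let_def one k diff_Suc_1 if_not_P[OF c(1)] if_not_P[OF c(2)]
      by (intro homogeneous_part_closed g)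
  qed
qed

text \<open>The component of degree w of a multilinear map. The weights of the parts of the entries
  are accumulated in w, and at the end the part of that weight is taken of the value.\<close>

primrec homogenize ::
  "('m::nontriv mod_ring \<Rightarrow> int) \<Rightarrow> ('k::field, 'n::finite, 'm) alg list \<Rightarrow>
    (('k, 'n, 'm) alg list \<Rightarrow> ('k, 'n, 'm) alg) \<Rightarrow> int \<times> int \<Rightarrow> ('k, 'n, 'm) alg"
where
  "homogenize \<xi> [] = (\<lambda>H w. weight_part \<xi> w (H []))"
| "homogenize \<xi> (x # xs) = (\<lambda>H w. \<Sum>v\<in>weights TYPE('n) \<xi>.
     homogenize \<xi> xs (\<lambda>l. H (weight_part \<xi> v x # l)) (w + v))"

abbreviation "mlin_alg \<equiv> mlin scale_alg scale_alg"

lemma homogenize_cong: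
  "(\<And>l. length l = length xs \<Longrightarrow> H l = H' l) \<Longrightarrow> homogenize \<xi> xs H w = homogenize \<xi> xs H' w"
proof (induction xs arbitrary: H H' w)
  case (Cons x xs)
  show ?case unfolding homogenize.simps
    by (intro sum.cong refl Cons.IH) (simp add: Cons.prems)
qed simp

lemma homogenize_add: "homogenize \<xi> xs (\<lambda>l. H l + H' l) w = homogenize \<xi> xs H w + homogenize \<xi> xs H' w"
  by (induction xs arbitrary: H H' w) (simp_all add: weight_part_add sum.distrib)

lemma homogenize_scale: "homogenize \<xi> xs (\<lambda>l. scale_alg c (H l)) w = scale_alg c (homogenize \<xi> xs H w)"
  by (induction xs arbitrary: H w) (simp_all add: weight_part_scale alg.scale_sum_right)

lemma homogenize_zero: "homogenize \<xi> xs (\<lambda>l. 0) w = 0"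
  by (induction xs arbitrary: w) simp_all

lemma mlin_homogenize: "mlin_alg n H \<Longrightarrow> mlin_alg n (\<lambda>xs. homogenize \<xi> xs H w)"
proof (induction n arbitrary: H w)
  case (Suc n)
  show ?case
  proof (rule mlin_SucI)
    fix r :: "('a, 'b, 'c) alg list" assume r: "length r = n"
    have H: "lin scale_alg scale_alg (\<lambda>x. H (x # l))" if "length l = n" for l using Suc.prems that by simp
    have "homogenize \<xi> r (\<lambda>l. H (weight_part \<xi> v (x + y) # l)) u =
        homogenize \<xi> r (\<lambda>l. H (weight_part \<xi> v x # l) + H (weight_part \<xi> v y # l)) u"
      "homogenize \<xi> r (\<lambda>l. H (weight_part \<xi> v (scale_alg c x) # l)) u =
        homogenize \<xi> r (\<lambda>l. scale_alg c (H (weight_part \<xi> v x # l))) u" for v x y u c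
      by (rule homogenize_cong; use H r in \<open>simp add: lin_def weight_part_add weight_part_scale\<close>)+
    then show "lin scale_alg scale_alg (\<lambda>x. homogenize \<xi> (x # r) H w)"
      by (simp add: lin_def homogenize_add homogenize_scale sum.distrib alg.scale_sum_right)
  next
    fix x
    show "mlin_alg n (\<lambda>l. homogenize \<xi> (x # l) H w)"
      unfolding homogenize.simps
      by (intro mlin_sum[OF vector_space_scale_alg] Suc.IH mlin_Cons[OF Suc.prems])
  qed
qed simp

lemma homogenize_Cons:
  assumes "mlin_alg (Suc n) H" "homogeneous \<xi> v x" "length xs = n"
  shows "homogenize \<xi> (x # xs) H w = homogenize \<xi> xs (\<lambda>l. H (x # l)) (w + v :: int \<times> int)"
proof -
  have H: "lin scale_alg scale_alg (\<lambda>x. H (x # l))" if "length l = n" for l using assms(1) that by simp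
  have "homogenize \<xi> xs (\<lambda>l. H (weight_part \<xi> u x # l)) (w + u) =
      (if u = v then homogenize \<xi> xs (\<lambda>l. H (x # l)) (w + v) else 0)" for u
  proof (cases "u = v")
    case False
    then have "weight_part \<xi> u x = 0" using homogeneous_weight_part[OF assms(2), of u] by simp
    then have "homogenize \<xi> xs (\<lambda>l. H (weight_part \<xi> u x # l)) (w + u) = homogenize \<xi> xs (\<lambda>l. 0) (w + u)"
      by (intro homogenize_cong) (simp add: lin_0[OF H] assms(3))
    then show ?thesis using False by (simp add: homogenize_zero)
  qed (use assms(2) in simp)
  moreover have "homogenize \<xi> xs (\<lambda>l. H (x # l)) (w + v) = 0" if "v \<notin> weights TYPE('b) \<xi>"
  proof -
    have "x = 0" using weight_part_eq_0[OF that, of x] assms(2) by simp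
    then have "homogenize \<xi> xs (\<lambda>l. H (x # l)) (w + v) = homogenize \<xi> xs (\<lambda>l. 0) (w + v)"
      by (intro homogenize_cong) (simp add: lin_0[OF H] assms(3))
    then show ?thesis by (simp add: homogenize_zero)
  qed
  ultimately show ?thesis by (auto simp: finite_weights)
qed

lemma homogenize_homogeneous_args:
  "mlin_alg n H \<Longrightarrow> list_all2 (homogeneous \<xi>) vs xs \<Longrightarrow> length xs = n \<Longrightarrow>
    homogenize \<xi> xs H w = weight_part \<xi> (w + sum_list vs) (H xs)"
proof (induction xs arbitrary: n H w vs)
  case (Cons x xs)
  then obtain v us where vs: "vs = v # us" "homogeneous \<xi> v x" "list_all2 (homogeneous \<xi>) us xs"
    by (auto simp: list_all2_Cons2)
  obtain k where k: "n = Suc k" "length xs = k" using Cons.prems(3) by auto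
  have H: "mlin_alg (Suc k) H" using Cons.prems(1) k by simp
  show ?case
    using homogenize_Cons[OF H vs(2) k(2)] Cons.IH[OF mlin_Cons[OF H] vs(3) k(2), where w = "w + v"]
    by (simp add: vs(1) add.assoc)
qed simp

lemma mlin_eq_homogeneous:
  assumes "mlin_alg n F" "mlin_alg n G" "length xs = n"
    and "\<And>xs vs. list_all2 (homogeneous \<xi>) vs xs \<Longrightarrow> length xs = n \<Longrightarrow> F xs = G xs"
  shows "F xs = G (xs :: ('k::field, 'n::finite, 'm::nontriv) alg list)"
  using assms
proof (induction n arbitrary: F G xs)
  case 0
  then show ?case by auto
next
  case (Suc n)
  then obtain x r where x: "xs = x # r" "length r = n" by (auto simp: length_Suc_conv)
  have L: "lin scale_alg scale_alg (\<lambda>x. F (x # r))" "lin scale_alg scale_alg (\<lambda>x. G (x # r))"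
    using Suc.prems(1,2) x by simp_all
  have "F (weight_part \<xi> v x # r) = G (weight_part \<xi> v x # r)" for v
  proof (rule Suc.IH[OF mlin_Cons[OF Suc.prems(1)] mlin_Cons[OF Suc.prems(2)] x(2)])
    fix xs :: "('k, 'n, 'm) alg list" and vs assume "list_all2 (homogeneous \<xi>) vs xs" "length xs = n"
    then show "F (weight_part \<xi> v x # xs) = G (weight_part \<xi> v x # xs)"
      using Suc.prems(4)[of "v # vs" "weight_part \<xi> v x # xs"] by (simp add: weight_part_weight_part)
  qed
  then have "F ((\<Sum>v\<in>weights TYPE('n) \<xi>. weight_part \<xi> v x) # r) = G ((\<Sum>v\<in>weights TYPE('n) \<xi>. weight_part \<xi> v x) # r)"
    by (simp only: lin_sum[OF L(1)] lin_sum[OF L(2)])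
  then show ?case by (simp add: x(1) sum_weight_part)
qed

definition homogeneous_cochain ::
  "('m::nontriv mod_ring \<Rightarrow> int) \<Rightarrow> int \<times> int \<Rightarrow> nat \<Rightarrow> (('k::field, 'n::finite, 'm) alg list \<Rightarrow> ('k, 'n, 'm) alg) \<Rightarrow> bool" where
  "homogeneous_cochain \<xi> w n F \<longleftrightarrow>
     (\<forall>xs vs. list_all2 (homogeneous \<xi>) vs xs \<longrightarrow> length xs = n \<longrightarrow> homogeneous \<xi> (w + sum_list vs) (F xs))"

lemma homogeneous_cochain_homogenize:
  "mlin_alg n F \<Longrightarrow> homogeneous_cochain \<xi> w n (\<lambda>xs. homogenize \<xi> xs F w)"
  unfolding homogeneous_cochain_def
  by (simp add: homogenize_homogeneous_args weight_part_weight_part)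

lemma homogenize_eq_self:
  assumes "mlin_alg n F" "homogeneous_cochain \<xi> w n F" "length xs = n"
  shows "homogenize \<xi> xs F w = F xs"
proof (rule mlin_eq_homogeneous[OF mlin_homogenize[OF assms(1)] assms(1,3)])
  fix xs :: "('a, 'b, 'c) alg list" and vs assume "list_all2 (homogeneous \<xi>) vs xs" "length xs = n"
  then show "homogenize \<xi> xs F w = F xs"
    using assms(2) by (simp add: homogenize_homogeneous_args[OF assms(1)] homogeneous_cochain_def)
qed

text \<open>Multiplication in A adds weights, so taking components commutes with the differential.
  Both sides are multilinear, hence homogeneous entries suffice.\<close>

lemma homogenize_bar_diff:
  assumes "mlin_alg n H" "length xs = Suc n"
  shows "bar_diff (*) (\<lambda>l. homogenize \<xi> l H w) xs = homogenize \<xi> xs (bar_diff (*) H) w"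
proof -
  have m: "mlin_alg (Suc n) (bar_diff (*) H)" if "mlin_alg n H" for n and H :: "('a, 'b, 'c) alg list \<Rightarrow> _"
    using that by (rule alg_module.mlin_bar_diff)
  have *: "bar_diff (*) (\<lambda>l. homogenize \<xi> l H w) xs = weight_part \<xi> (w + sum_list vs) (bar_diff (*) H xs)"
    if "list_all2 (homogeneous \<xi>) vs xs" "mlin_alg n H" "length xs = Suc n" for xs vs n H w
    using that
  proof (induction n arbitrary: xs vs H w)
    case 0
    then obtain x v where "xs = [x]" "vs = [v]" "homogeneous \<xi> v x"
      by (auto simp: length_Suc_conv list_all2_Cons2)
    then show ?case by (simp add: weight_part_mult_right)
  next
    case (Suc n)
    then obtain x y r where xs: "xs = x # y # r" "length r = n" by (metis length_Suc_conv)
    then obtain v u us where vs: "vs = v # u # us" "homogeneous \<xi> v x" "homogeneous \<xi> u y" "list_all2 (homogeneous \<xi>) us r"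
      using Suc.prems(1) by (auto simp: list_all2_Cons2)
    have "homogenize \<xi> (x * y # r) H w = weight_part \<xi> (w + sum_list ((v + u) # us)) (H (x * y # r))"
      by (rule homogenize_homogeneous_args[OF Suc.prems(2)]) (use vs xs in \<open>simp_all add: homogeneous_mult\<close>)
    moreover have "bar_diff (*) (\<lambda>l. homogenize \<xi> (x # l) H w) (y # r) =
        bar_diff (*) (\<lambda>l. homogenize \<xi> l (\<lambda>l. H (x # l)) (w + v)) (y # r)"
      by (rule bar_diff_cong) (rule homogenize_Cons[OF Suc.prems(2) vs(2)], use xs in simp)
    moreover have "\<dots> = weight_part \<xi> (w + v + sum_list (u # us)) (bar_diff (*) (\<lambda>l. H (x # l)) (y # r))"
      by (rule Suc.IH) (use vs xs mlin_Cons[OF Suc.prems(2)] in simp_all)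
    ultimately show ?case
      by (simp add: xs vs(1) weight_part_diff add.assoc)
  qed
  show ?thesis
  proof (rule mlin_eq_homogeneous[OF m[OF mlin_homogenize[OF assms(1)]] mlin_homogenize[OF m[OF assms(1)]] assms(2)])
    fix xs :: "('a, 'b, 'c) alg list" and vs assume "list_all2 (homogeneous \<xi>) vs xs" "length xs = Suc n"
    then show "bar_diff (*) (\<lambda>l. homogenize \<xi> l H w) xs = homogenize \<xi> xs (bar_diff (*) H) w"
      using assms(1) by (simp add: * homogenize_homogeneous_args[OF m])
  qed
qed

lemma homogenize_left_ext:
  assumes "mlin_alg n G" "length xs = Suc n"
  shows "left_ext (\<lambda>l. homogenize \<xi> l G w) xs = homogenize \<xi> xs (left_ext G) w"
proof (rule mlin_eq_homogeneous[OF mlin_left_ext[OF mlin_homogenize[OF assms(1)]] mlin_homogenize[OF mlin_left_ext[OF assms(1)]] assms(2)])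
  fix xs :: "('a, 'b, 'c) alg list" and vs assume xs: "list_all2 (homogeneous \<xi>) vs xs" "length xs = Suc n"
  then obtain x r v us where x: "xs = x # r" "length r = n" "vs = v # us" "homogeneous \<xi> v x" "list_all2 (homogeneous \<xi>) us r"
    by (auto simp: length_Suc_conv list_all2_Cons2)
  have "w + sum_list vs = v + (w + sum_list us)" by (simp add: x)
  then show "left_ext (\<lambda>l. homogenize \<xi> l G w) xs = homogenize \<xi> xs (left_ext G) w"
    unfolding homogenize_homogeneous_args[OF mlin_left_ext[OF assms(1)] xs]
    using homogenize_homogeneous_args[OF assms(1) x(5,2)] x(1,4)
    by (simp only: left_ext_def list.sel weight_part_mult_left)
qed

lemma homogenize_cochains: "F \<in> cochains scale_alg n \<Longrightarrow> (\<lambda>xs. homogenize \<xi> xs F w) \<in> cochains scale_alg n"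
proof -
  assume F: "F \<in> cochains scale_alg n"
  then have "homogenize \<xi> xs F w = homogenize \<xi> xs (\<lambda>l. 0) w" if "length xs \<noteq> n" for xs
    by (intro homogenize_cong) (use that in \<open>simp add: alg_module.cochains_iff\<close>)
  then show ?thesis using F by (simp add: alg_module.cochains_iff mlin_homogenize homogenize_zero)
qed

lemma homogenize_cocycles:
  assumes F: "F \<in> cocycles scale_alg n"
  shows "(\<lambda>xs. homogenize \<xi> xs F w) \<in> cocycles scale_alg n"
proof -
  have mF: "mlin_alg n F" using F by (simp add: cocycles_def alg_module.cochains_iff)
  let ?G = "\<lambda>xs. homogenize \<xi> xs F w"
  have "hoch_diff n ?G xs = 0" for xs
  proof (cases "length xs = Suc n")
    case True
    then obtain x r where x: "xs = x # r" "length r = n" by (auto simp: length_Suc_conv)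
    have "hoch_diff n ?G xs = left_ext ?G xs - bar_diff (*) ?G xs"
      using True by (simp add: hoch_diff_bar_diff left_ext_def)
    also have "\<dots> = homogenize \<xi> xs (left_ext F) w - homogenize \<xi> xs (bar_diff (*) F) w"
      by (simp only: homogenize_left_ext[OF mF True] homogenize_bar_diff[OF mF True])
    also have "homogenize \<xi> xs (left_ext F) w = homogenize \<xi> xs (bar_diff (*) F) w"
    proof (rule homogenize_cong)
      fix l :: "('a, 'b, 'c) alg list" assume "length l = length xs"
      then have "length l = n + 1" using True by simp
      then have "hoch_diff n F l = left_ext F l - bar_diff (*) F l"
        by (simp add: hoch_diff_bar_diff left_ext_def)
      then show "left_ext F l = bar_diff (*) F l" using F by (simp add: cocycles_def)
    qed
    finally show ?thesis by simp
  qed (simp add: hoch_diff_def)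
  then show ?thesis using homogenize_cochains[of F n \<xi> w] F by (auto simp: cocycles_def)
qed

lemma homogeneous_idem: "homogeneous \<xi> 0 (idem i)"
  by (simp add: idem_path_elem weight_part_path_elem)

lemma weight_part_idem_mult: "weight_part \<xi> w (idem i * x * idem j) = idem i * weight_part \<xi> w x * idem j"
  using weight_part_mult_left[OF homogeneous_idem, of \<xi> w i "x * idem j"]
    weight_part_mult_right[OF homogeneous_idem, of \<xi> w x j] by (simp add: mult.assoc)

lemma lift_right_homogeneous:
  fixes \<Phi> \<Psi> :: "('k::field, 'n::finite, 'm::nontriv) alg \<Rightarrow> 'm label \<Rightarrow> ('k, 'n, 'm) alg"
  assumes lin: "\<And>g. lin scale_alg scale_alg (\<lambda>x. \<Phi> x g)" "\<And>g. lin scale_alg scale_alg (\<lambda>x. \<Psi> x g)"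
    and eq: "\<And>u x r i. r \<le> n \<Longrightarrow> homogeneous \<xi> u x \<Longrightarrow>
      \<Psi> x (n, r, i) = weight_part \<xi> (w + u + label_weight TYPE('n) \<xi> (n, r, i)) (\<Phi> x (n, r, i))"
    and p: "p \<in> homogeneous_part \<xi> n v"
  shows "lift_right scale_alg (*) \<Psi> p = weight_part \<xi> (w + v) (lift_right scale_alg (*) \<Phi> p)"
  using p
proof (induction rule: homogeneous_part_induct)
  note L = AA.lin_lift_right[OF lin(1)] AA.lin_lift_right[OF lin(2)]
  {
    case zero
    show ?case by (simp add: lin_0[OF L(1)] lin_0[OF L(2)])
  next
    case (add p q)
    then show ?case using L by (simp add: lin_def weight_part_add)
  next
    case (scale c p)
    then show ?case using L by (simp add: lin_def weight_part_scale)
  next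
    case (tensor x y r i u u')
    have x: "homogeneous \<xi> u (x * idem (source (n, r, i)))"
      using homogeneous_mult[OF tensor(2) homogeneous_idem] by simp
    have y: "homogeneous \<xi> u' (idem (target (n, r, i)) * y)"
      using homogeneous_mult[OF homogeneous_idem tensor(3)] by simp
    have "w + v = w + u + label_weight TYPE('n) \<xi> (n, r, i) + u'"
      unfolding tensor(4)[symmetric] by (simp only: add.assoc)
    then show ?case
      unfolding AA.lift_right_tensor[OF lin(1)] AA.lift_right_tensor[OF lin(2)] eq[OF tensor(1) x]
      unfolding \<open>w + v = _\<close> weight_part_mult_right[OF y] by (simp only:)
  }
qed

text \<open>\<iota> preserves weights because the differential of P does.\<close>

lemma pull_gen_homogenize:
  fixes H :: "('k::field, 'n::finite, 'm::nontriv) alg list \<Rightarrow> ('k, 'n, 'm) alg"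
  shows "mlin_alg (Suc n) H \<Longrightarrow> r \<le> n \<Longrightarrow> homogeneous \<xi> v x \<Longrightarrow>
    pull_gen scale_alg (*) n (\<lambda>l. homogenize \<xi> l H w) x (n, r, i) =
      weight_part \<xi> (w + v + label_weight TYPE('n) \<xi> (n, r, i)) (pull_gen scale_alg (*) n H x (n, r, i))"
proof (induction n arbitrary: H r i v x w)
  case 0
  then show ?case
    using homogenize_homogeneous_args[of 1 H \<xi> "[v]" "[x]" w] by (simp add: zero_prod_def add.assoc del: homogenize.simps)
next
  case (Suc n)
  have m: "mlin_alg (Suc n) (\<lambda>l. H (x # l))" by (rule mlin_Cons[OF Suc.prems(1)])
  have "pull_gen scale_alg (*) n (\<lambda>l. homogenize \<xi> (x # l) H w) =
      pull_gen scale_alg (*) n (\<lambda>l. homogenize \<xi> l (\<lambda>l. H (x # l)) (w + v))"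
    by (rule AA.pull_gen_cong) (rule homogenize_Cons[OF Suc.prems(1,3)])
  then have "pull_gen scale_alg (*) (Suc n) (\<lambda>l. homogenize \<xi> l H w) x (Suc n, r, i) =
      lift_right scale_alg (*) (pull_gen scale_alg (*) n (\<lambda>l. homogenize \<xi> l (\<lambda>l. H (x # l)) (w + v))) (diff_gen (Suc n) r i)"
    by (simp del: homogenize.simps)
  also have "\<dots> = weight_part \<xi> ((w + v) + label_weight TYPE('n) \<xi> (Suc n, r, i))
      (lift_right scale_alg (*) (pull_gen scale_alg (*) n (\<lambda>l. H (x # l))) (diff_gen (Suc n) r i))"
    by (rule lift_right_homogeneous[OF AA.lin_pull_gen[OF m] AA.lin_pull_gen[OF mlin_homogenize[OF m]] _
          diff_gen_homogeneous[OF Suc.prems(2)]])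
       (rule Suc.IH[OF m])
  finally show ?case by simp
qed

lemma pull_cochain_homogenize:
  fixes G :: "('k::field, 'n::finite, 'm::nontriv) alg list \<Rightarrow> ('k, 'n, 'm) alg"
  assumes "mlin_alg n G" "r \<le> n"
  shows "pull_cochain n (\<lambda>l. homogenize \<xi> l G w) (n, r, i) =
    weight_part \<xi> (w + label_weight TYPE('n) \<xi> (n, r, i)) (pull_cochain n G (n, r, i))"
proof -
  have one: "homogeneous \<xi> 0 (1 :: ('k, 'n, 'm) alg)"
    by (simp add: word_sum_Nil[symmetric] word_sum_def weight_part_sum weight_part_path_elem)
  have "pull_gen scale_alg (*) n (left_ext (\<lambda>l. homogenize \<xi> l G w)) =
      pull_gen scale_alg (*) n (\<lambda>l. homogenize \<xi> l (left_ext G) w)"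
    by (rule AA.pull_gen_cong) (rule homogenize_left_ext[OF assms(1)])
  then show ?thesis
    using pull_gen_homogenize[OF mlin_left_ext[OF assms(1)] assms(2) one]
    by (simp add: pull_cochain_def del: label_weight.simps)
qed

lemma evaluate_homogeneous:
  fixes k :: "'m::nontriv label \<Rightarrow> ('k::field, 'n::finite, 'm) alg"
  assumes "p \<in> homogeneous_part \<xi> n v"
  shows "evaluate (\<lambda>g. weight_part \<xi> (w + label_weight TYPE('n) \<xi> g) (k g)) p = weight_part \<xi> (w + v) (evaluate k p)"
  using assms
proof (induction rule: homogeneous_part_induct)
  case (tensor x y r i u u')
  let ?g = "(n, r, i)"
  have x: "homogeneous \<xi> u (x * idem (source ?g))"
    using homogeneous_mult[OF tensor(2) homogeneous_idem] by simp
  have y: "homogeneous \<xi> u' (idem (target ?g) * y)"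
    using homogeneous_mult[OF homogeneous_idem tensor(3)] by simp
  have e: "w + v = u + (w + label_weight TYPE('n) \<xi> ?g + u')"
    unfolding tensor(4)[symmetric] by (simp only: add.assoc add.left_commute)
  have "weight_part \<xi> (w + v) (evaluate k (tensor x ?g y)) =
      weight_part \<xi> (w + v) (x * idem (source ?g) * (k ?g * (idem (target ?g) * y)))"
    by (simp add: evaluate_tensor mult.assoc)
  also have "\<dots> = x * idem (source ?g) * (weight_part \<xi> (w + label_weight TYPE('n) \<xi> ?g) (k ?g) * (idem (target ?g) * y))"
    unfolding e weight_part_mult_left[OF x] weight_part_mult_right[OF y] ..
  finally show ?case by (simp only: evaluate_tensor mult.assoc)
qed (simp_all add: evaluate_add evaluate_scale weight_part_add weight_part_scale)

lemma pull_cochain_diff: "pull_cochain n (\<lambda>l. G l - G' l) g = pull_cochain n G g - pull_cochain n G' g"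
proof -
  have "left_ext (\<lambda>l. G l - G' l) = (\<lambda>l. left_ext G l - left_ext G' l)"
    by (rule ext) (simp add: left_ext_def right_diff_distrib)
  then show ?thesis by (simp add: pull_cochain_def AA.pull_gen_diff)
qed

lemma evaluate_one: "evaluate f (tensor 1 g 1) = idem (source g) * f g * idem (target g)"
  by (simp add: evaluate_tensor)

lemma evaluate_differential_component:
  assumes "\<And>r i. r \<le> Suc n \<Longrightarrow> evaluate f (tensor 1 (Suc n, r, i) 1) = evaluate k (diff_gen (Suc n) r i)"
    and "p \<in> component (Suc n)"
  shows "evaluate f p = evaluate k (differential p)"
  using assms(2)
proof (induction rule: component_induct)
  case (tensor x r i y)
  let ?g = "(Suc n, r, i)"
  have "evaluate f (tensor x ?g y) = x * (idem (source ?g) * f ?g * idem (target ?g)) * y"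
    by (simp add: evaluate_tensor mult.assoc)
  then show ?case
    using assms(1)[OF tensor, of i] by (simp only: differential_tensor evaluate_mult evaluate_one)
qed (simp_all add: evaluate_add evaluate_scale differential_linear)

definition resolution_cocycle :: "nat \<Rightarrow> ('m::nontriv label \<Rightarrow> ('k::field, 'n::finite, 'm) alg) \<Rightarrow> bool" where
  "resolution_cocycle n f \<longleftrightarrow> (\<forall>r i. r \<le> Suc n \<longrightarrow> evaluate f (diff_gen (Suc n) r i) = 0)"

lemma resolution_cocycle_differential:
  assumes "resolution_cocycle n f" "p \<in> component (Suc n)"
  shows "evaluate f (differential p) = 0"
proof -
  have z: "evaluate (\<lambda>_. 0) p = 0" for p :: "('b, 'c, 'a) bimod"
    by (induction p rule: bimod_induct) (simp_all add: evaluate_add evaluate_tensor)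
  have "evaluate (\<lambda>_. 0) p = evaluate f (differential p)"
    by (rule evaluate_differential_component[OF _ assms(2)]) (use assms(1) in \<open>simp add: resolution_cocycle_def z\<close>)
  then show ?thesis by (simp add: z)
qed

section \<open>Homogeneous representatives and homogeneous coboundaries\<close>

context
  fixes \<pi> :: "('k::field, 'n::finite, 'm::nontriv) alg list \<Rightarrow> ('k, 'n, 'm) bimod"
  assumes \<pi>: "comparison_map \<pi>"
begin

text \<open>f \<circ> \<pi> is not homogeneous in general, since \<pi> is arbitrary; F is its
  component of degree w. On P, f \<circ> \<pi> \<circ> \<iota> = f + k \<circ> \<partial> by
  \<open>pull_bar_rep\<close>, and f has degree w, so f \<circ> \<pi> and F differ there by the
  coboundary of \<open>l\<close>, which is k minus its component of degree w. The bound on the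
  degree is that of \<open>pull_bar_rep\<close>.\<close>

lemma homogeneous_representative:
  fixes f :: "'m label \<Rightarrow> ('k, 'n, 'm) alg"
  assumes m: "odd CARD('m)" and n: "Suc n \<le> 2 * CARD('m)" and f: "resolution_cocycle (Suc n) f"
    and w: "\<And>r i. r \<le> Suc n \<Longrightarrow> homogeneous \<xi> (w + label_weight TYPE('n) \<xi> (Suc n, r, i)) (f (Suc n, r, i))"
  shows "\<exists>F\<in>cocycles scale_alg (Suc n). homogeneous_cochain \<xi> w (Suc n) F \<and>
    HH_class scale_alg (Suc n) (bar_rep \<pi> (Suc n) f) = HH_class scale_alg (Suc n) F"
proof -
  let ?B = "bar_rep \<pi> (Suc n) f"
  let ?F = "\<lambda>xs. homogenize \<xi> xs ?B w"
  let ?lw = "label_weight TYPE('n) \<xi>"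
  have B: "?B \<in> cocycles scale_alg (Suc n)"
    by (rule bar_rep_cocycles[OF \<pi>]) (rule resolution_cocycle_differential[OF f])
  then have mB: "mlin_alg (Suc n) ?B" by (simp add: cocycles_def alg_module.cochains_iff)
  have F: "?F \<in> cocycles scale_alg (Suc n)" by (rule homogenize_cocycles[OF B])
  have hF: "homogeneous_cochain \<xi> w (Suc n) ?F" by (rule homogeneous_cochain_homogenize[OF mB])
  obtain k where k: "\<And>p. p \<in> component (Suc n) \<Longrightarrow>
      evaluate (pull_cochain (Suc n) ?B) p - evaluate f p = evaluate k (differential p)"
    using pull_bar_rep[OF \<pi> m n resolution_cocycle_differential[OF f]] by blast
  define l where "l g = k g - weight_part \<xi> (w + ?lw g) (k g)" for g
  have "(\<lambda>xs. ?B xs - ?F xs) \<in> coboundaries scale_alg (Suc n)"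
  proof (rule coboundary_if_pull_coboundary[OF \<pi> alg_module.cocycles_diff[OF B F]], rule evaluate_differential_component)
    fix r and i :: "'m mod_ring" assume r: "r \<le> Suc n"
    let ?g = "(Suc n, r, i)"
    let ?t = "tensor 1 ?g 1 :: ('k, 'n, 'm) bimod"
    have t: "?t \<in> component (Suc n)" by (rule tensor_one_component[OF r])
    have d: "differential ?t = diff_gen (Suc n) r i" by (simp add: differential_tensor)
    have e: "evaluate (pull_cochain (Suc n) ?B) ?t = evaluate f ?t + evaluate k (diff_gen (Suc n) r i)"
      using k[OF t] by (simp add: d algebra_simps)
    have "evaluate (pull_cochain (Suc n) ?F) ?t = weight_part \<xi> (w + ?lw ?g) (evaluate (pull_cochain (Suc n) ?B) ?t)"
      unfolding evaluate_one pull_cochain_homogenize[OF mB r] weight_part_idem_mult ..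
    also have "\<dots> = evaluate f ?t + weight_part \<xi> (w + ?lw ?g) (evaluate k (diff_gen (Suc n) r i))"
      unfolding e weight_part_add evaluate_one[of f] weight_part_idem_mult w[OF r] ..
    also have "weight_part \<xi> (w + ?lw ?g) (evaluate k (diff_gen (Suc n) r i)) =
        evaluate (\<lambda>g. weight_part \<xi> (w + ?lw g) (k g)) (diff_gen (Suc n) r i)"
      by (rule evaluate_homogeneous[OF diff_gen_homogeneous[OF r], symmetric])
    finally have eF: "evaluate (pull_cochain (Suc n) ?F) ?t = evaluate f ?t +
        evaluate (\<lambda>g. weight_part \<xi> (w + ?lw g) (k g)) (diff_gen (Suc n) r i)" .
    have lin_f: "evaluate (\<lambda>g. a g - b g) p = evaluate a p - evaluate b p"
      for a b :: "'m label \<Rightarrow> ('k, 'n, 'm) alg" and p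
      by (induction p rule: bimod_induct) (simp_all add: evaluate_add evaluate_tensor right_diff_distrib left_diff_distrib add_diff_add)
    have "pull_cochain (Suc n) (\<lambda>xs. ?B xs - ?F xs) = (\<lambda>g. pull_cochain (Suc n) ?B g - pull_cochain (Suc n) ?F g)"
      by (rule ext) (rule pull_cochain_diff)
    then show "evaluate (pull_cochain (Suc n) (\<lambda>xs. ?B xs - ?F xs)) ?t = evaluate l (diff_gen (Suc n) r i)"
      unfolding l_def by (simp add: lin_f e eF)
  qed
  moreover have "HH_class scale_alg (Suc n) ?B = HH_class scale_alg (Suc n) ?F"
    if "(\<lambda>xs. ?B xs - ?F xs) \<in> coboundaries scale_alg (Suc n)"
  proof -
    have "(\<lambda>xs. ?B xs - g xs) \<in> coboundaries scale_alg (Suc n) \<longleftrightarrow> (\<lambda>xs. ?F xs - g xs) \<in> coboundaries scale_alg (Suc n)" for g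
      using alg_module.coboundaries_diff[OF _ that, of "\<lambda>xs. ?B xs - g xs"]
        alg_module.coboundaries_add[OF that, of "\<lambda>xs. ?F xs - g xs"] by auto
    then show ?thesis using B F by (auto simp: alg_module.mem_HH_class)
  qed
  ultimately show ?thesis using F hF by blast
qed

text \<open>The question is moved to P: K \<circ> \<iota> is a cocycle there and still homogeneous,
  and \<kappa> is this cocycle cut down by idempotents to values parallel to the labels.\<close>

lemma homogeneous_coboundary:
  fixes K :: "('k, 'n, 'm) alg list \<Rightarrow> ('k, 'n, 'm) alg"
  assumes K: "K \<in> cocycles scale_alg (Suc n)" and hK: "homogeneous_cochain \<xi> w (Suc n) K"
    and H: "\<And>\<kappa> :: 'm label \<Rightarrow> ('k, 'n, 'm) alg. resolution_cocycle (Suc n) \<kappa> \<Longrightarrow>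
      (\<And>r i. r \<le> Suc n \<Longrightarrow> \<kappa> (Suc n, r, i) = idem i * \<kappa> (Suc n, r, i) * idem (target (Suc n, r, i))) \<Longrightarrow>
      (\<And>r i. r \<le> Suc n \<Longrightarrow> homogeneous \<xi> (w + label_weight TYPE('n) \<xi> (Suc n, r, i)) (\<kappa> (Suc n, r, i))) \<Longrightarrow>
      \<exists>k. \<forall>r i. r \<le> Suc n \<longrightarrow> \<kappa> (Suc n, r, i) = evaluate k (diff_gen (Suc n) r i)"
  shows "K \<in> coboundaries scale_alg (Suc n)"
proof -
  have mK: "mlin_alg (Suc n) K" using K by (simp add: cocycles_def alg_module.cochains_iff)
  define \<kappa> where "\<kappa> g = evaluate (pull_cochain (Suc n) K) (tensor 1 g 1)" for g
  have ek: "evaluate \<kappa> p = evaluate (pull_cochain (Suc n) K) p" for p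
    unfolding \<kappa>_def
    by (rule evaluate_eqI[symmetric]) (simp_all add: evaluate_add evaluate_mult)
  have "resolution_cocycle (Suc n) \<kappa>"
    unfolding resolution_cocycle_def
  proof (intro allI impI)
    fix r and i :: "'m mod_ring" assume r: "r \<le> Suc (Suc n)"
    let ?t = "tensor 1 (Suc (Suc n), r, i) 1 :: ('k, 'n, 'm) bimod"
    have t: "?t \<in> component (Suc (Suc n))" by (rule tensor_one_component[OF r])
    have "evaluate \<kappa> (diff_gen (Suc (Suc n)) r i) = pull_alg (Suc n) (left_ext K) (differential ?t)"
      by (simp add: ek pull_left_ext[OF mK] differential_tensor)
    also have "\<dots> = pull_alg (Suc (Suc n)) (bar_diff (*) (left_ext K)) ?t"
      by (rule AA.pull_bar_diff[OF mlin_left_ext[OF mK] t, symmetric])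
    also have "\<dots> = pull_alg (Suc (Suc n)) (\<lambda>l. 0) ?t"
    proof (rule arg_cong[OF AA.pull_cong, of _ _ _ "\<lambda>f. f ?t"])
      fix l :: "('k, 'n, 'm) alg list" assume "length l = Suc (Suc (Suc n))"
      then obtain x y r where "l = x # y # r" "length r = Suc n" by (auto simp: length_Suc_conv)
      then show "bar_diff (*) (left_ext K) l = 0"
        using K by (simp add: bar_diff_left_ext cocycles_def del: bar_diff.simps)
    qed
    finally show "evaluate \<kappa> (diff_gen (Suc (Suc n)) r i) = 0" by (simp add: AA.pull_zero)
  qed
  moreover have "\<kappa> (Suc n, r, i) = idem i * \<kappa> (Suc n, r, i) * idem (target (Suc n, r, i))" for r i
    unfolding \<kappa>_def evaluate_one by (simp add: mult.assoc idem_mult idem_mult_assoc del: target.simps)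
  moreover have "homogeneous \<xi> (w + label_weight TYPE('n) \<xi> (Suc n, r, i)) (\<kappa> (Suc n, r, i))" if r: "r \<le> Suc n" for r i
  proof -
    have "pull_gen scale_alg (*) (Suc n) (left_ext (\<lambda>l. homogenize \<xi> l K w)) = pull_gen scale_alg (*) (Suc n) (left_ext K)"
      by (rule AA.pull_gen_cong) (simp add: left_ext_def homogenize_eq_self[OF mK hK])
    then have "pull_cochain (Suc n) (\<lambda>l. homogenize \<xi> l K w) (Suc n, r, i) = pull_cochain (Suc n) K (Suc n, r, i)"
      by (simp add: pull_cochain_def)
    then have "homogeneous \<xi> (w + label_weight TYPE('n) \<xi> (Suc n, r, i)) (pull_cochain (Suc n) K (Suc n, r, i))"
      using pull_cochain_homogenize[OF mK r, of \<xi> w i] by simp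
    then show ?thesis
      unfolding \<kappa>_def evaluate_one weight_part_idem_mult by simp
  qed
  ultimately obtain k where k: "\<forall>r i. r \<le> Suc n \<longrightarrow> \<kappa> (Suc n, r, i) = evaluate k (diff_gen (Suc n) r i)"
    using H[of \<kappa>] by blast
  show ?thesis
    by (rule coboundary_if_pull_coboundary[OF \<pi> K], rule evaluate_differential_component)
       (use k in \<open>simp_all add: \<kappa>_def\<close>)
qed

end

section \<open>Weights of brackets\<close>

lemma homogeneous_cochain_circ:
  fixes f g :: "('k::field, 'n::finite, 'm::nontriv) alg list \<Rightarrow> ('k, 'n, 'm) alg"
  assumes f: "homogeneous_cochain \<xi> v n f" and g: "homogeneous_cochain \<xi> w q g" and l: "Suc l = n + q"
  shows "homogeneous_cochain \<xi> (v + w) l (circ n q f g)"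
  unfolding homogeneous_cochain_def
proof (intro allI impI)
  fix xs :: "('k, 'n, 'm) alg list" and vs assume xs: "list_all2 (homogeneous \<xi>) vs xs" "length xs = l"
  have len: "length vs = l" using xs list_all2_lengthD by force
  have s: "homogeneous \<xi> u ((- 1) ^ e * x)" if "homogeneous \<xi> u x" for u e and x :: "('k, 'n, 'm) alg"
    using that by (cases "even e") (simp_all add: weight_part_minus)
  have "homogeneous \<xi> (v + w + sum_list vs)
      (f (take (i - 1) xs @ [g (take q (drop (i - 1) xs))] @ drop (i - 1 + q) xs))" if i: "i \<in> {1..n}" for i
  proof -
    let ?j = "i - 1"
    let ?us = "take q (drop ?j vs)"
    have "homogeneous \<xi> (w + sum_list ?us) (g (take q (drop ?j xs)))"
      using g xs i l unfolding homogeneous_cochain_def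
      by (auto intro!: list_all2_takeI list_all2_dropI)
    then have "list_all2 (homogeneous \<xi>) (take ?j vs @ [w + sum_list ?us] @ drop (?j + q) vs)
        (take ?j xs @ [g (take q (drop ?j xs))] @ drop (?j + q) xs)"
      using xs by (intro list_all2_appendI list_all2_takeI list_all2_dropI) simp_all
    moreover have "length (take ?j xs @ [g (take q (drop ?j xs))] @ drop (?j + q) xs) = n"
      using i l xs(2) by auto
    ultimately have "homogeneous \<xi> (v + sum_list (take ?j vs @ [w + sum_list ?us] @ drop (?j + q) vs))
      (f (take ?j xs @ [g (take q (drop ?j xs))] @ drop (?j + q) xs))"
      using f unfolding homogeneous_cochain_def by blast
    moreover have "sum_list vs = sum_list (take ?j vs) + sum_list ?us + sum_list (drop (?j + q) vs)"
    proof -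
      have "vs = take ?j vs @ ?us @ drop (?j + q) vs"
        by (metis append_take_drop_id drop_drop add.commute)
      then show ?thesis by (metis sum_list.append add.assoc)
    qed
    then have "v + sum_list (take ?j vs @ [w + sum_list ?us] @ drop (?j + q) vs) = v + w + sum_list vs"
      by (simp add: algebra_simps)
    ultimately show ?thesis by (simp only:)
  qed
  then show "homogeneous \<xi> (v + w + sum_list vs) (circ n q f g xs)"
    unfolding circ_def using l xs(2) by (simp add: weight_part_sum s)
qed

lemma homogeneous_cochain_gerstenhaber:
  fixes f g :: "('k::field, 'n::finite, 'm::nontriv) alg list \<Rightarrow> ('k, 'n, 'm) alg"
  assumes "homogeneous_cochain \<xi> v n f" "homogeneous_cochain \<xi> w q g" "Suc l = n + q"
  shows "homogeneous_cochain \<xi> (v + w) l (gerstenhaber n q f g)"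
proof -
  have "homogeneous_cochain \<xi> (v + w) l (circ n q f g)" "homogeneous_cochain \<xi> (v + w) l (circ q n g f)"
    using homogeneous_cochain_circ[OF assms] homogeneous_cochain_circ[OF assms(2,1), of l] assms(3)
    by (simp_all add: add.commute)
  then show ?thesis
    unfolding homogeneous_cochain_def gerstenhaber_def
    by (cases "even ((n + 1) * (q + 1))") (simp_all add: weight_part_diff weight_part_add)
qed

section \<open>Homogeneous cocycles on the resolution\<close>

abbreviation alt_path :: "'m::nontriv mod_ring \<Rightarrow> step \<Rightarrow> nat \<Rightarrow> ('k::field, 'n::finite, 'm) alg" where
  "alt_path i s L \<equiv> path_elem (i, alternating s L)"

lemma alt_path_word:
  "alt_path i s a * alt_word t b =
     (if a = 0 then alt_path i t b else if b = 0 \<or> t = (if even a then s else flip s) then alt_path i s (a + b) else 0)"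
proof -
  have "alt_path i s a * alt_word t b = idem i * (alt_word s a * alt_word t b)"
    by (simp only: mult.assoc[symmetric] idem_word_sum)
  then show ?thesis unfolding alt_word_mult by (simp only: idem_word_sum if_distrib[of "\<lambda>x. idem i * x"] mult_zero_right)
qed

lemma sum_shift_alternating:
  "sum_list (map shift (alternating s a)) = (if even a then 0 else shift s :: 'a::ring_1)"
  by (induction a arbitrary: s) (auto simp: eq_neg_iff_add_eq_0[symmetric] minus_unique)

lemma alt_word_path:
  "alt_word s a * alt_path i t b =
     (if a = 0 then alt_path i t b else if b = 0 \<or> t = (if even a then s else flip s)
      then alt_path (if even a then i else i - shift s) s (a + b) else 0)"
proof -
  have "alt_word s a * alt_path i t b = word_sum (alternating s a) * idem i * alt_word t b"
    by (simp only: mult.assoc idem_word_sum)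
  also have "\<dots> = alt_path (if even a then i else i - shift s) s a * alt_word t b"
    by (simp add: word_sum_idem sum_shift_alternating)
  finally show ?thesis unfolding alt_path_word by (cases "a = 0") simp_all
qed

lemma homogeneous_closure:
  fixes u :: "('k::field, 'n::finite, 'm::nontriv) alg"
  assumes u: "homogeneous \<xi> v u" "idem i * u = u"
    and P: "P 0" "\<And>x y. P x \<Longrightarrow> P y \<Longrightarrow> P (x + y)"
      "\<And>c s L. L \<le> 2 * CARD('n) \<Longrightarrow> weight \<xi> (i, alternating s L) = v \<Longrightarrow> P (scale_alg c (alt_path i s L))"
  shows "P u"
proof -
  have "P (idem i * weight_part \<xi> v x)" for x
  proof (induction x rule: alg_induct)
    case (path c p)
    obtain j w where p: "p = (j, w)" by (cases p)
    consider "j \<noteq> i" | "weight \<xi> p \<noteq> v" | "(path_elem p :: ('k, 'n, 'm) alg) = 0"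
      | s where "j = i" "weight \<xi> p = v" "(i, s, length w) \<in> normal_words TYPE('n)"
        "(path_elem p :: ('k, 'n, 'm) alg) = alt_path i s (length w)" "weight \<xi> (i, alternating s (length w)) = v"
    proof -
      have "(path_elem (j, w) :: ('k, 'n, 'm) alg) = 0 \<or> (\<exists>s. (j, s, length w) \<in> normal_words TYPE('n) \<and>
          (path_elem (j, w) :: ('k, 'n, 'm) alg) = alt_path j s (length w) \<and>
          weight \<xi> (j, w) = weight \<xi> (j, alternating s (length w)))"
        by (rule path_elem_normal_form)
      then show ?thesis using that unfolding p by metis
    qed
    then show ?case
      by cases (use P in \<open>auto simp: weight_part_scale weight_part_path_elem scale_alg_mult_right idem_path_elem
          path_elem_mult p normal_words_def\<close>)
  qed (simp_all add: P distrib_left weight_part_add)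
  from this[of u] show ?thesis using u by simp
qed

lemma parity_cases: "(\<And>k. L = 2 * k \<Longrightarrow> P) \<Longrightarrow> (\<And>k. L = Suc (2 * k) \<Longrightarrow> P) \<Longrightarrow> P" for L :: nat
  by (cases "even L") (auto elim!: evenE oddE)

lemma weight_alternating_cases:
  assumes "weight (\<lambda>_. 1) (i, alternating s L) = (c, d)"
  shows "d = 0 \<and> c \<ge> 0 \<and> L = 2 * nat c \<or> d = 1 \<and> c \<ge> 0 \<and> s = Fwd \<and> L = Suc (2 * nat c)
    \<or> d = - 1 \<and> c \<ge> 1 \<and> s = Bwd \<and> L = Suc (2 * nat (c - 1))"
proof (cases L rule: parity_cases)
  case (1 k)
  then show ?thesis using assms by (auto simp: weight_alternating)
next
  case (2 k)
  then show ?thesis using assms weight_alternating(2,3)[of "\<lambda>_. 1" i k] by (cases s) (auto simp del: alternating.simps)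
qed

lemma homogeneous_forms:
  fixes u :: "('k::field, 'n::finite, 'm::nontriv) alg"
  assumes u: "idem i * u = u"
  shows "homogeneous (\<lambda>_. 1) (int c, 0) u \<Longrightarrow>
      \<exists>a b. u = scale_alg a (alt_path i Fwd (2 * c)) + scale_alg b (alt_path i Bwd (2 * c))"
    and "homogeneous (\<lambda>_. 1) (int c, 1) u \<Longrightarrow> \<exists>a. u = scale_alg a (alt_path i Fwd (Suc (2 * c)))"
    and "homogeneous (\<lambda>_. 1) (int (Suc c), - 1) u \<Longrightarrow> \<exists>a. u = scale_alg a (alt_path i Bwd (Suc (2 * c)))"
    and "homogeneous (\<lambda>_. 1) (C, D) u \<Longrightarrow> u \<noteq> 0 \<Longrightarrow>
      D = 0 \<and> 0 \<le> C \<and> C \<le> int CARD('n) \<or> D = 1 \<and> 0 \<le> C \<and> C < int CARD('n) \<or> D = - 1 \<and> 1 \<le> C \<and> C \<le> int CARD('n)"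
proof -
  note add = alg.scale_left_distrib[symmetric]
  show "\<exists>a b. u = scale_alg a (alt_path i Fwd (2 * c)) + scale_alg b (alt_path i Bwd (2 * c))"
    if "homogeneous (\<lambda>_. 1) (int c, 0) u"
    using that u
  proof (rule homogeneous_closure)
    show "\<exists>a b. (0 :: ('k, 'n, 'm) alg) = scale_alg a (alt_path i Fwd (2 * c)) + scale_alg b (alt_path i Bwd (2 * c))"
      by (intro exI[of _ 0]) simp
    show "\<exists>a b. x + y = scale_alg a (alt_path i Fwd (2 * c)) + scale_alg b (alt_path i Bwd (2 * c))"
      if x: "\<exists>a b. x = scale_alg a (alt_path i Fwd (2 * c)) + scale_alg b (alt_path i Bwd (2 * c))"
        and y: "\<exists>a b. y = scale_alg a (alt_path i Fwd (2 * c)) + scale_alg b (alt_path i Bwd (2 * c))"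
      for x y :: "('k, 'n, 'm) alg"
    proof -
      obtain a b where "x = scale_alg a (alt_path i Fwd (2 * c)) + scale_alg b (alt_path i Bwd (2 * c))" using x by blast
      moreover obtain a' b' where "y = scale_alg a' (alt_path i Fwd (2 * c)) + scale_alg b' (alt_path i Bwd (2 * c))"
        using y by blast
      ultimately have "x + y = scale_alg (a + a') (alt_path i Fwd (2 * c)) + scale_alg (b + b') (alt_path i Bwd (2 * c))"
        by (simp add: alg.scale_left_distrib algebra_simps)
      then show ?thesis by blast
    qed
    show "\<exists>a b. scale_alg e (alt_path i s L) =
        (scale_alg a (alt_path i Fwd (2 * c)) + scale_alg b (alt_path i Bwd (2 * c)) :: ('k, 'n, 'm) alg)"
      if "weight (\<lambda>_. 1) (i, alternating s L) = (int c, 0)" for e s L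
    proof -
      have L: "L = 2 * c" using weight_alternating_cases[OF that] by auto
      show ?thesis
      proof (cases s)
        case Fwd
        then show ?thesis by (intro exI[of _ e] exI[of _ 0]) (simp add: L)
      next
        case Bwd
        then show ?thesis by (intro exI[of _ 0] exI[of _ e]) (simp add: L)
      qed
    qed
  qed
  have z: "(0 :: ('k, 'n, 'm) alg) = scale_alg 0 x" for x by simp
  show "\<exists>a. u = scale_alg a (alt_path i Fwd (Suc (2 * c)))" if "homogeneous (\<lambda>_. 1) (int c, 1) u"
    using that u
    by (rule homogeneous_closure[where P = "\<lambda>u. \<exists>a. u = scale_alg a _"])
       (auto dest: weight_alternating_cases simp: add simp del: alternating.simps intro: z)
  show "\<exists>a. u = scale_alg a (alt_path i Bwd (Suc (2 * c)))" if "homogeneous (\<lambda>_. 1) (int (Suc c), - 1) u"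
    using that u
    by (rule homogeneous_closure[where P = "\<lambda>u. \<exists>a. u = scale_alg a _"])
       (auto dest: weight_alternating_cases simp: add simp del: alternating.simps intro: z)
  show "D = 0 \<and> 0 \<le> C \<and> C \<le> int CARD('n) \<or> D = 1 \<and> 0 \<le> C \<and> C < int CARD('n) \<or> D = - 1 \<and> 1 \<le> C \<and> C \<le> int CARD('n)"
    (is ?c) if "homogeneous (\<lambda>_. 1) (C, D) u" "u \<noteq> 0"
  proof (rule ccontr)
    assume c: "\<not> ?c"
    have "u = 0"
      using that(1) u
    proof (rule homogeneous_closure)
      fix a s L assume L: "L \<le> 2 * CARD('n)" "weight (\<lambda>_. 1) (i, alternating s L) = (C, D)"
      have False using weight_alternating_cases[OF L(2)] L(1) c by linarith
      then show "scale_alg a (alt_path i s L) = (0 :: ('k, 'n, 'm) alg)" ..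
    qed simp_all
    then show False using that(2) by simp
  qed
qed

lemma label_weight_one:
  "label_weight TYPE('n::finite) (\<lambda>_. 1) (n, r, i) =
    (if 2 * r \<le> n then int (CARD('n) * r) else int (CARD('n) * (n - r)) + int (2 * r - n), int n - 2 * int r)"
proof -
  have *: "weight (\<lambda>_. 1) (i, replicate d Fwd) = (0, int d)" "weight (\<lambda>_. 1) (i, replicate d Bwd) = (int d, - int d)" for d i
    by (induction d arbitrary: i) (simp_all add: zero_prod_def)
  show ?thesis by (auto simp: * min_def)
qed

lemma evaluate_gtensor:
  "evaluate k (gtensor x n \<rho> j y) =
    x * (if 0 \<le> \<rho> \<and> \<rho> \<le> int n then idem j * k (n, nat \<rho>, j) * idem (target (n, nat \<rho>, j)) else 0) * y"
  by (simp add: gtensor_def evaluate_tensor evaluate_0 mult.assoc del: target.simps)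

lemma evaluate_sign_if: "evaluate k (sign_if c p) = sign_if c (evaluate k p)"
  by (simp add: sign_if_def evaluate_minus)

lemma evaluate_zero_fun: "evaluate (\<lambda>_. 0) p = 0"
  by (induction p rule: bimod_induct) (simp_all add: evaluate_add evaluate_tensor)

section \<open>Cocycles on P of one degree n and one weight (c, e)\<close>

locale homogeneous_resolution_cocycle =
  fixes \<kappa> :: "'m::nontriv label \<Rightarrow> ('k::field, 'n::finite, 'm) alg" and n :: nat and c e :: int
  assumes cocycle: "resolution_cocycle n \<kappa>"
    and normal: "r \<le> n \<Longrightarrow> \<kappa> (n, r, i) = idem i * \<kappa> (n, r, i) * idem (target (n, r, i))"
    and homogeneous: "r \<le> n \<Longrightarrow> homogeneous (\<lambda>_. 1) ((c, e) + label_weight TYPE('n) (\<lambda>_. 1) (n, r, i)) (\<kappa> (n, r, i))"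
begin

definition val :: "int \<Rightarrow> 'm mod_ring \<Rightarrow> ('k, 'n, 'm) alg" where
  "val \<rho> i = (if 0 \<le> \<rho> \<and> \<rho> \<le> int n then \<kappa> (n, nat \<rho>, i) else 0)"

lemma val: "r \<le> n \<Longrightarrow> val (int r) i = \<kappa> (n, r, i)"
  by (simp add: val_def)

lemma evaluate_gtensor_val: "evaluate \<kappa> (gtensor x n \<rho> j y) = x * val \<rho> j * y"
  using normal[of "nat \<rho>" j, symmetric] by (simp add: evaluate_gtensor val_def nat_le_iff del: target.simps)

lemma idem_val: "idem i * val \<rho> i = val \<rho> i"
proof -
  have "idem i * x = x" if "x = idem i * x * y" for x y :: "('k, 'n, 'm) alg"
  proof -
    have "idem i * x = idem i * (idem i * x * y)" using that by simp
    also have "\<dots> = idem i * x * y" by (simp add: mult.assoc idem_mult_assoc)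
    also have "\<dots> = x" by (rule that[symmetric])
    finally show ?thesis .
  qed
  from this[OF normal[of "nat \<rho>" i]] show ?thesis by (simp add: val_def nat_le_iff)
qed

text \<open>The first component of the weight of the values at index \<rho>; the second one is e + n
  - 2 \<rho>. As the displacements in A are 0, 1 and -1, the second component leaves one or two
  indices \<rho>, and the level decides which paths are possible there.\<close>

definition level :: "int \<Rightarrow> int" where
  "level \<rho> = c + (if 2 * \<rho> \<le> int n then int CARD('n) * \<rho> else int CARD('n) * (int n - \<rho>) + 2 * \<rho> - int n)"

lemma homogeneous_val: "homogeneous (\<lambda>_. 1) (level \<rho>, e + int n - 2 * \<rho>) (val \<rho> i)"
proof (cases "0 \<le> \<rho> \<and> \<rho> \<le> int n")
  case True
  then obtain r where r: "\<rho> = int r" "r \<le> n" by (metis nonneg_int_cases of_nat_le_iff)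
  have "(c, e) + label_weight TYPE('n) (\<lambda>_. 1) (n, r, i) = (level \<rho>, e + int n - 2 * \<rho>)"
    unfolding label_weight_one level_def r(1) using r(2) by (auto simp: of_nat_diff)
  then show ?thesis using homogeneous[OF r(2), of i] by (simp add: r val)
next
  case False
  then show ?thesis by (auto simp: val_def)
qed

lemma val_nonzero:
  "val \<rho> i \<noteq> 0 \<Longrightarrow> e + int n - 2 * \<rho> = 0 \<and> 0 \<le> level \<rho> \<and> level \<rho> \<le> int CARD('n) \<or>
    e + int n - 2 * \<rho> = 1 \<and> 0 \<le> level \<rho> \<and> level \<rho> < int CARD('n) \<or>
    e + int n - 2 * \<rho> = - 1 \<and> 1 \<le> level \<rho> \<and> level \<rho> \<le> int CARD('n)"
  using homogeneous_forms(4)[OF idem_val homogeneous_val] by blast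

lemma val_range: "val \<rho> i \<noteq> 0 \<Longrightarrow> 0 \<le> \<rho> \<and> \<rho> \<le> int n"
  by (auto simp: val_def split: if_splits)

lemma cocycle_boundary: "evaluate \<kappa> (boundary (Suc n) \<rho> i) = 0"
  using cocycle unfolding resolution_cocycle_def boundary_def by (auto simp: nat_le_iff evaluate_0)

lemma cocycle_pos:
  assumes "int (Suc n) > 2 * \<rho>"
  shows "val \<rho> i * alt_word Fwd 1 + sign_if (even (int (Suc n) + \<rho>)) (alt_word Fwd 1 * val \<rho> (i + 1))
    + sign_if (even (int (Suc n) + \<rho>)) (alt_word Bwd (2 * CARD('n) - 1) * val (\<rho> - 1) (i - 1))
    + sign_if (even (Suc n)) (val (\<rho> - 1) i * alt_word Bwd (2 * CARD('n) - 1)) = 0"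
  using cocycle_boundary[of \<rho> i] unfolding boundary_pos[OF assms]
  by (simp add: evaluate_add evaluate_gtensor_val evaluate_sign_if del: alternating.simps of_nat_Suc even_add)

lemma cocycle_neg:
  assumes "int (Suc n) < 2 * \<rho>"
  shows "val \<rho> i * alt_word Fwd (2 * CARD('n) - 1)
    + sign_if (even (int (Suc n) + \<rho>)) (alt_word Fwd (2 * CARD('n) - 1) * val \<rho> (i + 1))
    + sign_if (even (int (Suc n) + \<rho>)) (alt_word Bwd 1 * val (\<rho> - 1) (i - 1))
    + sign_if (even (Suc n)) (val (\<rho> - 1) i * alt_word Bwd 1) = 0"
  using cocycle_boundary[of \<rho> i] unfolding boundary_neg[OF assms]
  by (simp add: evaluate_add evaluate_gtensor_val evaluate_sign_if del: alternating.simps of_nat_Suc even_add)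

lemma cocycle_mid:
  assumes "int (Suc n) = 2 * \<rho>"
  shows "(\<Sum>l<CARD('n). alt_word Bwd (2 * l) * val \<rho> i * alt_word Fwd (Suc (2 * (CARD('n) - 1 - l))))
    + sign_if (even \<rho>) (\<Sum>l<CARD('n). alt_word Fwd (Suc (2 * l)) * val \<rho> (i + 1) * alt_word Fwd (2 * (CARD('n) - 1 - l)))
    + sign_if (even \<rho>) (\<Sum>l<CARD('n). alt_word Bwd (Suc (2 * l)) * val (\<rho> - 1) (i - 1) * alt_word Bwd (2 * (CARD('n) - 1 - l)))
    + (\<Sum>l<CARD('n). alt_word Fwd (2 * l) * val (\<rho> - 1) i * alt_word Bwd (Suc (2 * (CARD('n) - 1 - l)))) = 0"
  using cocycle_boundary[of \<rho> i] unfolding boundary_mid[OF assms]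
  by (simp add: evaluate_add evaluate_gtensor_val evaluate_sign_if evaluate_sum del: alternating.simps)

lemma cobounds_0: "(\<And>r i. r \<le> n \<Longrightarrow> val (int r) i = 0) \<Longrightarrow> \<exists>k. \<forall>r i. r \<le> n \<longrightarrow> \<kappa> (n, r, i) = evaluate k (diff_gen n r i)"
  by (intro exI[of _ "\<lambda>_. 0"]) (simp add: evaluate_zero_fun val)

end

lemma of_nat_card_mod_ring: "(of_nat CARD('m) :: 'm::nontriv mod_ring) = 0"
  using of_int_mod_ring_eq_0_iff[of "int CARD('m)", where 'm = 'm] by simp

text \<open>Once around the cycle the sign changes m times, an odd number, so a i = - a i.\<close>

lemma alternating_family_zero:
  fixes a :: "'m::nontriv mod_ring \<Rightarrow> 'k::field"
  assumes m: "odd CARD('m)" and two: "(2 :: 'k) \<noteq> 0" and a: "\<And>i. a i + a (i + 1) = 0"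
  shows "a i = 0"
proof -
  have "a (i + of_nat k) = (- 1) ^ k * a i" for k
  proof (induction k)
    case (Suc k)
    have "a (i + of_nat (Suc k)) = - a (i + of_nat k)"
      using a[of "i + of_nat k"] by (simp add: eq_neg_iff_add_eq_0 ac_simps)
    then show ?case using Suc by simp
  qed simp
  from this[of "CARD('m)"] have "a i = - a i"
    using m by (simp add: of_nat_card_mod_ring)
  then have "2 * a i = 0" by (simp add: eq_neg_iff_add_eq_0)
  then show ?thesis using two by simp
qed

lemma alternating_family_solve:
  fixes a :: "'m::nontriv mod_ring \<Rightarrow> 'k::field"
  assumes m: "odd CARD('m)" and two: "(2 :: 'k) \<noteq> 0"
  obtains b where "\<And>i. b i + b (i + 1) = a i"
proof
  fix i
  \<comment> \<open>In the sum of two consecutive values all terms cancel except the first of one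
    and the last of the other; both are a i, since m is odd and i + m = i.\<close>
  let ?s = "\<lambda>i. \<Sum>j<CARD('m). (- 1) ^ j * a (i + of_nat j)"
  obtain M where M: "CARD('m) = Suc M" using gr0_implies_Suc[of "CARD('m)"] by auto
  have "?s (i + 1) = (\<Sum>j<M. (- 1) ^ j * a (i + of_nat (Suc j))) + a i"
    using m of_nat_card_mod_ring[where 'm = 'm] by (simp add: M add.assoc)
  moreover have "?s i = a i - (\<Sum>j<M. (- 1) ^ j * a (i + of_nat (Suc j)))"
    unfolding M sum.lessThan_Suc_shift by (simp add: sum_negf)
  ultimately have "?s i + ?s (i + 1) = 2 * a i" by simp
  then show "?s i / 2 + ?s (i + 1) / 2 = a i"
    using two by (simp add: add_divide_distrib[symmetric])
qed

lemma scale_alt_path_eq_0: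
  fixes a :: "'k::field"
  assumes "scale_alg a (alt_path i s L) = (0 :: ('k, 'n::finite, 'm::nontriv) alg)" "L \<le> 2 * CARD('n)"
  shows "a = 0"
  using arg_cong[OF assms(1), of "coeff_at i s L"] assms(2) step_cases[of s]
  by (auto simp: coeff_at_scale coeff_at_path_elem split: if_splits)

section \<open>Cocycles that are forced to vanish\<close>

context homogeneous_resolution_cocycle
begin

lemma val_vanish_Fwd:
  assumes "odd CARD('m)" "(2 :: 'k) \<noteq> 0"
    and a: "\<And>i. val \<rho> i = scale_alg (a i) (alt_path i s L)"
    and q: "L + q \<le> 2 * CARD('n)" "odd q" "\<And>i. alt_path i s L * alt_word Fwd q = (p i :: ('k, 'n, 'm) alg)"
      "\<And>i. alt_word Fwd q * alt_path (i + 1) s L = (p i :: ('k, 'n, 'm) alg)" "\<And>i. p i = alt_path i Fwd (L + q)"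
    and eq: "\<And>i. val \<rho> i * alt_word Fwd q + alt_word Fwd q * val \<rho> (i + 1) = 0"
  shows "val \<rho> i = 0"
proof -
  have "scale_alg (a i + a (i + 1)) (alt_path i Fwd (L + q)) = (0 :: ('k, 'n, 'm) alg)" for i
    using eq[of i] by (simp only: a scale_alg_mult_left scale_alg_mult_right q(3,4,5) alg.scale_left_distrib)
  then have "a i + a (i + 1) = 0" for i by (rule scale_alt_path_eq_0) (rule q(1))
  then show ?thesis using alternating_family_zero[OF assms(1,2)] by (simp add: a)
qed

lemma val_vanish_Bwd:
  assumes "odd CARD('m)" "(2 :: 'k) \<noteq> 0"
    and a: "\<And>i. val \<rho> i = scale_alg (a i) (alt_path i s L)"
    and q: "L + q \<le> 2 * CARD('n)" "odd q" "\<And>i. alt_path i s L * alt_word Bwd q = (p i :: ('k, 'n, 'm) alg)"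
      "\<And>i. alt_word Bwd q * alt_path (i - 1) s L = (p i :: ('k, 'n, 'm) alg)" "\<And>i. p i = alt_path i Bwd (L + q)"
    and eq: "\<And>i. alt_word Bwd q * val \<rho> (i - 1) + val \<rho> i * alt_word Bwd q = 0"
  shows "val \<rho> i = 0"
proof -
  have "scale_alg (a (i - 1) + a i) (alt_path i Bwd (L + q)) = (0 :: ('k, 'n, 'm) alg)" for i
    using eq[of i] by (simp only: a scale_alg_mult_left scale_alg_mult_right q(3,4,5) alg.scale_left_distrib)
  then have "a (i - 1) + a i = 0" for i by (rule scale_alt_path_eq_0) (rule q(1))
  from this[of "_ + 1"] have "a i + a (i + 1) = 0" for i by simp
  then show ?thesis using alternating_family_zero[OF assms(1,2)] by (simp add: a)
qed

lemma val_idem: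
  assumes "level \<rho> = 0" "e + int n - 2 * \<rho> = 0"
  obtains a where "\<And>i. val \<rho> i = scale_alg (a i) (alt_path i Fwd 0)"
proof -
  have "\<exists>a. val \<rho> i = scale_alg a (alt_path i Fwd 0)" for i
    using homogeneous_forms(1)[OF idem_val, of 0 \<rho> i] homogeneous_val[of \<rho> i] assms
    by (auto simp: alg.scale_left_distrib[symmetric])
  then show thesis using that by metis
qed

lemma val_Fwd:
  assumes "level \<rho> = int t" "e + int n - 2 * \<rho> = 1"
  obtains a where "\<And>i. val \<rho> i = scale_alg (a i) (alt_path i Fwd (Suc (2 * t)))"
proof -
  have "\<exists>a. val \<rho> i = scale_alg a (alt_path i Fwd (Suc (2 * t)))" for i
    using homogeneous_forms(2)[OF idem_val, of t \<rho> i] homogeneous_val[of \<rho> i] assms by simp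
  then show thesis using that by metis
qed

lemma val_Bwd:
  assumes "level \<rho> = int (Suc t)" "e + int n - 2 * \<rho> = - 1"
  obtains a where "\<And>i. val \<rho> i = scale_alg (a i) (alt_path i Bwd (Suc (2 * t)))"
proof -
  have "\<exists>a. val \<rho> i = scale_alg a (alt_path i Bwd (Suc (2 * t)))" for i
    using homogeneous_forms(3)[OF idem_val, of t \<rho> i] homogeneous_val[of \<rho> i] unfolding assms by simp
  then show thesis using that by metis
qed

text \<open>The values are multiples of idempotents. The cocycle condition at \<rho> (for even
  \<rho>, with forward words) or at \<rho> + 1 (for odd \<rho>, with backward words) has equal signs
  as n is odd, so the coefficients alternate around the cycle. The last assumption keeps this
  condition away from the middle label of degree n + 1.\<close>

lemma val_idem_vanish:
  assumes m: "odd CARD('m)" "(2 :: 'k) \<noteq> 0" "odd n"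
    and \<rho>: "level \<rho> = 0" "e + int n - 2 * \<rho> = 0" "\<And>\<sigma> i. \<sigma> \<noteq> \<rho> \<Longrightarrow> val \<sigma> i = 0"
    and "even \<rho> \<and> 2 * \<rho> \<noteq> int (Suc n) \<or> odd \<rho> \<and> 2 * \<rho> + 2 \<noteq> int (Suc n)"
  shows "val \<rho> i = 0"
proof -
  have N: "CARD('n) > 0" by simp
  have o: "even (Suc n)" using m(3) by simp
  obtain a where a: "\<And>i. val \<rho> i = scale_alg (a i) (alt_path i Fwd 0)"
    using val_idem[OF \<rho>(1,2)] by blast
  have p: "alt_path i Fwd 0 * alt_word s q = (alt_path i s q :: ('k, 'n, 'm) alg)" for i s q
    unfolding alt_path_word by simp
  have w: "alt_word Fwd q * alt_path (i + 1) Fwd 0 = (alt_path i Fwd q :: ('k, 'n, 'm) alg)" 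
    "alt_word Bwd q * alt_path (i - 1) Fwd 0 = (alt_path i Bwd q :: ('k, 'n, 'm) alg)" if "odd q" for i q
    unfolding alt_word_path using that by (auto elim: oddE)
  have F: "val \<rho> i = 0" if q: "q \<le> 2 * CARD('n)" "odd q"
      and "\<And>i. val \<rho> i * alt_word Fwd q + alt_word Fwd q * val \<rho> (i + 1) = 0" for q
    by (rule val_vanish_Fwd[OF m(1,2) a _ q(2) p w(1)[OF q(2)] _ that(3)]) (use q(1) in simp_all)
  have B: "val \<rho> i = 0" if q: "q \<le> 2 * CARD('n)" "odd q"
      and "\<And>i. alt_word Bwd q * val \<rho> (i - 1) + val \<rho> i * alt_word Bwd q = 0" for q
    by (rule val_vanish_Bwd[OF m(1,2) a _ q(2) p w(2)[OF q(2)] _ that(3)]) (use q(1) in simp_all)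
  have q: "1 \<le> 2 * CARD('n)" "odd (1 :: nat)" "2 * CARD('n) - 1 \<le> 2 * CARD('n)" "odd (2 * CARD('n) - 1)"
    using N by simp_all
  consider "even \<rho>" "2 * \<rho> < int (Suc n)" | "even \<rho>" "2 * \<rho> > int (Suc n)"
    | "odd \<rho>" "2 * (\<rho> + 1) < int (Suc n)" | "odd \<rho>" "2 * (\<rho> + 1) > int (Suc n)"
    using assms(7) by (auto simp: neq_iff distrib_left)
  then show ?thesis
  proof cases
    case 1
    have "val \<rho> i * alt_word Fwd 1 + alt_word Fwd 1 * val \<rho> (i + 1) = 0" for i
      using cocycle_pos[OF 1(2), of i] 1(1) o by (simp add: sign_if_def \<rho>(3) del: alternating.simps)
    then show ?thesis by (rule F[OF q(1,2)])
  next
    case 2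
    have "val \<rho> i * alt_word Fwd (2 * CARD('n) - 1) + alt_word Fwd (2 * CARD('n) - 1) * val \<rho> (i + 1) = 0" for i
      using cocycle_neg[OF 2(2), of i] 2(1) o by (simp add: sign_if_def \<rho>(3) del: alternating.simps)
    then show ?thesis by (rule F[OF q(3,4)])
  next
    case 3
    have "alt_word Bwd (2 * CARD('n) - 1) * val \<rho> (i - 1) + val \<rho> i * alt_word Bwd (2 * CARD('n) - 1) = 0" for i
      using cocycle_pos[OF 3(2), of i] 3(1) o by (simp add: sign_if_def \<rho>(3) del: alternating.simps)
    then show ?thesis by (rule B[OF q(3,4)])
  next
    case 4
    have "alt_word Bwd 1 * val \<rho> (i - 1) + val \<rho> i * alt_word Bwd 1 = 0" for i
      using cocycle_neg[OF 4(2), of i] 4(1) o by (simp add: sign_if_def \<rho>(3) del: alternating.simps)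
    then show ?thesis by (rule B[OF q(1,2)])
  qed
qed

text \<open>Multiplying by a forward arrow on either side produces the two alternating words of
  length 2t + 2. Below length 2N these are independent, so each coefficient is 0; at length 2N they
  coincide, and for even \<rho> the signs agree, so the argument around the cycle applies.\<close>

lemma val_Bwd_vanish:
  assumes m: "odd CARD('m)" "(2 :: 'k) \<noteq> 0" "odd n"
    and \<rho>: "level \<rho> = int (Suc t)" "e + int n - 2 * \<rho> = - 1" "\<And>\<sigma> i. \<sigma> \<noteq> \<rho> \<Longrightarrow> val \<sigma> i = 0"
    and t: "2 * \<rho> < int (Suc n)" "Suc t < CARD('n) \<or> Suc t = CARD('n) \<and> even \<rho>"
  shows "val \<rho> i = 0"
proof -
  obtain a where a: "\<And>i. val \<rho> i = scale_alg (a i) (alt_path i Bwd (Suc (2 * t)))"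
    using val_Bwd[OF \<rho>(1,2)] by blast
  have p: "alt_path i Bwd (Suc (2 * t)) * alt_word Fwd 1 = (alt_path i Bwd (2 * Suc t) :: ('k, 'n, 'm) alg)" for i
    unfolding alt_path_word by simp
  have w: "alt_word Fwd 1 * alt_path (i + 1) Bwd (Suc (2 * t)) = (alt_path i Fwd (2 * Suc t) :: ('k, 'n, 'm) alg)" for i
    unfolding alt_word_path by simp
  have eq: "scale_alg (a i) (alt_path i Bwd (2 * Suc t)) +
      sign_if (even \<rho>) (scale_alg (a (i + 1)) (alt_path i Fwd (2 * Suc t))) = (0 :: ('k, 'n, 'm) alg)" for i
    using cocycle_pos[OF t(1), of i] m(3) \<rho>(3)[of "\<rho> - 1"]
    unfolding a scale_alg_mult_left scale_alg_mult_right p w by (cases "even \<rho>") (simp_all add: sign_if_def del: alternating.simps mult_Suc_right)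
  consider "Suc t < CARD('n)" | "Suc t = CARD('n)" "even \<rho>" using t(2) by blast
  then have "a i = 0" for i
  proof cases
    case 1
    then show ?thesis
      using arg_cong[OF eq[of i], of "coeff_at i Bwd (2 * Suc t)"]
      by (auto simp: sign_if_def coeff_at_add coeff_at_scale coeff_at_path_elem lin_minus[OF lin_coeff_at] split: if_splits)
  next
    case 2
    have "scale_alg (a i + a (i + 1)) (alt_path i Fwd (2 * CARD('n))) = (0 :: ('k, 'n, 'm) alg)" for i
      using eq[of i] unfolding 2(1) path_elem_socle[of i Bwd] by (simp add: 2(2) sign_if_def alg.scale_left_distrib)
    then have "a i + a (i + 1) = 0" for i by (rule scale_alt_path_eq_0) simp
    then show ?thesis by (rule alternating_family_zero[OF m(1,2)])
  qed
  then show ?thesis by (simp add: a)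
qed

text \<open>Mirror image of \<open>val_Bwd_vanish\<close>: the condition is the one at \<rho> + 1,
  with a backward arrow, and the signs agree for odd \<rho>.\<close>

lemma val_Fwd_vanish:
  assumes m: "odd CARD('m)" "(2 :: 'k) \<noteq> 0" "odd n"
    and \<rho>: "level \<rho> = int t" "e + int n - 2 * \<rho> = 1" "\<And>\<sigma> i. \<sigma> \<noteq> \<rho> \<Longrightarrow> val \<sigma> i = 0"
    and t: "2 * (\<rho> + 1) > int (Suc n)" "Suc t < CARD('n) \<or> Suc t = CARD('n) \<and> odd \<rho>"
  shows "val \<rho> i = 0"
proof -
  obtain a where a: "\<And>i. val \<rho> i = scale_alg (a i) (alt_path i Fwd (Suc (2 * t)))"
    using val_Fwd[OF \<rho>(1,2)] by blast
  have p: "alt_path i Fwd (Suc (2 * t)) * alt_word Bwd 1 = (alt_path i Fwd (2 * Suc t) :: ('k, 'n, 'm) alg)" for i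
    unfolding alt_path_word by simp
  have w: "alt_word Bwd 1 * alt_path (i - 1) Fwd (Suc (2 * t)) = (alt_path i Bwd (2 * Suc t) :: ('k, 'n, 'm) alg)" for i
    unfolding alt_word_path by simp
  have eq: "sign_if (odd \<rho>) (scale_alg (a (i - 1)) (alt_path i Bwd (2 * Suc t))) +
      scale_alg (a i) (alt_path i Fwd (2 * Suc t)) = (0 :: ('k, 'n, 'm) alg)" for i
    using cocycle_neg[OF t(1), of i] m(3) \<rho>(3)[of "\<rho> + 1"]
    by (simp only: a scale_alg_mult_left scale_alg_mult_right p w add_diff_cancel_right')
       (cases "even \<rho>", simp_all add: sign_if_def del: alternating.simps mult_Suc_right)
  consider "Suc t < CARD('n)" | "Suc t = CARD('n)" "odd \<rho>" using t(2) by blast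
  then have "a i = 0" for i
  proof cases
    case 1
    then show ?thesis
      using arg_cong[OF eq[of i], of "coeff_at i Fwd (2 * Suc t)"]
      by (auto simp: sign_if_def coeff_at_add coeff_at_scale coeff_at_path_elem lin_minus[OF lin_coeff_at] split: if_splits)
  next
    case 2
    have "scale_alg (a (i - 1) + a i) (alt_path i Fwd (2 * CARD('n))) = (0 :: ('k, 'n, 'm) alg)" for i
      using eq[of i] unfolding 2(1) path_elem_socle[of i Bwd] by (simp add: 2(2) sign_if_def alg.scale_left_distrib)
    then have "a (i - 1) + a i = 0" for i by (rule scale_alt_path_eq_0) simp
    from this[of "_ + 1"] have "a i + a (i + 1) = 0" for i by simp
    then show ?thesis by (rule alternating_family_zero[OF m(1,2)])
  qed
  then show ?thesis by (simp add: a)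
qed

end

definition single :: "nat \<Rightarrow> nat \<Rightarrow> ('m::nontriv mod_ring \<Rightarrow> ('k::field, 'n::finite, 'm) alg) \<Rightarrow> 'm label \<Rightarrow> ('k, 'n, 'm) alg" where
  "single n r u = (\<lambda>(n', r', i). if n' = n \<and> r' = r then u i else 0)"

lemma evaluate_single:
  assumes "r \<le> n" "\<And>i. idem i * u i * idem (target (n, r, i)) = u i"
  shows "evaluate (single n r u) (gtensor x n \<rho> j y) = x * (if \<rho> = int r then u j else 0) * y"
  using assms by (auto simp: evaluate_gtensor single_def simp del: target.simps)

context
  fixes n r :: nat and u :: "'m::nontriv mod_ring \<Rightarrow> ('k::field, 'n::finite, 'm) alg"
  assumes u: "r \<le> n" "\<And>i. idem i * u i * idem (target (n, r, i)) = u i"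
begin

lemma evaluate_single_pos:
  assumes "int (Suc n) > 2 * \<rho>"
  shows "evaluate (single n r u) (boundary (Suc n) \<rho> i) =
    (if \<rho> = int r then u i * alt_word Fwd 1 + sign_if (even (int (Suc n) + \<rho>)) (alt_word Fwd 1 * u (i + 1))
     else if \<rho> = int r + 1 then sign_if (even (int (Suc n) + \<rho>)) (alt_word Bwd (2 * CARD('n) - 1) * u (i - 1))
       + sign_if (even (Suc n)) (u i * alt_word Bwd (2 * CARD('n) - 1)) else 0)"
  unfolding boundary_pos[OF assms] evaluate_add evaluate_sign_if evaluate_single[OF u]
  by (auto simp: sign_if_def simp del: alternating.simps)

lemma evaluate_single_neg:
  assumes "int (Suc n) < 2 * \<rho>"
  shows "evaluate (single n r u) (boundary (Suc n) \<rho> i) =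
    (if \<rho> = int r then u i * alt_word Fwd (2 * CARD('n) - 1)
       + sign_if (even (int (Suc n) + \<rho>)) (alt_word Fwd (2 * CARD('n) - 1) * u (i + 1))
     else if \<rho> = int r + 1 then sign_if (even (int (Suc n) + \<rho>)) (alt_word Bwd 1 * u (i - 1))
       + sign_if (even (Suc n)) (u i * alt_word Bwd 1) else 0)"
  unfolding boundary_neg[OF assms] evaluate_add evaluate_sign_if evaluate_single[OF u]
  by (auto simp: sign_if_def simp del: alternating.simps)

end

section \<open>Cocycles with an explicit primitive\<close>

context homogeneous_resolution_cocycle
begin

lemma cobounds:
  assumes "\<And>\<rho> i. val \<rho> i = evaluate k (boundary n \<rho> i)"
  shows "\<exists>k. \<forall>r i. r \<le> n \<longrightarrow> \<kappa> (n, r, i) = evaluate k (diff_gen n r i)"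
proof (intro exI[of _ k] allI impI)
  fix r i assume "r \<le> n"
  then show "\<kappa> (n, r, i) = evaluate k (diff_gen n r i)"
    using assms[of "int r" i] by (simp add: val boundary_def)
qed

text \<open>The weight allows multiples a i of forward and b i of backward arrows at the two indices
  next to the middle. The condition at the middle label of degree n + 1 is N (\<nu> (i - 1) + \<nu>
  i) = 0 for \<nu> i = a i + b (i + 1), so \<nu> = 0. The cocycle is then the coboundary of d i
  times the idempotent, placed on the middle labels of degree n - 1, where d i + d (i + 1) = a
  i.\<close>

lemma cobounds_near_middle:
  assumes m: "odd CARD('m)" "(2 :: 'k) \<noteq> 0" "(of_nat CARD('n) :: 'k) \<noteq> 0"
    and n: "n = Suc (2 * r)" "odd r" and w: "c = - int (CARD('n) * r)" "e = 0"
  shows "\<exists>k. \<forall>r i. r \<le> n \<longrightarrow> \<kappa> (n, r, i) = evaluate k (diff_gen n r i)"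
proof -
  let ?r = "int r"
  have l1: "level ?r = int 0" "e + int n - 2 * ?r = 1" unfolding level_def unfolding n w by simp_all
  have l2: "level (?r + 1) = int (Suc 0)" "e + int n - 2 * (?r + 1) = - 1"
    unfolding level_def unfolding n w by simp_all
  obtain a where a: "\<And>i. val ?r i = scale_alg (a i) (alt_path i Fwd 1)"
    using val_Fwd[OF l1] by auto
  obtain b where b: "\<And>i. val (?r + 1) i = scale_alg (b i) (alt_path i Bwd 1)"
    using val_Bwd[OF l2] by auto
  have z: "val \<rho> i = 0" if "\<rho> \<noteq> ?r" "\<rho> \<noteq> ?r + 1" for \<rho> i
    using val_nonzero[of \<rho> i] that by (auto simp: n w)
  define \<nu> where "\<nu> i = a i + b (i + 1)" for i
  define s :: "'m mod_ring \<Rightarrow> ('k, 'n, 'm) alg" where "s i = alt_path i Fwd (2 * CARD('n))" for i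
  have s: "alt_path i t (2 * CARD('n)) = s i" for i t unfolding s_def by (rule path_elem_socle)
  have len: "2 * l + 1 + Suc (2 * (CARD('n) - 1 - l)) = 2 * CARD('n)"
    "Suc (2 * l) + 1 + 2 * (CARD('n) - 1 - l) = 2 * CARD('n)" if "l < CARD('n)" for l
    using that by auto
  \<comment> \<open>Every summand over l completes the arrow to the same element of length 2N, hence
    the factor N.\<close>
  have t1: "alt_word Bwd (2 * l) * val (?r + 1) i * alt_word Fwd (Suc (2 * (CARD('n) - 1 - l))) = scale_alg (b i) (s i)"
    and t2: "alt_word Fwd (Suc (2 * l)) * val (?r + 1) (i + 1) * alt_word Fwd (2 * (CARD('n) - 1 - l)) = scale_alg (b (i + 1)) (s i)"
    and t3: "alt_word Bwd (Suc (2 * l)) * val ?r (i - 1) * alt_word Bwd (2 * (CARD('n) - 1 - l)) = scale_alg (a (i - 1)) (s i)"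
    and t4: "alt_word Fwd (2 * l) * val ?r i * alt_word Bwd (Suc (2 * (CARD('n) - 1 - l))) = scale_alg (a i) (s i)"
    if "l < CARD('n)" for l i
    unfolding a b scale_alg_mult_left scale_alg_mult_right alt_word_path alt_path_word
    using len[OF that] s by (auto simp: alt_path_word simp del: alternating.simps)
  have "scale_alg (of_nat CARD('n) * (\<nu> (i - 1) + \<nu> i)) (s i) = 0" for i
  proof -
    have "of_nat CARD('n) * scale_alg (b i) (s i) + of_nat CARD('n) * scale_alg (b (i + 1)) (s i) +
        of_nat CARD('n) * scale_alg (a (i - 1)) (s i) + of_nat CARD('n) * scale_alg (a i) (s i) = 0"
    proof -
      have mid: "int (Suc n) = 2 * (?r + 1)" "even (?r + 1)" using n by simp_all
      have c: "(\<Sum>l<CARD('n). f l) = of_nat CARD('n) * x" if "\<And>l. l < CARD('n) \<Longrightarrow> f l = x"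
        for f and x :: "('k, 'n, 'm) alg"
        using that by simp
      have "(\<Sum>l<CARD('n). alt_word Bwd (2 * l) * val (?r + 1) i * alt_word Fwd (Suc (2 * (CARD('n) - 1 - l)))) =
          of_nat CARD('n) * scale_alg (b i) (s i)" by (rule c) (rule t1)
      moreover have "(\<Sum>l<CARD('n). alt_word Fwd (Suc (2 * l)) * val (?r + 1) (i + 1) * alt_word Fwd (2 * (CARD('n) - 1 - l))) =
          of_nat CARD('n) * scale_alg (b (i + 1)) (s i)" by (rule c) (rule t2)
      moreover have "(\<Sum>l<CARD('n). alt_word Bwd (Suc (2 * l)) * val ?r (i - 1) * alt_word Bwd (2 * (CARD('n) - 1 - l))) =
          of_nat CARD('n) * scale_alg (a (i - 1)) (s i)" by (rule c) (rule t3)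
      moreover have "(\<Sum>l<CARD('n). alt_word Fwd (2 * l) * val ?r i * alt_word Bwd (Suc (2 * (CARD('n) - 1 - l)))) =
          of_nat CARD('n) * scale_alg (a i) (s i)" by (rule c) (rule t4)
      ultimately show ?thesis
        using cocycle_mid[OF mid(1), of i] unfolding add_diff_cancel_right' sign_if_def if_P[OF mid(2)] by (simp only:)
    qed
    moreover have "of_nat N * x = scale_alg (of_nat N) x" for N and x :: "('k, 'n, 'm) alg"
      by (induction N) (simp_all add: alg.scale_left_distrib distrib_right)
    ultimately show ?thesis
      by (simp add: \<nu>_def alg.scale_left_distrib distrib_left algebra_simps)
  qed
  then have "of_nat CARD('n) * (\<nu> (i - 1) + \<nu> i) = 0" for i
    unfolding s_def by (rule scale_alt_path_eq_0) simp
  from this[of "_ + 1"] have "\<nu> i + \<nu> (i + 1) = 0" for i using m(3) by simp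
  then have "\<nu> i = 0" for i by (rule alternating_family_zero[OF m(1,2)])
  then have ba: "b i = - a (i - 1)" for i
    using \<nu>_def[of "i - 1"] by (simp add: eq_neg_iff_add_eq_0 add.commute)
  obtain d where d: "\<And>i. d i + d (i + 1) = a i" using alternating_family_solve[OF m(1,2)] by blast
  have nM: "boundary n = boundary (Suc (2 * r))" unfolding n(1) ..
  define u :: "'m mod_ring \<Rightarrow> ('k, 'n, 'm) alg" where "u i = scale_alg (d i) (alt_path i Fwd 0)" for i
  have u: "idem i * u i * idem (target (2 * r, r, i)) = u i" for i
    by (simp add: u_def idem_path_elem path_elem_mult scale_alg_mult_left scale_alg_mult_right)
  show ?thesis
  proof (rule cobounds)
    fix \<rho> :: int and i
    consider "\<rho> = ?r" | "\<rho> = ?r + 1" | "\<rho> < ?r" | "\<rho> > ?r + 1" by linarith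
    then show "val \<rho> i = evaluate (single (2 * r) r u) (boundary n \<rho> i)"
    proof cases
      case 1
      then show ?thesis unfolding nM
        by (subst evaluate_single_pos[OF _ u])
           (use n(2) in \<open>simp_all add: a d[symmetric] u_def sign_if_def scale_alg_mult_left scale_alg_mult_right
              alt_path_word alt_word_path alg.scale_left_distrib del: alternating.simps\<close>)
    next
      case 2
      then show ?thesis unfolding nM
        by (subst evaluate_single_neg[OF _ u])
           (use n(2) in \<open>simp_all add: b ba d[of "i - 1", symmetric] u_def sign_if_def scale_alg_mult_left
              scale_alg_mult_right alt_path_word alt_word_path alg.scale_left_distrib alg.scale_left_diff_distrib del: alternating.simps\<close>)
    next
      case 3
      then show ?thesis unfolding nM by (subst evaluate_single_pos[OF _ u]) (use z in auto)
    next
      case 4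
      then show ?thesis unfolding nM by (subst evaluate_single_neg[OF _ u]) (use z in auto)
    qed
  qed
qed

lemma val_pair:
  assumes "level \<rho> = 1" "e + int n - 2 * \<rho> = 0"
  obtains a b where "\<And>i. val \<rho> i = scale_alg (a i) (alt_path i Fwd (Suc (Suc 0))) + scale_alg (b i) (alt_path i Bwd (Suc (Suc 0)))"
proof -
  have "\<exists>a b. val \<rho> i = scale_alg a (alt_path i Fwd (Suc (Suc 0))) + scale_alg b (alt_path i Bwd (Suc (Suc 0)))" for i
    using homogeneous_forms(1)[OF idem_val, of "Suc 0" \<rho> i] homogeneous_val[of \<rho> i] assms
    by (simp add: numeral_2_eq_2 del: alternating.simps)
  then show thesis using that by metis
qed

text \<open>This is the weight of the bracket of \<open>gen_F\<close> and \<open>gen_psi\<close>.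
  The coefficients a i, b i of the two words of length 2 at index 0 satisfy a i + b (i + 1) = 0,
  because words of length 3 are not 0 when N > 1. The primitive is b i times the backward arrow on
  the label (m - 1, 0, i), which is parallel to it as i + m - 1 = i - 1.\<close>

lemma cobounds_bottom:
  assumes m: "odd CARD('m)" "CARD('m) \<ge> 3" and N: "CARD('n) > 1"
    and n: "n = CARD('m)" and w: "c = 1" "e = - int CARD('m)"
  shows "\<exists>k. \<forall>r i. r \<le> n \<longrightarrow> \<kappa> (n, r, i) = evaluate k (diff_gen n r i)"
proof -
  obtain M where M: "CARD('m) = Suc M" "even M" "M \<ge> 2" using m by (cases "CARD('m)") auto
  have l: "level 0 = 1" "e + int n - 2 * 0 = 0" unfolding level_def unfolding n w by simp_all
  obtain a b where ab: "\<And>i. val 0 i = scale_alg (a i) (alt_path i Fwd (Suc (Suc 0))) + scale_alg (b i) (alt_path i Bwd (Suc (Suc 0)))"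
    using val_pair[OF l] by blast
  have z: "val \<rho> i = 0" if "\<rho> \<noteq> 0" for \<rho> i
    using val_nonzero[of \<rho> i] that by (auto simp: n w)
  have od: "odd n" unfolding n by (rule m(1))
  have "scale_alg (a i + b (i + 1)) (alt_path i Fwd (Suc (Suc (Suc 0)))) = (0 :: ('k, 'n, 'm) alg)" for i
    using cocycle_pos[of 0 i] od z[of "- 1"]
    by (simp add: sign_if_def ab distrib_left distrib_right scale_alg_mult_left scale_alg_mult_right
        alt_path_word alt_word_path alg.scale_left_distrib del: alternating.simps)
  then have "a i + b (i + 1) = 0" for i by (rule scale_alt_path_eq_0) (use N in simp)
  then have ba: "a i = - b (i + 1)" for i by (simp add: eq_neg_iff_add_eq_0)
  have nM: "boundary n = boundary (Suc M)" unfolding n M(1) ..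
  define u :: "'m mod_ring \<Rightarrow> ('k, 'n, 'm) alg" where "u i = scale_alg (b i) (alt_path i Bwd 1)" for i
  have "(of_nat M :: 'm mod_ring) = - 1"
    using of_nat_card_mod_ring[where 'm = 'm] by (simp add: M eq_neg_iff_add_eq_0 add.commute)
  then have u: "idem i * u i * idem (target (M, 0, i)) = u i" for i
    by (simp add: u_def idem_path_elem path_elem_mult scale_alg_mult_left scale_alg_mult_right)
  show ?thesis
  proof (rule cobounds)
    fix \<rho> :: int and i
    consider "\<rho> = 0" | "\<rho> = 1" | "\<rho> < 0" | "\<rho> > 1" by linarith
    then show "val \<rho> i = evaluate (single M 0 u) (boundary n \<rho> i)"
    proof cases
      case 1
      then show ?thesis unfolding nM
        by (subst evaluate_single_pos[OF _ u])
           (use M(2) in \<open>simp_all add: ab ba u_def sign_if_def scale_alg_mult_left scale_alg_mult_right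
              alt_path_word alt_word_path del: alternating.simps\<close>)
    next
      case 2
      then show ?thesis unfolding nM
        by (subst evaluate_single_pos[OF _ u])
           (use M(2,3) N in \<open>simp_all add: z u_def sign_if_def scale_alg_mult_left scale_alg_mult_right
              alt_path_word alt_word_path del: alternating.simps\<close>)
    next
      case 3
      then show ?thesis unfolding nM by (subst evaluate_single_pos[OF _ u]) (use z in auto)
    next
      case 4
      have "even (int M)" using M(2) by simp
      then have "int M + 1 \<noteq> 2 * \<rho>" by presburger
      then consider "int (Suc M) > 2 * \<rho>" | "int (Suc M) < 2 * \<rho>" by (auto simp: neq_iff)
      then show ?thesis unfolding nM
        using 4 z evaluate_single_pos[OF _ u, of \<rho> i] evaluate_single_neg[OF _ u, of \<rho> i] by cases auto
    qed
  qed
qed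

text \<open>The counterpart for \<open>gen_F\<close> and \<open>gen_phi\<close>, at index m, with
  forward arrows on the labels (m - 1, m - 1, i).\<close>

lemma cobounds_top:
  assumes m: "odd CARD('m)" "CARD('m) \<ge> 3" and N: "CARD('n) > 1"
    and n: "n = CARD('m)" and w: "c = 1 - int CARD('m)" "e = int CARD('m)"
  shows "\<exists>k. \<forall>r i. r \<le> n \<longrightarrow> \<kappa> (n, r, i) = evaluate k (diff_gen n r i)"
proof -
  obtain M where M: "CARD('m) = Suc M" "even M" "M \<ge> 2" using m by (cases "CARD('m)") auto
  let ?m = "int M + 1"
  have l: "level ?m = 1" "e + int n - 2 * ?m = 0" unfolding level_def unfolding n w M(1) by simp_all
  obtain a b where ab: "\<And>i. val ?m i = scale_alg (a i) (alt_path i Fwd (Suc (Suc 0))) + scale_alg (b i) (alt_path i Bwd (Suc (Suc 0)))"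
    using val_pair[OF l] by blast
  have z: "val \<rho> i = 0" if "\<rho> \<noteq> ?m" for \<rho> i
    using val_nonzero[of \<rho> i] that by (auto simp: n w M(1))
  have od: "int (Suc n) < 2 * (?m + 1)" "even (int (Suc n) + (?m + 1))" "even (Suc n)" "?m + 1 - 1 = ?m"
    unfolding n M(1) using M(2) by simp_all
  have "scale_alg (a (i - 1) + b i) (alt_path i Bwd (Suc (Suc (Suc 0)))) = (0 :: ('k, 'n, 'm) alg)" for i
    using cocycle_neg[OF od(1), of i] z[of "?m + 1"]
    unfolding od(4) sign_if_def if_P[OF od(2)] if_P[OF od(3)]
    by (simp add: ab distrib_left distrib_right scale_alg_mult_left scale_alg_mult_right
        alt_path_word alt_word_path alg.scale_left_distrib del: alternating.simps)
  then have "a (i - 1) + b i = 0" for i by (rule scale_alt_path_eq_0) (use N in simp)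
  then have ba: "b i = - a (i - 1)" for i by (simp add: eq_neg_iff_add_eq_0 add.commute)
  have nM: "boundary n = boundary (Suc M)" unfolding n M(1) ..
  define u :: "'m mod_ring \<Rightarrow> ('k, 'n, 'm) alg" where "u i = scale_alg (- a i) (alt_path i Fwd 1)" for i
  have "(of_nat M :: 'm mod_ring) = - 1"
    using of_nat_card_mod_ring[where 'm = 'm] by (simp add: M eq_neg_iff_add_eq_0 add.commute)
  then have u: "idem i * u i * idem (target (M, M, i)) = u i" for i
    by (simp add: u_def idem_path_elem path_elem_mult scale_alg_mult_left scale_alg_mult_right)
  show ?thesis
  proof (rule cobounds)
    fix \<rho> :: int and i
    consider "\<rho> = ?m" | "\<rho> = ?m - 1" | "\<rho> \<noteq> ?m" "\<rho> \<noteq> ?m - 1" by linarith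
    then show "val \<rho> i = evaluate (single M M u) (boundary n \<rho> i)"
    proof cases
      case 1
      then show ?thesis unfolding nM
        by (subst evaluate_single_neg[OF _ u])
           (use M(2) in \<open>simp_all add: ab ba u_def sign_if_def scale_alg_mult_left scale_alg_mult_right
              alt_path_word alt_word_path del: alternating.simps\<close>)
    next
      case 2
      then show ?thesis unfolding nM
        by (subst evaluate_single_neg[OF _ u])
           (use M(2,3) N in \<open>simp_all add: z u_def sign_if_def scale_alg_mult_left scale_alg_mult_right
              alt_path_word alt_word_path del: alternating.simps\<close>)
    next
      case 3
      have "even (int M)" using M(2) by simp
      then have "int M + 1 \<noteq> 2 * \<rho>" by presburger
      then consider "int (Suc M) > 2 * \<rho>" | "int (Suc M) < 2 * \<rho>" by (auto simp: neq_iff)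
      then show ?thesis unfolding nM
        using 3 z evaluate_single_pos[OF _ u, of \<rho> i] evaluate_single_neg[OF _ u, of \<rho> i] by cases auto
    qed
  qed
qed

end

section \<open>Weights without cohomology\<close>

definition acyclic_weight :: "('k::field, 'n::finite, 'm::nontriv) alg itself \<Rightarrow> nat \<Rightarrow> int \<Rightarrow> int \<Rightarrow> bool" where
  "acyclic_weight _ n c e \<longleftrightarrow> (\<forall>\<kappa> :: 'm label \<Rightarrow> ('k, 'n, 'm) alg. homogeneous_resolution_cocycle \<kappa> n c e \<longrightarrow>
     (\<exists>k. \<forall>r i. r \<le> n \<longrightarrow> \<kappa> (n, r, i) = evaluate k (diff_gen n r i)))"

text \<open>A triple holds the degree and the weight of a class; under the bracket weights add up
  and the total degree drops by one. The bound keeps the degree of the bracket positive.\<close>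

definition acyclic_pair :: "('k::field, 'n::finite, 'm::nontriv) alg itself \<Rightarrow> nat \<times> int \<times> int \<Rightarrow> nat \<times> int \<times> int \<Rightarrow> bool" where
  "acyclic_pair T = (\<lambda>(p, c, e) (q, c', e'). p + q > 1 \<and> acyclic_weight T (p + q - 1) (c + c') (e + e'))"

lemma acyclic_pair_sym: "acyclic_pair T a b \<Longrightarrow> acyclic_pair T b a"
  by (auto simp: acyclic_pair_def add.commute)

lemma acyclic_weightI:
  assumes "\<And>\<kappa> :: 'm::nontriv label \<Rightarrow> ('k::field, 'n::finite, 'm) alg. homogeneous_resolution_cocycle \<kappa> n c e \<Longrightarrow>
     \<exists>k. \<forall>r i. r \<le> n \<longrightarrow> \<kappa> (n, r, i) = evaluate k (diff_gen n r i)"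
  shows "acyclic_weight TYPE(('k, 'n, 'm) alg) n c e"
  using assms by (simp add: acyclic_weight_def)

lemma acyclic_weight_if_val:
  assumes "\<And>(\<kappa> :: 'm::nontriv label \<Rightarrow> ('k::field, 'n::finite, 'm) alg) \<rho> i.
    homogeneous_resolution_cocycle \<kappa> n c e \<Longrightarrow> homogeneous_resolution_cocycle.val \<kappa> n \<rho> i = 0"
  shows "acyclic_weight TYPE(('k, 'n, 'm) alg) n c e"
proof (rule acyclic_weightI)
  fix \<kappa> :: "'m label \<Rightarrow> ('k, 'n, 'm) alg"
  assume "homogeneous_resolution_cocycle \<kappa> n c e"
  from homogeneous_resolution_cocycle.cobounds_0[OF this assms[OF this]]
  show "\<exists>k. \<forall>r i. r \<le> n \<longrightarrow> \<kappa> (n, r, i) = evaluate k (diff_gen n r i)" .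
qed

text \<open>Only the indices s, with forward values, and s + 1, with backward values, pass the test
  on displacements; \<open>out\<close> excludes both, by the range of the index or by the level. L
  is a copy of \<open>level\<close> that can be evaluated outside the locale.\<close>

lemma acyclic_weight_odd:
  assumes s: "e + int n = 2 * s + 1"
    and L: "\<And>\<rho>. L \<rho> = c + (if 2 * \<rho> \<le> int n then int CARD('n) * \<rho> else int CARD('n) * (int n - \<rho>) + 2 * \<rho> - int n)"
    and out: "0 \<le> s \<Longrightarrow> s \<le> int n \<Longrightarrow> 0 \<le> L s \<Longrightarrow> L s < int CARD('n) \<Longrightarrow> False"
      "0 \<le> s + 1 \<Longrightarrow> s + 1 \<le> int n \<Longrightarrow> 1 \<le> L (s + 1) \<Longrightarrow> L (s + 1) \<le> int CARD('n) \<Longrightarrow> False"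
  shows "acyclic_weight TYPE(('k::field, 'n::finite, 'm::nontriv) alg) n c e"
proof (rule acyclic_weight_if_val)
  fix \<kappa> :: "'m label \<Rightarrow> ('k, 'n, 'm) alg" and \<rho> i
  assume "homogeneous_resolution_cocycle \<kappa> n c e"
  then interpret homogeneous_resolution_cocycle \<kappa> n c e .
  have l: "level \<rho> = L \<rho>" by (simp add: L level_def)
  have "\<rho> = s" if "e + int n - 2 * \<rho> = 1" using s that by linarith
  moreover have "\<rho> = s + 1" if "e + int n - 2 * \<rho> = - 1" using s that by linarith
  moreover have "e + int n - 2 * \<rho> \<noteq> 0" using s by presburger
  ultimately show "val \<rho> i = 0"
    using out val_nonzero[of \<rho> i] val_range[of \<rho> i] unfolding l by metis
qed

lemma acyclic_weight_even:
  assumes s: "e + int n = 2 * s"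
    and L: "\<And>\<rho>. L \<rho> = c + (if 2 * \<rho> \<le> int n then int CARD('n) * \<rho> else int CARD('n) * (int n - \<rho>) + 2 * \<rho> - int n)"
    and out: "0 \<le> s \<Longrightarrow> s \<le> int n \<Longrightarrow> 0 \<le> L s \<Longrightarrow> L s \<le> int CARD('n) \<Longrightarrow> False"
  shows "acyclic_weight TYPE(('k::field, 'n::finite, 'm::nontriv) alg) n c e"
proof (rule acyclic_weight_if_val)
  fix \<kappa> :: "'m label \<Rightarrow> ('k, 'n, 'm) alg" and \<rho> i
  assume "homogeneous_resolution_cocycle \<kappa> n c e"
  then interpret homogeneous_resolution_cocycle \<kappa> n c e .
  have l: "level \<rho> = L \<rho>" by (simp add: L level_def)
  have "\<rho> = s" if "e + int n - 2 * \<rho> = 0" using s that by linarith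
  moreover have "e + int n - 2 * \<rho> \<noteq> 1" "e + int n - 2 * \<rho> \<noteq> - 1" using s by presburger+
  ultimately show "val \<rho> i = 0"
    using out val_nonzero[of \<rho> i] val_range[of \<rho> i] unfolding l by metis
qed

context
  assumes m: "odd CARD('m::nontriv)" and two: "(2 :: 'k::field) \<noteq> 0"
begin

lemma acyclic_weight_idem:
  assumes s: "e + int n = 2 * s"
    and L: "\<And>\<rho>. L \<rho> = c + (if 2 * \<rho> \<le> int n then int CARD('n) * \<rho> else int CARD('n) * (int n - \<rho>) + 2 * \<rho> - int n)"
    and "L s = 0" "odd n" "even s \<and> 2 * s \<noteq> int (Suc n) \<or> odd s \<and> 2 * s + 2 \<noteq> int (Suc n)"
  shows "acyclic_weight TYPE(('k, 'n::finite, 'm) alg) n c e"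
proof (rule acyclic_weight_if_val)
  fix \<kappa> :: "'m label \<Rightarrow> ('k, 'n, 'm) alg" and \<rho> i
  assume "homogeneous_resolution_cocycle \<kappa> n c e"
  then interpret homogeneous_resolution_cocycle \<kappa> n c e .
  have l: "level \<rho> = L \<rho>" for \<rho> by (simp add: L level_def)
  have z: "val \<sigma> i = 0" if "\<sigma> \<noteq> s" for \<sigma> i
    using val_nonzero[of \<sigma> i] s that by (auto simp: algebra_simps)
  have e: "e + int n - 2 * s = 0" using s by simp
  show "val \<rho> i = 0"
    using z val_idem_vanish[OF m two assms(4) assms(3)[folded l] e z assms(5)] by (cases "\<rho> = s") auto
qed

text \<open>The neighbour s - 1, where forward values could occur, is excluded by its range or its
  level; s itself is settled by \<open>val_Bwd_vanish\<close>.\<close>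

lemma acyclic_weight_Bwd:
  assumes s: "e + int n = 2 * s - 1"
    and L: "\<And>\<rho>. L \<rho> = c + (if 2 * \<rho> \<le> int n then int CARD('n) * \<rho> else int CARD('n) * (int n - \<rho>) + 2 * \<rho> - int n)"
    and "L s = int (Suc t)" "odd n" "s = 0 \<or> L (s - 1) < 0" "2 * s < int (Suc n)"
      "Suc t < CARD('n) \<or> Suc t = CARD('n) \<and> even s"
  shows "acyclic_weight TYPE(('k, 'n::finite, 'm) alg) n c e"
proof (rule acyclic_weight_if_val)
  fix \<kappa> :: "'m label \<Rightarrow> ('k, 'n, 'm) alg" and \<rho> i
  assume "homogeneous_resolution_cocycle \<kappa> n c e"
  then interpret homogeneous_resolution_cocycle \<kappa> n c e .
  have l: "level \<rho> = L \<rho>" for \<rho> by (simp add: L level_def)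
  have z: "val \<sigma> i = 0" if "\<sigma> \<noteq> s" for \<sigma> i
  proof (rule ccontr)
    assume nz: "val \<sigma> i \<noteq> 0"
    have "e + int n - 2 * \<sigma> = 0 \<or> e + int n - 2 * \<sigma> = 1 \<or> e + int n - 2 * \<sigma> = - 1"
      using val_nonzero[OF nz] by blast
    then have \<sigma>: "\<sigma> = s - 1" using s that by presburger
    then have "0 \<le> L (s - 1)" using val_nonzero[OF nz] s unfolding l by auto
    then show False using val_range[OF nz] assms(5) \<sigma> by auto
  qed
  have e: "e + int n - 2 * s = - 1" using s by simp
  show "val \<rho> i = 0"
    using z val_Bwd_vanish[OF m two assms(4) assms(3)[folded l] e z assms(6,7)] by (cases "\<rho> = s") auto
qed

lemma acyclic_weight_Fwd:
  assumes s: "e + int n = 2 * s + 1"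
    and L: "\<And>\<rho>. L \<rho> = c + (if 2 * \<rho> \<le> int n then int CARD('n) * \<rho> else int CARD('n) * (int n - \<rho>) + 2 * \<rho> - int n)"
    and "L s = int t" "odd n" "s = int n \<or> L (s + 1) < 1" "2 * (s + 1) > int (Suc n)"
      "Suc t < CARD('n) \<or> Suc t = CARD('n) \<and> odd s"
  shows "acyclic_weight TYPE(('k, 'n::finite, 'm) alg) n c e"
proof (rule acyclic_weight_if_val)
  fix \<kappa> :: "'m label \<Rightarrow> ('k, 'n, 'm) alg" and \<rho> i
  assume "homogeneous_resolution_cocycle \<kappa> n c e"
  then interpret homogeneous_resolution_cocycle \<kappa> n c e .
  have l: "level \<rho> = L \<rho>" for \<rho> by (simp add: L level_def)
  have z: "val \<sigma> i = 0" if "\<sigma> \<noteq> s" for \<sigma> i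
  proof (rule ccontr)
    assume nz: "val \<sigma> i \<noteq> 0"
    have "e + int n - 2 * \<sigma> = 0 \<or> e + int n - 2 * \<sigma> = 1 \<or> e + int n - 2 * \<sigma> = - 1"
      using val_nonzero[OF nz] by blast
    then have \<sigma>: "\<sigma> = s + 1" using s that by presburger
    then have "1 \<le> L (s + 1)" using val_nonzero[OF nz] s unfolding l by auto
    then show False using val_range[OF nz] assms(5) \<sigma> by auto
  qed
  have e: "e + int n - 2 * s = 1" using s by simp
  show "val \<rho> i = 0"
    using z val_Fwd_vanish[OF m two assms(4) assms(3)[folded l] e z assms(6,7)] by (cases "\<rho> = s") auto
qed

end

section \<open>The weights of pairs of generators, with m = 2M + 1\<close>

context
  fixes M :: nat
  assumes m: "CARD('m::nontriv) = 2 * M + 1" "M \<ge> 1" and two: "(2 :: 'k::field) \<noteq> 0"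
    and N0: "(of_nat CARD('n::finite) :: 'k) \<noteq> 0"
begin

lemma odd_m: "odd CARD('m)" by (simp add: m)

lemma N_pos: "int CARD('n) \<ge> 1"
  using zero_less_card_finite[where 'a = 'n] by linarith

text \<open>For these weights A has no possible value at any index. The number given to each rule is
  the s with e + n = 2s + 1 or e + n = 2s.\<close>

lemma acyclic_zero:
  "CARD('n) \<ge> 2 \<Longrightarrow> acyclic_weight TYPE(('k, 'n, 'm) alg) 3 (1 - 2 * int CARD('n)) 0"
  "CARD('n) \<ge> 3 \<Longrightarrow> acyclic_weight TYPE(('k, 'n, 'm) alg) 3 (2 - 2 * int CARD('n)) 0"
  "CARD('n) \<ge> 2 \<Longrightarrow> acyclic_weight TYPE(('k, 'n, 'm) alg) 5 (1 - 3 * int CARD('n)) 0"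
  "acyclic_weight TYPE(('k, 'n, 'm) alg) 7 (- 4 * int CARD('n)) 0"
  "acyclic_weight TYPE(('k, 'n, 'm) alg) (2 * M - 1) c (int CARD('m))"
  "acyclic_weight TYPE(('k, 'n, 'm) alg) (2 * M - 1) c (- int CARD('m))"
  "acyclic_weight TYPE(('k, 'n, 'm) alg) (4 * M - 1) c (2 * int CARD('m))"
  "acyclic_weight TYPE(('k, 'n, 'm) alg) (4 * M - 1) c (- 2 * int CARD('m))"
  "acyclic_weight TYPE(('k, 'n, 'm) alg) (6 * M + 1) c (3 * int CARD('m))"
  "acyclic_weight TYPE(('k, 'n, 'm) alg) (6 * M + 1) c (- 3 * int CARD('m))"
  "acyclic_weight TYPE(('k, 'n, 'm) alg) (4 * M + 5) (- 2 * int CARD('n)) (- 2 * int CARD('m))"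
  "acyclic_weight TYPE(('k, 'n, 'm) alg) (4 * M + 5) (- 2 * int CARD('n) - 2 * int CARD('m)) (2 * int CARD('m))"
  "acyclic_weight TYPE(('k, 'n, 'm) alg) (8 * M + 3) 0 (- 4 * int CARD('m))"
  "acyclic_weight TYPE(('k, 'n, 'm) alg) (8 * M + 3) (- 4 * int CARD('m)) (4 * int CARD('m))"
proof -
  show "acyclic_weight TYPE(('k, 'n, 'm) alg) 3 (1 - 2 * int CARD('n)) 0" if "CARD('n) \<ge> 2"
    by (rule acyclic_weight_odd[of _ _ "1", OF _ refl]) (use N_pos m(2) that in \<open>auto simp: Let_def m(1) of_nat_diff algebra_simps split: if_splits\<close>)
  show "acyclic_weight TYPE(('k, 'n, 'm) alg) 3 (2 - 2 * int CARD('n)) 0" if "CARD('n) \<ge> 3"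
    by (rule acyclic_weight_odd[of _ _ "1", OF _ refl]) (use N_pos m(2) that in \<open>auto simp: Let_def m(1) of_nat_diff algebra_simps split: if_splits\<close>)
  show "acyclic_weight TYPE(('k, 'n, 'm) alg) 5 (1 - 3 * int CARD('n)) 0" if "CARD('n) \<ge> 2"
    by (rule acyclic_weight_odd[of _ _ "2", OF _ refl]) (use N_pos m(2) that in \<open>auto simp: Let_def m(1) of_nat_diff algebra_simps split: if_splits\<close>)
  show "acyclic_weight TYPE(('k, 'n, 'm) alg) 7 (- 4 * int CARD('n)) 0"
    by (rule acyclic_weight_odd[of _ _ "3", OF _ refl]) (use N_pos m(2) in \<open>auto simp: Let_def m(1) of_nat_diff algebra_simps split: if_splits\<close>)
  show "acyclic_weight TYPE(('k, 'n, 'm) alg) (2 * M - 1) c (int CARD('m))"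
    by (rule acyclic_weight_even[of _ _ "2 * int M", OF _ refl]) (use N_pos m(2) in \<open>auto simp: Let_def m(1) of_nat_diff algebra_simps split: if_splits\<close>)
  show "acyclic_weight TYPE(('k, 'n, 'm) alg) (2 * M - 1) c (- int CARD('m))"
    by (rule acyclic_weight_even[of _ _ "- 1", OF _ refl]) (use N_pos m(2) in \<open>auto simp: Let_def m(1) of_nat_diff algebra_simps split: if_splits\<close>)
  show "acyclic_weight TYPE(('k, 'n, 'm) alg) (4 * M - 1) c (2 * int CARD('m))"
    by (rule acyclic_weight_odd[of _ _ "4 * int M", OF _ refl]) (use N_pos m(2) in \<open>auto simp: Let_def m(1) of_nat_diff algebra_simps split: if_splits\<close>)
  show "acyclic_weight TYPE(('k, 'n, 'm) alg) (4 * M - 1) c (- 2 * int CARD('m))"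
    by (rule acyclic_weight_odd[of _ _ "- 2", OF _ refl]) (use N_pos m(2) in \<open>auto simp: Let_def m(1) of_nat_diff algebra_simps split: if_splits\<close>)
  show "acyclic_weight TYPE(('k, 'n, 'm) alg) (6 * M + 1) c (3 * int CARD('m))"
    by (rule acyclic_weight_even[of _ _ "6 * int M + 2", OF _ refl]) (use N_pos m(2) in \<open>auto simp: Let_def m(1) of_nat_diff algebra_simps split: if_splits\<close>)
  show "acyclic_weight TYPE(('k, 'n, 'm) alg) (6 * M + 1) c (- 3 * int CARD('m))"
    by (rule acyclic_weight_even[of _ _ "- 1", OF _ refl]) (use N_pos m(2) in \<open>auto simp: Let_def m(1) of_nat_diff algebra_simps split: if_splits\<close>)
  show "acyclic_weight TYPE(('k, 'n, 'm) alg) (4 * M + 5) (- 2 * int CARD('n)) (- 2 * int CARD('m))"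
    by (rule acyclic_weight_odd[of _ _ "1", OF _ refl]) (use N_pos m(2) in \<open>auto simp: Let_def m(1) of_nat_diff algebra_simps split: if_splits\<close>)
  show "acyclic_weight TYPE(('k, 'n, 'm) alg) (4 * M + 5) (- 2 * int CARD('n) - 2 * int CARD('m)) (2 * int CARD('m))"
    by (rule acyclic_weight_odd[of _ _ "4 * int M + 3", OF _ refl]) (use N_pos m(2) in \<open>auto simp: Let_def m(1) of_nat_diff algebra_simps split: if_splits\<close>)
  show "acyclic_weight TYPE(('k, 'n, 'm) alg) (8 * M + 3) 0 (- 4 * int CARD('m))"
    by (rule acyclic_weight_odd[of _ _ "- 1", OF _ refl]) (use N_pos m(2) in \<open>auto simp: Let_def m(1) of_nat_diff algebra_simps split: if_splits\<close>)
  show "acyclic_weight TYPE(('k, 'n, 'm) alg) (8 * M + 3) (- 4 * int CARD('m)) (4 * int CARD('m))"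
    by (rule acyclic_weight_odd[of _ _ "8 * int M + 3", OF _ refl]) (use N_pos m(2) in \<open>auto simp: Let_def m(1) of_nat_diff algebra_simps split: if_splits\<close>)
qed

text \<open>The levels involve the product of M and N, which linear arithmetic can bound only
  through the auxiliary inequality \<open>h\<close>.\<close>

lemma acyclic_nonlinear:
  "CARD('n) \<ge> 2 \<Longrightarrow> acyclic_weight TYPE(('k, 'n, 'm) alg) (4 * M - 1) (2 * int CARD('n) - int CARD('m)) 0"
  "CARD('n) \<ge> 2 \<Longrightarrow> acyclic_weight TYPE(('k, 'n, 'm) alg) (6 * M + 1) (int CARD('n) - int CARD('m)) (- int CARD('m))"
  "CARD('n) \<ge> 2 \<Longrightarrow> acyclic_weight TYPE(('k, 'n, 'm) alg) (6 * M + 1) (int CARD('n) - 2 * int CARD('m)) (int CARD('m))"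
  "acyclic_weight TYPE(('k, 'n, 'm) alg) (8 * M + 3) (- 2 * int CARD('m)) 0"
proof -
  have h: "2 * int M \<le> int M * int CARD('n)" if "CARD('n) \<ge> 2"
    using that m(2) mult_left_mono[of 2 "int CARD('n)" "int M"] by simp
  show "acyclic_weight TYPE(('k, 'n, 'm) alg) (4 * M - 1) (2 * int CARD('n) - int CARD('m)) 0" if "CARD('n) \<ge> 2"
    by (rule acyclic_weight_odd[of _ _ "2 * int M - 1", OF _ refl])
       (use h[OF that] m(2) in \<open>auto simp: m(1) of_nat_diff algebra_simps split: if_splits\<close>)
  show "acyclic_weight TYPE(('k, 'n, 'm) alg) (6 * M + 1) (int CARD('n) - int CARD('m)) (- int CARD('m))" if "CARD('n) \<ge> 2"
    by (rule acyclic_weight_even[of _ _ "2 * int M", OF _ refl])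
       (use h[OF that] m(2) in \<open>auto simp: m(1) of_nat_diff algebra_simps split: if_splits\<close>)
  show "acyclic_weight TYPE(('k, 'n, 'm) alg) (6 * M + 1) (int CARD('n) - 2 * int CARD('m)) (int CARD('m))" if "CARD('n) \<ge> 2"
    by (rule acyclic_weight_even[of _ _ "4 * int M + 1", OF _ refl])
       (use h[OF that] m(2) in \<open>auto simp: m(1) of_nat_diff algebra_simps split: if_splits\<close>)
  have h': "CARD('n) = 1 \<or> 2 \<le> int CARD('n) \<and> 8 * int M < int M * (int CARD('n) * 4) + 1"
    using h N_pos by linarith
  show "acyclic_weight TYPE(('k, 'n, 'm) alg) (8 * M + 3) (- 2 * int CARD('m)) 0"
    by (rule acyclic_weight_odd[of _ _ "4 * int M + 1", OF _ refl])
       (use h' m(2) in \<open>auto simp: m(1) of_nat_diff algebra_simps split: if_splits\<close>)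
qed

text \<open>These weights belong to \<open>eps\<close> with \<open>chi4\<close> (and
  \<open>gen_F\<close> with \<open>gen_F\<close> if N = 2), \<open>gen_phi\<close> with
  \<open>gen_psi\<close> if N = 1, and \<open>gen_F\<close> with \<open>gen_phi\<close> and with
  \<open>gen_psi\<close>.\<close>

lemma acyclic_cobounds:
  "acyclic_weight TYPE(('k, 'n, 'm) alg) 3 (- int CARD('n)) 0"
  "CARD('n) = 1 \<Longrightarrow> acyclic_weight TYPE(('k, 'n, 'm) alg) (4 * M - 1) (2 * int CARD('n) - int CARD('m)) 0"
  "CARD('n) \<ge> 2 \<Longrightarrow> acyclic_weight TYPE(('k, 'n, 'm) alg) CARD('m) (1 - int CARD('m)) (int CARD('m))"
  "CARD('n) \<ge> 2 \<Longrightarrow> acyclic_weight TYPE(('k, 'n, 'm) alg) CARD('m) 1 (- int CARD('m))"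
proof -
  show "acyclic_weight TYPE(('k, 'n, 'm) alg) 3 (- int CARD('n)) 0"
    by (rule acyclic_weightI, erule homogeneous_resolution_cocycle.cobounds_near_middle[OF _ odd_m two N0, where r = 1]) simp_all
  show "acyclic_weight TYPE(('k, 'n, 'm) alg) (4 * M - 1) (2 * int CARD('n) - int CARD('m)) 0" if "CARD('n) = 1"
    by (rule acyclic_weightI, erule homogeneous_resolution_cocycle.cobounds_near_middle[OF _ odd_m two N0, where r = "2 * M - 1"])
       (use that m in \<open>auto simp: of_nat_diff\<close>)
  show "acyclic_weight TYPE(('k, 'n, 'm) alg) CARD('m) (1 - int CARD('m)) (int CARD('m))" if "CARD('n) \<ge> 2"
    by (rule acyclic_weightI, erule homogeneous_resolution_cocycle.cobounds_top[OF _ odd_m]) (use that m in simp_all)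
  show "acyclic_weight TYPE(('k, 'n, 'm) alg) CARD('m) 1 (- int CARD('m))" if "CARD('n) \<ge> 2"
    by (rule acyclic_weightI, erule homogeneous_resolution_cocycle.cobounds_bottom[OF _ odd_m]) (use that m in simp_all)
qed

text \<open>One index can carry values, and these vanish by the independence of paths or by the
  argument around the cycle. The last two cases, with N = 1, complement those of
  \<open>acyclic_nonlinear\<close> with N at least 2.\<close>

lemma acyclic_single:
  "acyclic_weight TYPE(('k, 'n, 'm) alg) (4 * M + 1) (int CARD('n)) (- 2 * int CARD('m))"
  "CARD('n) \<ge> 2 \<Longrightarrow> acyclic_weight TYPE(('k, 'n, 'm) alg) (4 * M + 1) 1 (- 2 * int CARD('m))"
  "CARD('n) \<ge> 2 \<Longrightarrow> acyclic_weight TYPE(('k, 'n, 'm) alg) (4 * M + 3) (1 - int CARD('n)) (- 2 * int CARD('m))"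
  "acyclic_weight TYPE(('k, 'n, 'm) alg) (4 * M + 1) (int CARD('n) - 2 * int CARD('m)) (2 * int CARD('m))"
  "CARD('n) \<ge> 2 \<Longrightarrow> acyclic_weight TYPE(('k, 'n, 'm) alg) (4 * M + 1) (1 - 2 * int CARD('m)) (2 * int CARD('m))"
  "CARD('n) \<ge> 2 \<Longrightarrow> acyclic_weight TYPE(('k, 'n, 'm) alg) (4 * M + 3) (1 - int CARD('n) - 2 * int CARD('m)) (2 * int CARD('m))"
  "acyclic_weight TYPE(('k, 'n, 'm) alg) (2 * M + 3) (- int CARD('n) - int CARD('m)) (int CARD('m))"
  "acyclic_weight TYPE(('k, 'n, 'm) alg) (2 * M + 3) (- int CARD('n)) (- int CARD('m))"
  "CARD('n) = 1 \<Longrightarrow> acyclic_weight TYPE(('k, 'n, 'm) alg) (6 * M + 1) (int CARD('n) - int CARD('m)) (- int CARD('m))"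
  "CARD('n) = 1 \<Longrightarrow> acyclic_weight TYPE(('k, 'n, 'm) alg) (6 * M + 1) (int CARD('n) - 2 * int CARD('m)) (int CARD('m))"
proof -
  show "acyclic_weight TYPE(('k, 'n, 'm) alg) (4 * M + 1) (int CARD('n)) (- 2 * int CARD('m))"
    by (rule acyclic_weight_Bwd[OF odd_m two, of _ _ "0" _ _ "CARD('n) - 1", OF _ refl])
       (use N_pos m(2) in \<open>auto simp: m(1) of_nat_diff algebra_simps\<close>)
  show "acyclic_weight TYPE(('k, 'n, 'm) alg) (4 * M + 1) 1 (- 2 * int CARD('m))" if "CARD('n) \<ge> 2"
    by (rule acyclic_weight_Bwd[OF odd_m two, of _ _ "0" _ _ "0", OF _ refl])
       (use N_pos that m(2) in \<open>auto simp: m(1) of_nat_diff algebra_simps\<close>)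
  show "acyclic_weight TYPE(('k, 'n, 'm) alg) (4 * M + 3) (1 - int CARD('n)) (- 2 * int CARD('m))" if "CARD('n) \<ge> 2"
    by (rule acyclic_weight_Bwd[OF odd_m two, of _ _ "1" _ _ "0", OF _ refl])
       (use N_pos that m(2) in \<open>auto simp: m(1) of_nat_diff algebra_simps\<close>)
  show "acyclic_weight TYPE(('k, 'n, 'm) alg) (4 * M + 1) (int CARD('n) - 2 * int CARD('m)) (2 * int CARD('m))"
    by (rule acyclic_weight_Fwd[OF odd_m two, of _ _ "4 * int M + 1" _ _ "CARD('n) - 1", OF _ refl])
       (use N_pos m(2) in \<open>auto simp: m(1) of_nat_diff algebra_simps\<close>)
  show "acyclic_weight TYPE(('k, 'n, 'm) alg) (4 * M + 1) (1 - 2 * int CARD('m)) (2 * int CARD('m))" if "CARD('n) \<ge> 2"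
    by (rule acyclic_weight_Fwd[OF odd_m two, of _ _ "4 * int M + 1" _ _ "0", OF _ refl])
       (use N_pos that m(2) in \<open>auto simp: m(1) of_nat_diff algebra_simps\<close>)
  show "acyclic_weight TYPE(('k, 'n, 'm) alg) (4 * M + 3) (1 - int CARD('n) - 2 * int CARD('m)) (2 * int CARD('m))" if "CARD('n) \<ge> 2"
    by (rule acyclic_weight_Fwd[OF odd_m two, of _ _ "4 * int M + 2" _ _ "0", OF _ refl])
       (use N_pos that m(2) in \<open>auto simp: m(1) of_nat_diff algebra_simps\<close>)
  show "acyclic_weight TYPE(('k, 'n, 'm) alg) (2 * M + 3) (- int CARD('n) - int CARD('m)) (int CARD('m))"
    by (rule acyclic_weight_idem[OF odd_m two, of _ _ "2 * int M + 2" _ _, OF _ refl])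
       (use N_pos m(2) in \<open>auto simp: m(1) of_nat_diff algebra_simps\<close>)
  show "acyclic_weight TYPE(('k, 'n, 'm) alg) (2 * M + 3) (- int CARD('n)) (- int CARD('m))"
    by (rule acyclic_weight_idem[OF odd_m two, of _ _ "1" _ _, OF _ refl])
       (use N_pos m(2) in \<open>auto simp: m(1) of_nat_diff algebra_simps\<close>)
  show "acyclic_weight TYPE(('k, 'n, 'm) alg) (6 * M + 1) (int CARD('n) - int CARD('m)) (- int CARD('m))" if "CARD('n) = 1"
    by (rule acyclic_weight_idem[OF odd_m two, of _ _ "2 * int M" _ _, OF _ refl])
       (use N_pos that m(2) in \<open>auto simp: m(1) of_nat_diff algebra_simps\<close>)
  show "acyclic_weight TYPE(('k, 'n, 'm) alg) (6 * M + 1) (int CARD('n) - 2 * int CARD('m)) (int CARD('m))" if "CARD('n) = 1"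
    by (rule acyclic_weight_idem[OF odd_m two, of _ _ "4 * int M + 1" _ _, OF _ refl])
       (use N_pos that m(2) in \<open>auto simp: m(1) of_nat_diff algebra_simps\<close>)
qed

lemma acyclic_pairs:
  "acyclic_pair TYPE(('k, 'n, 'm) alg) (0, int CARD('n), 0) (4, - 2 * int CARD('n), 0)"
  "CARD('n) \<ge> 2 \<Longrightarrow> acyclic_pair TYPE(('k, 'n, 'm) alg) (0, 1, 0) (4, - 2 * int CARD('n), 0)"
  "CARD('n) \<ge> 2 \<Longrightarrow> acyclic_pair TYPE(('k, 'n, 'm) alg) (2, 1 - int CARD('n), 0) (4, - 2 * int CARD('n), 0)"
  "acyclic_pair TYPE(('k, 'n, 'm) alg) (4, - 2 * int CARD('n), 0) (4, - 2 * int CARD('n), 0)"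
  "acyclic_pair TYPE(('k, 'n, 'm) alg) (0, int CARD('n), 0) (CARD('m) - 1, int CARD('n) - int CARD('m), int CARD('m))"
  "CARD('n) \<ge> 2 \<Longrightarrow> acyclic_pair TYPE(('k, 'n, 'm) alg) (0, 1, 0) (CARD('m) - 1, int CARD('n) - int CARD('m), int CARD('m))"
  "CARD('n) \<ge> 2 \<Longrightarrow> acyclic_pair TYPE(('k, 'n, 'm) alg) (2, 1 - int CARD('n), 0) (CARD('m) - 1, int CARD('n) - int CARD('m), int CARD('m))"
  "acyclic_pair TYPE(('k, 'n, 'm) alg) (4, - 2 * int CARD('n), 0) (CARD('m) - 1, int CARD('n) - int CARD('m), int CARD('m))"
  "acyclic_pair TYPE(('k, 'n, 'm) alg) (CARD('m) - 1, int CARD('n) - int CARD('m), int CARD('m)) (CARD('m) - 1, int CARD('n) - int CARD('m), int CARD('m))"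
  "acyclic_pair TYPE(('k, 'n, 'm) alg) (0, int CARD('n), 0) (CARD('m) - 1, int CARD('n), - int CARD('m))"
  "CARD('n) \<ge> 2 \<Longrightarrow> acyclic_pair TYPE(('k, 'n, 'm) alg) (0, 1, 0) (CARD('m) - 1, int CARD('n), - int CARD('m))"
  "CARD('n) \<ge> 2 \<Longrightarrow> acyclic_pair TYPE(('k, 'n, 'm) alg) (2, 1 - int CARD('n), 0) (CARD('m) - 1, int CARD('n), - int CARD('m))"
  "acyclic_pair TYPE(('k, 'n, 'm) alg) (4, - 2 * int CARD('n), 0) (CARD('m) - 1, int CARD('n), - int CARD('m))"
  "acyclic_pair TYPE(('k, 'n, 'm) alg) (CARD('m) - 1, int CARD('n) - int CARD('m), int CARD('m)) (CARD('m) - 1, int CARD('n), - int CARD('m))"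
  "acyclic_pair TYPE(('k, 'n, 'm) alg) (CARD('m) - 1, int CARD('n), - int CARD('m)) (CARD('m) - 1, int CARD('n), - int CARD('m))"
  "acyclic_pair TYPE(('k, 'n, 'm) alg) (0, int CARD('n), 0) (2 * CARD('m), 0, - 2 * int CARD('m))"
  "CARD('n) \<ge> 2 \<Longrightarrow> acyclic_pair TYPE(('k, 'n, 'm) alg) (0, 1, 0) (2 * CARD('m), 0, - 2 * int CARD('m))"
  "CARD('n) \<ge> 2 \<Longrightarrow> acyclic_pair TYPE(('k, 'n, 'm) alg) (2, 1 - int CARD('n), 0) (2 * CARD('m), 0, - 2 * int CARD('m))"
  "acyclic_pair TYPE(('k, 'n, 'm) alg) (4, - 2 * int CARD('n), 0) (2 * CARD('m), 0, - 2 * int CARD('m))"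
  "acyclic_pair TYPE(('k, 'n, 'm) alg) (CARD('m) - 1, int CARD('n) - int CARD('m), int CARD('m)) (2 * CARD('m), 0, - 2 * int CARD('m))"
  "acyclic_pair TYPE(('k, 'n, 'm) alg) (CARD('m) - 1, int CARD('n), - int CARD('m)) (2 * CARD('m), 0, - 2 * int CARD('m))"
  "acyclic_pair TYPE(('k, 'n, 'm) alg) (2 * CARD('m), 0, - 2 * int CARD('m)) (2 * CARD('m), 0, - 2 * int CARD('m))"
  "acyclic_pair TYPE(('k, 'n, 'm) alg) (0, int CARD('n), 0) (2 * CARD('m), - 2 * int CARD('m), 2 * int CARD('m))"
  "CARD('n) \<ge> 2 \<Longrightarrow> acyclic_pair TYPE(('k, 'n, 'm) alg) (0, 1, 0) (2 * CARD('m), - 2 * int CARD('m), 2 * int CARD('m))"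
  "CARD('n) \<ge> 2 \<Longrightarrow> acyclic_pair TYPE(('k, 'n, 'm) alg) (2, 1 - int CARD('n), 0) (2 * CARD('m), - 2 * int CARD('m), 2 * int CARD('m))"
  "acyclic_pair TYPE(('k, 'n, 'm) alg) (4, - 2 * int CARD('n), 0) (2 * CARD('m), - 2 * int CARD('m), 2 * int CARD('m))"
  "acyclic_pair TYPE(('k, 'n, 'm) alg) (CARD('m) - 1, int CARD('n) - int CARD('m), int CARD('m)) (2 * CARD('m), - 2 * int CARD('m), 2 * int CARD('m))"
  "acyclic_pair TYPE(('k, 'n, 'm) alg) (CARD('m) - 1, int CARD('n), - int CARD('m)) (2 * CARD('m), - 2 * int CARD('m), 2 * int CARD('m))"
  "acyclic_pair TYPE(('k, 'n, 'm) alg) (2 * CARD('m), 0, - 2 * int CARD('m)) (2 * CARD('m), - 2 * int CARD('m), 2 * int CARD('m))"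
  "acyclic_pair TYPE(('k, 'n, 'm) alg) (2 * CARD('m), - 2 * int CARD('m), 2 * int CARD('m)) (2 * CARD('m), - 2 * int CARD('m), 2 * int CARD('m))"
  "CARD('n) \<ge> 2 \<Longrightarrow> acyclic_pair TYPE(('k, 'n, 'm) alg) (2, 1 - int CARD('n), 0) (2, 1 - int CARD('n), 0)"
proof -
  have pair: "acyclic_pair TYPE(('k, 'n, 'm) alg) (p, c, e) (q, c', e')"
    if "acyclic_weight TYPE(('k, 'n, 'm) alg) l d g" "p + q = Suc l" "l > 0" "d = c + c'" "g = e + e'" for p q l c e c' e' d g
    using that by (simp add: acyclic_pair_def)
  have N: "CARD('n) \<ge> 2 \<or> CARD('n) = 1" using N_pos by linarith
  show "acyclic_pair TYPE(('k, 'n, 'm) alg) (0, int CARD('n), 0) (4, - 2 * int CARD('n), 0)"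
    by (rule pair[OF acyclic_cobounds(1)]) (use m in simp_all)
  show "acyclic_pair TYPE(('k, 'n, 'm) alg) (0, 1, 0) (4, - 2 * int CARD('n), 0)" if "CARD('n) \<ge> 2"
    by (rule pair[OF acyclic_zero(1)[OF that]]) (use m in simp_all)
  show "acyclic_pair TYPE(('k, 'n, 'm) alg) (2, 1 - int CARD('n), 0) (4, - 2 * int CARD('n), 0)" if "CARD('n) \<ge> 2"
    by (rule pair[OF acyclic_zero(3)[OF that]]) (use m in simp_all)
  show "acyclic_pair TYPE(('k, 'n, 'm) alg) (4, - 2 * int CARD('n), 0) (4, - 2 * int CARD('n), 0)"
    by (rule pair[OF acyclic_zero(4)]) (use m in simp_all)
  show "acyclic_pair TYPE(('k, 'n, 'm) alg) (0, int CARD('n), 0) (CARD('m) - 1, int CARD('n) - int CARD('m), int CARD('m))"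
    by (rule pair[OF acyclic_zero(5)]) (use m in simp_all)
  show "acyclic_pair TYPE(('k, 'n, 'm) alg) (0, 1, 0) (CARD('m) - 1, int CARD('n) - int CARD('m), int CARD('m))" if "CARD('n) \<ge> 2"
    by (rule pair[OF acyclic_zero(5)]) (use m in simp_all)
  show "acyclic_pair TYPE(('k, 'n, 'm) alg) (2, 1 - int CARD('n), 0) (CARD('m) - 1, int CARD('n) - int CARD('m), int CARD('m))" if "CARD('n) \<ge> 2"
    by (rule pair[OF acyclic_cobounds(3)[OF that]]) (use m in simp_all)
  show "acyclic_pair TYPE(('k, 'n, 'm) alg) (4, - 2 * int CARD('n), 0) (CARD('m) - 1, int CARD('n) - int CARD('m), int CARD('m))"
    by (rule pair[OF acyclic_single(7)]) (use m in simp_all)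
  show "acyclic_pair TYPE(('k, 'n, 'm) alg) (CARD('m) - 1, int CARD('n) - int CARD('m), int CARD('m)) (CARD('m) - 1, int CARD('n) - int CARD('m), int CARD('m))"
    by (rule pair[OF acyclic_zero(7)]) (use m in simp_all)
  show "acyclic_pair TYPE(('k, 'n, 'm) alg) (0, int CARD('n), 0) (CARD('m) - 1, int CARD('n), - int CARD('m))"
    by (rule pair[OF acyclic_zero(6)]) (use m in simp_all)
  show "acyclic_pair TYPE(('k, 'n, 'm) alg) (0, 1, 0) (CARD('m) - 1, int CARD('n), - int CARD('m))" if "CARD('n) \<ge> 2"
    by (rule pair[OF acyclic_zero(6)]) (use m in simp_all)
  show "acyclic_pair TYPE(('k, 'n, 'm) alg) (2, 1 - int CARD('n), 0) (CARD('m) - 1, int CARD('n), - int CARD('m))" if "CARD('n) \<ge> 2"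
    by (rule pair[OF acyclic_cobounds(4)[OF that]]) (use m in simp_all)
  show "acyclic_pair TYPE(('k, 'n, 'm) alg) (4, - 2 * int CARD('n), 0) (CARD('m) - 1, int CARD('n), - int CARD('m))"
    by (rule pair[OF acyclic_single(8)]) (use m in simp_all)
  show "acyclic_pair TYPE(('k, 'n, 'm) alg) (CARD('m) - 1, int CARD('n) - int CARD('m), int CARD('m)) (CARD('m) - 1, int CARD('n), - int CARD('m))"
  proof (cases "CARD('n) = 1")
    case True
    show ?thesis by (rule pair[OF acyclic_cobounds(2)[OF True]]) (use m in simp_all)
  next
    case False
    then have "CARD('n) \<ge> 2" using N by simp
    then show ?thesis by (intro pair[OF acyclic_nonlinear(1)]) (use m in simp_all)
  qed
  show "acyclic_pair TYPE(('k, 'n, 'm) alg) (CARD('m) - 1, int CARD('n), - int CARD('m)) (CARD('m) - 1, int CARD('n), - int CARD('m))"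
    by (rule pair[OF acyclic_zero(8)]) (use m in simp_all)
  show "acyclic_pair TYPE(('k, 'n, 'm) alg) (0, int CARD('n), 0) (2 * CARD('m), 0, - 2 * int CARD('m))"
    by (rule pair[OF acyclic_single(1)]) (use m in simp_all)
  show "acyclic_pair TYPE(('k, 'n, 'm) alg) (0, 1, 0) (2 * CARD('m), 0, - 2 * int CARD('m))" if "CARD('n) \<ge> 2"
    by (rule pair[OF acyclic_single(2)[OF that]]) (use m in simp_all)
  show "acyclic_pair TYPE(('k, 'n, 'm) alg) (2, 1 - int CARD('n), 0) (2 * CARD('m), 0, - 2 * int CARD('m))" if "CARD('n) \<ge> 2"
    by (rule pair[OF acyclic_single(3)[OF that]]) (use m in simp_all)
  show "acyclic_pair TYPE(('k, 'n, 'm) alg) (4, - 2 * int CARD('n), 0) (2 * CARD('m), 0, - 2 * int CARD('m))"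
    by (rule pair[OF acyclic_zero(11)]) (use m in simp_all)
  show "acyclic_pair TYPE(('k, 'n, 'm) alg) (CARD('m) - 1, int CARD('n) - int CARD('m), int CARD('m)) (2 * CARD('m), 0, - 2 * int CARD('m))"
  proof (cases "CARD('n) = 1")
    case True
    show ?thesis by (rule pair[OF acyclic_single(9)[OF True]]) (use m in simp_all)
  next
    case False
    then have "CARD('n) \<ge> 2" using N by simp
    then show ?thesis by (intro pair[OF acyclic_nonlinear(2)]) (use m in simp_all)
  qed
  show "acyclic_pair TYPE(('k, 'n, 'm) alg) (CARD('m) - 1, int CARD('n), - int CARD('m)) (2 * CARD('m), 0, - 2 * int CARD('m))"
    by (rule pair[OF acyclic_zero(10)]) (use m in simp_all)
  show "acyclic_pair TYPE(('k, 'n, 'm) alg) (2 * CARD('m), 0, - 2 * int CARD('m)) (2 * CARD('m), 0, - 2 * int CARD('m))"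
    by (rule pair[OF acyclic_zero(13)]) (use m in simp_all)
  show "acyclic_pair TYPE(('k, 'n, 'm) alg) (0, int CARD('n), 0) (2 * CARD('m), - 2 * int CARD('m), 2 * int CARD('m))"
    by (rule pair[OF acyclic_single(4)]) (use m in simp_all)
  show "acyclic_pair TYPE(('k, 'n, 'm) alg) (0, 1, 0) (2 * CARD('m), - 2 * int CARD('m), 2 * int CARD('m))" if "CARD('n) \<ge> 2"
    by (rule pair[OF acyclic_single(5)[OF that]]) (use m in simp_all)
  show "acyclic_pair TYPE(('k, 'n, 'm) alg) (2, 1 - int CARD('n), 0) (2 * CARD('m), - 2 * int CARD('m), 2 * int CARD('m))" if "CARD('n) \<ge> 2"
    by (rule pair[OF acyclic_single(6)[OF that]]) (use m in simp_all)
  show "acyclic_pair TYPE(('k, 'n, 'm) alg) (4, - 2 * int CARD('n), 0) (2 * CARD('m), - 2 * int CARD('m), 2 * int CARD('m))"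
    by (rule pair[OF acyclic_zero(12)]) (use m in simp_all)
  show "acyclic_pair TYPE(('k, 'n, 'm) alg) (CARD('m) - 1, int CARD('n) - int CARD('m), int CARD('m)) (2 * CARD('m), - 2 * int CARD('m), 2 * int CARD('m))"
    by (rule pair[OF acyclic_zero(9)]) (use m in simp_all)
  show "acyclic_pair TYPE(('k, 'n, 'm) alg) (CARD('m) - 1, int CARD('n), - int CARD('m)) (2 * CARD('m), - 2 * int CARD('m), 2 * int CARD('m))"
  proof (cases "CARD('n) = 1")
    case True
    show ?thesis by (rule pair[OF acyclic_single(10)[OF True]]) (use m in simp_all)
  next
    case False
    then have "CARD('n) \<ge> 2" using N by simp
    then show ?thesis by (intro pair[OF acyclic_nonlinear(3)]) (use m in simp_all)
  qed
  show "acyclic_pair TYPE(('k, 'n, 'm) alg) (2 * CARD('m), 0, - 2 * int CARD('m)) (2 * CARD('m), - 2 * int CARD('m), 2 * int CARD('m))"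
    by (rule pair[OF acyclic_nonlinear(4)]) (use m in simp_all)
  show "acyclic_pair TYPE(('k, 'n, 'm) alg) (2 * CARD('m), - 2 * int CARD('m), 2 * int CARD('m)) (2 * CARD('m), - 2 * int CARD('m), 2 * int CARD('m))"
    by (rule pair[OF acyclic_zero(14)]) (use m in simp_all)
  show "acyclic_pair TYPE(('k, 'n, 'm) alg) (2, 1 - int CARD('n), 0) (2, 1 - int CARD('n), 0)" if "CARD('n) \<ge> 2"
  \<comment> \<open>For N = 2 the weight 2 - 2N equals -N, the one treated next to the
    middle.\<close>
  proof (cases "CARD('n) = 2")
    case True
    then show ?thesis by (intro pair[OF acyclic_cobounds(1)]) simp_all
  next
    case False
    then have "CARD('n) \<ge> 3" using that by simp
    then show ?thesis by (rule pair[OF acyclic_zero(2)]) simp_all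
  qed
qed

end

section \<open>The generators\<close>

lemma central_if_commutes:
  fixes z :: "('k::field, 'n::finite, 'm::nontriv) alg"
  assumes "\<And>i. z * idem i = idem i * z" "\<And>s. z * alt_word s 1 = alt_word s 1 * z"
  shows "z * x = x * z"
proof -
  have w: "z * word_sum w = word_sum w * z" for w
  proof (induction w)
    case Nil
    then show ?case by (simp add: word_sum_Nil)
  next
    case (Cons s w)
    have "word_sum (s # w) = (alt_word s 1 * word_sum w :: ('k, 'n, 'm) alg)"
      by (simp add: word_sum_mult)
    then have "z * word_sum (s # w) = (z * alt_word s 1) * word_sum w" by (simp only: mult.assoc)
    also have "\<dots> = alt_word s 1 * (word_sum w * z)" unfolding assms(2) Cons[symmetric] by (simp only: mult.assoc)
    finally show ?case using \<open>word_sum (s # w) = _\<close> by (simp only: mult.assoc)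
  qed
  show ?thesis
  proof (induction x rule: alg_induct)
    case (path c p)
    have "path_elem p = (idem (fst p) * word_sum (snd p) :: ('k, 'n, 'm) alg)" by (simp add: idem_word_sum)
    then have "z * path_elem p = (z * idem (fst p)) * word_sum (snd p)" by (simp only: mult.assoc)
    also have "\<dots> = idem (fst p) * (word_sum (snd p) * z)" unfolding assms(1) w[symmetric] by (simp only: mult.assoc)
    finally have "z * path_elem p = path_elem p * z" using \<open>path_elem p = _\<close> by (simp only: mult.assoc)
    then show ?case by (simp add: scale_alg_mult_left scale_alg_mult_right)
  qed (simp_all add: distrib_left distrib_right)
qed

lemma eps_alt_path: "eps i = (alt_path i Fwd (2 * CARD('n)) :: ('k::field, 'n::finite, 'm::nontriv) alg)"
  by (simp add: eps_def arrow_bar_arrow_power(1))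

lemma central_f_alt_path:
  "central_f i = (alt_path i Fwd (Suc (Suc 0)) + alt_path (i + 1) Bwd (Suc (Suc 0)) :: ('k::field, 'n::finite, 'm::nontriv) alg)"
  by (simp add: central_f_def arrow_path_elem bar_arrow_path_elem path_elem_mult)

lemma eps_central:
  fixes x :: "('k::field, 'n::finite, 'm::nontriv) alg"
  shows "eps i * x = x * eps i"
proof (rule central_if_commutes)
  fix j s
  show "eps i * idem j = (idem j * eps i :: ('k, 'n, 'm) alg)"
    by (simp add: eps_alt_path path_elem_idem sum_shift_alternating del: alternating.simps)
  \<comment> \<open>Of the two alternating words that name \<open>eps i\<close>, on either side the
    one is chosen for which the product is a word of length 2N + 1.\<close>
  have "(eps i * alt_word s 1 :: ('k, 'n, 'm) alg) = alt_path i s (2 * CARD('n)) * alt_word s 1"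
    unfolding eps_alt_path path_elem_socle[of i s] ..
  also have "\<dots> = 0" unfolding alt_path_word by (simp add: path_elem_long del: alternating.simps)
  finally have "(eps i * alt_word s 1 :: ('k, 'n, 'm) alg) = 0" .
  moreover have "alt_word s 1 * eps i = (alt_word s 1 * alt_path i (flip s) (2 * CARD('n)) :: ('k, 'n, 'm) alg)"
    unfolding eps_alt_path path_elem_socle[of i "flip s"] ..
  moreover have "alt_word s 1 * alt_path i (flip s) (2 * CARD('n)) = (0 :: ('k, 'n, 'm) alg)"
    unfolding alt_word_path by (simp add: path_elem_long del: alternating.simps)
  ultimately show "eps i * alt_word s 1 = (alt_word s 1 * eps i :: ('k, 'n, 'm) alg)" by simp
qed

lemma central_f_central:
  fixes x :: "('k::field, 'n::finite, 'm::nontriv) alg"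
  shows "central_f i * x = x * central_f i"
proof (rule central_if_commutes)
  fix j s
  show "central_f i * idem j = (idem j * central_f i :: ('k, 'n, 'm) alg)"
    by (simp add: central_f_alt_path distrib_left distrib_right path_elem_idem)
  show "central_f i * alt_word s 1 = (alt_word s 1 * central_f i :: ('k, 'n, 'm) alg)"
    unfolding central_f_alt_path distrib_left distrib_right alt_path_word alt_word_path
    by (cases s) (simp_all del: alternating.simps)
qed

section \<open>Homogeneous representatives of the generators\<close>

definition homogeneous_class ::
  "('m::nontriv mod_ring \<Rightarrow> int) \<Rightarrow> nat \<Rightarrow> int \<times> int \<Rightarrow> (('k::field, 'n::finite, 'm) alg list \<Rightarrow> ('k, 'n, 'm) alg) set \<Rightarrow> bool" where
  "homogeneous_class \<xi> p w X \<longleftrightarrow> (\<exists>F\<in>cocycles scale_alg p. homogeneous_cochain \<xi> w p F \<and> X = HH_class scale_alg p F)"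

lemma central_cocycle:
  assumes "\<And>x. z * x = x * z"
  shows "(\<lambda>xs. if xs = [] then z else 0) \<in> cocycles scale_alg 0"
proof -
  have "hoch_diff 0 (\<lambda>xs. if xs = [] then z else 0) xs = 0" for xs
    using assms by (auto simp: hoch_diff_def length_Suc_conv)
  then show ?thesis by (auto simp: cocycles_def alg_module.cochains_iff)
qed

lemma homogeneous_class_central:
  assumes "\<And>x. z * x = x * z" "homogeneous \<xi> w z"
  shows "homogeneous_class \<xi> 0 w (central_class z)"
  unfolding homogeneous_class_def central_class_def
  by (intro bexI[OF _ central_cocycle[OF assms(1)]] conjI refl)
     (use assms(2) in \<open>simp add: homogeneous_cochain_def zero_prod_def[symmetric]\<close>)

lemma homogeneous_alt_path: "homogeneous \<xi> (weight \<xi> (i, alternating s L)) (alt_path i s L)"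
  by (simp add: weight_part_path_elem)

lemma homogeneous_eps: "homogeneous \<xi> (int CARD('n), 0) (eps i :: ('k::field, 'n::finite, 'm::nontriv) alg)"
  using homogeneous_alt_path[of \<xi> i Fwd "2 * CARD('n)"] unfolding eps_alt_path weight_alternating .

lemma homogeneous_central_f: "homogeneous \<xi> (1, 0) (central_f i)"
  using weight_alternating(1)[of \<xi> _ _ 1]
  by (simp add: central_f_alt_path weight_part_add weight_part_path_elem numeral_2_eq_2 del: alternating.simps)

lemma class_via_bar_rep: "class_via \<pi> n f = HH_class scale_alg n (bar_rep \<pi> n f)"
proof -
  have "(\<lambda>xs. if length xs = n then evaluate f (\<pi> xs) else 0) = bar_rep \<pi> n f"
    by (rule ext) (simp add: bar_rep_def)
  then show ?thesis by (simp add: class_via_def)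
qed

context
  fixes \<pi> :: "('k::field, 'n::finite, 'm::nontriv) alg list \<Rightarrow> ('k, 'n, 'm) bimod"
  assumes \<pi>: "comparison_map \<pi>" and m: "odd CARD('m)"
begin

text \<open>The differential of a label of index \<rho> involves the indices \<rho> and \<rho> - 1,
  so the cocycle condition can fail only at \<rho> = r and \<rho> = r + 1. As n is even, degree n +
  1 has no middle label.\<close>

lemma homogeneous_class_single:
  assumes n: "n > 0" "n \<le> 2 * CARD('m)" "even n" and r: "r \<le> n"
    and u: "\<And>i. idem i * u i * idem (target (n, r, i)) = (u i :: ('k, 'n, 'm) alg)"
    and c: "\<And>i. evaluate (single n r u) (boundary (Suc n) (int r) i) = 0"
      "\<And>i. evaluate (single n r u) (boundary (Suc n) (int r + 1) i) = 0"
    and w: "\<And>i. homogeneous \<xi> (w + label_weight TYPE('n) \<xi> (n, r, i)) (u i)"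
  shows "homogeneous_class \<xi> n w (class_via \<pi> n (single n r u))"
proof -
  obtain n' where n': "n = Suc n'" using n(1) by (cases n) auto
  have "resolution_cocycle n (single n r u)"
    unfolding resolution_cocycle_def
  proof (intro allI impI)
    fix \<rho> i assume \<rho>: "\<rho> \<le> Suc n"
    have "evaluate (single n r u) (boundary (Suc n) (int \<rho>) i) = 0"
    proof -
      have "int (Suc n) \<noteq> 2 * int \<rho>" using n(3) by presburger
      consider "\<rho> = r" | "int \<rho> = int r + 1" | "int (Suc n) > 2 * int \<rho>" "\<rho> \<noteq> r" "int \<rho> \<noteq> int r + 1"
        | "int (Suc n) < 2 * int \<rho>" "\<rho> \<noteq> r" "int \<rho> \<noteq> int r + 1"
        using \<open>int (Suc n) \<noteq> 2 * int \<rho>\<close> by linarith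
      then show ?thesis
        by cases (simp_all add: c evaluate_single_pos[OF r u] evaluate_single_neg[OF r u])
    qed
    then show "evaluate (single n r u) (diff_gen (Suc n) \<rho> i) = 0" using \<rho> by (simp add: boundary_def)
  qed
  moreover have "homogeneous \<xi> (w + label_weight TYPE('n) \<xi> (n, \<rho>, i)) (single n r u (n, \<rho>, i))" for \<rho> i
    using w[of i] by (auto simp: single_def simp del: label_weight.simps)
  ultimately show ?thesis
    unfolding homogeneous_class_def class_via_bar_rep n'
    using homogeneous_representative[OF \<pi> m, of n' "single n r u" \<xi> w] n(2) unfolding n' by blast
qed

lemma bracket_acyclic:
  fixes X Y :: "(('k, 'n, 'm) alg list \<Rightarrow> ('k, 'n, 'm) alg) set"
  assumes X: "homogeneous_class (\<lambda>_. 1) p (c, e) X" and Y: "homogeneous_class (\<lambda>_. 1) q (c', e') Y"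
    and pq: "p + q = Suc l" "l > 0" and a: "acyclic_weight TYPE(('k, 'n, 'm) alg) l (c + c') (e + e')"
  shows "HH_bracket scale_alg p q X Y = HH_zero scale_alg (p + q - 1)"
proof -
  obtain F where F: "F \<in> cocycles scale_alg p" "homogeneous_cochain (\<lambda>_. 1) (c, e) p F" "X = HH_class scale_alg p F"
    using X by (auto simp: homogeneous_class_def)
  obtain G where G: "G \<in> cocycles scale_alg q" "homogeneous_cochain (\<lambda>_. 1) (c', e') q G" "Y = HH_class scale_alg q G"
    using Y by (auto simp: homogeneous_class_def)
  obtain n where n: "l = Suc n" using pq(2) by (cases l) auto
  let ?K = "gerstenhaber p q F G"
  have FG: "F \<in> cochains scale_alg p" "G \<in> cochains scale_alg q" "hoch_diff p F = (\<lambda>_. 0)" "hoch_diff q G = (\<lambda>_. 0)"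
    using F(1) G(1) by (auto simp: cocycles_def)
  have "?K \<in> cochains scale_alg l"
    using alg_module.gerstenhaber_cochains[OF FG(1,2)] pq(1) by simp
  moreover have "hoch_diff l ?K xs = 0" for xs
  proof -
    have z: "gerstenhaber r s (\<lambda>_. 0) H xs = 0" if "H \<in> cochains scale_alg s" for r s and H :: "('k, 'n, 'm) alg list \<Rightarrow> _"
      using alg_module.gerstenhaber_diff[of s H r "\<lambda>_. 0" "\<lambda>_. 0" xs] that by (simp add: alg_module.cochains_iff)
    then have "gerstenhaber p (Suc q) F (\<lambda>_. 0) xs = 0" "gerstenhaber (Suc p) q (\<lambda>_. 0) G xs = 0"
      using FG(1,2) alg_module.gerstenhaber_swap[of p "Suc q" F "\<lambda>_. 0" xs] by simp_all
    then show ?thesis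
      using alg_module.hoch_diff_gerstenhaber[OF FG(1,2), of xs] pq(1) by (simp add: FG)
  qed
  ultimately have K: "?K \<in> cocycles scale_alg (Suc n)" by (auto simp: cocycles_def n)
  have "?K \<in> coboundaries scale_alg (Suc n)"
  proof (rule homogeneous_coboundary[OF \<pi> K])
    show "homogeneous_cochain (\<lambda>_. 1) (c + c', e + e') (Suc n) ?K"
      using homogeneous_cochain_gerstenhaber[OF F(2) G(2), of "Suc n"] pq(1) n by simp
    fix \<kappa> :: "'m label \<Rightarrow> ('k, 'n, 'm) alg"
    assume \<kappa>: "resolution_cocycle (Suc n) \<kappa>"
      "\<And>r i. r \<le> Suc n \<Longrightarrow> \<kappa> (Suc n, r, i) = idem i * \<kappa> (Suc n, r, i) * idem (target (Suc n, r, i))"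
      "\<And>r i. r \<le> Suc n \<Longrightarrow> homogeneous (\<lambda>_. 1) ((c + c', e + e') + label_weight TYPE('n) (\<lambda>_. 1) (Suc n, r, i)) (\<kappa> (Suc n, r, i))"
    then have "homogeneous_resolution_cocycle \<kappa> (Suc n) (c + c') (e + e')"
      by unfold_locales
    then show "\<exists>k. \<forall>r i. r \<le> Suc n \<longrightarrow> \<kappa> (Suc n, r, i) = evaluate k (diff_gen (Suc n) r i)"
      using a by (simp add: acyclic_weight_def n)
  qed
  then show ?thesis
    unfolding F(3) G(3) using pq n by (intro alg_module.HH_bracket_eq_zero F(1) G(1)) simp_all
qed

lemma sum_par:
  fixes u :: "'m mod_ring \<Rightarrow> ('k, 'n, 'm) alg"
  shows "(\<lambda>g. \<Sum>i\<in>UNIV. par n r i (u i) g) = single n r u"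
proof
  fix g :: "'m label"
  obtain n' r' j where g: "g = (n', r', j)" by (cases g)
  show "(\<Sum>i\<in>UNIV. par n r i (u i) g) = single n r u g"
    by (cases "n' = n \<and> r' = r") (auto simp: g par_def single_def)
qed

lemmas path_simps = scale_alg_mult_left scale_alg_mult_right alt_path_word alt_word_path path_elem_idem sign_if_def

lemma homogeneous_class_chi4:
  assumes "CARD('m) \<ge> 3"
  shows "homogeneous_class (\<lambda>_. 1) 4 (- 2 * int CARD('n), 0) (class_via \<pi> 4 chi4)"
proof -
  define u :: "'m mod_ring \<Rightarrow> ('k, 'n, 'm) alg" where "u i = alt_path i Fwd 0" for i
  have u: "idem i * u i * idem (target (4, 2, i)) = u i" for i
    by (simp add: u_def path_simps)
  have e: "chi4 = single 4 2 u"
    using sum_par[of 4 2 u] by (simp add: chi4_def[abs_def] u_def idem_path_elem)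
  show ?thesis
    unfolding e
  proof (rule homogeneous_class_single[OF _ _ _ _ u])
    show "evaluate (single 4 2 u) (boundary (Suc 4) (int 2) i) = 0" for i
      by (subst evaluate_single_pos[OF _ u]) (simp_all add: u_def path_simps del: alternating.simps)
    show "evaluate (single 4 2 u) (boundary (Suc 4) (int 2 + 1) i) = 0" for i
      by (subst evaluate_single_neg[OF _ u]) (simp_all add: u_def path_simps del: alternating.simps)
  qed (use assms in \<open>simp_all add: label_weight_one u_def weight_part_path_elem zero_prod_def del: label_weight.simps\<close>)
qed

lemma homogeneous_class_chi:
  shows "homogeneous_class (\<lambda>_. 1) (2 * CARD('m)) (0, - 2 * int CARD('m)) (class_via \<pi> (2 * CARD('m)) chi_plus)"
    and "homogeneous_class (\<lambda>_. 1) (2 * CARD('m)) (- 2 * int CARD('m), 2 * int CARD('m)) (class_via \<pi> (2 * CARD('m)) chi_minus)"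
proof -
  define u :: "'m mod_ring \<Rightarrow> ('k, 'n, 'm) alg" where "u i = alt_path i Fwd 0" for i
  note m0 = of_nat_card_mod_ring[where 'm = 'm]
  have u: "idem i * u i * idem (target (2 * CARD('m), 0, i)) = u i"
    "idem i * u i * idem (target (2 * CARD('m), 2 * CARD('m), i)) = u i" for i
    by (simp_all add: u_def path_simps m0)
  have e: "chi_plus = single (2 * CARD('m)) 0 u" "chi_minus = single (2 * CARD('m)) (2 * CARD('m)) u"
    using sum_par[of "2 * CARD('m)" _ u]
    by (simp_all add: chi_plus_def[abs_def] chi_minus_def[abs_def] u_def idem_path_elem)
  obtain k l where kl: "CARD('m) = Suc k" "CARD('n) = Suc l"
    using gr0_implies_Suc[of "CARD('m)"] gr0_implies_Suc[of "CARD('n)"] by auto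
  then have pos: "int (Suc (2 * CARD('m))) > 2 * (int 0 + 1)" "\<not> 2 * CARD('n) \<le> Suc 0"
    "int (Suc (2 * CARD('m))) < 2 * int (2 * CARD('m))" "int (Suc (2 * CARD('m))) < 2 * (int (2 * CARD('m)) + 1)"
    using m by (auto elim: oddE simp: kl)
  show "homogeneous_class (\<lambda>_. 1) (2 * CARD('m)) (0, - 2 * int CARD('m)) (class_via \<pi> (2 * CARD('m)) chi_plus)"
    unfolding e
  proof (rule homogeneous_class_single[OF _ _ _ _ u(1)])
    show "evaluate (single (2 * CARD('m)) 0 u) (boundary (Suc (2 * CARD('m))) (int 0) i) = 0" for i
      by (subst evaluate_single_pos[OF _ u(1)]) (simp_all add: u_def path_simps del: alternating.simps)
    show "evaluate (single (2 * CARD('m)) 0 u) (boundary (Suc (2 * CARD('m))) (int 0 + 1) i) = 0" for i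
      by (subst evaluate_single_pos[OF _ u(1) pos(1)]) (use pos(2) in \<open>simp_all add: u_def path_simps del: alternating.simps\<close>)
  qed (use kl in \<open>simp_all add: label_weight_one u_def weight_part_path_elem zero_prod_def del: label_weight.simps\<close>)
  show "homogeneous_class (\<lambda>_. 1) (2 * CARD('m)) (- 2 * int CARD('m), 2 * int CARD('m)) (class_via \<pi> (2 * CARD('m)) chi_minus)"
    unfolding e
  proof (rule homogeneous_class_single[OF _ _ _ _ u(2)])
    show "evaluate (single (2 * CARD('m)) (2 * CARD('m)) u) (boundary (Suc (2 * CARD('m))) (int (2 * CARD('m))) i) = 0" for i
      by (subst evaluate_single_neg[OF _ u(2) pos(3)]) (use pos(2) in \<open>simp_all add: u_def path_simps del: alternating.simps\<close>)
    show "evaluate (single (2 * CARD('m)) (2 * CARD('m)) u) (boundary (Suc (2 * CARD('m))) (int (2 * CARD('m)) + 1) i) = 0" for i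
      by (subst evaluate_single_neg[OF _ u(2) pos(4)]) (use pos(2) in \<open>simp_all add: u_def path_simps del: alternating.simps\<close>)
  qed (use kl in \<open>simp_all add: label_weight_one u_def weight_part_path_elem zero_prod_def del: label_weight.simps\<close>)
qed

lemma arrow_powers:
  "(arrow i * bar_arrow i) ^ k * arrow i = (alt_path i Fwd (Suc (2 * k)) :: ('k, 'n, 'm) alg)"
  "(bar_arrow (i - 1) * arrow (i - 1)) ^ k * bar_arrow (i - 1) = (alt_path i Bwd (Suc (2 * k)) :: ('k, 'n, 'm) alg)"
proof -
  have a: "alternating s (2 * k) @ [s] = alternating s (Suc (2 * k))" for s
    using alternating_add[of s "2 * k" 1] by simp
  show "(arrow i * bar_arrow i) ^ k * arrow i = (alt_path i Fwd (Suc (2 * k)) :: ('k, 'n, 'm) alg)"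
  proof (cases "k = 0")
    case False
    then have k: "k > 0" by simp
    show ?thesis unfolding arrow_bar_arrow_power(1)[OF k] unfolding arrow_path_elem
      by (simp add: path_elem_mult sum_shift_alternating a del: alternating.simps)
  qed (simp add: arrow_path_elem)
  show "(bar_arrow (i - 1) * arrow (i - 1)) ^ k * bar_arrow (i - 1) = (alt_path i Bwd (Suc (2 * k)) :: ('k, 'n, 'm) alg)"
  proof (cases "k = 0")
    case False
    then have k: "k > 0" by simp
    show ?thesis unfolding arrow_bar_arrow_power(2)[OF k] unfolding bar_arrow_path_elem
      by (simp add: path_elem_mult sum_shift_alternating a del: alternating.simps)
  qed (simp add: bar_arrow_path_elem)
qed

lemma homogeneous_class_phi_psi:
  assumes m3: "CARD('m) \<ge> 3"
  shows "homogeneous_class (\<lambda>_. 1) (CARD('m) - 1) (int CARD('n) - int CARD('m), int CARD('m)) (class_via \<pi> (CARD('m) - 1) gen_phi)"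
    and "homogeneous_class (\<lambda>_. 1) (CARD('m) - 1) (int CARD('n), - int CARD('m)) (class_via \<pi> (CARD('m) - 1) gen_psi)"
proof -
  obtain M where M: "CARD('m) = Suc M" "even M" "M \<ge> 2" using m m3 by (cases "CARD('m)") auto
  obtain K where K: "CARD('n) = Suc K" using gr0_implies_Suc[of "CARD('n)"] by auto
  define u v :: "'m mod_ring \<Rightarrow> ('k, 'n, 'm) alg"
    where "u i = alt_path i Fwd (Suc (2 * K))" and "v i = alt_path i Bwd (Suc (2 * K))" for i
  have M1: "(of_nat M :: 'm mod_ring) = - 1"
    using of_nat_card_mod_ring[where 'm = 'm] by (simp add: M eq_neg_iff_add_eq_0 add.commute)
  have u: "idem i * u i * idem (target (M, M, i)) = u i" for i
    by (simp add: u_def path_simps M1 sum_shift_alternating del: alternating.simps)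
  have v: "idem i * v i * idem (target (M, 0, i)) = v i" for i
    by (simp add: v_def path_simps M1 sum_shift_alternating del: alternating.simps)
  have e: "gen_phi = single M M u" "gen_psi = single M 0 v"
    using sum_par[of M M u] sum_par[of M 0 v]
    by (simp_all add: gen_phi_def[abs_def] gen_psi_def[abs_def] u_def v_def arrow_powers M(1) K)
  have s: "alt_path i Bwd (Suc (Suc (2 * K))) = (alt_path i Fwd (Suc (Suc (2 * K))) :: ('k, 'n, 'm) alg)" for i
    using path_elem_socle[of i Bwd, where ?'n = 'n] unfolding K by simp
  have M': "CARD('m) - 1 = M" by (simp add: M)
  show "homogeneous_class (\<lambda>_. 1) (CARD('m) - 1) (int CARD('n) - int CARD('m), int CARD('m)) (class_via \<pi> (CARD('m) - 1) gen_phi)"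
    unfolding e M'
  proof (rule homogeneous_class_single[OF _ _ _ _ u])
    show "evaluate (single M M u) (boundary (Suc M) (int M) i) = 0" for i
      by (subst evaluate_single_neg[OF _ u]) (use M in \<open>simp_all add: u_def path_simps K del: alternating.simps\<close>)
    show "evaluate (single M M u) (boundary (Suc M) (int M + 1) i) = 0" for i
      by (subst evaluate_single_neg[OF _ u]) (use M in \<open>simp_all add: u_def path_simps K s del: alternating.simps\<close>)
  qed (use M in \<open>simp_all add: label_weight_one u_def weight_part_path_elem weight_alternating K del: label_weight.simps alternating.simps\<close>)
  show "homogeneous_class (\<lambda>_. 1) (CARD('m) - 1) (int CARD('n), - int CARD('m)) (class_via \<pi> (CARD('m) - 1) gen_psi)"
    unfolding e M'
  proof (rule homogeneous_class_single[OF _ _ _ _ v])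
    show "evaluate (single M 0 v) (boundary (Suc M) (int 0) i) = 0" for i
      by (subst evaluate_single_pos[OF _ v]) (use M in \<open>simp_all add: v_def path_simps K s del: alternating.simps\<close>)
    show "evaluate (single M 0 v) (boundary (Suc M) (int 0 + 1) i) = 0" for i
      by (subst evaluate_single_pos[OF _ v]) (use M in \<open>simp_all add: v_def path_simps K s del: alternating.simps\<close>)
  qed (use M in \<open>simp_all add: label_weight_one v_def weight_part_path_elem weight_alternating K del: label_weight.simps alternating.simps\<close>)
qed

text \<open>Here \<xi> is arbitrary, which \<open>inner_with_central_f\<close> exploits: the label
  (2, 1, i) has weight (N, 0) and the values have weight (1, 0), whatever \<xi> is.\<close>

lemma homogeneous_class_F:
  assumes m3: "CARD('m) \<ge> 3"
  shows "homogeneous_class \<xi> 2 (1 - int CARD('n), 0) (class_via \<pi> 2 (gen_F j))"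
proof -
  \<comment> \<open>The indicator of j writes both summands of \<open>gen_F\<close> as one function
    of the vertex.\<close>
  define x :: "'m mod_ring \<Rightarrow> 'k" where "x i = (if i = j then 1 else 0)" for i
  define u :: "'m mod_ring \<Rightarrow> ('k, 'n, 'm) alg"
    where "u i = scale_alg (x i) (alt_path i Fwd (Suc (Suc 0))) - scale_alg (x (i - 1)) (alt_path i Bwd (Suc (Suc 0)))" for i
  have u: "idem i * u i * idem (target (2, 1, i)) = u i" for i
    by (simp add: u_def path_simps left_diff_distrib right_diff_distrib)
  have e: "gen_F j = single 2 1 u"
  proof
    fix g :: "'m label"
    obtain n r i where g: "g = (n, r, i)" by (cases g)
    have "j \<noteq> j + 1" by simp
    then show "gen_F j g = single 2 1 u g"
      by (auto simp: g gen_F_def par_def single_def u_def x_def arrow_path_elem bar_arrow_path_elem path_elem_mult)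
  qed
  show ?thesis
    unfolding e
  proof (rule homogeneous_class_single[OF _ _ _ _ u])
    show "evaluate (single 2 1 u) (boundary (Suc 2) (int 1) i) = 0" for i
      by (subst evaluate_single_pos[OF _ u])
         (simp_all add: u_def path_simps left_diff_distrib right_diff_distrib del: alternating.simps)
    show "evaluate (single 2 1 u) (boundary (Suc 2) (int 1 + 1) i) = 0" for i
      by (subst evaluate_single_neg[OF _ u])
         (simp_all add: u_def path_simps left_diff_distrib right_diff_distrib del: alternating.simps)
    show "homogeneous \<xi> ((1 - int CARD('n), 0) + label_weight TYPE('n) \<xi> (2, 1, i)) (u i)" for i
      using weight_alternating(1)[of \<xi> i _ 1]
      by (simp add: u_def weight_part_diff weight_part_scale weight_part_path_elem zero_prod_def numeral_2_eq_2 del: alternating.simps)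
  qed (use m3 in simp_all)
qed

end

section \<open>Brackets of central elements with classes of degree two\<close>

lemma cocycle_2:
  fixes F :: "('k::field, 'n::finite, 'm::nontriv) alg list \<Rightarrow> ('k, 'n, 'm) alg"
  assumes "F \<in> cocycles scale_alg 2"
  shows "x * F [y, w] - F [x * y, w] + F [x, y * w] - F [x, y] * w = 0"
proof -
  have "hoch_diff 2 F [x, y, w] = 0" using assms by (simp add: cocycles_def)
  then show ?thesis by (simp add: hoch_diff_def numeral_2_eq_2 algebra_simps)
qed

text \<open>The degree one cocycle \<open>x \<mapsto> F(z, x) - F(x, z)\<close> represents the bracket of \<open>F\<close> with the central element \<open>z\<close>.\<close>

definition inner_with ::
  "(('k::field, 'n::finite, 'm::nontriv) alg list \<Rightarrow> ('k, 'n, 'm) alg) \<Rightarrow> ('k, 'n, 'm) alg \<Rightarrow> bool" where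
  "inner_with F z \<longleftrightarrow> (\<forall>x. z * x = x * z) \<and> (\<exists>c. \<forall>x. F [z, x] - F [x, z] = x * c - c * x)"

lemma gerstenhaber_central_coboundary:
  fixes F :: "('k::field, 'n::finite, 'm::nontriv) alg list \<Rightarrow> ('k, 'n, 'm) alg"
  assumes "inner_with F z"
  shows "gerstenhaber 2 0 F (\<lambda>xs. if xs = [] then z else 0) \<in> coboundaries scale_alg (2 + 0 - 1)"
proof -
  obtain c where c: "\<And>x. F [z, x] - F [x, z] = x * c - c * x"
    using assms by (auto simp: inner_with_def)
  let ?c = "\<lambda>xs. if xs = [] then c else 0"
  have "gerstenhaber 2 0 F (\<lambda>xs. if xs = [] then z else 0) xs = hoch_diff 0 ?c xs" for xs
  proof (cases "length xs = 1")
    case True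
    then obtain x where "xs = [x]" by (auto simp: length_Suc_conv)
    then show ?thesis
      using c[of x] by (simp add: gerstenhaber_def circ_def hoch_diff_def numeral_2_eq_2)
  next
    case False
    then show ?thesis by (auto simp: gerstenhaber_def circ_def hoch_diff_def)
  qed
  then have "gerstenhaber 2 0 F (\<lambda>xs. if xs = [] then z else 0) = hoch_diff 0 ?c" by (rule ext)
  moreover have "?c \<in> cochains scale_alg 0" by (simp add: alg_module.cochains_iff)
  ultimately show ?thesis by (auto simp: coboundaries_def)
qed

text \<open>The bracket with F is a derivation up to coboundaries. By the cocycle identities for (z,
  w, x), (x, z, w) and (z, x, w), the product of z and w takes the element z d + c w, corrected by
  F(z, w).\<close>

lemma inner_with_mult:
  assumes F: "F \<in> cocycles scale_alg 2" and "inner_with F z" "inner_with F w"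
  shows "inner_with F (z * w)"
proof -
  obtain c d where c: "\<And>x. F [z, x] - F [x, z] = x * c - c * x" and d: "\<And>x. F [w, x] - F [x, w] = x * d - d * x"
    and z: "\<And>x. z * x = x * z" and w: "\<And>x. w * x = x * w"
    using assms by (auto simp: inner_with_def)
  have "F [z * w, x] - F [x, z * w] = x * (z * d + c * w + F [z, w]) - (z * d + c * w + F [z, w]) * x" for x
  proof -
    have 1: "F [z * w, x] = z * F [w, x] + F [z, w * x] - F [z, w] * x"
      using cocycle_2[OF F, of z w x] by (simp add: algebra_simps)
    have 2: "F [x, z * w] = F [x * z, w] + F [x, z] * w - x * F [z, w]"
      using cocycle_2[OF F, of x z w] by (simp add: algebra_simps)
    have 3: "F [z, w * x] - F [x * z, w] = F [z, x] * w - z * F [x, w]"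
      using cocycle_2[OF F, of z x w] by (simp add: algebra_simps z[of x] w[of x])
    have "F [z * w, x] - F [x, z * w] = z * (F [w, x] - F [x, w]) + (F [z, x] - F [x, z]) * w + x * F [z, w] - F [z, w] * x"
      unfolding 1 2 right_diff_distrib left_diff_distrib using 3 by (simp add: algebra_simps)
    also have "z * (F [w, x] - F [x, w]) = x * (z * d) - z * d * x"
      unfolding d right_diff_distrib by (simp only: mult.assoc[symmetric] z[of x])
    also have "(F [z, x] - F [x, z]) * w = x * (c * w) - c * w * x"
      unfolding c left_diff_distrib by (simp only: mult.assoc w[of x])
    finally show ?thesis by (simp add: distrib_left distrib_right algebra_simps)
  qed
  moreover have "z * w * x = x * (z * w)" for x using z w by (metis mult.assoc)
  ultimately show ?thesis unfolding inner_with_def by blast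
qed

lemma inner_with_power:
  "F \<in> cocycles scale_alg 2 \<Longrightarrow> inner_with F z \<Longrightarrow> inner_with F (z ^ Suc n)"
  by (induction n) (simp_all add: inner_with_mult)

lemma mlin_2:
  fixes F :: "('k::field, 'n::finite, 'm::nontriv) alg list \<Rightarrow> ('k, 'n, 'm) alg"
  assumes "F \<in> cocycles scale_alg 2"
  shows "lin scale_alg scale_alg (\<lambda>x. F [x, y])" "lin scale_alg scale_alg (\<lambda>x. F [y, x])"
proof -
  have m: "mlin_alg 2 F" using assms by (simp add: cocycles_def alg_module.cochains_iff)
  show "lin scale_alg scale_alg (\<lambda>x. F [x, y])" "lin scale_alg scale_alg (\<lambda>x. F [y, x])"
    using m by (simp_all add: numeral_2_eq_2)
qed

lemma inner_with_linear:
  fixes F :: "('k::field, 'n::finite, 'm::nontriv) alg list \<Rightarrow> ('k, 'n, 'm) alg"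
  assumes F: "F \<in> cocycles scale_alg 2"
  shows "inner_with F z \<Longrightarrow> inner_with F w \<Longrightarrow> inner_with F (z + w)"
    and "inner_with F z \<Longrightarrow> inner_with F (scale_alg a z)"
proof -
  note L = mlin_2[OF F, unfolded lin_def]
  show "inner_with F (z + w)" if zw: "inner_with F z" "inner_with F w"
  proof -
    obtain c d where c: "\<And>x. F [z, x] - F [x, z] = x * c - c * x" and d: "\<And>x. F [w, x] - F [x, w] = x * d - d * x"
      using zw by (auto simp: inner_with_def)
    have "F [z + w, x] - F [x, z + w] = x * (c + d) - (c + d) * x" for x
    proof -
      have "F [z + w, x] - F [x, z + w] = (F [z, x] - F [x, z]) + (F [w, x] - F [x, w])" by (simp add: L)
      then show ?thesis unfolding c d by (simp add: distrib_left distrib_right)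
    qed
    moreover have "(z + w) * x = x * (z + w)" for x
      using zw by (simp add: inner_with_def distrib_left distrib_right)
    ultimately show ?thesis unfolding inner_with_def by blast
  qed
  show "inner_with F (scale_alg a z)" if z: "inner_with F z"
  proof -
    obtain c where c: "\<And>x. F [z, x] - F [x, z] = x * c - c * x" using z by (auto simp: inner_with_def)
    have "F [scale_alg a z, x] - F [x, scale_alg a z] = x * scale_alg a c - scale_alg a c * x" for x
    proof -
      have "F [scale_alg a z, x] - F [x, scale_alg a z] = scale_alg a (F [z, x] - F [x, z])"
        by (simp add: L alg.scale_right_diff_distrib)
      then show ?thesis unfolding c by (simp add: alg.scale_right_diff_distrib scale_alg_mult_left scale_alg_mult_right)
    qed
    moreover have "scale_alg a z * x = x * scale_alg a z" for x
      using z by (simp add: inner_with_def scale_alg_mult_left scale_alg_mult_right)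
    ultimately show ?thesis unfolding inner_with_def by blast
  qed
qed

text \<open>The weights used for \<open>central_f i\<close> depend on i, hence so does the
  homogeneous representative; this brings the results back to one F.\<close>

lemma inner_with_cohomologous:
  fixes F G :: "('k::field, 'n::finite, 'm::nontriv) alg list \<Rightarrow> ('k, 'n, 'm) alg"
  assumes "(\<lambda>xs. F xs - G xs) \<in> coboundaries scale_alg 2" "inner_with G z"
  shows "inner_with F z"
proof -
  obtain H where "(\<lambda>xs. F xs - G xs) = hoch_diff 1 H"
    using assms(1) by (auto simp: coboundaries_def numeral_2_eq_2)
  then have H: "F [x, y] - G [x, y] = x * H [y] - H [x * y] + H [x] * y" for x y
    by (simp add: fun_eq_iff hoch_diff_def)
  obtain c where c: "\<And>x. G [z, x] - G [x, z] = x * c - c * x" and z: "\<And>x. z * x = x * z"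
    using assms(2) by (auto simp: inner_with_def)
  have "F [z, x] - F [x, z] = x * (c - H [z]) - (c - H [z]) * x" for x
  proof -
    have "F [z, x] = G [z, x] + (H [x] * z - H [x * z] + H [z] * x)" "F [x, z] = G [x, z] + (x * H [z] - H [x * z] + H [x] * z)"
      using H[of z x] H[of x z] by (simp_all add: z algebra_simps)
    then have "F [z, x] - F [x, z] = (G [z, x] - G [x, z]) + (H [z] * x - x * H [z])" by simp
    also have "\<dots> = x * (c - H [z]) - (c - H [z]) * x" unfolding c by (simp add: left_diff_distrib right_diff_distrib)
    finally show ?thesis .
  qed
  then show ?thesis using z by (auto simp: inner_with_def)
qed

lemma central_f_power:
  "central_f i ^ Suc k = (alt_path i Fwd (2 * Suc k) + alt_path (i + 1) Bwd (2 * Suc k) :: ('k::field, 'n::finite, 'm::nontriv) alg)"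
proof (induction k)
  case 0
  then show ?case by (simp add: central_f_alt_path numeral_2_eq_2 del: alternating.simps)
next
  case (Suc k)
  have a: "alternating s (Suc (Suc 0)) @ alternating s l = alternating s (Suc (Suc l))" for s l by simp
  show ?case
    unfolding power_Suc[of _ "Suc k"] Suc
    by (simp add: central_f_alt_path distrib_left distrib_right path_elem_mult a)
qed

lemma central_f_power_card:
  "central_f i ^ CARD('n) = (eps i + eps (i + 1) :: ('k::field, 'n::finite, 'm::nontriv) alg)"
proof -
  obtain k where k: "CARD('n) = Suc k" using gr0_implies_Suc[of "CARD('n)"] by auto
  show ?thesis
    using central_f_power[of i k, where ?'k = 'k and ?'n = 'n] path_elem_socle[of "i + 1" Bwd, where ?'k = 'k and ?'n = 'n]
    unfolding k[symmetric] by (simp add: eps_alt_path)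
qed

lemma inner_with_eps:
  fixes F :: "('k::field, 'n::finite, 'm::nontriv) alg list \<Rightarrow> ('k, 'n, 'm) alg"
  assumes F: "F \<in> cocycles scale_alg 2" and f: "\<And>i. inner_with F (central_f i)"
    and m: "odd CARD('m)" and two: "(2 :: 'k) \<noteq> 0"
  shows "inner_with F (eps i)"
proof -
  obtain k where k: "CARD('n) = Suc k" using gr0_implies_Suc[of "CARD('n)"] by auto
  have e: "inner_with F (eps i + eps (i + 1))" for i
    using inner_with_power[OF F f[of i], of k] unfolding k[symmetric] central_f_power_card .
  \<comment> \<open>Modulo elements already known to have an inner bracket, \<open>eps\<close>
    changes sign with each step; m steps, an odd number, lead from \<open>eps i\<close> to its
    negative.\<close>
  have "inner_with F (eps (i + of_nat j) - scale_alg ((- 1) ^ j) (eps i))" for j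
  proof (induction j)
    case 0
    have "inner_with F 0" using inner_with_linear(2)[OF F f, of 0] by simp
    then show ?case by simp
  next
    case (Suc j)
    have "inner_with F (scale_alg (- 1) (eps (i + of_nat j) - scale_alg ((- 1) ^ j) (eps i)))"
      by (rule inner_with_linear(2)[OF F Suc])
    from inner_with_linear(1)[OF F e[of "i + of_nat j"] this] show ?case
      by (simp add: alg.scale_right_diff_distrib ac_simps)
  qed
  from this[of "CARD('m)"] have "inner_with F (eps i + eps i)"
    using m by (simp add: of_nat_card_mod_ring)
  then have "inner_with F (scale_alg 2 (eps i))" by (simp add: alg.scale_left_distrib[of 1 1, simplified])
  from inner_with_linear(2)[OF F this, of "1 / 2"] show ?thesis using two by simp
qed

section \<open>The bracket of F with \<open>central_f\<close>\<close>

lemma homogeneous_zero: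
  fixes u :: "('k::field, 'n::finite, 'm::nontriv) alg"
  assumes "homogeneous \<xi> (c, d) u" "c < 0 \<or> d \<noteq> 0 \<and> (\<forall>v. d \<noteq> \<xi> v \<and> d \<noteq> - \<xi> v)"
  shows "u = 0"
proof -
  have "(c, d) \<notin> weights TYPE('n) \<xi>"
  proof
    assume "(c, d) \<in> weights TYPE('n) \<xi>"
    then obtain i s L where L: "weight \<xi> (i, alternating s L) = (c, d)" by (auto simp: weights_def)
    show False
    proof (cases L rule: parity_cases)
      case (1 k)
      then show ?thesis using L assms(2) by (simp add: weight_alternating)
    next
      case (2 k)
      then show ?thesis using L assms(2) weight_alternating(2,3)[of \<xi> i k] by (cases s) (auto simp del: alternating.simps)
    qed
  qed
  from weight_part_eq_0[OF this] assms(1) show ?thesis by metis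
qed

text \<open>On P, besides the values at arrows, only products of E (e_i) with an arrow starting at i
  enter; these are 0 by the derivation rule applied to e_i times the arrow.\<close>

lemma cocycle_1_coboundary:
  fixes \<pi> :: "('k::field, 'n::finite, 'm::nontriv) alg list \<Rightarrow> ('k, 'n, 'm) bimod"
  assumes \<pi>: "comparison_map \<pi>" and E: "E \<in> cocycles scale_alg 1"
    and a: "\<And>i. E [arrow i] = 0" "\<And>i. E [bar_arrow i] = (0 :: ('k, 'n, 'm) alg)"
  shows "E \<in> coboundaries scale_alg 1"
proof -
  have m: "mlin_alg 1 E" using E by (simp add: cocycles_def alg_module.cochains_iff)
  have d: "x * E [y] - E [x * y] + E [x] * y = 0" for x y
    using E by (auto simp: cocycles_def fun_eq_iff hoch_diff_def dest: spec[of _ "[x, y]"])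
  have ea: "E [idem i] * arrow i = 0" for i
    using d[of "idem i" "arrow i"] a(1) by (simp add: idem_path_elem arrow_path_elem path_elem_mult)
  have eb: "E [idem i] * bar_arrow (i - 1) = 0" for i
    using d[of "idem i" "bar_arrow (i - 1)"] a(2)[of "i - 1"]
    by (simp add: idem_path_elem bar_arrow_path_elem path_elem_mult)
  define \<Phi> where "\<Phi> = pull_gen scale_alg (*) 0 E"
  have L: "lin scale_alg scale_alg (\<lambda>x. \<Phi> x g)" for g :: "'m label"
    using m by (simp add: \<Phi>_def)
  have \<Phi>_app: "\<Phi> x g = E [x]" for x g by (simp add: \<Phi>_def)
  have ext: "(\<lambda>l. left_ext E (1 # l)) = E" by (simp add: left_ext_def)
  have pull: "lift_right scale_alg (*) \<Phi> (gtensor x 0 \<rho> j y) =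
      (if \<rho> = 0 then E [x * idem j] * (idem j * y) else 0)" for x y \<rho> j
    by (auto simp: gtensor_def AA.lift_right_tensor[OF L] lin_0[OF AA.lin_lift_right[OF L]] \<Phi>_app)
  note L' = AA.lin_lift_right[OF L]
  have a': "idem j * alt_word Fwd 1 = (arrow j :: ('k, 'n, 'm) alg)" "alt_word Fwd 1 * idem (j + 1) = (arrow j :: ('k, 'n, 'm) alg)"
    "idem j * alt_word Bwd 1 = (bar_arrow (j - 1) :: ('k, 'n, 'm) alg)" "alt_word Bwd 1 * idem (j - 1) = (bar_arrow (j - 1) :: ('k, 'n, 'm) alg)" for j
    by (simp_all add: idem_word_sum word_sum_idem arrow_path_elem bar_arrow_path_elem)
  have "pull_cochain 1 E (1, r, i) = 0" if "r \<le> 1" for r i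
  proof -
    have "pull_cochain 1 E (1, r, i) =
        lift_right scale_alg (*) \<Phi> (diff_gen (Suc 0) r i)"
      by (simp add: pull_cochain_def ext \<Phi>_def)
    also have "\<dots> = 0"
    proof (cases "r = 0")
      case True
      then show ?thesis
        unfolding diff_gen_words Let_def
        by (simp add: signed_eq L'[unfolded lin_def] pull lin_minus[OF L'] lin_diff[OF L'] a'[simplified] ea a)
    next
      case False
      then have "r = 1" using that by simp
      then show ?thesis
        unfolding diff_gen_words Let_def
        by (simp add: signed_eq L'[unfolded lin_def] pull lin_minus[OF L'] lin_diff[OF L'] a'[simplified] eb a)
    qed
    finally show ?thesis .
  qed
  then have "evaluate (pull_cochain (Suc 0) E) p = evaluate (\<lambda>_. 0) (differential p)" if "p \<in> component (Suc 0)" for p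
    using that by (intro evaluate_differential_component[where f = "pull_cochain (Suc 0) E"]) (simp_all add: evaluate_one evaluate_zero_fun)
  from coboundary_if_pull_coboundary[OF \<pi> _ this] E show ?thesis by simp
qed

lemma homogeneous_cochain_2:
  "homogeneous_cochain \<xi> w 2 F \<Longrightarrow> homogeneous \<xi> u x \<Longrightarrow> homogeneous \<xi> v y \<Longrightarrow> homogeneous \<xi> (w + (u + v)) (F [x, y])"
  unfolding homogeneous_cochain_def by (drule spec[of _ "[x, y]"], drule spec[of _ "[u, v]"]) simp

text \<open>
  The weights \<open>5\<close> and \<open>1\<close> separate the arrows at \<open>i\<close> from the other ones: sums such as \<open>5 - 1\<close> and
  \<open>5 + 5\<close> are not weights of \<open>A\<close>, so \<open>F\<close> vanishes on most pairs of arrows.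
\<close>

lemma inner_with_central_f:
  fixes \<pi> :: "('k::field, 'n::finite, 'm::nontriv) alg list \<Rightarrow> ('k, 'n, 'm) bimod"
  assumes \<pi>: "comparison_map \<pi>" and F: "F \<in> cocycles scale_alg 2" and N: "CARD('n) > 1"
    and h: "homogeneous_cochain (\<lambda>l. if l = i then 5 else 1) (1 - int CARD('n), 0) 2 F"
  shows "inner_with F (central_f i :: ('k, 'n, 'm) alg)"
proof -
  let ?\<xi> = "\<lambda>l :: 'm mod_ring. if l = i then 5 else 1 :: int"
  define a b :: "('k, 'n, 'm) alg" where "a = arrow i" and "b = bar_arrow i"
  define c where "c = F [a, b] + F [b, a]"
  define E where "E xs = (if length xs = 1 then F [central_f i, hd xs] - F [hd xs, central_f i] - (hd xs * c - c * hd xs) else 0)" for xs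
  note L = mlin_2[OF F, unfolded lin_def]
  have z: "central_f i = a * b + b * a" by (simp add: central_f_def a_def b_def)
  have "E \<in> cochains scale_alg 1"
  proof -
    have "mlin_alg 1 E"
      by (simp add: E_def lin_def L distrib_left distrib_right scale_alg_mult_left scale_alg_mult_right
          alg.scale_right_diff_distrib algebra_simps)
    then show ?thesis by (simp add: alg_module.cochains_iff E_def)
  qed
  moreover have "hoch_diff 1 E xs = 0" for xs
  proof (cases "length xs = 2")
    case True
    then obtain x y where xs: "xs = [x, y]" by (auto simp: length_Suc_conv numeral_2_eq_2)
    let ?z = "central_f i :: ('k, 'n, 'm) alg"
    have 1: "F [?z * x, y] = ?z * F [x, y] + F [?z, x * y] - F [?z, x] * y"
      using cocycle_2[OF F, of ?z x y] by (simp add: algebra_simps)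
    have 2: "F [x, y * ?z] = F [x * y, ?z] + F [x, y] * ?z - x * F [y, ?z]"
      using cocycle_2[OF F, of x y ?z] by (simp add: algebra_simps)
    have 3: "x * F [?z, y] - F [x * ?z, y] + F [x, ?z * y] - F [x, ?z] * y = 0"
      using cocycle_2[OF F, of x ?z y] .
    have "x * F [?z, y] - x * F [y, ?z] - (F [?z, x * y] - F [x * y, ?z]) + (F [?z, x] * y - F [x, ?z] * y) = 0"
      using 3 unfolding central_f_central[of i x, symmetric] central_f_central[of i y]
        1 2 central_f_central[of i "F [x, y]"]
      by (simp add: algebra_simps)
    then show ?thesis by (simp add: xs hoch_diff_def E_def algebra_simps)
  next
    case False
    then show ?thesis by (simp add: hoch_diff_def)
  qed
  ultimately have E: "E \<in> cocycles scale_alg 1" by (auto simp: cocycles_def)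
  have ha: "homogeneous ?\<xi> (0, ?\<xi> l) (arrow l :: ('k, 'n, 'm) alg)" and hb: "homogeneous ?\<xi> (1, - ?\<xi> l) (bar_arrow l :: ('k, 'n, 'm) alg)" for l
    by (simp_all add: arrow_path_elem bar_arrow_path_elem weight_part_path_elem zero_prod_def)
  note hF = homogeneous_cochain_2[OF h]
  \<comment> \<open>The first component of the weight is 1 - N < 0 here, so the vertices do not
    matter.\<close>
  have aa: "F [arrow l, arrow l'] = 0" for l l'
    by (rule homogeneous_zero[OF hF[OF ha ha, of l l', unfolded add_Pair]]) (use N in simp)
  \<comment> \<open>The second component is -10 or -6, while A has only 0, \<plusminus>1 and
    \<plusminus>5.\<close>
  have bb: "F [b, bar_arrow l] = 0" "F [bar_arrow l, b] = 0" for l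
    unfolding b_def
    by (rule homogeneous_zero[OF hF[OF hb hb, unfolded add_Pair]], simp)+
  \<comment> \<open>The second component is \<plusminus>4.\<close>
  have ab: "F [a, bar_arrow l] = 0" "F [bar_arrow l, a] = 0" "F [b, arrow l] = 0" "F [arrow l, b] = 0" if "l \<noteq> i" for l
    unfolding a_def b_def using that
    by (auto intro!: homogeneous_zero[OF hF[OF ha hb, unfolded add_Pair]] homogeneous_zero[OF hF[OF hb ha, unfolded add_Pair]] split: if_splits)
  have F0: "F [0, x] = 0" "F [x, 0] = 0" for x
    using mlin_2[OF F] by (auto dest: lin_0)
  \<comment> \<open>The choice of c absorbs the terms x F(a, b), F(a, b) x and those with a and b
    exchanged.\<close>
  have D: "F [central_f i, x] - F [x, central_f i] - (x * c - c * x) =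
      a * F [b, x] + F [a, b * x] + b * F [a, x] + F [b, a * x] - F [x * a, b] - F [x, a] * b - F [x * b, a] - F [x, b] * a" for x
  proof -
    have "F [a * b, x] = a * F [b, x] + F [a, b * x] - F [a, b] * x"
      "F [b * a, x] = b * F [a, x] + F [b, a * x] - F [b, a] * x"
      "F [x, a * b] = F [x * a, b] + F [x, a] * b - x * F [a, b]"
      "F [x, b * a] = F [x * b, a] + F [x, b] * a - x * F [b, a]"
      using cocycle_2[OF F, of a b x] cocycle_2[OF F, of b a x] cocycle_2[OF F, of x a b] cocycle_2[OF F, of x b a]
      by (simp_all add: algebra_simps)
    then show ?thesis by (simp add: z c_def L algebra_simps)
  qed
  have ED: "E [x] = a * F [b, x] + F [a, b * x] + b * F [a, x] + F [b, a * x] - F [x * a, b] - F [x, a] * b - F [x * b, a] - F [x, b] * a" for x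
    unfolding D[symmetric] by (simp add: E_def)
  have sq: "a * arrow l = 0" "arrow l * a = 0" "b * bar_arrow l = 0" "bar_arrow l * b = 0" for l
    by (simp_all add: path_elem_square[where u = "[]" and v = "[]", simplified] a_def b_def arrow_path_elem bar_arrow_path_elem path_elem_mult)
  have ne: "b * arrow l = 0" "arrow l * b = 0" "a * bar_arrow l = 0" "bar_arrow l * a = 0" if "l \<noteq> i" for l
    using that by (simp_all add: a_def b_def arrow_path_elem bar_arrow_path_elem path_elem_mult)
  have Ea: "E [arrow l] = 0" for l
  proof (cases "l = i")
    case True
    have "F [a, a] = 0" unfolding a_def by (rule aa)
    then have "E [a] = a * F [b, a] + F [a, b * a] - F [a * b, a] - F [a, b] * a"
      using sq(1)[of i] by (simp add: ED F0 a_def[symmetric])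
    then show ?thesis using cocycle_2[OF F, of a b a] by (simp add: True a_def[symmetric] algebra_simps)
  next
    case False
    have "F [a, arrow l] = 0" "F [arrow l, a] = 0" unfolding a_def by (rule aa)+
    then show ?thesis using False by (simp add: ED F0 sq ne ab)
  qed
  have Eb: "E [bar_arrow l] = 0" for l
  proof (cases "l = i")
    case True
    have "F [b, b] = 0" using bb(1)[of i] by (simp add: b_def)
    then have "E [b] = b * F [a, b] + F [b, a * b] - F [b * a, b] - F [b, a] * b"
      using sq(3)[of i] by (simp add: ED F0 b_def[symmetric])
    then show ?thesis using cocycle_2[OF F, of b a b] by (simp add: True b_def[symmetric] algebra_simps)
  next
    case False
    then show ?thesis by (simp add: ED F0 sq ne ab bb)
  qed
  obtain G where G: "E = hoch_diff 0 G"
    using cocycle_1_coboundary[OF \<pi> E Ea Eb] by (auto simp: coboundaries_def)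
  have "F [central_f i, x] - F [x, central_f i] = x * (c + G []) - (c + G []) * x" for x
    using fun_cong[OF G, of "[x]"] by (simp add: E_def hoch_diff_def algebra_simps)
  then show ?thesis unfolding inner_with_def using central_f_central by blast
qed

section \<open>Assembling the brackets\<close>

lemma HH_class_eq_coboundary:
  fixes F G :: "('k::field, 'n::finite, 'm::nontriv) alg list \<Rightarrow> ('k, 'n, 'm) alg"
  assumes "HH_class scale_alg n F = HH_class scale_alg n G" "G \<in> cocycles scale_alg n"
  shows "(\<lambda>xs. F xs - G xs) \<in> coboundaries scale_alg n"
proof -
  have "G \<in> HH_class scale_alg n G"
    using assms(2) alg_module.coboundaries_zero by (simp add: alg_module.mem_HH_class)
  then have "G \<in> HH_class scale_alg n F" by (simp add: assms(1))
  then show ?thesis by (simp add: alg_module.mem_HH_class)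
qed

lemma bracket_F_central:
  fixes \<pi> :: "('k::field, 'n::finite, 'm::nontriv) alg list \<Rightarrow> ('k, 'n, 'm) bimod"
  assumes \<pi>: "comparison_map \<pi>" and m: "odd CARD('m)" "CARD('m) \<ge> 3" and two: "(2 :: 'k) \<noteq> 0"
    and N: "CARD('n) > 1" and z: "z = eps i \<or> z = central_f i"
  shows "HH_bracket scale_alg 2 0 (class_via \<pi> 2 (gen_F j)) (central_class z) = HH_zero scale_alg (2 + 0 - 1)"
    and "HH_bracket scale_alg 0 2 (central_class z) (class_via \<pi> 2 (gen_F j)) = HH_zero scale_alg (0 + 2 - 1)"
proof -
  let ?X = "class_via \<pi> 2 (gen_F j)"
  let ?c = "\<lambda>xs. if xs = [] then z else 0"
  obtain F where F: "F \<in> cocycles scale_alg 2" "?X = HH_class scale_alg 2 F"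
    using homogeneous_class_F[OF \<pi> m, of "\<lambda>_. 1" j] by (auto simp: homogeneous_class_def)
  have f: "inner_with F (central_f l)" for l
  proof -
    obtain G where G: "G \<in> cocycles scale_alg 2" "?X = HH_class scale_alg 2 G"
      "homogeneous_cochain (\<lambda>v. if v = l then 5 else 1) (1 - int CARD('n), 0) 2 G"
      using homogeneous_class_F[OF \<pi> m, of "\<lambda>v. if v = l then 5 else 1" j] by (auto simp: homogeneous_class_def)
    have "HH_class scale_alg 2 F = HH_class scale_alg 2 G" using F(2) G(2) by simp
    from inner_with_cohomologous[OF HH_class_eq_coboundary[OF this G(1)] inner_with_central_f[OF \<pi> G(1) N G(3)]]
    show ?thesis .
  qed
  have "inner_with F z"
    using z f inner_with_eps[OF F(1) f m(1) two] by auto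
  note b = gerstenhaber_central_coboundary[OF this]
  have z': "\<And>x. z * x = x * z" using z eps_central central_f_central by auto
  note c = central_cocycle[OF z']
  show "HH_bracket scale_alg 2 0 ?X (central_class z) = HH_zero scale_alg (2 + 0 - 1)"
    unfolding F(2) central_class_def by (rule alg_module.HH_bracket_eq_zero[OF F(1) c b]) simp
  show "HH_bracket scale_alg 0 2 (central_class z) ?X = HH_zero scale_alg (0 + 2 - 1)"
    unfolding F(2) central_class_def
    by (rule alg_module.HH_bracket_eq_zero[OF c F(1) alg_module.gerstenhaber_coboundary_swap[OF b]]) simp
qed

lemma bracket_central:
  assumes "\<And>x. z * x = x * z" "\<And>x. w * x = x * (w :: ('k::field, 'n::finite, 'm::nontriv) alg)"
  shows "HH_bracket scale_alg 0 0 (central_class z) (central_class w) = HH_zero scale_alg (0 + 0 - 1)"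
proof -
  have "gerstenhaber 0 0 f g = (\<lambda>_. 0)" for f g :: "('k, 'n, 'm) alg list \<Rightarrow> _"
    by (rule ext) (simp add: gerstenhaber_def circ_def)
  then show ?thesis
    unfolding central_class_def
    by (intro alg_module.HH_bracket_eq_zero central_cocycle assms) (simp_all add: alg_module.coboundaries_zero)
qed

text \<open>Degree and weight of \<open>chi4\<close>, \<open>gen_phi\<close>,
  \<open>gen_psi\<close>, \<open>chi_plus\<close> and \<open>chi_minus\<close>, in this order; the
  weight of a class is that of its values minus that of its labels.\<close>

definition high_weights :: "('k::field, 'n::finite, 'm::nontriv) alg itself \<Rightarrow> (nat \<times> int \<times> int) set" where
  "high_weights _ = {(4, - 2 * int CARD('n), 0), (CARD('m) - 1, int CARD('n) - int CARD('m), int CARD('m)),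
     (CARD('m) - 1, int CARD('n), - int CARD('m)), (2 * CARD('m), 0, - 2 * int CARD('m)),
     (2 * CARD('m), - 2 * int CARD('m), 2 * int CARD('m))}"

lemma generators_cases:
  fixes \<pi> :: "('k::field, 'n::finite, 'm::nontriv) alg list \<Rightarrow> ('k, 'n, 'm) bimod"
  assumes \<pi>: "comparison_map \<pi>" and m: "odd CARD('m)" "CARD('m) \<ge> 3" and X: "(p, X) \<in> generators \<pi>"
  obtains i z c where "p = 0" "X = central_class z" "z = eps i \<or> z = central_f i" "homogeneous_class (\<lambda>_. 1) 0 (c, 0) X"
      "c = int CARD('n) \<or> c = 1 \<and> CARD('n) \<ge> 2"
  | j where "CARD('n) \<ge> 2" "p = 2" "X = class_via \<pi> 2 (gen_F j)" "homogeneous_class (\<lambda>_. 1) 2 (1 - int CARD('n), 0) X"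
  | c e where "(p, c, e) \<in> high_weights TYPE(('k, 'n, 'm) alg)" "homogeneous_class (\<lambda>_. 1) p (c, e) X"
proof -
  consider i where "p = 0" "X = central_class (eps i)" | i where "p = 0" "X = central_class (central_f i)" "CARD('n) \<ge> 2"
    | j where "p = 2" "X = class_via \<pi> 2 (gen_F j)" "CARD('n) \<ge> 2"
    | "p = 4" "X = class_via \<pi> 4 chi4" | "p = CARD('m) - 1" "X = class_via \<pi> (CARD('m) - 1) gen_phi"
    | "p = CARD('m) - 1" "X = class_via \<pi> (CARD('m) - 1) gen_psi"
    | "p = 2 * CARD('m)" "X = class_via \<pi> (2 * CARD('m)) chi_plus"
    | "p = 2 * CARD('m)" "X = class_via \<pi> (2 * CARD('m)) chi_minus"
    using X unfolding generators_def by (auto simp del: One_nat_def)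
  then show thesis
  proof cases
    case (1 i)
    have "homogeneous_class (\<lambda>_. 1) 0 (int CARD('n), 0) (central_class (eps i :: ('k, 'n, 'm) alg))"
      by (rule homogeneous_class_central[OF eps_central homogeneous_eps])
    then show ?thesis using 1 that(1)[of "eps i" i "int CARD('n)"] by simp
  next
    case (2 i)
    have "homogeneous_class (\<lambda>_. 1) 0 (1, 0) (central_class (central_f i :: ('k, 'n, 'm) alg))"
      by (rule homogeneous_class_central[OF central_f_central homogeneous_central_f])
    then show ?thesis using 2 that(1)[of "central_f i" i 1] by simp
  next
    case (3 j)
    then show ?thesis using that(2) homogeneous_class_F[OF \<pi> m] by blast
  next
    case 4
    then show ?thesis
      using that(3)[of "- 2 * int CARD('n)" 0] homogeneous_class_chi4[OF \<pi> m] by (simp add: high_weights_def)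
  next
    case 5
    then show ?thesis
      using that(3)[of "int CARD('n) - int CARD('m)" "int CARD('m)"] homogeneous_class_phi_psi(1)[OF \<pi> m]
      by (simp add: high_weights_def)
  next
    case 6
    then show ?thesis
      using that(3)[of "int CARD('n)" "- int CARD('m)"] homogeneous_class_phi_psi(2)[OF \<pi> m]
      by (simp add: high_weights_def)
  next
    case 7
    then show ?thesis
      using that(3)[of 0 "- 2 * int CARD('m)"] homogeneous_class_chi(1)[OF \<pi> m(1)] by (simp add: high_weights_def)
  next
    case 8
    then show ?thesis
      using that(3)[of "- 2 * int CARD('m)" "2 * int CARD('m)"] homogeneous_class_chi(2)[OF \<pi> m(1)]
      by (simp add: high_weights_def)
  qed
qed

theorem proposition7p4:
  fixes \<pi> :: "('k::field, 'n::finite, 'm::nontriv) alg list \<Rightarrow> ('k, 'n, 'm) bimod"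
  assumes "CARD('n) \<ge> 1"
    and "CARD('m) \<ge> 3"
    and "odd CARD('m)"
    and "\<not> CHAR('k) dvd 2"
    and "\<not> CHAR('k) dvd CARD('n)"
    and "\<not> CHAR('k) dvd CARD('m)"
    and "comparison_map \<pi>"
    and "(p, X) \<in> generators \<pi>"
    and "(q, Y) \<in> generators \<pi>"
  shows "HH_bracket scale_alg p q X Y = HH_zero scale_alg (p + q - 1)"
proof -
  note m = assms(3,2) and \<pi> = assms(7)
  let ?T = "TYPE(('k, 'n, 'm) alg)"
  have two: "(2 :: 'k) \<noteq> 0"
    using assms(4) of_nat_eq_0_iff_char_dvd[of 2, where 'a = 'k] by simp
  have N0: "(of_nat CARD('n) :: 'k) \<noteq> 0"
    using assms(5) by (simp add: of_nat_eq_0_iff_char_dvd)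
  obtain M where M: "CARD('m) = 2 * M + 1" using m(1) by (elim oddE)
  have M1: "M \<ge> 1" using M m(2) by simp
  note pairs = acyclic_pairs[OF M M1 two N0]
  have acyc: "HH_bracket scale_alg p q X Y = HH_zero scale_alg (p + q - 1)"
    if "homogeneous_class (\<lambda>_. 1) p (c, e) X" "homogeneous_class (\<lambda>_. 1) q (c', e') Y"
      "acyclic_pair ?T (p, c, e) (q, c', e')" for c e c' e'
  proof (rule bracket_acyclic[OF \<pi> m(1) that(1,2)])
    have "p + q > 1" using that(3) by (simp add: acyclic_pair_def)
    then show "p + q = Suc (p + q - 1)" "p + q - 1 > 0" by linarith+
    show "acyclic_weight ?T (p + q - 1) (c + c') (e + e')" using that(3) by (simp add: acyclic_pair_def)
  qed
  \<comment> \<open>The low triples belong to \<open>eps\<close>, \<open>central_f\<close> and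
    \<open>gen_F\<close>. Brackets among these are treated apart: two central elements by degree,
    \<open>gen_F\<close> with a central element by \<open>bracket_F_central\<close>, and
    \<open>gen_F\<close> with \<open>gen_F\<close> by the last item of
    \<open>acyclic_pairs\<close>.\<close>
  have low: "acyclic_pair ?T a b"
    if "a = (0, int CARD('n), 0) \<or> CARD('n) \<ge> 2 \<and> (a = (0, 1, 0) \<or> a = (2, 1 - int CARD('n), 0))" "b \<in> high_weights ?T" for a b
    using that unfolding high_weights_def insert_iff empty_iff by (elim disjE conjE) (simp_all only: pairs)
  have high: "acyclic_pair ?T a b" if "a \<in> high_weights ?T" "b \<in> high_weights ?T" for a b
    using that unfolding high_weights_def insert_iff empty_iff
    by (elim disjE) (simp_all only: pairs pairs[THEN acyclic_pair_sym])
  show ?thesis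
    using assms(8)
  proof (cases rule: generators_cases[OF \<pi> m, consumes 1])
    case X: (1 i z c)
    show ?thesis using assms(9)
    proof (cases rule: generators_cases[OF \<pi> m, consumes 1])
      case Y: (1 j w d)
      have "z * x = x * z" "w * x = x * w" for x
        using X(3) Y(3) eps_central central_f_central by auto
      then show ?thesis unfolding X(1,2) Y(1,2) by (rule bracket_central)
    next
      case Y: (2 j)
      show ?thesis unfolding X(1,2) Y(2,3) using bracket_F_central(2)[OF \<pi> m two _ X(3)] Y(1) by simp
    next
      case Y: (3 d e)
      show ?thesis by (rule acyc[OF _ Y(2) low[OF _ Y(1)]]) (use X in auto)
    qed
  next
    case X: (2 i)
    show ?thesis using assms(9)
    proof (cases rule: generators_cases[OF \<pi> m, consumes 1])
      case Y: (1 j w d)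
      show ?thesis unfolding Y(1,2) X(2,3) using bracket_F_central(1)[OF \<pi> m two _ Y(3)] X(1) by simp
    next
      case Y: (2 j)
      show ?thesis
        by (rule acyc[of "1 - int CARD('n)" 0 "1 - int CARD('n)" 0]) (use X Y pairs in simp_all)
    next
      case Y: (3 d e)
      show ?thesis by (rule acyc[OF _ Y(2) low[OF _ Y(1)]]) (use X in auto)
    qed
  next
    case X: (3 c e)
    show ?thesis using assms(9)
    proof (cases rule: generators_cases[OF \<pi> m, consumes 1])
      case Y: (1 j w d)
      show ?thesis by (rule acyc[OF X(2) _ acyclic_pair_sym[OF low[OF _ X(1)]]]) (use Y in auto)
    next
      case Y: (2 j)
      show ?thesis by (rule acyc[OF X(2) _ acyclic_pair_sym[OF low[OF _ X(1)]]]) (use Y in auto)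
    next
      case Y: (3 d e')
      show ?thesis by (rule acyc[OF X(2) Y(2) high[OF X(1) Y(1)]])
    qed
  qed
qed

end
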